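(* Let $n>1$, $0\le s\le n-1$, and let $\gamma=(\gamma_{pi})$ be an admissible $s\times n$ parameter matrix over $\mathbb F$ that is of a reduced form, with associated number $s'$ and indices $k_1<\dots<k_{s'}$. For $k\in\{1,\dots,[n/2]\}$ put $$\alpha_{qk}:=-\sum_{k'=1}^k(\gamma_{q,n-k'+1}-\gamma_{qk'})=-\sum_{k'=k_q}^k(\gamma_{q,n-k'+1}-\gamma_{qk'}),\quad q=1,\dots,s',$$ and $\beta_{qk}:=-\Delta_{qk}/\Delta$, where $\Delta:=\det(\alpha_{q'k_{q''}})_{q',q''=1,\dots,s'}=(-1)^{s'}$ and $\Delta_{qk}$ is the determinant obtained from $\Delta$ by replacing the column $(\alpha_{q'k_q})_{q'=1,\dots,s'}$ by the column $(\alpha_{q'k})_{q'=1,\dots,s'}$. Then a basis of $\mathrm{Inv}(\mathfrak t_\gamma(n))$ is formed by the expressions $$|\mathcal E^{1,k}_{\varkappa,n}|\prod_{q=1}^{s'}|\mathcal E^{1,k_q}_{\varkappa_q,n}|^{\beta_{qk}},\qquad k\in\{1,\dots,[n/2]\}\setminus\{k_1,\dots,k_{s'}\},$$ $$f_p+\sum_{k=1}^{[n/2]}\frac{(-1)^{k+1}}{|\mathcal E^{1,k}_{\varkappa,n}|}(\gamma_{pk}-\gamma_{p,k+1})\sum_{k<i<\varkappa}\left|\begin{array}{cc}\mathcal E^{1,k}_{i,i}&\mathcal E^{1,k}_{\varkappa,n}\\ 0&\mathcal E^{i,i}_{\varkappa,n}\end{array}\right|,\qquad p=s'+1,\dots,s,$$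 where $\varkappa:=n-k+1$, $\varkappa_q:=n-k_q+1$, and $\mathcal E^{i_1,i_2}_{j_1,j_2}$, $i_1\le i_2$, $j_1\le j_2$, denotes the matrix $(e_{ij})^{i=i_1,\dots,i_2}_{j=j_1,\dots,j_2}$.
   Context: $\mathbb F$ is $\mathbb C$ or $\mathbb R$; $[a]$ is the integer part of $a$; $|A|=\det A$. An $s\times n$ matrix $\gamma=(\gamma_{pi})$ over $\mathbb F$ is admissible if the diagonal matrices $\Gamma_p=\mathrm{diag}(\gamma_{p1},\dots,\gamma_{pn})$, $p=1,\dots,s$, and the identity matrix are jointly linearly independent (for $s=0$ there is no $\gamma$, and terms with subscript $p$ are omitted). The Lie algebra $\mathfrak t_\gamma(n)$ over $\mathbb F$ has basis $e_{ij}$ ($1\le i<j\le n$), $f_p$ ($1\le p\le s$), and commutation relations $[e_{ij},e_{i'j'}]=\delta_{i'j}e_{ij'}-\delta_{ij'}e_{i'j}$, $[f_p,e_{ij}]=(\gamma_{pi}-\gamma_{pj})e_{ij}$, $[f_p,f_{p'}]=0$; i.e. it is identified with the span of the strictly upper triangular $n\times n$ matrices ($e_{ij}\sim E^n_{ij}$, matrix units) and the $\Gamma_p$ ($f_p\sim\Gamma_p$). It is the Lie algebra of the connected Lie group $\mathrm T_\gamma(n)$ of nonsingular upper triangular matrices $B=(b_{ij})$ for which there are $\varepsilon_1,\dots,\varepsilon_s\in\mathbb F$ with $b_{ii}=\exp(\sum_p\gamma_{pi}\varepsilon_p)$ for all $i$. Reduced form: $\gamma$ is of a reduced form if there are $s'\in\{0,\dots,\min(s,[n/2])\}$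 and $1\le k_1<\dots<k_{s'}\le[n/2]$ such that, writing $\varkappa=n-k+1$, $\varkappa_q=n-k_q+1$: for each $q=1,\dots,s'$, $\gamma_{qk}=\gamma_{q\varkappa}$ for $k<k_q$, $\gamma_{q\varkappa_q}-\gamma_{qk_q}=1$, and $\gamma_{pk_q}=\gamma_{p\varkappa_q}$ for all $p\ne q$ ($1\le p\le s$); and $\gamma_{pk}=\gamma_{p\varkappa}$ for all $p>s'$, $k=1,\dots,[n/2]$. Invariants: for a connected Lie group $G$ with Lie algebra $\mathfrak g$ having basis $e_1,\dots,e_m$, the coadjoint action is $\langle\mathrm{Ad}^*_gx,u\rangle=\langle x,\mathrm{Ad}_{g^{-1}}u\rangle$. An invariant of $\mathrm{Ad}^*_G$ on a domain $\Omega\subset\mathfrak g^*$ is a smooth function $F:\Omega\to\mathbb F$ with $F(\mathrm{Ad}^*_gx)=F(x)$ for all $g\in G$, $x\in\Omega$ with $\mathrm{Ad}^*_gx\in\Omega$; here $\Omega$ is a neighborhood of a point of a regular orbit (an orbit of maximal dimension), chosen so that $\mathrm{Ad}^*_G$ acts regularly on $\Omega$. A basis of the set $\mathrm{Inv}(\mathrm{Ad}^*_G)$ of invariants is a set of $N_{\mathfrak g}=\dim\mathfrak g-\mathrm{rank}\,\mathrm{Ad}^*_G$ functionally independent invariants ($\mathrm{rank}\,\mathrm{Ad}^*_G$ is the dimension of the regular orbits); every invariant is then uniquely a function of them. If $x_1,\dots,x_m$ are the coordinates on $\mathfrak g^*$ dual to $e_1,\dots,e_m$, each invariant $F(x_1,\dots,x_m)$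 of $\mathrm{Ad}^*_G$ gives an invariant (generalized Casimir operator) $\mathrm{Sym}\,F(e_1,\dots,e_m)$ of $\mathfrak g$, where $\mathrm{Sym}$ acts only on monomials containing noncommuting elements, by $\mathrm{Sym}(e_{i_1}\cdots e_{i_r})=\frac1{r!}\sum_{\sigma\in S_r}e_{i_{\sigma_1}}\cdots e_{i_{\sigma_r}}$. $\mathrm{Inv}(\mathfrak g)$ is the set of these, and a basis of $\mathrm{Inv}(\mathfrak g)$ is the set of $\mathrm{Sym}\,F^l$, $l=1,\dots,N_{\mathfrak g}$, for a basis $(F^l)$ of $\mathrm{Inv}(\mathrm{Ad}^*_G)$. Ordering convention: in the expressions of the second kind the only noncommuting elements in a monomial of a determinant are one element of $\mathcal E^{1,k}_{i,i}$ and one element of $\mathcal E^{i,i}_{\varkappa,n}$. The expressions are written in `non-symmetrized' form, with a uniform order fixed in all monomials (elements of $\mathcal E^{1,k}_{i,i}$ always before, or always after, elements of $\mathcal E^{i,i}_{\varkappa,n}$); such a form is identified with the symmetrized invariant up to a constant summand. Power conventions: in the complex case with non-integer exponents, a branch of the logarithm is fixed and used for all powers. In the real case, when an exponent is not an integer or a rational number with odd denominator, the corresponding determinant (as a function on the dual space) is replaced by its absolute value. *)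

theory Defs
  imports
    "HOL-Analysis.Analysis"
    "HOL-Library.Function_Algebras"
    "HOL-Combinatorics.Permutations"
    "Jordan_Normal_Form.Determinant"
    "Jordan_Normal_Form.Gauss_Jordan_Elimination"
begin

hide_const (open) Determinants.det

section \<open>The Lie algebra and its Lie group\<close>

text \<open>Indices of parameters, rows and columns are 1-based as on paper; matrices of type
  \<^typ>\<open>'a mat\<close> are 0-based, hence the shifts by \<^const>\<open>Suc\<close>. The parameter matrix is a function
  \<open>\<gamma> p i\<close>, of which only the values with \<open>1 \<le> p \<le> s\<close>, \<open>1 \<le> i \<le> n\<close> matter.\<close>

datatype lidx = E nat nat | P nat

definition basis_idx :: "nat \<Rightarrow> nat \<Rightarrow> lidx set" where
  "basis_idx n s = {E i j | i j. 1 \<le> i \<and> i < j \<and> j \<le> n} \<union> {P p | p. 1 \<le> p \<and> p \<le> s}"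

fun basis_mat :: "nat \<Rightarrow> (nat \<Rightarrow> nat \<Rightarrow> 'f::field) \<Rightarrow> lidx \<Rightarrow> 'f mat" where
  "basis_mat n \<gamma> (E i j) = mat n n (\<lambda>(r, c). if Suc r = i \<and> Suc c = j then 1 else 0)"
| "basis_mat n \<gamma> (P p) = mat n n (\<lambda>(r, c). if r = c then \<gamma> p (Suc r) else 0)"

text \<open>Joint linear independence of the diagonal matrices \<open>\<Gamma>\<^sub>1, \<dots>, \<Gamma>\<^sub>s\<close> and the identity, read off
  on the diagonals.\<close>

definition admissible :: "nat \<Rightarrow> nat \<Rightarrow> (nat \<Rightarrow> nat \<Rightarrow> 'f::field) \<Rightarrow> bool" where
  "admissible n s \<gamma> \<longleftrightarrow>
    (\<forall>c0 c. (\<forall>i\<in>{1..n}. c0 + (\<Sum>p=1..s. c p * \<gamma> p i) = 0) \<longrightarrow> c0 = 0 \<and> (\<forall>p\<in>{1..s}. c p = 0))"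

definition reduced_form ::
  "nat \<Rightarrow> nat \<Rightarrow> (nat \<Rightarrow> nat \<Rightarrow> 'f::field) \<Rightarrow> nat \<Rightarrow> (nat \<Rightarrow> nat) \<Rightarrow> bool" where
  "reduced_form n s \<gamma> s' k \<longleftrightarrow>
     s' \<le> min s (n div 2) \<and>
     (\<forall>q\<in>{1..s'}. 1 \<le> k q \<and> k q \<le> n div 2) \<and> strict_mono_on {1..s'} k \<and>
     (\<forall>q\<in>{1..s'}.
        (\<forall>j\<in>{1..<k q}. \<gamma> q j = \<gamma> q (n - j + 1)) \<and>
        \<gamma> q (n - k q + 1) - \<gamma> q (k q) = 1 \<and>
        (\<forall>p\<in>{1..s} - {q}. \<gamma> p (k q) = \<gamma> p (n - k q + 1))) \<and>
     (\<forall>p\<in>{s'<..s}. \<forall>j\<in>{1..n div 2}. \<gamma> p j = \<gamma> p (n - j + 1))"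

definition lie_elem ::
  "nat \<Rightarrow> nat \<Rightarrow> (nat \<Rightarrow> nat \<Rightarrow> 'f::field) \<Rightarrow> (lidx \<Rightarrow> 'f) \<Rightarrow> 'f mat" where
  "lie_elem n s \<gamma> c = mat n n (\<lambda>ij. \<Sum>a\<in>basis_idx n s. c a * basis_mat n \<gamma> a $$ ij)"

text \<open>Coordinates of an element of the Lie algebra; they are unique when \<open>\<gamma>\<close> is admissible.\<close>

definition lie_coord ::
  "nat \<Rightarrow> nat \<Rightarrow> (nat \<Rightarrow> nat \<Rightarrow> 'f::field) \<Rightarrow> 'f mat \<Rightarrow> lidx \<Rightarrow> 'f" where
  "lie_coord n s \<gamma> u = (THE c. c \<in> (\<Pi>\<^sub>E a\<in>basis_idx n s. UNIV) \<and> lie_elem n s \<gamma> c = u)"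

definition lie_bracket :: "'f::field mat \<Rightarrow> 'f mat \<Rightarrow> 'f mat" where
  "lie_bracket u v = u * v - v * u"

definition struct_const ::
  "nat \<Rightarrow> nat \<Rightarrow> (nat \<Rightarrow> nat \<Rightarrow> 'f::field) \<Rightarrow> lidx \<Rightarrow> lidx \<Rightarrow> lidx \<Rightarrow> 'f" where
  "struct_const n s \<gamma> a b = lie_coord n s \<gamma> (lie_bracket (basis_mat n \<gamma> a) (basis_mat n \<gamma> b))"

definition T_group ::
  "nat \<Rightarrow> nat \<Rightarrow> (nat \<Rightarrow> nat \<Rightarrow> 'f::{real_normed_field,banach}) \<Rightarrow> 'f mat set" where
  "T_group n s \<gamma> = {B \<in> carrier_mat n n. upper_triangular B \<and>
     (\<exists>\<epsilon>. \<forall>i<n. B $$ (i, i) = exp (\<Sum>p=1..s. \<gamma> p (Suc i) * \<epsilon> p))}"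

text \<open>Global coordinates \<open>(b\<^sub>i\<^sub>j, \<epsilon>\<^sub>p)\<close> on the Lie group (a covering in the complex case); they carry
  its Lie group topology, and the origin corresponds to the identity matrix.\<close>

definition T_param ::
  "nat \<Rightarrow> nat \<Rightarrow> (nat \<Rightarrow> nat \<Rightarrow> 'f::{real_normed_field,banach}) \<Rightarrow> (lidx \<Rightarrow> 'f) \<Rightarrow> 'f mat" where
  "T_param n s \<gamma> \<theta> = mat n n (\<lambda>(i, j).
     if i = j then exp (\<Sum>p=1..s. \<gamma> p (Suc i) * \<theta> (P p))
     else if i < j then \<theta> (E (Suc i) (Suc j)) else 0)"

section \<open>The coadjoint action\<close>

text \<open>A point of the dual space is given by its coordinates with respect to the dual basis, as an
  extensional function on \<^const>\<open>basis_idx\<close>.\<close>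

definition dual_top :: "nat \<Rightarrow> nat \<Rightarrow> (lidx \<Rightarrow> 'f::topological_space) topology" where
  "dual_top n s = product_topology (\<lambda>_. euclidean) (basis_idx n s)"

definition dual_pair ::
  "nat \<Rightarrow> nat \<Rightarrow> (nat \<Rightarrow> nat \<Rightarrow> 'f::field) \<Rightarrow> (lidx \<Rightarrow> 'f) \<Rightarrow> 'f mat \<Rightarrow> 'f" where
  "dual_pair n s \<gamma> x u = (\<Sum>a\<in>basis_idx n s. x a * lie_coord n s \<gamma> u a)"

definition minv :: "'f::field mat \<Rightarrow> 'f mat" where
  "minv B = the (mat_inverse B)"

definition Ad :: "'f::field mat \<Rightarrow> 'f mat \<Rightarrow> 'f mat" where
  "Ad B u = B * u * minv B"

definition coAd ::
  "nat \<Rightarrow> nat \<Rightarrow> (nat \<Rightarrow> nat \<Rightarrow> 'f::field) \<Rightarrow> 'f mat \<Rightarrow> (lidx \<Rightarrow> 'f) \<Rightarrow> lidx \<Rightarrow> 'f" where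
  "coAd n s \<gamma> B x = (\<lambda>a\<in>basis_idx n s. dual_pair n s \<gamma> x (Ad (minv B) (basis_mat n \<gamma> a)))"

definition orbit ::
  "nat \<Rightarrow> nat \<Rightarrow> (nat \<Rightarrow> nat \<Rightarrow> 'f::{real_normed_field,banach}) \<Rightarrow> (lidx \<Rightarrow> 'f) \<Rightarrow> (lidx \<Rightarrow> 'f) set" where
  "orbit n s \<gamma> x = {coAd n s \<gamma> B x | B. B \<in> T_group n s \<gamma>}"

definition partial :: "lidx \<Rightarrow> ((lidx \<Rightarrow> 'f::real_normed_field) \<Rightarrow> 'f) \<Rightarrow> (lidx \<Rightarrow> 'f) \<Rightarrow> 'f" where
  "partial a F x = deriv (\<lambda>t. F (x(a := t))) (x a)"

text \<open>The dimension of an orbit is the rank of the differential of the orbit map at the identity of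
  the group (this rank is constant along the group).\<close>

definition orbit_tangent ::
  "nat \<Rightarrow> nat \<Rightarrow> (nat \<Rightarrow> nat \<Rightarrow> 'f::{real_normed_field,banach}) \<Rightarrow> (lidx \<Rightarrow> 'f) \<Rightarrow> lidx \<Rightarrow> lidx \<Rightarrow> 'f" where
  "orbit_tangent n s \<gamma> x a = (\<lambda>b\<in>basis_idx n s.
     partial a (\<lambda>\<theta>. coAd n s \<gamma> (T_param n s \<gamma> \<theta>) x b) (\<lambda>_\<in>basis_idx n s. 0))"

text \<open>Restricting to extensional functions, the vectors are extended by zero before taking the
  dimension of their span in the vector space of all functions.\<close>

definition orbit_dim ::
  "nat \<Rightarrow> nat \<Rightarrow> (nat \<Rightarrow> nat \<Rightarrow> 'f::{real_normed_field,banach}) \<Rightarrow> (lidx \<Rightarrow> 'f) \<Rightarrow> nat" where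
  "orbit_dim n s \<gamma> x = vector_space.dim (\<lambda>c v b. c * v b)
     ((\<lambda>a b. if b \<in> basis_idx n s then orbit_tangent n s \<gamma> x a b else 0) ` basis_idx n s)"

definition coAd_rank ::
  "nat \<Rightarrow> nat \<Rightarrow> (nat \<Rightarrow> nat \<Rightarrow> 'f::{real_normed_field,banach}) \<Rightarrow> nat" where
  "coAd_rank n s \<gamma> = Max (orbit_dim n s \<gamma> ` (\<Pi>\<^sub>E a\<in>basis_idx n s. UNIV))"

text \<open>Regular action on an open set: all orbits have the same dimension, and every point has
  arbitrarily small neighbourhoods meeting each orbit in a pathwise connected set.\<close>

definition acts_regularly ::
  "nat \<Rightarrow> nat \<Rightarrow> (nat \<Rightarrow> nat \<Rightarrow> 'f::{real_normed_field,banach}) \<Rightarrow> (lidx \<Rightarrow> 'f) set \<Rightarrow> bool" where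
  "acts_regularly n s \<gamma> \<Omega> \<longleftrightarrow>
     (\<forall>x\<in>\<Omega>. \<forall>y\<in>\<Omega>. orbit_dim n s \<gamma> x = orbit_dim n s \<gamma> y) \<and>
     (\<forall>x\<in>\<Omega>. \<forall>U. openin (dual_top n s) U \<and> x \<in> U \<and> U \<subseteq> \<Omega> \<longrightarrow>
        (\<exists>V. openin (dual_top n s) V \<and> x \<in> V \<and> V \<subseteq> U \<and>
          (\<forall>y\<in>topspace (dual_top n s). path_connectedin (dual_top n s) (orbit n s \<gamma> y \<inter> V))))"

section \<open>Invariants of the coadjoint action\<close>

text \<open>Smoothness over the ground field: all iterated partial derivatives over that field exist and
  are continuous. Over the complex numbers this means holomorphy.\<close>

primrec Ck_on ::
  "nat \<Rightarrow> nat \<Rightarrow> nat \<Rightarrow> (lidx \<Rightarrow> 'f::real_normed_field) set \<Rightarrow> ((lidx \<Rightarrow> 'f) \<Rightarrow> 'f) \<Rightarrow> bool" where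
  "Ck_on n s 0 \<Omega> F \<longleftrightarrow> continuous_map (subtopology (dual_top n s) \<Omega>) euclidean F"
| "Ck_on n s (Suc m) \<Omega> F \<longleftrightarrow>
     continuous_map (subtopology (dual_top n s) \<Omega>) euclidean F \<and>
     (\<forall>a\<in>basis_idx n s.
        (\<forall>x\<in>\<Omega>. (\<lambda>t. F (x(a := t))) field_differentiable at (x a)) \<and> Ck_on n s m \<Omega> (partial a F))"

definition smooth_fun ::
  "nat \<Rightarrow> nat \<Rightarrow> (lidx \<Rightarrow> 'f::real_normed_field) set \<Rightarrow> ((lidx \<Rightarrow> 'f) \<Rightarrow> 'f) \<Rightarrow> bool" where
  "smooth_fun n s \<Omega> F \<longleftrightarrow> (\<forall>m. Ck_on n s m \<Omega> F)"

definition same_orbit ::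
  "nat \<Rightarrow> nat \<Rightarrow> (nat \<Rightarrow> nat \<Rightarrow> 'f::{real_normed_field,banach}) \<Rightarrow> (lidx \<Rightarrow> 'f) \<Rightarrow> (lidx \<Rightarrow> 'f) \<Rightarrow> bool" where
  "same_orbit n s \<gamma> x y \<longleftrightarrow> (\<exists>B\<in>T_group n s \<gamma>. y = coAd n s \<gamma> B x)"

text \<open>The orbit relation of the local transformation group induced on \<open>\<Omega>\<close>: the two points are joined
  by moving along a path in the group that starts at the identity and keeps the point in \<open>\<Omega>\<close>.\<close>

definition same_local_orbit ::
  "nat \<Rightarrow> nat \<Rightarrow> (nat \<Rightarrow> nat \<Rightarrow> 'f::{real_normed_field,banach}) \<Rightarrow> (lidx \<Rightarrow> 'f) set \<Rightarrow>
    (lidx \<Rightarrow> 'f) \<Rightarrow> (lidx \<Rightarrow> 'f) \<Rightarrow> bool" where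
  "same_local_orbit n s \<gamma> \<Omega> x y \<longleftrightarrow>
     (\<exists>\<theta>::real \<Rightarrow> lidx \<Rightarrow> 'f.
        (\<forall>a\<in>basis_idx n s. continuous_on {0..1} (\<lambda>t. \<theta> t a) \<and> \<theta> 0 a = 0) \<and>
        (\<forall>t\<in>{0..1}. coAd n s \<gamma> (T_param n s \<gamma> (\<theta> t)) x \<in> \<Omega>) \<and>
        y = coAd n s \<gamma> (T_param n s \<gamma> (\<theta> 1)) x)"

definition is_invariant ::
  "nat \<Rightarrow> nat \<Rightarrow> ((lidx \<Rightarrow> 'f) \<Rightarrow> (lidx \<Rightarrow> 'f) \<Rightarrow> bool) \<Rightarrow> (lidx \<Rightarrow> 'f::real_normed_field) set \<Rightarrow>
    ((lidx \<Rightarrow> 'f) \<Rightarrow> 'f) \<Rightarrow> bool" where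
  "is_invariant n s R \<Omega> F \<longleftrightarrow> smooth_fun n s \<Omega> F \<and> (\<forall>x\<in>\<Omega>. \<forall>y\<in>\<Omega>. R x y \<longrightarrow> F y = F x)"

definition functionally_independent ::
  "nat \<Rightarrow> nat \<Rightarrow> (lidx \<Rightarrow> 'f::real_normed_field) set \<Rightarrow> 'l set \<Rightarrow> ('l \<Rightarrow> (lidx \<Rightarrow> 'f) \<Rightarrow> 'f) \<Rightarrow> bool" where
  "functionally_independent n s \<Omega> L F \<longleftrightarrow>
     (\<forall>x\<in>\<Omega>. \<forall>c. (\<forall>a\<in>basis_idx n s. (\<Sum>l\<in>L. c l * partial a (F l) x) = 0) \<longrightarrow> (\<forall>l\<in>L. c l = 0))"

definition Inv_basis ::
  "nat \<Rightarrow> nat \<Rightarrow> (nat \<Rightarrow> nat \<Rightarrow> 'f::{real_normed_field,banach}) \<Rightarrow>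
    ((lidx \<Rightarrow> 'f) \<Rightarrow> (lidx \<Rightarrow> 'f) \<Rightarrow> bool) \<Rightarrow> (lidx \<Rightarrow> 'f) set \<Rightarrow>
    'l set \<Rightarrow> ('l \<Rightarrow> (lidx \<Rightarrow> 'f) \<Rightarrow> 'f) \<Rightarrow> bool" where
  "Inv_basis n s \<gamma> R \<Omega> L F \<longleftrightarrow>
     finite L \<and> (\<forall>l\<in>L. is_invariant n s R \<Omega> (F l)) \<and>
     functionally_independent n s \<Omega> L F \<and>
     card L = card (basis_idx n s) - coAd_rank n s \<gamma>"

section \<open>Generalized Casimir operators\<close>

text \<open>A formal operator is a finite sum of terms, each a word in the basis elements of the Lie
  algebra with a coefficient that is a function of mutually commuting basis elements, all of which
  commute with the letters of the word. It is stored as the map from words to coefficients.\<close>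

type_synonym 'f oper = "lidx list \<Rightarrow> (lidx \<Rightarrow> 'f) \<Rightarrow> 'f"

definition term_op :: "((lidx \<Rightarrow> 'f) \<Rightarrow> 'f) \<Rightarrow> lidx list \<Rightarrow> ('f::real_normed_field) oper" where
  "term_op \<phi> w = (\<lambda>v x. if v = w then \<phi> x else 0)"

definition commuting :: "nat \<Rightarrow> (nat \<Rightarrow> nat \<Rightarrow> 'f::field) \<Rightarrow> lidx \<Rightarrow> lidx \<Rightarrow> bool" where
  "commuting n \<gamma> a b \<longleftrightarrow> lie_bracket (basis_mat n \<gamma> a) (basis_mat n \<gamma> b) = 0\<^sub>m n n"

definition adapted ::
  "nat \<Rightarrow> nat \<Rightarrow> (nat \<Rightarrow> nat \<Rightarrow> 'f::real_normed_field) \<Rightarrow> (lidx \<Rightarrow> 'f) set \<Rightarrow> lidx set \<Rightarrow>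
    ((lidx \<Rightarrow> 'f) \<Rightarrow> 'f) \<Rightarrow> lidx list \<Rightarrow> bool" where
  "adapted n s \<gamma> \<Omega> J \<phi> w \<longleftrightarrow>
     J \<subseteq> basis_idx n s \<and> set w \<subseteq> basis_idx n s \<and>
     (\<forall>a\<in>J. \<forall>b\<in>J \<union> set w. commuting n \<gamma> a b) \<and>
     smooth_fun n s \<Omega> \<phi> \<and>
     (\<forall>x\<in>\<Omega>. \<forall>y\<in>\<Omega>. (\<forall>a\<in>J. x a = y a) \<longrightarrow> \<phi> x = \<phi> y)"

text \<open>The operators that vanish by virtue of the commutation relations (and because a letter that
  commutes with everything in its term may be moved into the coefficient).\<close>

inductive null_op ::
  "nat \<Rightarrow> nat \<Rightarrow> (nat \<Rightarrow> nat \<Rightarrow> 'f::real_normed_field) \<Rightarrow> (lidx \<Rightarrow> 'f) set \<Rightarrow> 'f oper \<Rightarrow> bool"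
  for n s \<gamma> \<Omega> where
  zero: "null_op n s \<gamma> \<Omega> 0"
| add: "null_op n s \<gamma> \<Omega> S \<Longrightarrow> null_op n s \<gamma> \<Omega> T \<Longrightarrow> null_op n s \<gamma> \<Omega> (S + T)"
| vanish: "(\<And>x. x \<in> \<Omega> \<Longrightarrow> \<phi> x = 0) \<Longrightarrow> null_op n s \<gamma> \<Omega> (term_op \<phi> w)"
| commutator: "adapted n s \<gamma> \<Omega> J \<phi> (u @ [a, b] @ v) \<Longrightarrow>
    null_op n s \<gamma> \<Omega> (term_op \<phi> (u @ [a, b] @ v) - term_op \<phi> (u @ [b, a] @ v) -
      (\<Sum>c\<in>basis_idx n s. term_op (\<lambda>x. struct_const n s \<gamma> a b c * \<phi> x) (u @ [c] @ v)))"
| absorb: "adapted n s \<gamma> \<Omega> J \<phi> (u @ v) \<Longrightarrow> a \<in> J \<Longrightarrow>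
    null_op n s \<gamma> \<Omega> (term_op \<phi> (u @ [a] @ v) - term_op (\<lambda>x. \<phi> x * x a) (u @ v))"

definition op_eq ::
  "nat \<Rightarrow> nat \<Rightarrow> (nat \<Rightarrow> nat \<Rightarrow> 'f::real_normed_field) \<Rightarrow> (lidx \<Rightarrow> 'f) set \<Rightarrow> 'f oper \<Rightarrow> 'f oper \<Rightarrow> bool" where
  "op_eq n s \<gamma> \<Omega> S T \<longleftrightarrow> null_op n s \<gamma> \<Omega> (S - T)"

definition Sym_term :: "((lidx \<Rightarrow> 'f) \<Rightarrow> 'f) \<Rightarrow> lidx list \<Rightarrow> ('f::real_normed_field) oper" where
  "Sym_term \<phi> w = (\<Sum>\<sigma> | \<sigma> permutes {..<length w}.
     term_op (\<lambda>x. 1 / fact (length w) * \<phi> x) (permute_list \<sigma> w))"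

text \<open>The operator \<open>T\<close> is the symmetrization of the function \<open>F\<close>, where \<open>F\<close> is written as a sum of
  monomials in possibly noncommuting variables, with coefficients in commuting ones.\<close>

definition is_Sym ::
  "nat \<Rightarrow> nat \<Rightarrow> (nat \<Rightarrow> nat \<Rightarrow> 'f::real_normed_field) \<Rightarrow> (lidx \<Rightarrow> 'f) set \<Rightarrow>
    ((lidx \<Rightarrow> 'f) \<Rightarrow> 'f) \<Rightarrow> 'f oper \<Rightarrow> bool" where
  "is_Sym n s \<gamma> \<Omega> F T \<longleftrightarrow>
     (\<exists>ms. (\<forall>(\<phi>, w)\<in>set ms. \<exists>J. adapted n s \<gamma> \<Omega> J \<phi> w) \<and>
       (\<forall>x\<in>\<Omega>. F x = (\<Sum>(\<phi>, w)\<leftarrow>ms. \<phi> x * prod_list (map x w))) \<and>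
       op_eq n s \<gamma> \<Omega> T (\<Sum>(\<phi>, w)\<leftarrow>ms. Sym_term \<phi> w))"

definition Casimir_basis ::
  "nat \<Rightarrow> nat \<Rightarrow> (nat \<Rightarrow> nat \<Rightarrow> 'f::{real_normed_field,banach}) \<Rightarrow>
    ((lidx \<Rightarrow> 'f) \<Rightarrow> (lidx \<Rightarrow> 'f) \<Rightarrow> bool) \<Rightarrow> (lidx \<Rightarrow> 'f) set \<Rightarrow>
    'l set \<Rightarrow> ('l \<Rightarrow> 'f oper) \<Rightarrow> bool" where
  "Casimir_basis n s \<gamma> R \<Omega> L T \<longleftrightarrow>
     (\<exists>F. Inv_basis n s \<gamma> R \<Omega> L F \<and> (\<forall>l\<in>L. is_Sym n s \<gamma> \<Omega> (F l) (T l)))"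

section \<open>The explicit expressions\<close>

definition alpha :: "nat \<Rightarrow> (nat \<Rightarrow> nat \<Rightarrow> 'f::field) \<Rightarrow> nat \<Rightarrow> nat \<Rightarrow> 'f" where
  "alpha n \<gamma> q j = - (\<Sum>k'=1..j. \<gamma> q (n - k' + 1) - \<gamma> q k')"

definition Delta :: "nat \<Rightarrow> (nat \<Rightarrow> nat \<Rightarrow> 'f::field) \<Rightarrow> nat \<Rightarrow> (nat \<Rightarrow> nat) \<Rightarrow> 'f" where
  "Delta n \<gamma> s' k = det (mat s' s' (\<lambda>(r, c). alpha n \<gamma> (Suc r) (k (Suc c))))"

definition Delta_repl :: "nat \<Rightarrow> (nat \<Rightarrow> nat \<Rightarrow> 'f::field) \<Rightarrow> nat \<Rightarrow> (nat \<Rightarrow> nat) \<Rightarrow> nat \<Rightarrow> nat \<Rightarrow> 'f" where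
  "Delta_repl n \<gamma> s' k q j =
     det (mat s' s' (\<lambda>(r, c). alpha n \<gamma> (Suc r) (if Suc c = q then j else k (Suc c))))"

definition beta :: "nat \<Rightarrow> (nat \<Rightarrow> nat \<Rightarrow> 'f::field) \<Rightarrow> nat \<Rightarrow> (nat \<Rightarrow> nat) \<Rightarrow> nat \<Rightarrow> nat \<Rightarrow> 'f" where
  "beta n \<gamma> s' k q j = - Delta_repl n \<gamma> s' k q j / Delta n \<gamma> s' k"

text \<open>The matrix with rows \<open>i1..i2\<close> and columns \<open>j1..j2\<close> of basis elements (\<^const>\<open>Some\<close>) or zeros
  (\<^const>\<open>None\<close>), and its value at a point of the dual space.\<close>

definition Emat :: "nat \<Rightarrow> nat \<Rightarrow> nat \<Rightarrow> nat \<Rightarrow> lidx option mat" where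
  "Emat i1 i2 j1 j2 = mat (Suc i2 - i1) (Suc j2 - j1) (\<lambda>(r, c). Some (E (i1 + r) (j1 + c)))"

definition eval_mat :: "(lidx \<Rightarrow> 'f::field) \<Rightarrow> lidx option mat \<Rightarrow> 'f mat" where
  "eval_mat x M = map_mat (\<lambda>e. case e of None \<Rightarrow> 0 | Some a \<Rightarrow> x a) M"

definition corner_minor :: "nat \<Rightarrow> nat \<Rightarrow> (lidx \<Rightarrow> 'f::field) \<Rightarrow> 'f" where
  "corner_minor n j x = det (eval_mat x (Emat 1 j (n - j + 1) n))"

text \<open>Leibniz expansion of \<open>\<phi> |M|\<close> with the factors of each monomial in the order of rows (if the
  flag is set) or in the opposite order.\<close>

definition ordered_det ::
  "bool \<Rightarrow> ((lidx \<Rightarrow> 'f) \<Rightarrow> 'f) \<Rightarrow> lidx option mat \<Rightarrow> ('f::real_normed_field) oper" where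
  "ordered_det ord \<phi> M =
     (\<Sum>\<sigma> | \<sigma> permutes {..<dim_row M} \<and> (\<forall>r<dim_row M. M $$ (r, \<sigma> r) \<noteq> None).
        term_op (\<lambda>x. of_int (sign \<sigma>) * \<phi> x)
          (map (\<lambda>r. the (M $$ (r, \<sigma> r))) (if ord then [0..<dim_row M] else rev [0..<dim_row M])))"

definition first_kind ::
  "nat \<Rightarrow> (nat \<Rightarrow> nat \<Rightarrow> 'f::real_normed_field) \<Rightarrow> nat \<Rightarrow> (nat \<Rightarrow> nat) \<Rightarrow> ('f \<Rightarrow> 'f \<Rightarrow> 'f) \<Rightarrow> nat \<Rightarrow> 'f oper" where
  "first_kind n \<gamma> s' k pw j =
     term_op (\<lambda>x. corner_minor n j x *
       (\<Prod>q=1..s'. pw (corner_minor n (k q) x) (beta n \<gamma> s' k q j))) []"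

definition second_kind ::
  "nat \<Rightarrow> (nat \<Rightarrow> nat \<Rightarrow> 'f::real_normed_field) \<Rightarrow> bool \<Rightarrow> nat \<Rightarrow> 'f oper" where
  "second_kind n \<gamma> ord p =
     term_op (\<lambda>_. 1) [P p] +
     (\<Sum>j=1..n div 2. \<Sum>i\<in>{j<..<n - j + 1}.
        ordered_det ord (\<lambda>x. (- 1) ^ (j + 1) / corner_minor n j x * (\<gamma> p j - \<gamma> p (j + 1)))
          (four_block_mat
            (Emat 1 j i i)               (Emat 1 j (n - j + 1) n)
            (mat 1 1 (\<lambda>_. None))  (Emat i i (n - j + 1) n)))"

definition expr_set :: "nat \<Rightarrow> nat \<Rightarrow> nat \<Rightarrow> (nat \<Rightarrow> nat) \<Rightarrow> (nat + nat) set" where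
  "expr_set n s s' k = ({1..n div 2} - k ` {1..s'}) <+> {s' + 1..s}"

definition casimir_expr ::
  "nat \<Rightarrow> (nat \<Rightarrow> nat \<Rightarrow> 'f::real_normed_field) \<Rightarrow> nat \<Rightarrow> (nat \<Rightarrow> nat) \<Rightarrow> ('f \<Rightarrow> 'f \<Rightarrow> 'f) \<Rightarrow> bool \<Rightarrow>
    nat + nat \<Rightarrow> 'f oper" where
  "casimir_expr n \<gamma> s' k pw ord = case_sum (first_kind n \<gamma> s' k pw) (second_kind n \<gamma> ord)"

text \<open>Points at which the expressions are defined; \<open>W b\<close> is the set of nonzero bases for which the
  power with exponent \<open>b\<close> is available.\<close>

definition expr_domain ::
  "nat \<Rightarrow> nat \<Rightarrow> (nat \<Rightarrow> nat \<Rightarrow> 'f::real_normed_field) \<Rightarrow> nat \<Rightarrow> (nat \<Rightarrow> nat) \<Rightarrow> ('f \<Rightarrow> 'f set) \<Rightarrow>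
    (lidx \<Rightarrow> 'f) set" where
  "expr_domain n s \<gamma> s' k W = {x \<in> topspace (dual_top n s).
     (\<forall>j\<in>{1..n div 2}. corner_minor n j x \<noteq> 0) \<and>
     (\<forall>j\<in>{1..n div 2} - k ` {1..s'}. \<forall>q\<in>{1..s'}. corner_minor n (k q) x \<in> W (beta n \<gamma> s' k q j))}"

subsection \<open>Powers\<close>

definition real_pow :: "real \<Rightarrow> real \<Rightarrow> real" where
  "real_pow z b =
     (if \<exists>r. b = of_rat r \<and> odd (snd (quotient_of r))
      then (let (u, v) = quotient_of (THE r. b = of_rat r) in root (nat v) z powi u)
      else \<bar>z\<bar> powr b)"

definition log_branch :: "complex set \<Rightarrow> (complex \<Rightarrow> complex) \<Rightarrow> bool" where
  "log_branch D lg \<longleftrightarrow>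
     open D \<and> connected D \<and> D \<noteq> {} \<and> continuous_on D lg \<and> (\<forall>z\<in>D. exp (lg z) = z)"

definition complex_pow :: "(complex \<Rightarrow> complex) \<Rightarrow> complex \<Rightarrow> complex \<Rightarrow> complex" where
  "complex_pow lg z b = (if b \<in> \<int> then z powi (THE m. b = of_int m) else exp (b * lg z))"

definition complex_pow_dom :: "complex set \<Rightarrow> complex \<Rightarrow> complex set" where
  "complex_pow_dom D b = (if b \<in> \<int> then UNIV else D)"

end

theory Submission
  imports Defs
begin

text \<open>A point \<open>x\<close> of the dual space is represented by an \<open>n \<times> n\<close> matrix \<open>Y\<close>, on which a group element
  \<open>B\<close> acts by \<open>Y \<mapsto> g Y g\<^sup>-\<^sup>1\<close> with \<open>g\<close> the (lower triangular) inverse transpose of \<open>B\<close>. The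
  \<open>j\<close>-th upper right corner minor is multiplied by \<open>exp (- \<Sum>\<^sub>p \<epsilon>\<^sub>p \<alpha>\<^sub>p\<^sub>j)\<close>, so that the exponents
  \<open>\<beta>\<close> obtained from Cramer's rule make the expressions of the first kind invariant. If \<open>K\<^sub>j\<close> is the
  inverse of the \<open>j\<close>-th corner, put in the lower left corner of an \<open>n \<times> n\<close> matrix, then \<open>K\<^sub>j\<close> is
  conjugated by \<open>g\<close> as well; hence \<open>tr (K\<^sub>j Y\<^sup>2)\<close> is invariant, and Abel summation writes each
  expression of the second kind as a linear combination of these traces and of \<open>tr Y\<close>.

  The gradient of the logarithm of the \<open>j\<close>-th corner minor is \<open>K\<^sub>j\<close>, and the diagonal of \<open>Y K\<^sub>j\<close> begins
  with \<open>j\<close> ones followed by zeros, so that the \<open>K\<^sub>j\<close> are linearly independent. This gives functional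
  independence. Combinations of the \<open>K\<^sub>j\<close>, and of the matrices \<open>K\<^sub>j Y + Y K\<^sub>j - K\<^sub>j Y\<^sup>2 K\<^sub>j\<close> and the identity,
  stabilize a regular point, which bounds the rank of the coadjoint action from above; the bound is
  attained at an antidiagonal matrix.

  In the expressions of the second kind, exchanging the two noncommuting factors produces an entry of
  the corner, and the resulting determinant is a multiple of the corner minor in the denominator;
  ordering therefore affects the expression only by a constant. For complex powers, the values of an
  invariant on one orbit form a countable set, so that the invariant is constant on pathwise connected
  pieces of the orbit.\<close>

section \<open>Finite families of vectors\<close>

text \<open>The matrix Y is not determined by x: its entries below the diagonal are free, and its
  diagonal is known only through the pairings with the diagonal matrices
  \<open>\<Gamma>\<^sub>p\<close>. A single trace tr(K_j Y^2) is therefore not a function on the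
  dual space. Weighting the traces by differences of \<gamma> makes the diagonal of Y enter only
  through its pairing with row p of \<gamma>, and this rests on the symmetry of that row, which
  holds for p > s'. A row q \<le> s' is instead spent on cancelling weights of corner minors, at the
  price of the minor with index k_q. Since j \<le> n/2, the corners lie strictly above the diagonal,
  where Y is determined by x.

  The vectors that annihilate the tangent space of an orbit are the differentials of invariants, so
  a single independence argument yields both functional independence and the upper bound of the
  rank.\<close>

definition indep_family :: "'l set \<Rightarrow> 'i set \<Rightarrow> ('l \<Rightarrow> 'i \<Rightarrow> 'f::field) \<Rightarrow> bool" where
  "indep_family L I w \<longleftrightarrow> (\<forall>c. (\<forall>i\<in>I. (\<Sum>l\<in>L. c l * w l i) = 0) \<longrightarrow> (\<forall>l\<in>L. c l = 0))"

lemma indep_familyD: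
  assumes "indep_family L I w" "\<And>i. i \<in> I \<Longrightarrow> (\<Sum>l\<in>L. c l * w l i) = 0" "l \<in> L"
  shows "c l = 0"
  using assms unfolding indep_family_def by blast

lemma indep_familyI:
  assumes "\<And>c l. (\<And>i. i \<in> I \<Longrightarrow> (\<Sum>l\<in>L. c l * w l i) = 0) \<Longrightarrow> l \<in> L \<Longrightarrow> c l = 0"
  shows "indep_family L I w"
  using assms unfolding indep_family_def by blast

lemma indep_family_subset:
  assumes "indep_family L I w" "L' \<subseteq> L" "finite L"
  shows "indep_family L' I w"
proof (rule indep_familyI)
  fix c l assume z: "\<And>i. i \<in> I \<Longrightarrow> (\<Sum>l\<in>L'. c l * w l i) = 0" and l: "l \<in> L'"
  have "(\<lambda>l. if l \<in> L' then c l else 0) l = 0"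
  proof (rule indep_familyD[where c = "\<lambda>l. if l \<in> L' then c l else 0" and l = l, OF assms(1)])
    fix i assume "i \<in> I"
    have "(\<Sum>l\<in>L. (if l \<in> L' then c l else 0) * w l i) = (\<Sum>l\<in>L'. c l * w l i)"
      using assms by (intro sum.mono_neutral_cong_right) auto
    with z \<open>i \<in> I\<close> show "(\<Sum>l\<in>L. (if l \<in> L' then c l else 0) * w l i) = 0" by simp
  qed (use l assms in auto)
  with l show "c l = 0" by simp
qed

text \<open>Induction on the family, in the manner of Gram-Schmidt: a coordinate at which the new
  vector is not explained by the old ones yields its dual vector, and the old dual vectors are then
  corrected.\<close>

lemma dual_vectors:
  fixes w :: "'l \<Rightarrow> 'i \<Rightarrow> 'f::field"
  assumes "finite L" "finite I" "indep_family L I w"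
  shows "\<exists>g. \<forall>l\<in>L. \<forall>l'\<in>L. (\<Sum>i\<in>I. g l i * w l' i) = (if l = l' then 1 else 0)"
  using assms(1,3)
proof (induction L rule: finite_induct)
  case empty
  then show ?case by simp
next
  case (insert a L)
  have "indep_family L I w"
    using insert.prems by (rule indep_family_subset) (use insert.hyps in auto)
  with insert.IH obtain g
    where g: "\<And>l l'. l \<in> L \<Longrightarrow> l' \<in> L \<Longrightarrow> (\<Sum>i\<in>I. g l i * w l' i) = (if l = l' then 1 else 0)"
    by blast
  define p where "p l = (\<Sum>i\<in>I. g l i * w a i)" for l
  \<comment> \<open>The part of \<open>w a\<close> that all old dual vectors annihilate;
    independence makes it nonzero at some coordinate.\<close>
  define u where "u i = w a i - (\<Sum>l\<in>L. p l * w l i)" for i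
  have "\<exists>i\<in>I. u i \<noteq> 0"
  proof (rule ccontr)
    assume "\<not> ?thesis"
    hence 0: "\<And>i. i \<in> I \<Longrightarrow> u i = 0" by blast
    have "(\<lambda>l. if l = a then 1 else - p l) a = 0"
    proof (rule indep_familyD[where c = "\<lambda>l. if l = a then 1 else - p l" and l = a, OF insert.prems])
      fix i assume i: "i \<in> I"
      have "(\<Sum>l\<in>L. (if l = a then 1 else - p l) * w l i) = (\<Sum>l\<in>L. - p l * w l i)"
        using insert.hyps by (intro sum.cong) auto
      then show "(\<Sum>l\<in>insert a L. (if l = a then 1 else - p l) * w l i) = 0"
        using insert.hyps 0[OF i] by (simp add: u_def sum_negf)
    qed simp
    then show False by simp
  qed
  then obtain i0 where i0: "i0 \<in> I" "u i0 \<noteq> 0" by blast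
  \<comment> \<open>Evaluation at \<open>i0\<close>, corrected by the old dual vectors so that it
    vanishes on every \<open>w l\<close>. On \<open>w a\<close> the numerator becomes
    \<open>u i0\<close>, whence the denominator.\<close>
  define h where "h i = ((if i = i0 then 1 else 0) - (\<Sum>l\<in>L. g l i * w l i0)) / u i0" for i
  have hv: "(\<Sum>i\<in>I. h i * v i) = (v i0 - (\<Sum>l\<in>L. (\<Sum>i\<in>I. g l i * v i) * w l i0)) / u i0" for v
  proof -
    have "(\<Sum>i\<in>I. h i * v i) =
        (\<Sum>i\<in>I. ((if i = i0 then v i else 0) - (\<Sum>l\<in>L. g l i * v i * w l i0)) / u i0)"
      unfolding h_def by (intro sum.cong refl)
        (simp add: diff_divide_distrib left_diff_distrib right_diff_distrib sum_distrib_left mult.commute mult.left_commute)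
    also have "\<dots> = ((\<Sum>i\<in>I. if i = i0 then v i else 0) - (\<Sum>i\<in>I. \<Sum>l\<in>L. g l i * v i * w l i0)) / u i0"
      by (simp add: sum_divide_distrib[symmetric] sum_subtractf)
    also have "(\<Sum>i\<in>I. \<Sum>l\<in>L. g l i * v i * w l i0) = (\<Sum>l\<in>L. (\<Sum>i\<in>I. g l i * v i) * w l i0)"
      by (subst sum.swap) (simp add: sum_distrib_right)
    also have "(\<Sum>i\<in>I. if i = i0 then v i else 0) = v i0" using i0 assms(2) by simp
    finally show ?thesis .
  qed
  have ha: "(\<Sum>i\<in>I. h i * w a i) = 1"
    unfolding hv p_def[symmetric] using i0 by (simp add: u_def)
  have hl: "(\<Sum>i\<in>I. h i * w l i) = 0" if l: "l \<in> L" for l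
  proof -
    have "(\<Sum>l'\<in>L. (\<Sum>i\<in>I. g l' i * w l i) * w l' i0) = (\<Sum>l'\<in>L. if l' = l then w l' i0 else 0)"
      using g l by (intro sum.cong) auto
    also have "\<dots> = w l i0" using l insert.hyps by simp
    finally show ?thesis unfolding hv by simp
  qed
  define G where "G l i = (if l = a then h i else g l i - p l * h i)" for l i
  have GL: "(\<Sum>i\<in>I. G l i * v i) = (\<Sum>i\<in>I. g l i * v i) - p l * (\<Sum>i\<in>I. h i * v i)" if "l \<in> L" for l v
  proof -
    have "l \<noteq> a" using that insert.hyps by auto
    then show ?thesis unfolding G_def by (simp add: algebra_simps sum_subtractf sum_distrib_left)
  qed
  have Ga: "(\<Sum>i\<in>I. G a i * v i) = (\<Sum>i\<in>I. h i * v i)" for v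
    by (simp add: G_def)
  have "\<forall>l\<in>insert a L. \<forall>l'\<in>insert a L. (\<Sum>i\<in>I. G l i * w l' i) = (if l = l' then 1 else 0)"
    using insert.hyps g by (auto simp: GL Ga ha hl p_def[symmetric])
  then show ?case by blast
qed

section \<open>Ranks of finite families, in the vector space whose dimension defines
  \<open>orbit_dim\<close>\<close>

interpretation fun_vs: vector_space "\<lambda>(c::'f::field) (v::'i \<Rightarrow> 'f) b. c * v b"
  by unfold_locales (auto simp: fun_eq_iff algebra_simps)

lemma sum_scaled_fun:
  "(\<Sum>x\<in>A. (\<lambda>b. c x * f x b)) = (\<lambda>b. \<Sum>x\<in>A. c x * (f x b :: 'f::field))"
  by (induction A rule: infinite_finite_induct) (auto simp: fun_eq_iff)

text \<open>Bridge from families to sets: a repeated vector makes a family dependent but leaves its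
  image unchanged, so injectivity has to be stated separately.\<close>

lemma indep_family_UNIV_iff:
  fixes v :: "'a \<Rightarrow> 'i \<Rightarrow> 'f::field"
  assumes "finite A"
  shows "indep_family A UNIV v \<longleftrightarrow> inj_on v A \<and> fun_vs.independent (v ` A)"
proof
  assume ind: "indep_family A UNIV v"
  have inj: "inj_on v A"
  proof (rule inj_onI, rule ccontr)
    fix a b assume ab: "a \<in> A" "b \<in> A" "v a = v b" "a \<noteq> b"
    have "(\<lambda>l. if l = a then 1 else if l = b then -1 else 0) a = (0::'f)"
    proof (rule indep_familyD[where c = "\<lambda>l. if l = a then 1 else if l = b then -1 else 0" and l = a, OF ind])
      fix i
      have "(\<Sum>l\<in>A. (if l = a then 1 else if l = b then -1 else 0) * v l i) =
         (\<Sum>l\<in>A. (if l = a then v l i else 0) - (if l = b then v l i else 0))"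
        using ab by (intro sum.cong) auto
      also have "\<dots> = 0" using ab assms by (simp add: sum_subtractf)
      finally show "(\<Sum>l\<in>A. (if l = a then 1 else if l = b then -1 else 0) * v l i) = 0" .
    qed (use ab in auto)
    then show False by simp
  qed
  moreover have "fun_vs.independent (v ` A)"
  proof (rule fun_vs.independent_if_scalars_zero)
    fix f x assume s: "(\<Sum>x\<in>v ` A. (\<lambda>b. f x * x b)) = 0" and x: "x \<in> v ` A"
    from x obtain a where a: "a \<in> A" "x = v a" by auto
    have "(\<lambda>a. f (v a)) a = 0"
    proof (rule indep_familyD[where c = "\<lambda>a. f (v a)" and l = a, OF ind])
      fix i
      have "(\<Sum>l\<in>A. f (v l) * v l i) = (\<Sum>x\<in>v ` A. (\<lambda>b. f x * x b)) i"
        unfolding sum_scaled_fun using inj by (simp add: sum.reindex)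
      then show "(\<Sum>l\<in>A. f (v l) * v l i) = 0" unfolding s by simp
    qed (use a in auto)
    then show "f x = 0" using a by simp
  qed (use assms in auto)
  ultimately show "inj_on v A \<and> fun_vs.independent (v ` A)" by blast
next
  assume a: "inj_on v A \<and> fun_vs.independent (v ` A)"
  show "indep_family A UNIV v"
  proof (rule indep_familyI)
    fix c l assume z: "\<And>i. i \<in> UNIV \<Longrightarrow> (\<Sum>l\<in>A. c l * v l i) = 0" and l: "l \<in> A"
    have "(\<lambda>x. c (the_inv_into A v x)) (v l) = 0"
    proof (rule fun_vs.independentD[of "v ` A" "v ` A" "\<lambda>x. c (the_inv_into A v x)"])
      show "(\<Sum>x\<in>v ` A. (\<lambda>b. c (the_inv_into A v x) * x b)) = 0"
        unfolding sum_scaled_fun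
        using z a by (auto simp: fun_eq_iff sum.reindex the_inv_into_f_f)
    qed (use a l assms in auto)
    then show "c l = 0" using a l by (simp add: the_inv_into_f_f)
  qed
qed

text \<open>Extended by zero outside \<open>I\<close>, the family lies in the span of the coordinate
  vectors belonging to \<open>I\<close>.\<close>

lemma indep_family_card_le:
  fixes v :: "'l \<Rightarrow> 'i \<Rightarrow> 'f::field"
  assumes "finite A" "finite I" "indep_family A I v"
  shows "card A \<le> card I"
proof -
  define v' where "v' a i = (if i \<in> I then v a i else 0)" for a i
  have "indep_family A UNIV v'"
  proof (rule indep_familyI)
    fix c l assume z: "\<And>i. i \<in> UNIV \<Longrightarrow> (\<Sum>l\<in>A. c l * v' l i) = 0" and l: "l \<in> A"
    show "c l = 0"
    proof (rule indep_familyD[OF assms(3) _ l])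
      fix i assume "i \<in> I"
      then show "(\<Sum>l\<in>A. c l * v l i) = 0" using z[of i] by (simp add: v'_def)
    qed
  qed
  hence *: "inj_on v' A" "fun_vs.independent (v' ` A)"
    using indep_family_UNIV_iff[OF assms(1)] by blast+
  define u :: "'i \<Rightarrow> 'i \<Rightarrow> 'f" where "u i = (\<lambda>b. if b = i then 1 else 0)" for i
  have "v' ` A \<subseteq> fun_vs.span (u ` I)"
  proof
    fix x assume "x \<in> v' ` A"
    then obtain a where x: "x = v' a" by auto
    have "x = (\<Sum>i\<in>I. (\<lambda>b. v a i * u i b))"
      unfolding sum_scaled_fun x using assms(2) by (auto simp: fun_eq_iff v'_def u_def if_distrib cong: if_cong)
    also have "\<dots> \<in> fun_vs.span (u ` I)"
      by (intro fun_vs.span_sum fun_vs.span_scale fun_vs.span_base) auto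
    finally show "x \<in> fun_vs.span (u ` I)" .
  qed
  with fun_vs.independent_span_bound[of "u ` I" "v' ` A"] * assms(2)
  have "card (v' ` A) \<le> card (u ` I)" by auto
  also have "\<dots> \<le> card I" using assms(2) by (rule card_image_le)
  finally show ?thesis using * by (simp add: card_image)
qed

lemma dim_family_obtain:
  fixes v :: "'l \<Rightarrow> 'i \<Rightarrow> 'f::field"
  assumes "finite A"
  obtains A' where "A' \<subseteq> A" "card A' = fun_vs.dim (v ` A)" "indep_family A' UNIV v"
proof -
  obtain B where B: "B \<subseteq> v ` A" "fun_vs.independent B" "card B = fun_vs.dim (v ` A)"
    using fun_vs.basis_exists by metis
  obtain A' where A': "A' \<subseteq> A" "inj_on v A'" "B = v ` A'"
    using B(1) by (metis subset_image_inj)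
  have "indep_family A' UNIV v"
    using A' B assms by (subst indep_family_UNIV_iff) (auto intro: finite_subset)
  then show thesis using that A' B by (simp add: card_image)
qed

lemma indep_family_card_le_dim:
  fixes v :: "'l \<Rightarrow> 'i \<Rightarrow> 'f::field"
  assumes "finite A" "A' \<subseteq> A" "indep_family A' UNIV v"
  shows "card A' \<le> fun_vs.dim (v ` A)"
proof -
  have *: "inj_on v A'" "fun_vs.independent (v ` A')"
    using indep_family_UNIV_iff[of A' v] assms finite_subset by blast+
  obtain B where B: "v ` A' \<subseteq> B" "B \<subseteq> v ` A" "fun_vs.independent B" "v ` A \<subseteq> fun_vs.span B"
    using fun_vs.maximal_independent_subset_extend[of "v ` A'" "v ` A"] * assms by blast
  have "fun_vs.dim (v ` A) = card B"
    using fun_vs.basis_card_eq_dim B by metis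
  moreover have "card (v ` A') \<le> card B"
    using B assms by (intro card_mono) (auto intro: finite_subset)
  ultimately show ?thesis using * by (simp add: card_image)
qed

text \<open>Upper bound for a rank. Vectors dual to the \<open>w l\<close> are independent of the
  \<open>v a\<close>, because every \<open>w l\<close> vanishes on all \<open>v a\<close> and picks
  out a single dual vector.\<close>

lemma dim_add_card_annihilator_le:
  fixes v :: "'a \<Rightarrow> 'i \<Rightarrow> 'f::field"
  assumes fin: "finite A" "finite L" "finite I"
    and supp: "\<And>a i. a \<in> A \<Longrightarrow> i \<notin> I \<Longrightarrow> v a i = 0"
    and ind: "indep_family L I w"
    and orth: "\<And>a l. a \<in> A \<Longrightarrow> l \<in> L \<Longrightarrow> (\<Sum>i\<in>I. v a i * w l i) = 0"
  shows "fun_vs.dim (v ` A) + card L \<le> card I"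
proof -
  obtain A' where A': "A' \<subseteq> A" "card A' = fun_vs.dim (v ` A)" "indep_family A' UNIV v"
    using dim_family_obtain[OF fin(1)] by metis
  have fA': "finite A'" using A' fin finite_subset by blast
  obtain g where g: "\<And>l l'. l \<in> L \<Longrightarrow> l' \<in> L \<Longrightarrow> (\<Sum>i\<in>I. g l i * w l' i) = (if l = l' then 1 else 0)"
    using dual_vectors[OF fin(2,3) ind] by blast
  have "indep_family (A' <+> L) I (case_sum v g)"
  proof (rule indep_familyI)
    fix c x assume z: "\<And>i. i \<in> I \<Longrightarrow> (\<Sum>x\<in>A' <+> L. c x * (case_sum v g x) i) = 0" and x: "x \<in> A' <+> L"
    have z': "(\<Sum>a\<in>A'. c (Inl a) * v a i) + (\<Sum>l\<in>L. c (Inr l) * g l i) = 0" if "i \<in> I" for i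
      using z[OF that] fA' fin by (simp add: sum.Plus)
    have cL: "c (Inr l) = 0" if l: "l \<in> L" for l
    proof -
      have "0 = (\<Sum>i\<in>I. ((\<Sum>a\<in>A'. c (Inl a) * v a i) + (\<Sum>l\<in>L. c (Inr l) * g l i)) * w l i)"
        using z' by simp
      also have "\<dots> = (\<Sum>i\<in>I. \<Sum>a\<in>A'. c (Inl a) * (v a i * w l i))
          + (\<Sum>i\<in>I. \<Sum>l'\<in>L. c (Inr l') * (g l' i * w l i))"
        by (simp add: sum_distrib_left sum_distrib_right algebra_simps sum.distrib)
      also have "(\<Sum>i\<in>I. \<Sum>a\<in>A'. c (Inl a) * (v a i * w l i)) = (\<Sum>a\<in>A'. c (Inl a) * (\<Sum>i\<in>I. v a i * w l i))"
        by (subst sum.swap) (simp add: sum_distrib_left)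
      also have "\<dots> = 0" using orth l A' by (intro sum.neutral) auto
      also have "(\<Sum>i\<in>I. \<Sum>l'\<in>L. c (Inr l') * (g l' i * w l i)) = (\<Sum>l'\<in>L. c (Inr l') * (\<Sum>i\<in>I. g l' i * w l i))"
        by (subst sum.swap) (simp add: sum_distrib_left)
      also have "\<dots> = (\<Sum>l'\<in>L. if l' = l then c (Inr l') else 0)"
        using g l by (intro sum.cong) auto
      also have "\<dots> = c (Inr l)" using l fin by simp
      finally show ?thesis by simp
    qed
    have cA: "c (Inl a) = 0" if a: "a \<in> A'" for a
    proof -
      have "(\<lambda>a. c (Inl a)) a = 0"
      proof (rule indep_familyD[where c = "\<lambda>a. c (Inl a)" and l = a, OF A'(3)])
        fix i
        show "(\<Sum>a\<in>A'. c (Inl a) * v a i) = 0"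
        proof (cases "i \<in> I")
          case True
          then show ?thesis using z'[OF True] cL by simp
        next
          case False
          then show ?thesis using supp A' by (intro sum.neutral) auto
        qed
      qed (rule a)
      then show ?thesis .
    qed
    show "c x = 0" using x cL cA by auto
  qed
  from indep_family_card_le[OF _ fin(3) this] fA' fin
  show ?thesis using A' by (simp add: card_Plus)
qed

text \<open>Lower bound for a rank: a basis of the \<open>v a\<close>, completed by the coordinate
  vectors of \<open>I'\<close>, spans \<open>card I\<close> independent vectors. It is applied at
  the antidiagonal point.\<close>

lemma card_le_dim_add_card:
  fixes v :: "'a \<Rightarrow> 'i \<Rightarrow> 'f::field"
  assumes fin: "finite A" "finite I"
    and span: "\<And>i. i \<in> I \<Longrightarrow> (\<lambda>b. if b = i then 1 else 0) \<in>
      fun_vs.span (v ` A \<union> (\<lambda>i b. if b = i then 1 else 0) ` I')"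
    and I': "finite I'"
  shows "card I \<le> fun_vs.dim (v ` A) + card I'"
proof -
  define u :: "'i \<Rightarrow> 'i \<Rightarrow> 'f" where "u i = (\<lambda>b. if b = i then 1 else 0)" for i
  obtain B where B: "B \<subseteq> v ` A" "fun_vs.independent B" "v ` A \<subseteq> fun_vs.span B" "card B = fun_vs.dim (v ` A)"
    using fun_vs.basis_exists by metis
  have finB: "finite B" using B fin finite_subset by blast
  have "u ` I \<subseteq> fun_vs.span (v ` A \<union> u ` I')" using span by (auto simp: u_def)
  also have "\<dots> \<subseteq> fun_vs.span (B \<union> u ` I')"
  proof (rule fun_vs.span_minimal)
    show "v ` A \<union> u ` I' \<subseteq> fun_vs.span (B \<union> u ` I')"
      using B(3) fun_vs.span_mono[of B "B \<union> u ` I'"] fun_vs.span_superset[of "B \<union> u ` I'"] by auto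
  qed simp
  finally have sp: "u ` I \<subseteq> fun_vs.span (B \<union> u ` I')" .
  have "indep_family I UNIV u"
  proof (rule indep_familyI)
    fix c l assume z: "\<And>i. i \<in> UNIV \<Longrightarrow> (\<Sum>l\<in>I. c l * u l i) = (0::'f)" and l: "l \<in> I"
    show "c l = 0" using z[of l] l fin by (simp add: u_def if_distrib cong: if_cong)
  qed
  hence u: "inj_on u I" "fun_vs.independent (u ` I)"
    using indep_family_UNIV_iff[OF fin(2)] by blast+
  have "card (u ` I) \<le> card (B \<union> u ` I')"
    using fun_vs.independent_span_bound[OF _ u(2) sp] finB I' by auto
  also have "\<dots> \<le> card B + card (u ` I')" by (rule card_Un_le)
  also have "\<dots> \<le> card B + card I'" using card_image_le[OF I'] by simp
  finally show ?thesis using u B by (simp add: card_image)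
qed

text \<open>A strictly diagonally dominant system has only the zero solution: in the equation of an
  index where the norm of \<open>c\<close> is largest, the sum is too small to cancel the leading
  term.\<close>

lemma dominant_imp_zero:
  fixes H :: "'a \<Rightarrow> 'a \<Rightarrow> 'f::real_normed_field"
  assumes fin: "finite A" and le: "\<And>a. a \<in> A \<Longrightarrow> (\<Sum>b\<in>A. norm (H a b)) < 1"
    and eq: "\<And>a. a \<in> A \<Longrightarrow> c a + (\<Sum>b\<in>A. H a b * c b) = 0"
    and a: "a \<in> A"
  shows "c a = 0"
proof -
  define m where "m = Max ((\<lambda>a. norm (c a)) ` A)"
  have ne: "A \<noteq> {}" using a by auto
  have m: "norm (c b) \<le> m" if "b \<in> A" for b
    unfolding m_def using fin that by (intro Max_ge) auto
  have "m \<in> (\<lambda>a. norm (c a)) ` A" unfolding m_def using fin ne by (intro Max_in) auto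
  then obtain a0 where a0: "a0 \<in> A" "norm (c a0) = m" by auto
  have "c a0 = - (\<Sum>b\<in>A. H a0 b * c b)" using eq[OF a0(1)] by (simp add: eq_neg_iff_add_eq_0)
  hence "m = norm (\<Sum>b\<in>A. H a0 b * c b)" using a0 by simp
  also have "\<dots> \<le> (\<Sum>b\<in>A. norm (H a0 b) * m)"
    by (rule order.trans[OF norm_sum], rule sum_mono) (auto simp: norm_mult intro!: mult_left_mono m)
  also have "\<dots> = (\<Sum>b\<in>A. norm (H a0 b)) * m" by (simp add: sum_distrib_right)
  finally have "m * (1 - (\<Sum>b\<in>A. norm (H a0 b))) \<le> 0" by (simp add: algebra_simps)
  hence "m \<le> 0" using le[OF a0(1)] by (simp add: mult_le_0_iff)
  with m[OF a] show ?thesis by (metis norm_le_zero_iff order.trans)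
qed

text \<open>Functionals dual to a maximal independent subfamily of the \<open>v0 a\<close> send the
  perturbed subfamily to the identity matrix plus t H, which is injective for small t.\<close>

lemma dim_segment_lower_semicontinuous:
  fixes v0 v1 :: "'a \<Rightarrow> 'i \<Rightarrow> 'f::real_normed_field"
  assumes fin: "finite A" "finite I"
    and supp: "\<And>a i. i \<notin> I \<Longrightarrow> v0 a i = 0"
  shows "\<exists>\<delta>>0. \<forall>t. norm t < \<delta> \<longrightarrow>
    fun_vs.dim (v0 ` A) \<le> fun_vs.dim ((\<lambda>a b. (1 - t) * v0 a b + t * v1 a b) ` A)"
proof -
  obtain A' where A': "A' \<subseteq> A" "card A' = fun_vs.dim (v0 ` A)" "indep_family A' UNIV v0"
    using dim_family_obtain[OF fin(1)] by metis
  have fA': "finite A'" using A' fin finite_subset by blast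
  have "indep_family A' I v0"
  proof (rule indep_familyI)
    fix c l assume z: "\<And>i. i \<in> I \<Longrightarrow> (\<Sum>l\<in>A'. c l * v0 l i) = 0" and l: "l \<in> A'"
    show "c l = 0"
      by (rule indep_familyD[OF A'(3) _ l], case_tac "i \<in> I") (auto simp: z supp)
  qed
  from dual_vectors[OF fA' fin(2) this] obtain g where
    g: "\<And>l l'. l \<in> A' \<Longrightarrow> l' \<in> A' \<Longrightarrow> (\<Sum>i\<in>I. g l i * v0 l' i) = (if l = l' then 1 else 0)" by blast
  define H where "H a b = (\<Sum>i\<in>I. g a i * (v1 b i - v0 b i))" for a b
  \<comment> \<open>The sum of all entries bounds every row sum of H. The summand 1 in 1 / (M + 1)
    keeps the radius meaningful when H vanishes.\<close>
  define M where "M = (\<Sum>a\<in>A'. \<Sum>b\<in>A'. norm (H a b))"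
  have M0: "M \<ge> 0" unfolding M_def by (intro sum_nonneg) auto
  show ?thesis
  proof (intro exI[of _ "1 / (M + 1)"] conjI allI impI)
    show "1 / (M + 1) > 0" using M0 by simp
    fix t :: 'f assume t: "norm t < 1 / (M + 1)"
    let ?v = "\<lambda>a b. (1 - t) * v0 a b + t * v1 a b"
    have "indep_family A' UNIV ?v"
    proof (rule indep_familyI)
      fix c l assume z: "\<And>i. i \<in> UNIV \<Longrightarrow> (\<Sum>l\<in>A'. c l * ?v l i) = 0" and l: "l \<in> A'"
      show "c l = 0"
      proof (rule dominant_imp_zero[OF fA' _ _ l, of "\<lambda>a b. t * H a b"])
        fix a assume a: "a \<in> A'"
        have "(\<Sum>b\<in>A'. norm (t * H a b)) = norm t * (\<Sum>b\<in>A'. norm (H a b))"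
          by (simp add: norm_mult sum_distrib_left)
        also have "\<dots> \<le> norm t * M" unfolding M_def using a fA'
          by (intro mult_left_mono member_le_sum[where f="\<lambda>a. \<Sum>b\<in>A'. norm (H a b)"] sum_nonneg) auto
        also have "\<dots> \<le> norm t * (M + 1)" by (intro mult_left_mono) auto
        also have "\<dots> < 1" using t M0 by (simp add: field_simps)
        finally show "(\<Sum>b\<in>A'. norm (t * H a b)) < 1" .
        \<comment> \<open>Pairing the assumed linear relation with the dual functional
          \<open>g a\<close> isolates the coefficient \<open>c a\<close>.\<close>
        have "0 = (\<Sum>i\<in>I. g a i * (\<Sum>b\<in>A'. c b * ?v b i))" using z by simp
        also have "\<dots> = (\<Sum>i\<in>I. \<Sum>b\<in>A'. c b * (g a i * v0 b i) + t * (g a i * (v1 b i - v0 b i)) * c b)"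
          by (simp add: sum_distrib_left algebra_simps)
        also have "\<dots> = (\<Sum>b\<in>A'. c b * (\<Sum>i\<in>I. g a i * v0 b i)) + (\<Sum>b\<in>A'. t * H a b * c b)"
          unfolding H_def by (subst sum.swap) (simp add: sum.distrib sum_distrib_left sum_distrib_right)
        also have "(\<Sum>b\<in>A'. c b * (\<Sum>i\<in>I. g a i * v0 b i)) = (\<Sum>b\<in>A'. if b = a then c b else 0)"
          using g a by (intro sum.cong) auto
        also have "\<dots> = c a" using a fA' by simp
        finally show "c a + (\<Sum>b\<in>A'. t * H a b * c b) = 0" by simp
      qed
    qed
    from indep_family_card_le_dim[OF fin(1) A'(1) this] A'(2)
    show "fun_vs.dim (v0 ` A) \<le> fun_vs.dim (?v ` A)" by simp
  qed
qed

section \<open>Matrices and the coadjoint action\<close>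

lemma mult_mat_index:
  assumes "A \<in> carrier_mat n m" "B \<in> carrier_mat m l" "i < n" "j < l"
  shows "(A * B) $$ (i, j) = (\<Sum>k<m. A $$ (i, k) * B $$ (k, j))"
  using assms by (auto simp: scalar_prod_def lessThan_atLeast0 intro!: sum.cong)

declare index_mult_mat(1) [simp del]

text \<open>The bilinear pairing tr(A^T B), without conjugation over the complex numbers as
  well.\<close>

definition frob :: "nat \<Rightarrow> 'f::field mat \<Rightarrow> 'f mat \<Rightarrow> 'f" where
  "frob n A B = (\<Sum>i<n. \<Sum>j<n. A $$ (i, j) * B $$ (i, j))"

lemma frob_mult_left:
  fixes Y A B :: "'f::field mat"
  assumes "Y \<in> carrier_mat n n" "A \<in> carrier_mat n n" "B \<in> carrier_mat n n"
  shows "frob n Y (A * B) = frob n B (transpose_mat A * Y)"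
proof -
  have "frob n Y (A * B) = (\<Sum>i<n. \<Sum>j<n. \<Sum>k<n. Y $$ (i, j) * A $$ (i, k) * B $$ (k, j))"
    unfolding frob_def using assms by (simp add: mult_mat_index[of _ n n _ n] sum_distrib_left mult.assoc)
  also have "\<dots> = (\<Sum>i<n. \<Sum>k<n. \<Sum>j<n. Y $$ (i, j) * A $$ (i, k) * B $$ (k, j))"
    by (rule sum.cong[OF refl], rule sum.swap)
  also have "\<dots> = (\<Sum>k<n. \<Sum>i<n. \<Sum>j<n. Y $$ (i, j) * A $$ (i, k) * B $$ (k, j))"
    by (rule sum.swap)
  also have "\<dots> = (\<Sum>k<n. \<Sum>j<n. \<Sum>i<n. Y $$ (i, j) * A $$ (i, k) * B $$ (k, j))"
    by (rule sum.cong[OF refl], rule sum.swap)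
  also have "\<dots> = frob n B (transpose_mat A * Y)"
    unfolding frob_def using assms by (simp add: mult_mat_index[of _ n n _ n] sum_distrib_left mult_ac)
  finally show ?thesis .
qed

lemma frob_mult_right:
  fixes Y A B :: "'f::field mat"
  assumes "Y \<in> carrier_mat n n" "A \<in> carrier_mat n n" "B \<in> carrier_mat n n"
  shows "frob n Y (A * B) = frob n A (Y * transpose_mat B)"
proof -
  have "frob n Y (A * B) = (\<Sum>i<n. \<Sum>j<n. \<Sum>k<n. Y $$ (i, j) * A $$ (i, k) * B $$ (k, j))"
    unfolding frob_def using assms by (simp add: mult_mat_index[of _ n n _ n] sum_distrib_left mult.assoc)
  also have "\<dots> = (\<Sum>i<n. \<Sum>k<n. \<Sum>j<n. Y $$ (i, j) * A $$ (i, k) * B $$ (k, j))"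
    by (rule sum.cong[OF refl], rule sum.swap)
  also have "\<dots> = frob n A (Y * transpose_mat B)"
    unfolding frob_def using assms by (simp add: mult_mat_index[of _ n n _ n] sum_distrib_left mult_ac)
  finally show ?thesis .
qed

lemma frob_minus_right:
  fixes A B C :: "'f::field mat"
  assumes "B \<in> carrier_mat n n" "C \<in> carrier_mat n n"
  shows "frob n A (B - C) = frob n A B - frob n A C"
  unfolding frob_def using assms by (simp add: algebra_simps sum_subtractf)

definition mtr :: "nat \<Rightarrow> 'f::field mat \<Rightarrow> 'f" where
  "mtr n A = (\<Sum>i<n. A $$ (i, i))"

lemma mtr_comm:
  fixes A B :: "'f::field mat"
  assumes "A \<in> carrier_mat n n" "B \<in> carrier_mat n n"
  shows "mtr n (A * B) = mtr n (B * A)"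
proof -
  have "mtr n (A * B) = (\<Sum>i<n. \<Sum>k<n. A $$ (i, k) * B $$ (k, i))"
    unfolding mtr_def using assms by (simp add: mult_mat_index[of _ n n _ n])
  also have "\<dots> = (\<Sum>k<n. \<Sum>i<n. A $$ (i, k) * B $$ (k, i))" by (rule sum.swap)
  also have "\<dots> = mtr n (B * A)"
    unfolding mtr_def using assms by (simp add: mult_mat_index[of _ n n _ n] mult.commute)
  finally show ?thesis .
qed

lemma upper_triangular_mult_index:
  fixes A B :: "'f::field mat"
  assumes A: "A \<in> carrier_mat n n" "upper_triangular A" and B: "B \<in> carrier_mat n n" "upper_triangular B"
    and ij: "i < n" "j < n"
  shows "j < i \<Longrightarrow> (A * B) $$ (i, j) = 0"
    and "(A * B) $$ (i, i) = A $$ (i, i) * B $$ (i, i)"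
proof -
  assume "j < i"
  have "A $$ (i, k) * B $$ (k, j) = 0" if "k < n" for k
    using A B ij \<open>j < i\<close> that upper_triangularD[of A k i] upper_triangularD[of B j k]
    by (cases "k < i") auto
  then show "(A * B) $$ (i, j) = 0"
    using A B ij by (auto simp: mult_mat_index[of _ n n _ n] intro!: sum.neutral)
next
  have "(\<Sum>k<n. A $$ (i, k) * B $$ (k, i)) = (\<Sum>k<n. if k = i then A $$ (i, i) * B $$ (i, i) else 0)"
    using A B ij upper_triangularD[of A _ i] upper_triangularD[of B i]
    by (intro sum.cong) (auto, metis linorder_neqE_nat mult_eq_0_iff)
  then show "(A * B) $$ (i, i) = A $$ (i, i) * B $$ (i, i)"
    using A B ij by (simp add: mult_mat_index[of _ n n _ n])
qed

text \<open>Induction on the column: below the diagonal, the entry (i, j) of C B reduces to C_ij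
  B_jj once the earlier entries of row i are known to vanish.\<close>

lemma upper_triangular_inverse:
  fixes B C :: "'f::field mat"
  assumes B: "B \<in> carrier_mat n n" "upper_triangular B" "\<And>i. i < n \<Longrightarrow> B $$ (i, i) \<noteq> 0"
    and C: "C \<in> carrier_mat n n" "C * B = 1\<^sub>m n"
  shows "upper_triangular C"
proof -
  have "C $$ (i, j) = 0" if "i < n" "j < i" for i j
    using that(2)
  proof (induction j rule: less_induct)
    case (less j)
    have "0 = (C * B) $$ (i, j)" using C(2) that less by simp
    also have "\<dots> = (\<Sum>k<n. C $$ (i, k) * B $$ (k, j))"
      using B(1) C(1) that less by (simp add: mult_mat_index[of _ n n _ n])
    also have "\<dots> = (\<Sum>k<n. if k = j then C $$ (i, j) * B $$ (j, j) else 0)"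
    proof (intro sum.cong refl)
      fix k assume "k \<in> {..<n}"
      then show "C $$ (i, k) * B $$ (k, j) = (if k = j then C $$ (i, j) * B $$ (j, j) else 0)"
        using less upper_triangularD[OF B(2), of j k] B(1) by (cases k j rule: linorder_cases) auto
    qed
    also have "\<dots> = C $$ (i, j) * B $$ (j, j)" using that less by simp
    finally show ?case using B(3)[of j] that less by simp
  qed
  then show ?thesis using C(1) by (intro upper_triangularI) auto
qed

lemma minv_eqI:
  fixes B C :: "'f::field mat"
  assumes B: "B \<in> carrier_mat n n" and C: "C \<in> carrier_mat n n" and BC: "B * C = 1\<^sub>m n"
  shows "minv B = C"
proof -
  have CB: "C * B = 1\<^sub>m n" using mat_mult_left_right_inverse[OF B C BC] .
  have "B \<in> Units (ring_mat TYPE('f) n undefined)"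
    unfolding Units_def ring_mat_def using B C BC CB by auto
  then obtain C' where C': "mat_inverse B = Some C'" using mat_inverse(1)[OF B] by fastforce
  with mat_inverse(2)[OF B this] have "B * C' = 1\<^sub>m n" "C' * B = 1\<^sub>m n" "C' \<in> carrier_mat n n" by auto
  then have "C' = C' * (B * C)" using BC by simp
  also have "\<dots> = (C' * B) * C" using \<open>C' \<in> _\<close> B C by simp
  also have "\<dots> = C" using \<open>C' * B = _\<close> C by simp
  finally show ?thesis unfolding minv_def C' by simp
qed

section \<open>Basis, coordinates and lifts\<close>

lemma finite_basis_idx [simp]: "finite (basis_idx n s)"
proof -
  have "basis_idx n s \<subseteq> (\<lambda>(i, j). E i j) ` ({..n} \<times> {..n}) \<union> P ` {..s}"
    unfolding basis_idx_def by auto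
  then show ?thesis by (rule finite_subset) auto
qed

lemma E_in_basis_idx [simp]: "E i j \<in> basis_idx n s \<longleftrightarrow> 1 \<le> i \<and> i < j \<and> j \<le> n"
  and P_in_basis_idx [simp]: "P p \<in> basis_idx n s \<longleftrightarrow> 1 \<le> p \<and> p \<le> s"
  by (auto simp: basis_idx_def)

lemma basis_idx_cases:
  assumes "a \<in> basis_idx n s"
  obtains i j where "i < j" "j < n" "a = E (Suc i) (Suc j)"
  | p where "p \<in> {1..s}" "a = P p"
proof (cases a)
  case (E i j)
  then show ?thesis using assms that(1)[of "i - 1" "j - 1"] by auto
next
  case (P p)
  then show ?thesis using assms that(2) by auto
qed

lemma sum_basis_idx:
  "(\<Sum>a\<in>basis_idx n s. f a) =
    (\<Sum>i<n. \<Sum>j<n. if i < j then f (E (Suc i) (Suc j)) else 0) + (\<Sum>p=1..s. f (P p))"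
proof -
  have e: "{E i j | i j. 1 \<le> i \<and> i < j \<and> j \<le> n} =
      (\<lambda>(i, j). E (Suc i) (Suc j)) ` {(i, j) \<in> {..<n} \<times> {..<n}. i < j}" (is "?L = ?R")
  proof (intro equalityI subsetI)
    fix a assume "a \<in> ?L"
    then obtain i j where "a = E i j" "1 \<le> i" "i < j" "j \<le> n" by auto
    then show "a \<in> ?R" by (intro image_eqI[of _ _ "(i - 1, j - 1)"]) auto
  qed auto
  have p: "{P p | p. 1 \<le> p \<and> p \<le> s} = P ` {1..s}" by auto
  have "(\<Sum>a\<in>basis_idx n s. f a) = (\<Sum>a\<in>?L. f a) + (\<Sum>a\<in>{P p | p. 1 \<le> p \<and> p \<le> s}. f a)"
    unfolding basis_idx_def
    by (rule sum.union_disjoint)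
       (rule finite_subset[OF _ finite_basis_idx[of n s]], auto simp: p)
  also have "(\<Sum>a\<in>{P p | p. 1 \<le> p \<and> p \<le> s}. f a) = (\<Sum>p=1..s. f (P p))"
    unfolding p by (subst sum.reindex) (auto simp: inj_on_def)
  also have "(\<Sum>a\<in>?L. f a) = (\<Sum>(i, j)\<in>{(i, j) \<in> {..<n} \<times> {..<n}. i < j}. f (E (Suc i) (Suc j)))"
    unfolding e by (subst sum.reindex) (auto simp: inj_on_def case_prod_unfold)
  also have "\<dots> = (\<Sum>(i, j)\<in>{..<n} \<times> {..<n}. if i < j then f (E (Suc i) (Suc j)) else 0)"
    by (rule sum.mono_neutral_cong_left) (auto simp: case_prod_unfold)
  also have "\<dots> = (\<Sum>i<n. \<Sum>j<n. if i < j then f (E (Suc i) (Suc j)) else 0)"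
    by (rule sum.cartesian_product[symmetric])
  finally show ?thesis .
qed

lemma basis_mat_carrier [simp]: "basis_mat n \<gamma> a \<in> carrier_mat n n"
  by (cases a) auto

lemma lie_elem_carrier [simp]: "lie_elem n s \<gamma> c \<in> carrier_mat n n"
  by (simp add: lie_elem_def)

lemma frob_basis_E:
  assumes "i < n" "j < n"
  shows "frob n Z (basis_mat n \<gamma> (E (Suc i) (Suc j))) = Z $$ (i, j)"
proof -
  have "frob n Z (basis_mat n \<gamma> (E (Suc i) (Suc j))) =
      (\<Sum>k<n. \<Sum>l<n. if l = j then (if k = i then Z $$ (k, l) else 0) else 0)"
    unfolding frob_def by (intro sum.cong) auto
  then show ?thesis using assms by simp
qed

lemma frob_basis_P:
  "frob n Z (basis_mat n \<gamma> (P p)) = (\<Sum>i<n. \<gamma> p (Suc i) * Z $$ (i, i))"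
proof -
  have "frob n Z (basis_mat n \<gamma> (P p)) = (\<Sum>k<n. \<Sum>l<n. if l = k then \<gamma> p (Suc k) * Z $$ (k, k) else 0)"
    unfolding frob_def by (intro sum.cong) auto
  then show ?thesis by simp
qed

lemma frob_comm: "frob n A B = frob n B A"
  unfolding frob_def by (simp add: mult.commute)

lemma frob_lie_elem:
  "frob n Z (lie_elem n s \<gamma> c) = (\<Sum>a\<in>basis_idx n s. c a * frob n Z (basis_mat n \<gamma> a))"
proof -
  have "frob n Z (lie_elem n s \<gamma> c) =
      (\<Sum>i<n. \<Sum>j<n. \<Sum>a\<in>basis_idx n s. c a * (Z $$ (i, j) * basis_mat n \<gamma> a $$ (i, j)))"
    unfolding frob_def lie_elem_def by (simp add: sum_distrib_left mult_ac)
  also have "\<dots> = (\<Sum>i<n. \<Sum>a\<in>basis_idx n s. \<Sum>j<n. c a * (Z $$ (i, j) * basis_mat n \<gamma> a $$ (i, j)))"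
    by (rule sum.cong[OF refl], rule sum.swap)
  also have "\<dots> = (\<Sum>a\<in>basis_idx n s. \<Sum>i<n. \<Sum>j<n. c a * (Z $$ (i, j) * basis_mat n \<gamma> a $$ (i, j)))"
    by (rule sum.swap)
  finally show ?thesis unfolding frob_def by (simp add: sum_distrib_left)
qed

lemma lie_elem_index:
  assumes "k < n" "l < n"
  shows "lie_elem n s \<gamma> c $$ (k, l) =
    (if k < l then c (E (Suc k) (Suc l)) else if k = l then (\<Sum>p=1..s. c (P p) * \<gamma> p (Suc k)) else 0)"
proof -
  have "lie_elem n s \<gamma> c $$ (k, l) = (\<Sum>a\<in>basis_idx n s. c a * basis_mat n \<gamma> a $$ (k, l))"
    using assms by (simp add: lie_elem_def)
  also have "\<dots> = (\<Sum>i<n. \<Sum>j<n. if j = l then (if i = k then (if k < l then c (E (Suc k) (Suc l)) else 0) else 0) else 0)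
      + (\<Sum>p=1..s. if k = l then c (P p) * \<gamma> p (Suc k) else 0)"
    unfolding sum_basis_idx using assms
    by (intro arg_cong2[where f="(+)"] sum.cong) auto
  also have "\<dots> = (if k < l then c (E (Suc k) (Suc l)) else 0)
      + (if k = l then (\<Sum>p=1..s. c (P p) * \<gamma> p (Suc k)) else 0)"
    using assms by simp
  finally show ?thesis by auto
qed

lemma lie_elem_exhaust:
  fixes u :: "'f::field mat"
  assumes u: "u \<in> carrier_mat n n" "\<And>i j. j < i \<Longrightarrow> i < n \<Longrightarrow> u $$ (i, j) = 0"
    and diag: "\<And>i. i < n \<Longrightarrow> u $$ (i, i) = (\<Sum>p=1..s. d p * \<gamma> p (Suc i))"
  shows "u = lie_elem n s \<gamma> (\<lambda>a\<in>basis_idx n s. case a of E i j \<Rightarrow> u $$ (i - 1, j - 1) | P p \<Rightarrow> d p)"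
  using assms by (intro eq_matI) (auto simp: lie_elem_index lie_elem_def[THEN arg_cong[of _ _ dim_row]]
      lie_elem_def[THEN arg_cong[of _ _ dim_col]] intro!: sum.cong)

text \<open>Matrices whose pairing with the Lie algebra represents a point of the dual space; the entries
  below the diagonal are irrelevant.\<close>

definition lifts :: "nat \<Rightarrow> nat \<Rightarrow> (nat \<Rightarrow> nat \<Rightarrow> 'f::field) \<Rightarrow> (lidx \<Rightarrow> 'f) \<Rightarrow> 'f mat \<Rightarrow> bool" where
  "lifts n s \<gamma> x Y \<longleftrightarrow> Y \<in> carrier_mat n n \<and>
     (\<forall>a\<in>basis_idx n s. frob n Y (basis_mat n \<gamma> a) = x a)"

lemma liftsD:
  assumes "lifts n s \<gamma> x Y"
  shows "Y \<in> carrier_mat n n"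
    and "i < j \<Longrightarrow> j < n \<Longrightarrow> Y $$ (i, j) = x (E (Suc i) (Suc j))"
    and "p \<in> {1..s} \<Longrightarrow> (\<Sum>i<n. \<gamma> p (Suc i) * Y $$ (i, i)) = x (P p)"
proof -
  show "Y \<in> carrier_mat n n" using assms by (simp add: lifts_def)
  show "i < j \<Longrightarrow> j < n \<Longrightarrow> Y $$ (i, j) = x (E (Suc i) (Suc j))"
    using assms frob_basis_E[of i n j Y \<gamma>] by (auto simp: lifts_def simp del: basis_mat.simps)
  show "p \<in> {1..s} \<Longrightarrow> (\<Sum>i<n. \<gamma> p (Suc i) * Y $$ (i, i)) = x (P p)"
    using assms frob_basis_P[of n Y \<gamma> p] by (auto simp: lifts_def simp del: basis_mat.simps)
qed

section \<open>The coadjoint action in terms of lifts\<close>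

locale adm_param =
  fixes n s :: nat and \<gamma> :: "nat \<Rightarrow> nat \<Rightarrow> 'f::{real_normed_field,banach}"
  assumes adm: "admissible n s \<gamma>"
begin

abbreviation "\<B> \<equiv> basis_idx n s"
abbreviation "e \<equiv> basis_mat n \<gamma>"

text \<open>Coordinates at the \<open>E i j\<close> can be read off the matrix; those at the
  \<open>P p\<close> are determined by the diagonal because of admissibility, applied with
  coefficient 0 at the identity matrix.\<close>

lemma lie_elem_inj:
  assumes "c \<in> (\<Pi>\<^sub>E a\<in>\<B>. UNIV)" "c' \<in> (\<Pi>\<^sub>E a\<in>\<B>. UNIV)" "lie_elem n s \<gamma> c = lie_elem n s \<gamma> c'"
  shows "c = c'"
proof (rule extensionalityI[of _ \<B>])
  fix a assume "a \<in> \<B>"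
  then show "c a = c' a"
  proof (cases rule: basis_idx_cases)
    case (1 i j)
    then show ?thesis using assms(3) lie_elem_index[of i n j s \<gamma> c] lie_elem_index[of i n j s \<gamma> c'] by simp
  next
    case (2 p)
    have "\<forall>i\<in>{1..n}. 0 + (\<Sum>p=1..s. (c (P p) - c' (P p)) * \<gamma> p i) = 0"
    proof
      fix i assume "i \<in> {1..n}"
      then have "i - 1 < n" "Suc (i - 1) = i" by auto
      then show "0 + (\<Sum>p=1..s. (c (P p) - c' (P p)) * \<gamma> p i) = 0"
        using assms(3) lie_elem_index[of "i - 1" n "i - 1" s \<gamma> c] lie_elem_index[of "i - 1" n "i - 1" s \<gamma> c']
        by (simp add: left_diff_distrib sum_subtractf)
    qed
    with adm[unfolded admissible_def, rule_format, of 0 "\<lambda>p. c (P p) - c' (P p)"] 2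
    show ?thesis by auto
  qed
qed (use assms in \<open>auto simp: PiE_def\<close>)

lemma lie_coord_lie_elem:
  assumes "c \<in> (\<Pi>\<^sub>E a\<in>\<B>. UNIV)"
  shows "lie_coord n s \<gamma> (lie_elem n s \<gamma> c) = c"
  unfolding lie_coord_def by (rule the_equality) (use assms lie_elem_inj in auto)

lemma basis_mat_eq_lie_elem:
  assumes "a \<in> \<B>"
  shows "e a = lie_elem n s \<gamma> (\<lambda>b\<in>\<B>. if b = a then 1 else 0)"
proof (rule eq_matI)
  fix i j assume "i < dim_row (lie_elem n s \<gamma> (\<lambda>b\<in>\<B>. if b = a then 1 else 0))"
    "j < dim_col (lie_elem n s \<gamma> (\<lambda>b\<in>\<B>. if b = a then 1 else 0))"
  then have ij: "i < n" "j < n" by (auto simp: lie_elem_def)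
  have "(\<Sum>b\<in>\<B>. (\<lambda>b\<in>\<B>. if b = a then 1 else 0) b * e b $$ (i, j)) =
      (\<Sum>b\<in>\<B>. if b = a then e b $$ (i, j) else 0)"
    by (intro sum.cong) auto
  then show "e a $$ (i, j) = lie_elem n s \<gamma> (\<lambda>b\<in>\<B>. if b = a then 1 else 0) $$ (i, j)"
    using ij assms by (simp add: lie_elem_def)
qed (use carrier_matD[OF basis_mat_carrier[of n \<gamma> a]] in \<open>auto simp: lie_elem_def\<close>)

lemma dual_pair_lie_elem:
  assumes "lifts n s \<gamma> x Y" "c \<in> (\<Pi>\<^sub>E a\<in>\<B>. UNIV)"
  shows "dual_pair n s \<gamma> x (lie_elem n s \<gamma> c) = frob n Y (lie_elem n s \<gamma> c)"
  using assms unfolding dual_pair_def frob_lie_elem lie_coord_lie_elem[OF assms(2)]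
  by (auto simp: lifts_def intro!: sum.cong)

text \<open>The conditions on \<open>u\<close> say that it belongs to the Lie algebra, and there
  every lift computes the pairing.\<close>

lemma dual_pair_eq_frob:
  assumes "lifts n s \<gamma> x Y" "u \<in> carrier_mat n n" "\<And>i j. j < i \<Longrightarrow> i < n \<Longrightarrow> u $$ (i, j) = 0"
    and "\<And>i. i < n \<Longrightarrow> u $$ (i, i) = (\<Sum>p=1..s. d p * \<gamma> p (Suc i))"
  shows "dual_pair n s \<gamma> x u = frob n Y u"
  by (subst (1 2) lie_elem_exhaust[OF assms(2-4)], assumption+, rule dual_pair_lie_elem) (use assms in auto)

text \<open>Admissibility makes the rows of \<gamma> independent, and vectors dual to them provide a
  diagonal with prescribed pairings.\<close>

lemma lift_exists: "\<exists>Y. lifts n s \<gamma> x Y"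
proof -
  have "indep_family {1..s} {..<n} (\<lambda>p i. \<gamma> p (Suc i))"
  proof (rule indep_familyI)
    fix c p assume z: "\<And>i. i \<in> {..<n} \<Longrightarrow> (\<Sum>p=1..s. c p * \<gamma> p (Suc i)) = 0" and p: "p \<in> {1..s}"
    have "\<forall>i\<in>{1..n}. 0 + (\<Sum>p=1..s. c p * \<gamma> p i) = 0"
    proof
      fix i assume "i \<in> {1..n}"
      then have "i - 1 \<in> {..<n}" "Suc (i - 1) = i" by auto
      then show "0 + (\<Sum>p=1..s. c p * \<gamma> p i) = 0" using z[of "i - 1"] by simp
    qed
    with adm[unfolded admissible_def, rule_format, of 0 c] p show "c p = 0" by blast
  qed
  from dual_vectors[OF _ _ this] obtain g where
    g: "\<And>p q. p \<in> {1..s} \<Longrightarrow> q \<in> {1..s} \<Longrightarrow> (\<Sum>i<n. g p i * \<gamma> q (Suc i)) = (if p = q then 1 else 0)"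
    by fastforce
  define Y where "Y = mat n n (\<lambda>(i, j). if i < j then x (E (Suc i) (Suc j))
     else if i = j then (\<Sum>p=1..s. x (P p) * g p i) else 0)"
  have "(\<Sum>i<n. \<gamma> q (Suc i) * Y $$ (i, i)) = x (P q)" if q: "q \<in> {1..s}" for q
  proof -
    have "(\<Sum>i<n. \<gamma> q (Suc i) * Y $$ (i, i)) = (\<Sum>i<n. \<Sum>p=1..s. x (P p) * (g p i * \<gamma> q (Suc i)))"
      by (simp add: Y_def sum_distrib_left mult_ac)
    also have "\<dots> = (\<Sum>p=1..s. x (P p) * (\<Sum>i<n. g p i * \<gamma> q (Suc i)))"
      by (subst sum.swap) (simp add: sum_distrib_left)
    also have "\<dots> = (\<Sum>p=1..s. if p = q then x (P p) else 0)"
      using g q by (intro sum.cong) auto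
    also have "\<dots> = x (P q)" using q by simp
    finally show ?thesis .
  qed
  then have "lifts n s \<gamma> x Y"
    unfolding lifts_def
    by (auto elim!: basis_idx_cases simp: frob_basis_E frob_basis_P simp del: basis_mat.simps)
       (auto simp: Y_def)
  then show ?thesis by blast
qed

text \<open>Conjugation by mutually inverse triangular matrices preserves the diagonal of
  \<open>e a\<close>, so the conjugate stays in the Lie algebra and can be paired through a lift.
  The second form moves both factors to the side of the lift.\<close>

lemma coAd_frob:
  assumes B: "B \<in> carrier_mat n n" "upper_triangular B"
    and C: "C \<in> carrier_mat n n" "upper_triangular C" and BC: "B * C = 1\<^sub>m n"
    and Y: "lifts n s \<gamma> x Y" and a: "a \<in> \<B>"
  shows "coAd n s \<gamma> B x a = frob n Y (C * e a * B)"
    and "coAd n s \<gamma> B x a = frob n (transpose_mat C * Y * transpose_mat B) (e a)"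
proof -
  have CB: "C * B = 1\<^sub>m n" using mat_mult_left_right_inverse[OF B(1) C(1) BC] .
  have m: "minv B = C" "minv C = B" using minv_eqI[OF B(1) C(1) BC] minv_eqI[OF C(1) B(1) CB] by auto
  have ut: "upper_triangular (e a)"
  proof (rule upper_triangularI)
    fix i j assume "j < i" "i < dim_row (e a)"
    then show "e a $$ (i, j) = 0" using a by (cases rule: basis_idx_cases[OF a]) auto
  qed
  have car: "e a \<in> carrier_mat n n" by simp
  have Ce: "C * e a \<in> carrier_mat n n" "upper_triangular (C * e a)"
    using C car upper_triangular_mult_index(1)[OF C car ut] by (auto intro!: upper_triangularI)
  have diag: "(C * e a * B) $$ (i, i) = e a $$ (i, i)" if "i < n" for i
  proof -
    have "C $$ (i, i) * B $$ (i, i) = 1"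
      using upper_triangular_mult_index(2)[OF C B that that] CB that by simp
    then show ?thesis
      using upper_triangular_mult_index(2)[OF Ce B that that] upper_triangular_mult_index(2)[OF C car ut that that]
      by (simp add: mult_ac)
  qed
  have "coAd n s \<gamma> B x a = dual_pair n s \<gamma> x (C * e a * B)"
    using a by (simp add: coAd_def Ad_def m)
  also have "\<dots> = frob n Y (C * e a * B)"
  proof (rule dual_pair_eq_frob[OF Y])
    show "C * e a * B \<in> carrier_mat n n" using Ce B by simp
    show "\<And>i j. j < i \<Longrightarrow> i < n \<Longrightarrow> (C * e a * B) $$ (i, j) = 0"
      using upper_triangular_mult_index(1)[OF Ce B] by auto
    fix i assume i: "i < n"
    show "(C * e a * B) $$ (i, i) = (\<Sum>p=1..s. (if a = P p then 1 else 0) * \<gamma> p (Suc i))"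
      unfolding diag[OF i] using i by (cases rule: basis_idx_cases[OF a]) (auto simp: if_distrib[of "\<lambda>x. x * _"] cong: if_cong)
  qed
  finally show 1: "coAd n s \<gamma> B x a = frob n Y (C * e a * B)" .
  have Yc: "Y \<in> carrier_mat n n" using Y by (rule liftsD)
  have "frob n Y (C * e a * B) = frob n (C * e a) (Y * transpose_mat B)"
    using Yc B Ce by (intro frob_mult_right) auto
  also have "\<dots> = frob n (Y * transpose_mat B) (C * e a)" by (rule frob_comm)
  also have "\<dots> = frob n (e a) (transpose_mat C * (Y * transpose_mat B))"
    using Yc B C by (intro frob_mult_left) auto
  also have "transpose_mat C * (Y * transpose_mat B) = transpose_mat C * Y * transpose_mat B"
    using Yc B C by (intro assoc_mult_mat[symmetric, of _ n n _ n _ n]) auto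
  finally show "coAd n s \<gamma> B x a = frob n (transpose_mat C * Y * transpose_mat B) (e a)"
    unfolding 1 by (simp add: frob_comm)
qed

lemma lifts_coAd:
  assumes B: "B \<in> carrier_mat n n" "upper_triangular B"
    and C: "C \<in> carrier_mat n n" "upper_triangular C" and BC: "B * C = 1\<^sub>m n"
    and Y: "lifts n s \<gamma> x Y"
  shows "lifts n s \<gamma> (coAd n s \<gamma> B x) (transpose_mat C * Y * transpose_mat B)"
  using coAd_frob(2)[OF assms] liftsD(1)[OF Y] B C unfolding lifts_def by auto

lemma T_group_inverse:
  assumes "B \<in> T_group n s \<gamma>"
  obtains C where "C \<in> carrier_mat n n" "upper_triangular C" "B * C = 1\<^sub>m n" "C * B = 1\<^sub>m n"
    "\<And>i. i < n \<Longrightarrow> C $$ (i, i) = inverse (B $$ (i, i))"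
proof -
  have B: "B \<in> carrier_mat n n" "upper_triangular B" and nz: "\<And>i. i < n \<Longrightarrow> B $$ (i, i) \<noteq> 0"
    using assms unfolding T_group_def by auto
  have "det B \<noteq> 0" using det_upper_triangular[OF B(2,1)] B nz by (auto simp: diag_mat_def)
  from det_non_zero_imp_unit[OF B(1) this] obtain C where
    C: "C \<in> carrier_mat n n" "B * C = 1\<^sub>m n" "C * B = 1\<^sub>m n"
    unfolding Units_def ring_mat_def by auto
  have uC: "upper_triangular C" using upper_triangular_inverse[OF B nz C(1,3)] .
  have "C $$ (i, i) = inverse (B $$ (i, i))" if "i < n" for i
    using upper_triangular_mult_index(2)[OF B C(1) uC that that] C(2) that inverse_unique[of "B $$ (i,i)" "C $$ (i,i)"] by simp
  then show thesis using that C uC by blast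
qed

lemma T_param_in_T_group: "T_param n s \<gamma> \<theta> \<in> T_group n s \<gamma>"
  unfolding T_group_def T_param_def by (auto intro!: upper_triangularI exI[of _ "\<lambda>p. \<theta> (P p)"])

end

declare assoc_mult_mat [simp del]

section \<open>Tangent vectors of orbits\<close>

definition mat_deriv :: "nat \<Rightarrow> ('f::real_normed_field \<Rightarrow> 'f mat) \<Rightarrow> 'f mat \<Rightarrow> bool" where
  "mat_deriv n F F' \<longleftrightarrow> F' \<in> carrier_mat n n \<and> (\<forall>t. F t \<in> carrier_mat n n) \<and>
     (\<forall>i<n. \<forall>j<n. ((\<lambda>t. F t $$ (i, j)) has_field_derivative F' $$ (i, j)) (at 0))"

lemma mat_deriv_const: "M \<in> carrier_mat n n \<Longrightarrow> mat_deriv n (\<lambda>_. M) (0\<^sub>m n n)"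
  by (auto simp: mat_deriv_def)

lemma mat_deriv_mult:
  assumes "mat_deriv n F F'" "mat_deriv n G G'"
  shows "mat_deriv n (\<lambda>t. F t * G t) (F' * G 0 + F 0 * G')"
proof -
  have c: "F' \<in> carrier_mat n n" "G' \<in> carrier_mat n n" "\<And>t. F t \<in> carrier_mat n n" "\<And>t. G t \<in> carrier_mat n n"
    using assms by (auto simp: mat_deriv_def)
  show ?thesis
    unfolding mat_deriv_def
  proof (intro conjI allI impI)
    fix i j assume ij: "i < n" "j < n"
    have "((\<lambda>t. \<Sum>k<n. F t $$ (i, k) * G t $$ (k, j)) has_field_derivative
        (\<Sum>k<n. F' $$ (i, k) * G 0 $$ (k, j) + G' $$ (k, j) * F 0 $$ (i, k))) (at 0)"
      using assms ij by (intro DERIV_sum DERIV_mult) (auto simp: mat_deriv_def)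
    then show "((\<lambda>t. (F t * G t) $$ (i, j)) has_field_derivative (F' * G 0 + F 0 * G') $$ (i, j)) (at 0)"
      using c ij by (simp add: mult_mat_index[of _ n n _ n] sum.distrib mult.commute
          carrier_matD[OF c(1)] carrier_matD[OF c(2)] carrier_matD[OF c(3)] carrier_matD[OF c(4)])
  qed (use c in \<open>auto intro!: add_carrier_mat mult_carrier_mat[of _ n n _ n]\<close>)
qed

lemma frob_has_derivative:
  assumes "mat_deriv n F F'"
  shows "((\<lambda>t. frob n Y (F t)) has_field_derivative frob n Y F') (at 0)"
  unfolding frob_def using assms
  by (intro DERIV_sum DERIV_cmult) (auto simp: mat_deriv_def)

context adm_param
begin

text \<open>Each coordinate curve through the origin is a one-parameter subgroup, with inverse at
  parameter -t: it is 1 + t E_kl, where E_kl^2 = 0, or the exponential of a diagonal matrix.\<close>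

lemma one_parameter_subgroup:
  assumes a: "a \<in> \<B>"
  obtains B C where
    "\<And>t. T_param n s \<gamma> ((\<lambda>_\<in>\<B>. 0)(a := t)) = B t" "\<And>t. upper_triangular (B t)" "\<And>t. upper_triangular (C t)"
    "\<And>t. B t * C t = 1\<^sub>m n" "B 0 = 1\<^sub>m n" "C 0 = 1\<^sub>m n" "mat_deriv n B (e a)" "mat_deriv n C (- e a)"
  using a
proof (cases rule: basis_idx_cases)
  case (1 k l)
  define B where "B t = mat n n (\<lambda>(i, j). if i = j then 1 else if i = k \<and> j = l then t else 0)" for t :: 'f
  have T: "T_param n s \<gamma> ((\<lambda>_\<in>\<B>. 0)(a := t)) = B t" for t
    unfolding T_param_def B_def 1 using 1 by (intro eq_matI) auto
  have prod: "B t * B (- t) = 1\<^sub>m n" for t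
  proof (rule eq_matI)
    fix i j assume "i < dim_row (1\<^sub>m n)" "j < dim_col (1\<^sub>m n)"
    then have ij: "i < n" "j < n" by auto
    have c: "B t \<in> carrier_mat n n" "B (-t) \<in> carrier_mat n n" by (auto simp: B_def)
    have "(B t * B (- t)) $$ (i, j) = (\<Sum>m<n. B t $$ (i, m) * B (-t) $$ (m, j))"
      using ij c by (simp add: mult_mat_index[of _ n n _ n])
    also have "\<dots> = (\<Sum>m<n. (if m = i then B (-t) $$ (i, j) else 0) +
        (if m = l then (if i = k then t * B (-t) $$ (l, j) else 0) else 0))"
      using ij 1 by (intro sum.cong) (auto simp: B_def)
    also have "\<dots> = B (-t) $$ (i, j) + (if i = k then t * B (-t) $$ (l, j) else 0)"
      using ij 1 by (simp add: sum.distrib)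
    also have "\<dots> = 1\<^sub>m n $$ (i, j)" using ij 1 by (auto simp: B_def)
    finally show "(B t * B (- t)) $$ (i, j) = 1\<^sub>m n $$ (i, j)" .
  qed (auto simp: B_def)
  have entry: "B (f t) $$ (i, j) = (if i = k \<and> j = l then f t else if i = j then 1 else 0)"
    if "i < n" "j < n" for i j t and f :: "'f \<Rightarrow> 'f"
    using that 1 by (auto simp: B_def)
  have Bc: "B t \<in> carrier_mat n n" for t by (simp add: B_def)
  have d1: "mat_deriv n B (e a)"
    unfolding mat_deriv_def
  proof (intro conjI allI impI)
    fix i j assume "i < n" "j < n"
    then show "((\<lambda>t. B t $$ (i, j)) has_field_derivative e a $$ (i, j)) (at 0)"
      using 1 by (cases "i = k \<and> j = l") (auto simp: entry[of _ _ "\<lambda>t. t"])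
  qed (simp_all add: Bc)
  have d2: "mat_deriv n (\<lambda>t. B (- t)) (- e a)"
    unfolding mat_deriv_def
  proof (intro conjI allI impI)
    fix i j assume "i < n" "j < n"
    then show "((\<lambda>t. B (- t) $$ (i, j)) has_field_derivative (- e a) $$ (i, j)) (at 0)"
      using 1 by (cases "i = k \<and> j = l") (auto simp: entry[of _ _ uminus] intro!: derivative_eq_intros)
  qed (simp_all add: Bc)
  show ?thesis
    by (rule that[OF T _ _ prod _ _ d1 d2]) (use 1 in \<open>auto simp: B_def intro!: upper_triangularI eq_matI\<close>)
next
  case (2 p)
  define B where "B t = mat n n (\<lambda>(i, j). if i = j then exp (\<gamma> p (Suc i) * t) else 0)" for t :: 'f
  have T: "T_param n s \<gamma> ((\<lambda>_\<in>\<B>. 0)(a := t)) = B t" for t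
  proof -
    have "(\<Sum>q=1..s. \<gamma> q i * ((\<lambda>_\<in>\<B>. 0)(P p := t)) (P q)) = (\<Sum>q=1..s. if q = p then \<gamma> p i * t else 0)" for i
      by (intro sum.cong) auto
    then have "(\<Sum>q=1..s. \<gamma> q i * ((\<lambda>_\<in>\<B>. 0)(P p := t)) (P q)) = \<gamma> p i * t" for i
      using 2 by simp
    then show ?thesis unfolding T_param_def B_def 2 by (intro eq_matI) auto
  qed
  have prod: "B t * B (- t) = 1\<^sub>m n" for t
  proof (rule eq_matI)
    fix i j assume "i < dim_row (1\<^sub>m n)" "j < dim_col (1\<^sub>m n)"
    then have ij: "i < n" "j < n" by auto
    have c: "B t \<in> carrier_mat n n" "B (-t) \<in> carrier_mat n n" by (auto simp: B_def)
    have "(B t * B (- t)) $$ (i, j) = (\<Sum>m<n. B t $$ (i, m) * B (-t) $$ (m, j))"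
      using ij c by (simp add: mult_mat_index[of _ n n _ n])
    also have "\<dots> = (\<Sum>m<n. if m = i then B t $$ (i, i) * B (-t) $$ (i, j) else 0)"
      using ij by (intro sum.cong) (auto simp: B_def)
    also have "\<dots> = 1\<^sub>m n $$ (i, j)" using ij by (auto simp: B_def exp_add[symmetric])
    finally show "(B t * B (- t)) $$ (i, j) = 1\<^sub>m n $$ (i, j)" .
  qed (auto simp: B_def)
  have d1: "mat_deriv n B (e a)"
    unfolding mat_deriv_def using 2 by (auto simp: B_def intro!: derivative_eq_intros)
  have d2: "mat_deriv n (\<lambda>t. B (- t)) (- e a)"
    unfolding mat_deriv_def using 2 by (auto simp: B_def intro!: derivative_eq_intros)
  show ?thesis
    by (rule that[OF T _ _ prod _ _ d1 d2]) (auto simp: B_def intro!: upper_triangularI eq_matI)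
qed

text \<open>Product rule for C(t) \<open>e b\<close> B(t) at t = 0, where B and C have derivatives
  \<open>e a\<close> and its negative.\<close>

lemma orbit_tangent_eq:
  assumes a: "a \<in> \<B>" and b: "b \<in> \<B>" and Y: "lifts n s \<gamma> x Y"
  shows "orbit_tangent n s \<gamma> x a b = frob n Y (e b * e a - e a * e b)"
proof -
  obtain B C where T: "\<And>t. T_param n s \<gamma> ((\<lambda>_\<in>\<B>. 0)(a := t)) = B t"
    and ut: "\<And>t. upper_triangular (B t)" "\<And>t. upper_triangular (C t)"
    and BC: "\<And>t. B t * C t = 1\<^sub>m n" "B 0 = 1\<^sub>m n" "C 0 = 1\<^sub>m n"
    and d: "mat_deriv n B (e a)" "mat_deriv n C (- e a)"
    using one_parameter_subgroup[OF a] by metis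
  have c: "\<And>t. B t \<in> carrier_mat n n" "\<And>t. C t \<in> carrier_mat n n"
    using d by (auto simp: mat_deriv_def)
  have "(\<lambda>t. coAd n s \<gamma> (T_param n s \<gamma> ((\<lambda>_\<in>\<B>. 0)(a := t))) x b) = (\<lambda>t. frob n Y (C t * e b * B t))"
    unfolding T using coAd_frob(1)[OF c(1) ut(1) c(2) ut(2) BC(1) Y b] by blast
  moreover have "((\<lambda>t. frob n Y (C t * e b * B t)) has_field_derivative
      frob n Y ((- e a * e b + C 0 * 0\<^sub>m n n) * B 0 + (C 0 * e b) * e a)) (at 0)"
    by (intro frob_has_derivative mat_deriv_mult mat_deriv_const d) simp
  moreover have "(- e a * e b + C 0 * 0\<^sub>m n n) * B 0 + (C 0 * e b) * e a = e b * e a - e a * e b"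
    unfolding BC using carrier_matD[OF basis_mat_carrier[of n \<gamma> a]] carrier_matD[OF basis_mat_carrier[of n \<gamma> b]]
    by (intro eq_matI) (auto simp: mult_mat_index[of _ n n _ n] right_mult_one_mat[of _ n n] left_mult_one_mat[of _ n n]
        mult_mat_index[OF uminus_carrier_mat[OF basis_mat_carrier] basis_mat_carrier] sum_negf)
  ultimately show ?thesis
    using a b by (simp add: orbit_tangent_def partial_def DERIV_imp_deriv)
qed

end

section \<open>Inverses of the corner submatrices\<close>

text \<open>The inverse of the upper right \<open>j \<times> j\<close> corner of \<open>Y\<close>, placed in the lower left corner of an
  \<open>n \<times> n\<close> matrix.\<close>

definition corner_inv :: "nat \<Rightarrow> nat \<Rightarrow> 'f::field mat \<Rightarrow> 'f mat \<Rightarrow> bool" where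
  "corner_inv n j Y K \<longleftrightarrow> K \<in> carrier_mat n n \<and>
     (\<forall>l<n. \<forall>k<n. \<not> (n - j \<le> l \<and> k < j) \<longrightarrow> K $$ (l, k) = 0) \<and>
     (\<forall>i<j. \<forall>k<n. (Y * K) $$ (i, k) = (if i = k then 1 else 0)) \<and>
     (\<forall>l<n. \<forall>l'<n. n - j \<le> l' \<longrightarrow> (K * Y) $$ (l, l') = (if l = l' then 1 else 0))"

definition lower_tri :: "nat \<Rightarrow> 'f::zero mat \<Rightarrow> bool" where
  "lower_tri n g \<longleftrightarrow> (\<forall>i<n. \<forall>j<n. i < j \<longrightarrow> g $$ (i, j) = 0)"

text \<open>Left multiplication by a lower triangular matrix mixes a row only with earlier rows, and
  right multiplication mixes a column only with later columns. This preserves the block supporting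
  K, the unit rows among the first j rows of Y K and the unit columns among the last j columns of K
  Y.\<close>

lemma corner_inv_conj:
  fixes Y K g h :: "'f::field mat"
  assumes jn: "j \<le> n" and Y: "Y \<in> carrier_mat n n" and K: "corner_inv n j Y K"
    and g: "g \<in> carrier_mat n n" "lower_tri n g" and h: "h \<in> carrier_mat n n" "lower_tri n h"
    and gh: "g * h = 1\<^sub>m n"
  shows "corner_inv n j (g * Y * h) (g * K * h)"
proof -
  have hg: "h * g = 1\<^sub>m n" using mat_mult_left_right_inverse[OF g(1) h(1) gh] .
  have Kc: "K \<in> carrier_mat n n" using K by (simp add: corner_inv_def)
  have conj: "(g * A * h) * (g * B * h) = g * (A * B) * h" if "A \<in> carrier_mat n n" "B \<in> carrier_mat n n" for A B
  proof -
    have "(g * A * h) * (g * B * h) = g * A * (h * g) * (B * h)"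
      using that g h by (simp add: assoc_mult_mat[of _ n n _ n _ n])
    then show ?thesis unfolding hg using that g h by (simp add: assoc_mult_mat[of _ n n _ n _ n])
  qed
  have ix: "(g * A * h) $$ (i, k) = (\<Sum>b<n. \<Sum>a<n. g $$ (i, a) * A $$ (a, b) * h $$ (b, k))"
    if "A \<in> carrier_mat n n" "i < n" "k < n" for A i k
    using that g h by (simp add: mult_mat_index[of _ n n _ n] sum_distrib_right)
  have gh': "(\<Sum>a<n. g $$ (i, a) * h $$ (a, k)) = (if i = k then 1 else 0)" if "i < n" "k < n" for i k
    using arg_cong[OF gh, of "\<lambda>M. M $$ (i, k)"] that g h by (simp add: mult_mat_index[of _ n n _ n])
  have hzero: "h $$ (b, k) = 0" if "b < k" "k < n" for b k using h that by (auto simp: lower_tri_def)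
  have gzero: "g $$ (i, a) = 0" if "i < a" "a < n" for a i using g that by (auto simp: lower_tri_def)
  show ?thesis
    unfolding corner_inv_def
  proof (intro conjI allI impI)
    show "g * K * h \<in> carrier_mat n n" using g h Kc by auto
  next
    fix l k assume l: "l < n" and k: "k < n" and nb: "\<not> (n - j \<le> l \<and> k < j)"
    have "g $$ (l, a) * K $$ (a, b) * h $$ (b, k) = 0" if "a < n" "b < n" for a b
    proof (cases "n - j \<le> a \<and> b < j")
      case True
      then have "l < a \<or> b < k" using nb by auto
      then show ?thesis using gzero[of l a] hzero[of b k] that k by auto
    next
      case False
      then show ?thesis using K that by (auto simp: corner_inv_def)
    qed
    then show "(g * K * h) $$ (l, k) = 0" unfolding ix[OF Kc l k] by (intro sum.neutral ballI) auto
  next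
    fix i k assume i: "i < j" and k: "k < n"
    have i': "i < n" using i jn by simp
    have YK: "Y * K \<in> carrier_mat n n" using Y Kc by simp
    have "((g * Y * h) * (g * K * h)) $$ (i, k) = (\<Sum>b<n. \<Sum>a<n. g $$ (i, a) * (Y * K) $$ (a, b) * h $$ (b, k))"
      unfolding conj[OF Y Kc] ix[OF YK i' k] ..
    also have "\<dots> = (\<Sum>b<n. \<Sum>a<n. if a = b then g $$ (i, a) * h $$ (b, k) else 0)"
    proof (intro sum.cong refl)
      fix a b assume ab: "b \<in> {..<n}" "a \<in> {..<n}"
      show "g $$ (i, a) * (Y * K) $$ (a, b) * h $$ (b, k) = (if a = b then g $$ (i, a) * h $$ (b, k) else 0)"
      proof (cases "a < j")
        case True
        then have "(Y * K) $$ (a, b) = (if a = b then 1 else 0)" using K ab by (auto simp: corner_inv_def)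
        then show ?thesis by simp
      next
        case False
        then have "g $$ (i, a) = 0" using i ab by (intro gzero) auto
        then show ?thesis by auto
      qed
    qed
    also have "\<dots> = (if i = k then 1 else 0)" using gh'[OF i' k] by simp
    finally show "((g * Y * h) * (g * K * h)) $$ (i, k) = (if i = k then 1 else 0)" .
  next
    fix l l' assume l: "l < n" and l': "l' < n" and c: "n - j \<le> l'"
    have KY: "K * Y \<in> carrier_mat n n" using Y Kc by simp
    have "((g * K * h) * (g * Y * h)) $$ (l, l') = (\<Sum>b<n. \<Sum>a<n. g $$ (l, a) * (K * Y) $$ (a, b) * h $$ (b, l'))"
      unfolding conj[OF Kc Y] ix[OF KY l l'] ..
    also have "\<dots> = (\<Sum>b<n. \<Sum>a<n. if a = b then g $$ (l, a) * h $$ (b, l') else 0)"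
    proof (intro sum.cong refl)
      fix a b assume ab: "b \<in> {..<n}" "a \<in> {..<n}"
      show "g $$ (l, a) * (K * Y) $$ (a, b) * h $$ (b, l') = (if a = b then g $$ (l, a) * h $$ (b, l') else 0)"
      proof (cases "n - j \<le> b")
        case True
        then have "(K * Y) $$ (a, b) = (if a = b then 1 else 0)" using K ab by (auto simp: corner_inv_def)
        then show ?thesis by simp
      next
        case False
        then have "h $$ (b, l') = 0" using c l' by (intro hzero) auto
        then show ?thesis by auto
      qed
    qed
    also have "\<dots> = (if l = l' then 1 else 0)" using gh'[OF l l'] by simp
    finally show "((g * K * h) * (g * Y * h)) $$ (l, l') = (if l = l' then 1 else 0)" .
  qed
qed

text \<open>K = K (Y L) = (K Y) L = L: the nonzero columns of K meet only the unit rows of Y L, and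
  the nonzero rows of L meet only the unit columns of K Y.\<close>

lemma corner_inv_unique:
  fixes Y K L :: "'f::field mat"
  assumes jn: "j \<le> n" and Y: "Y \<in> carrier_mat n n" and K: "corner_inv n j Y K" and L: "corner_inv n j Y L"
  shows "K = L"
proof -
  have c: "K \<in> carrier_mat n n" "L \<in> carrier_mat n n" using K L by (auto simp: corner_inv_def)
  have "K * Y * L = L"
  proof (rule eq_matI)
    fix l k assume "l < dim_row L" "k < dim_col L"
    then have lk: "l < n" "k < n" using c by auto
    have "(K * Y * L) $$ (l, k) = (\<Sum>m<n. (K * Y) $$ (l, m) * L $$ (m, k))"
      using c Y lk by (simp add: mult_mat_index[of _ n n _ n])
    also have "\<dots> = (\<Sum>m<n. if m = l then L $$ (l, k) else 0)"
    proof (intro sum.cong refl)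
      fix m assume "m \<in> {..<n}"
      then show "(K * Y) $$ (l, m) * L $$ (m, k) = (if m = l then L $$ (l, k) else 0)"
        using K L lk by (cases "n - j \<le> m") (auto simp: corner_inv_def)
    qed
    finally show "(K * Y * L) $$ (l, k) = L $$ (l, k)" using lk by simp
  qed (use c in auto)
  moreover have "K * (Y * L) = K"
  proof (rule eq_matI)
    fix l k assume "l < dim_row K" "k < dim_col K"
    then have lk: "l < n" "k < n" using c by auto
    have "(K * (Y * L)) $$ (l, k) = (\<Sum>m<n. K $$ (l, m) * (Y * L) $$ (m, k))"
      using c Y lk by (simp add: mult_mat_index[of _ n n _ n])
    also have "\<dots> = (\<Sum>m<n. if m = k then K $$ (l, k) else 0)"
    proof (intro sum.cong refl)
      fix m assume "m \<in> {..<n}"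
      then show "K $$ (l, m) * (Y * L) $$ (m, k) = (if m = k then K $$ (l, k) else 0)"
        using K L lk by (cases "m < j") (auto simp: corner_inv_def)
    qed
    finally show "(K * (Y * L)) $$ (l, k) = K $$ (l, k)" using lk by simp
  qed (use c in auto)
  ultimately show ?thesis using c Y by (simp add: assoc_mult_mat[of _ n n _ n _ n])
qed

text \<open>For the first j positions the product is read as (Y K) Y, for the last j as Y (K
  Y).\<close>

lemma corner_inv_diag:
  fixes Y K :: "'f::field mat"
  assumes jn: "j \<le> n" and Y: "Y \<in> carrier_mat n n" and K: "corner_inv n j Y K" and i: "i < n"
  shows "i < j \<or> n - j \<le> i \<Longrightarrow> (Y * K * Y) $$ (i, i) = Y $$ (i, i)"
proof -
  have c: "K \<in> carrier_mat n n" using K by (auto simp: corner_inv_def)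
  assume "i < j \<or> n - j \<le> i"
  then show ?thesis
  proof
    assume ij: "i < j"
    have "(Y * K * Y) $$ (i, i) = (\<Sum>m<n. (Y * K) $$ (i, m) * Y $$ (m, i))"
      using c Y i by (simp add: mult_mat_index[of _ n n _ n])
    also have "\<dots> = (\<Sum>m<n. if m = i then Y $$ (i, i) else 0)"
      using K i ij by (intro sum.cong) (auto simp: corner_inv_def)
    finally show ?thesis using i by simp
  next
    assume ij: "n - j \<le> i"
    have "(Y * K * Y) $$ (i, i) = (Y * (K * Y)) $$ (i, i)"
      using c Y by (simp add: assoc_mult_mat[of _ n n _ n _ n])
    also have "\<dots> = (\<Sum>m<n. Y $$ (i, m) * (K * Y) $$ (m, i))"
      using c Y i by (simp add: mult_mat_index[of _ n n _ n])
    also have "\<dots> = (\<Sum>m<n. if m = i then Y $$ (i, i) else 0)"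
      using K i ij by (intro sum.cong) (auto simp: corner_inv_def)
    finally show ?thesis using i by simp
  qed
qed

text \<open>By uniqueness K' is the conjugate of K, so Y K Y is conjugated as a whole. Its trace
  equals tr(K Y^2).\<close>

lemma corner_trace_conj:
  fixes Y K K' g h :: "'f::field mat"
  assumes jn: "j \<le> n" and Y: "Y \<in> carrier_mat n n" and K: "corner_inv n j Y K"
    and g: "g \<in> carrier_mat n n" "lower_tri n g" and h: "h \<in> carrier_mat n n" "lower_tri n h"
    and gh: "g * h = 1\<^sub>m n" and K': "corner_inv n j (g * Y * h) K'"
  shows "mtr n ((g * Y * h) * K' * (g * Y * h)) = mtr n (Y * K * Y)"
proof -
  have hg: "h * g = 1\<^sub>m n" using mat_mult_left_right_inverse[OF g(1) h(1) gh] .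
  have c: "K \<in> carrier_mat n n" using K by (auto simp: corner_inv_def)
  have "K' = g * K * h"
    by (rule corner_inv_unique[OF jn _ K' corner_inv_conj[OF jn Y K g h gh]]) (use g h Y in auto)
  then have "(g * Y * h) * K' * (g * Y * h) = g * Y * (h * g) * K * (h * g) * Y * h"
    using g h Y c by (simp add: assoc_mult_mat[of _ n n _ n _ n])
  also have "\<dots> = g * (Y * K * Y * h)" unfolding hg using g h Y c by (simp add: assoc_mult_mat[of _ n n _ n _ n])
  finally have "mtr n ((g * Y * h) * K' * (g * Y * h)) = mtr n ((Y * K * Y * h) * g)"
    using mtr_comm[OF g(1), of "Y * K * Y * h"] g h Y c by (auto intro: mult_carrier_mat[of _ n n _ n])
  also have "(Y * K * Y * h) * g = Y * K * Y * (h * g)" using g h Y c by (simp add: assoc_mult_mat[of _ n n _ n _ n])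
  finally show ?thesis unfolding hg using Y c by simp
qed

text \<open>Only the entries on and above the diagonal matter when a matrix is paired with the Lie
  algebra. For 2 j \<le> n the block supporting K avoids them.\<close>

lemma corner_inv_upper:
  fixes Y K :: "'f::field mat"
  assumes jn: "2 * j \<le> n" and Y: "Y \<in> carrier_mat n n" and K: "corner_inv n j Y K"
    and ik: "i \<le> k" "k < n"
  shows "K $$ (i, k) = 0"
    and "(Y * K) $$ (i, k) = (if i = k \<and> i < j then 1 else 0)"
    and "(K * Y) $$ (i, k) = (if i = k \<and> n - j \<le> i then 1 else 0)"
    and "(K * Y * Y * K) $$ (i, k) = 0"
proof -
  have c: "K \<in> carrier_mat n n" using K by (auto simp: corner_inv_def)
  have supp: "K $$ (l, k) = 0" if "l < n" "k < n" "\<not> (n - j \<le> l \<and> k < j)" for l k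
    using K that by (simp add: corner_inv_def)
  show "K $$ (i, k) = 0" using ik jn by (intro supp) auto
  show "(Y * K) $$ (i, k) = (if i = k \<and> i < j then 1 else 0)"
  proof (cases "i < j")
    case True
    then show ?thesis using K ik by (simp add: corner_inv_def)
  next
    case False
    then have "(\<Sum>m<n. Y $$ (i, m) * K $$ (m, k)) = 0" using ik supp by (intro sum.neutral) auto
    then show ?thesis using False c Y ik by (simp add: mult_mat_index[of _ n n _ n])
  qed
  show "(K * Y) $$ (i, k) = (if i = k \<and> n - j \<le> i then 1 else 0)"
  proof (cases "n - j \<le> k")
    case True
    then show ?thesis using K ik by (auto simp: corner_inv_def)
  next
    case False
    then have "(\<Sum>m<n. K $$ (i, m) * Y $$ (m, k)) = 0" using ik supp by (intro sum.neutral) auto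
    then show ?thesis using False c Y ik by (auto simp: mult_mat_index[of _ n n _ n])
  qed
  show "(K * Y * Y * K) $$ (i, k) = 0"
  proof (cases "n - j \<le> i")
    case True
    then have "K $$ (m, k) = 0" if "m < n" for m using that ik jn by (intro supp) auto
    then have "(\<Sum>m<n. (K * Y * Y) $$ (i, m) * K $$ (m, k)) = 0" by (intro sum.neutral) auto
    moreover have "K * Y * Y \<in> carrier_mat n n" using c Y by (intro mult_carrier_mat[of _ n n _ n])
    ultimately show ?thesis using ik by (simp add: mult_mat_index[OF _ c])
  next
    case False
    then have "(\<Sum>m<n. K $$ (i, m) * (Y * Y * K) $$ (m, k)) = 0" using ik supp jn by (intro sum.neutral) auto
    moreover have "K * Y * Y * K = K * (Y * Y * K)" using c Y by (simp add: assoc_mult_mat[of _ n n _ n _ n])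
    moreover have "Y * Y * K \<in> carrier_mat n n" using c Y by (intro mult_carrier_mat[of _ n n _ n])
    ultimately show ?thesis using ik by (simp add: mult_mat_index[OF c])
  qed
qed

text \<open>\<open>[Y, Z] = (1 - Y K) Y\<^sup>2 K - K Y\<^sup>2 (1 - K Y)\<close> for \<open>Z = K Y + Y K - K Y\<^sup>2 K\<close>; the first factor kills
  the first \<open>j\<close> rows and the last one the last \<open>j\<close> columns.\<close>

lemma corner_commutator_upper:
  fixes Y K :: "'f::field mat"
  assumes jn: "2 * j \<le> n" and Y: "Y \<in> carrier_mat n n" and K: "corner_inv n j Y K"
    and ik: "i \<le> k" "k < n"
  defines "Z \<equiv> K * Y + Y * K - K * Y * Y * K"
  shows "(Z * Y - Y * Z) $$ (i, k) = 0"
proof -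
  have c: "K \<in> carrier_mat n n" using K by (auto simp: corner_inv_def)
  have ci: "i < n" using ik by simp
  have supp: "K $$ (l, k) = 0" if "l < n" "k < n" "\<not> (n - j \<le> l \<and> k < j)" for l k
    using K that by (simp add: corner_inv_def)
  define W where "W = Y * Y * K"
  define V where "V = K * Y * Y"
  have WV: "W \<in> carrier_mat n n" "V \<in> carrier_mat n n" using c Y by (auto simp: W_def V_def)
  have YZ: "Y * Z = Y * K * Y + W - Y * K * W"
    unfolding Z_def W_def using c Y
    by (simp add: mult_add_distrib_mat[of _ n n _ n] mult_minus_distrib_mat[of _ n n _ n] assoc_mult_mat[of _ n n _ n _ n])
  have ZY: "Z * Y = V + Y * K * Y - V * (K * Y)"
    unfolding Z_def V_def using c Y
    by (simp add: add_mult_distrib_mat[of _ n n _ _ n] minus_mult_distrib_mat[of _ n n _ _ n] assoc_mult_mat[of _ n n _ n _ n])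
  \<comment> \<open>Either row i of Y K is a unit row, or k \<ge> i \<ge> j and column k of K
    vanishes, which makes both sides zero.\<close>
  have 1: "W $$ (i, k) = (Y * K * W) $$ (i, k)"
  proof (cases "i < j")
    case True
    have "(Y * K * W) $$ (i, k) = (\<Sum>m<n. (Y * K) $$ (i, m) * W $$ (m, k))"
      using c Y WV ik by (simp add: mult_mat_index[of _ n n _ n])
    also have "\<dots> = (\<Sum>m<n. if m = i then W $$ (i, k) else 0)"
      using K True by (intro sum.cong) (auto simp: corner_inv_def)
    finally show ?thesis using ik by simp
  next
    case False
    have "W $$ (l, k) = 0" if "l < n" for l
    proof -
      have "(\<Sum>m<n. (Y * Y) $$ (l, m) * K $$ (m, k)) = 0" using False ik supp by (intro sum.neutral) auto
      then show ?thesis using c Y ik that by (simp add: W_def mult_mat_index[of _ n n _ n])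
    qed
    then show ?thesis using c Y WV ik by (simp add: mult_mat_index[of _ n n W n])
  qed
  have 2: "V $$ (i, k) = (V * (K * Y)) $$ (i, k)"
  proof (cases "n - j \<le> k")
    case True
    have "(V * (K * Y)) $$ (i, k) = (\<Sum>m<n. V $$ (i, m) * (K * Y) $$ (m, k))"
      using c Y WV ik by (simp add: mult_mat_index[of _ n n _ n])
    also have "\<dots> = (\<Sum>m<n. if m = k then V $$ (i, k) else 0)"
      using K True ik by (intro sum.cong) (auto simp: corner_inv_def)
    finally show ?thesis using ik by simp
  next
    case False
    have "V $$ (i, l) = 0" if "l < n" for l
    proof -
      have "V = K * (Y * Y)" using c Y by (simp add: V_def assoc_mult_mat[of _ n n _ n _ n])
      moreover have "(\<Sum>m<n. K $$ (i, m) * (Y * Y) $$ (m, l)) = 0" using False ik supp by (intro sum.neutral) auto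
      ultimately show ?thesis using c Y ik that by (simp add: mult_mat_index[of _ n n _ n])
    qed
    then show ?thesis using c Y WV ik by (simp add: mult_mat_index[of V n n _ n])
  qed
  have c2: "Y * K * Y \<in> carrier_mat n n" "Y * K * W \<in> carrier_mat n n" "V * (K * Y) \<in> carrier_mat n n"
    using c Y WV by auto
  show ?thesis
    unfolding YZ ZY using 1 2 ci ik(2)
    carrier_matD[OF c2(1)] carrier_matD[OF c2(2)] carrier_matD[OF c2(3)] carrier_matD[OF WV(1)] carrier_matD[OF WV(2)]
    by (simp del: index_mult_mat)
qed

subsection \<open>The explicit inverse\<close>

definition corner_mat :: "nat \<Rightarrow> nat \<Rightarrow> (lidx \<Rightarrow> 'f::field) \<Rightarrow> 'f mat" where
  "corner_mat n j x = eval_mat x (Emat 1 j (n - j + 1) n)"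

text \<open>The adjugate over the determinant, written with cofactors because these are also the
  partial derivatives of the corner minor.\<close>

definition corner_inv_mat :: "nat \<Rightarrow> nat \<Rightarrow> (lidx \<Rightarrow> 'f::field) \<Rightarrow> 'f mat" where
  "corner_inv_mat n j x = mat n n (\<lambda>(l, k). if n - j \<le> l \<and> k < j
     then cofactor (corner_mat n j x) k (l - (n - j)) / corner_minor n j x else 0)"

lemma corner_mat_carrier [simp]: "j \<le> n \<Longrightarrow> corner_mat n j x \<in> carrier_mat j j"
  by (auto simp: corner_mat_def eval_mat_def Emat_def)

lemma corner_mat_index:
  "j \<le> n \<Longrightarrow> r < j \<Longrightarrow> c < j \<Longrightarrow> corner_mat n j x $$ (r, c) = x (E (Suc r) (Suc (n - j + c)))"
  by (auto simp: corner_mat_def eval_mat_def Emat_def)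

lemma corner_minor_eq: "corner_minor n j x = det (corner_mat n j x)"
  by (simp add: corner_minor_def corner_mat_def)

lemma sum_last_block:
  fixes n j :: nat
  assumes "j \<le> n" "\<And>l. l < n - j \<Longrightarrow> f l = (0::'a::comm_monoid_add)"
  shows "(\<Sum>l<n. f l) = (\<Sum>c<j. f (n - j + c))"
proof -
  have "(\<Sum>l<n. f l) = (\<Sum>l\<in>{n - j..<n}. f l)"
    using assms(2) by (intro sum.mono_neutral_right) auto
  also have "\<dots> = (\<Sum>c<j. f (n - j + c))"
    by (rule sum.reindex_bij_witness[of _ "\<lambda>c. n - j + c" "\<lambda>l. l - (n - j)"]) (use assms(1) in auto)
  finally show ?thesis .
qed

lemma sum_first_block:
  fixes n j :: nat
  assumes "j \<le> n" "\<And>l. l < n \<Longrightarrow> j \<le> l \<Longrightarrow> f l = (0::'a::comm_monoid_add)"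
  shows "(\<Sum>l<n. f l) = (\<Sum>c<j. f c)"
  using assms by (intro sum.mono_neutral_right) auto

lemma corner_inv_corner_inv_mat:
  fixes x :: "lidx \<Rightarrow> 'f::field"
  assumes jn: "2 * j \<le> n" and Y: "Y \<in> carrier_mat n n"
    and Yx: "\<And>i k. i < k \<Longrightarrow> k < n \<Longrightarrow> Y $$ (i, k) = x (E (Suc i) (Suc k))"
    and nz: "corner_minor n j x \<noteq> 0"
  shows "corner_inv n j Y (corner_inv_mat n j x)"
proof -
  define A where "A = corner_mat n j x"
  let ?K = "corner_inv_mat n j x"
  have A: "A \<in> carrier_mat j j" using jn by (simp add: A_def)
  have Aix: "A $$ (r, c) = Y $$ (r, n - j + c)" if "r < j" "c < j" for r c
    using that jn Yx[of r "n - j + c"] by (simp add: A_def corner_mat_index)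
  have d: "det A = corner_minor n j x" by (simp add: A_def corner_minor_eq)
  have Kix: "?K $$ (n - j + c, k) = adj_mat A $$ (c, k) / det A" if "c < j" "k < j" for c k
    using that jn A d by (simp add: corner_inv_mat_def A_def[symmetric] adj_mat_def)
  have K0: "?K $$ (l, k) = 0" if "l < n" "k < n" "\<not> (n - j \<le> l \<and> k < j)" for l k
    using that by (auto simp: corner_inv_mat_def)
  have Kc: "?K \<in> carrier_mat n n" by (simp add: corner_inv_mat_def)
  show ?thesis
    unfolding corner_inv_def
  proof (intro conjI allI impI)
    fix i k assume i: "i < j" and k: "k < n"
    have "(Y * ?K) $$ (i, k) = (\<Sum>l<n. Y $$ (i, l) * ?K $$ (l, k))"
      using Kc Y i k jn by (simp add: mult_mat_index[of _ n n _ n])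
    also have "\<dots> = (if i = k then 1 else 0)"
    proof (cases "k < j")
      case True
      have "(\<Sum>l<n. Y $$ (i, l) * ?K $$ (l, k)) = (\<Sum>c<j. Y $$ (i, n - j + c) * ?K $$ (n - j + c, k))"
        using jn k K0 by (intro sum_last_block) auto
      also have "\<dots> = (\<Sum>c<j. A $$ (i, c) * adj_mat A $$ (c, k)) / det A"
        using i True by (simp add: Aix Kix sum_divide_distrib)
      also have "(\<Sum>c<j. A $$ (i, c) * adj_mat A $$ (c, k)) = (A * adj_mat A) $$ (i, k)"
        using i True A adj_mat(1)[OF A] by (simp add: mult_mat_index[of _ j j _ j])
      also have "\<dots> = (if i = k then det A else 0)" unfolding adj_mat(2)[OF A] using i True by simp
      finally show ?thesis using nz d by simp
    next
      case False
      then show ?thesis using i k K0 by (auto intro!: sum.neutral)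
    qed
    finally show "(Y * ?K) $$ (i, k) = (if i = k then 1 else 0)" .
  next
    fix l l' assume l: "l < n" and l': "l' < n" and c: "n - j \<le> l'"
    have "(?K * Y) $$ (l, l') = (\<Sum>k<n. ?K $$ (l, k) * Y $$ (k, l'))"
      using Kc Y l l' by (simp add: mult_mat_index[of _ n n _ n])
    also have "\<dots> = (if l = l' then 1 else 0)"
    proof (cases "n - j \<le> l")
      case True
      define r c' where "r = l - (n - j)" and "c' = l' - (n - j)"
      have rc: "r < j" "c' < j" "l = n - j + r" "l' = n - j + c'" using True c l l' jn by (auto simp: r_def c'_def)
      have "(\<Sum>k<n. ?K $$ (l, k) * Y $$ (k, l')) = (\<Sum>k<j. ?K $$ (l, k) * Y $$ (k, l'))"
        using jn l K0 by (intro sum_first_block) auto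
      also have "\<dots> = (\<Sum>k<j. adj_mat A $$ (r, k) * A $$ (k, c')) / det A"
        unfolding rc(3,4) using rc(1,2) by (simp add: Aix Kix sum_divide_distrib)
      also have "(\<Sum>k<j. adj_mat A $$ (r, k) * A $$ (k, c')) = (adj_mat A * A) $$ (r, c')"
        using rc A adj_mat(1)[OF A] by (simp add: mult_mat_index[of _ j j _ j])
      also have "\<dots> = (if l = l' then det A else 0)" unfolding adj_mat(3)[OF A] using rc by simp
      finally show ?thesis using nz d by simp
    next
      case False
      then show ?thesis using c l K0 by (auto intro!: sum.neutral)
    qed
    finally show "(?K * Y) $$ (l, l') = (if l = l' then 1 else 0)" .
  qed (use Kc K0 in auto)
qed

definition bordered_mat :: "nat \<Rightarrow> 'f::zero mat \<Rightarrow> (nat \<Rightarrow> 'f) \<Rightarrow> (nat \<Rightarrow> 'f) \<Rightarrow> 'f mat" where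
  "bordered_mat j A U V = mat (Suc j) (Suc j) (\<lambda>(r, c).
     if r < j then (if c = 0 then U r else A $$ (r, c - 1)) else if c = 0 then 0 else V (c - 1))"

text \<open>Clearing the upper part of the first column by column operations leaves a Schur complement.\<close>

lemma det_bordered_mat:
  fixes A :: "'f::field mat"
  assumes A: "A \<in> carrier_mat j j" and nz: "det A \<noteq> 0"
  shows "det (bordered_mat j A U V) = (-1) ^ (j + 1) * (\<Sum>c<j. \<Sum>r<j. V c * adj_mat A $$ (c, r) * U r)"
proof -
  \<comment> \<open>W is the vector -A^(-1) U. Multiplication by \<open>N\<close> adds to the first
    column the combination of the other columns with coefficients W, which cancels U.\<close>
  define W where "W c = - (\<Sum>r<j. adj_mat A $$ (c, r) * U r) / det A" for c
  define M where "M = bordered_mat j A U V"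
  define N where "N = mat (Suc j) (Suc j) (\<lambda>(r, c). if r = c then 1 else if c = 0 then W (r - 1) else 0)"
  have Mc: "M \<in> carrier_mat (Suc j) (Suc j)" and Nc: "N \<in> carrier_mat (Suc j) (Suc j)"
    by (auto simp: M_def bordered_mat_def N_def)
  have adj: "adj_mat A \<in> carrier_mat j j" using adj_mat[OF A] by simp
  have "det N = 1"
    by (subst det_lower_triangular[OF _ Nc]) (auto simp: N_def prod_list_diag_prod)
  then have "det M = det (M * N)" using det_mult[OF Mc Nc] by simp
  also have "\<dots> = (\<Sum>r<Suc j. (M * N) $$ (r, 0) * cofactor (M * N) r 0)"
    using Mc Nc by (intro laplace_expansion_column[of _ "Suc j"]) auto
  also have "\<dots> = (\<Sum>c<j. V c * W c) * cofactor (M * N) j 0"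
  proof -
    have MN0: "(M * N) $$ (r, 0) = M $$ (r, 0) + (\<Sum>c<j. M $$ (r, Suc c) * W c)" if "r \<le> j" for r
      using that Mc Nc
      by (subst mult_mat_index[OF Mc Nc]) (auto simp: N_def sum.lessThan_Suc_shift simp del: sum.lessThan_Suc intro!: sum.cong)
    have "(M * N) $$ (r, 0) = 0" if r: "r < j" for r
    proof -
      have "(\<Sum>c<j. A $$ (r, c) * W c) = - (\<Sum>c<j. \<Sum>r'<j. A $$ (r, c) * adj_mat A $$ (c, r') * U r') / det A"
        by (simp add: W_def sum_distrib_left sum_negf[symmetric] sum_divide_distrib mult.assoc)
      also have "(\<Sum>c<j. \<Sum>r'<j. A $$ (r, c) * adj_mat A $$ (c, r') * U r') =
          (\<Sum>r'<j. (\<Sum>c<j. A $$ (r, c) * adj_mat A $$ (c, r')) * U r')"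
        by (subst sum.swap) (simp add: sum_distrib_right)
      also have "\<dots> = (\<Sum>r'<j. (A * adj_mat A) $$ (r, r') * U r')"
        using r by (simp add: mult_mat_index[OF A adj])
      also have "\<dots> = (\<Sum>r'<j. if r' = r then det A * U r else 0)"
        unfolding adj_mat(2)[OF A] using r by (intro sum.cong) auto
      also have "\<dots> = det A * U r" using r by simp
      finally have "(\<Sum>c<j. A $$ (r, c) * W c) = - U r" using nz by simp
      then show ?thesis using r by (simp add: MN0) (simp add: M_def bordered_mat_def)
    qed
    moreover have "(M * N) $$ (j, 0) = (\<Sum>c<j. V c * W c)"
      by (simp add: MN0) (simp add: M_def bordered_mat_def)
    ultimately show ?thesis by simp
  qed
  \<comment> \<open>Only the last entry of the first column survives. Deleting its row and column
    leaves A, with sign (-1)^j from position (j, 0).\<close>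
  also have "cofactor (M * N) j 0 = (-1) ^ j * det A"
  proof -
    have "mat_delete (M * N) j 0 = A"
    proof (rule eq_matI)
      fix r c assume "r < dim_row A" "c < dim_col A"
      then have rc: "r < j" "c < j" using A by auto
      have "mat_delete (M * N) j 0 $$ (r, c) = (M * N) $$ (r, Suc c)"
        using rc Mc Nc by (auto simp: mat_delete_def)
      also have "\<dots> = (\<Sum>k<Suc j. if k = Suc c then M $$ (r, Suc c) else 0)"
      proof -
        have "M $$ (r, k) * N $$ (k, Suc c) = (if k = Suc c then M $$ (r, Suc c) else 0)" if "k < Suc j" for k
          using that rc by (auto simp: N_def)
        then show ?thesis using rc by (subst mult_mat_index[OF Mc Nc]) (simp_all del: sum.lessThan_Suc)
      qed
      also have "\<dots> = A $$ (r, c)" using rc by (simp add: M_def bordered_mat_def del: sum.lessThan_Suc)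
      finally show "mat_delete (M * N) j 0 $$ (r, c) = A $$ (r, c)" .
    qed (use A Mc Nc in auto)
    then show ?thesis by (simp add: cofactor_def)
  qed
  also have "(\<Sum>c<j. V c * W c) * ((-1) ^ j * det A) =
      (-1) ^ (j + 1) * (\<Sum>c<j. \<Sum>r<j. V c * adj_mat A $$ (c, r) * U r)"
  proof -
    have "(\<Sum>c<j. V c * W c) * det A = - (\<Sum>c<j. \<Sum>r<j. V c * adj_mat A $$ (c, r) * U r)"
    proof -
      have "V c * W c * det A = - (\<Sum>r<j. V c * adj_mat A $$ (c, r) * U r)" for c
        using nz by (simp add: W_def sum_distrib_left mult.assoc)
      then show ?thesis by (simp add: sum_distrib_right sum_negf)
    qed
    then show ?thesis by (simp add: mult.left_commute)
  qed
  finally show ?thesis by (simp add: M_def)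
qed

section \<open>The determinants in the expressions of the second kind\<close>

abbreviation second_block :: "nat \<Rightarrow> nat \<Rightarrow> nat \<Rightarrow> lidx option mat" where
  "second_block n j i \<equiv> four_block_mat
     (Emat 1 j i i)               (Emat 1 j (n - j + 1) n)
     (mat 1 1 (\<lambda>_. None))  (Emat i i (n - j + 1) n)"

lemma second_block_dim:
  assumes "j \<le> n"
  shows "dim_row (second_block n j i) = Suc j" "dim_col (second_block n j i) = Suc j"
  using assms by (auto simp: Emat_def)

lemma second_block_index:
  assumes "j \<le> n" "r < Suc j" "c < Suc j"
  shows "second_block n j i $$ (r, c) =
    (if r < j then (if c = 0 then Some (E (Suc r) i) else Some (E (Suc r) (n - j + c)))
     else if c = 0 then None else Some (E i (n - j + c)))"
  using assms by (auto simp: Emat_def)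

lemma eval_second_block:
  assumes "j \<le> n"
  shows "eval_mat x (second_block n j i) =
    bordered_mat j (corner_mat n j x) (\<lambda>r. x (E (Suc r) i)) (\<lambda>c. x (E i (Suc (n - j + c))))"
proof (rule eq_matI)
  fix r c assume "r < dim_row (bordered_mat j (corner_mat n j x) (\<lambda>r. x (E (Suc r) i)) (\<lambda>c. x (E i (Suc (n - j + c)))))"
    "c < dim_col (bordered_mat j (corner_mat n j x) (\<lambda>r. x (E (Suc r) i)) (\<lambda>c. x (E i (Suc (n - j + c)))))"
  then have rc: "r < Suc j" "c < Suc j" by (auto simp: bordered_mat_def)
  have "eval_mat x (second_block n j i) $$ (r, c) =
      (case second_block n j i $$ (r, c) of None \<Rightarrow> 0 | Some a \<Rightarrow> x a)"
    using rc second_block_dim[OF assms] unfolding eval_mat_def by (intro index_map_mat(1)) auto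
  then show "eval_mat x (second_block n j i) $$ (r, c) =
      bordered_mat j (corner_mat n j x) (\<lambda>r. x (E (Suc r) i)) (\<lambda>c. x (E i (Suc (n - j + c)))) $$ (r, c)"
    unfolding second_block_index[OF assms rc]
    using rc assms by (cases c) (auto simp: bordered_mat_def corner_mat_index)
qed (use second_block_dim[OF assms, of i] in \<open>simp_all add: eval_mat_def bordered_mat_def\<close>)

text \<open>The expression of the second kind with commuting variables, as a function on the dual
  space. It is later compared with the ordered operator \<open>second_kind\<close>.\<close>

definition second_fun :: "nat \<Rightarrow> (nat \<Rightarrow> nat \<Rightarrow> 'f::field) \<Rightarrow> nat \<Rightarrow> (lidx \<Rightarrow> 'f) \<Rightarrow> 'f" where
  "second_fun n \<gamma> p x = x (P p) + (\<Sum>j=1..n div 2. \<Sum>i\<in>{j<..<n - j + 1}.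
     (- 1) ^ (j + 1) / corner_minor n j x * (\<gamma> p j - \<gamma> p (j + 1)) * det (eval_mat x (second_block n j i)))"

text \<open>The bordered determinant is, up to sign, the corner minor times V A^(-1) U, where U and
  V are the parts of column i and row i that meet the corner. As K contains A^(-1), this number is
  the diagonal entry of Y K Y. For j \<le> i < n - j both borders lie strictly above the
  diagonal.\<close>

lemma det_second_block:
  fixes x :: "lidx \<Rightarrow> 'f::field"
  assumes jn: "2 * j \<le> n" and Y: "Y \<in> carrier_mat n n"
    and Yx: "\<And>i k. i < k \<Longrightarrow> k < n \<Longrightarrow> Y $$ (i, k) = x (E (Suc i) (Suc k))"
    and nz: "corner_minor n j x \<noteq> 0" and i: "j \<le> i" "i < n - j"
  shows "det (eval_mat x (second_block n j (Suc i))) =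
     (-1) ^ (j + 1) * corner_minor n j x * (Y * corner_inv_mat n j x * Y) $$ (i, i)"
proof -
  let ?A = "corner_mat n j x" and ?K = "corner_inv_mat n j x"
  have A: "?A \<in> carrier_mat j j" using jn by simp
  have Kc: "?K \<in> carrier_mat n n" by (simp add: corner_inv_mat_def)
  have K0: "?K $$ (l, k) = 0" if "l < n" "k < n" "\<not> (n - j \<le> l \<and> k < j)" for l k
    using that by (auto simp: corner_inv_mat_def)
  have Kix: "corner_minor n j x * ?K $$ (n - j + c, k) = adj_mat ?A $$ (c, k)" if "c < j" "k < j" for c k
    using that jn nz carrier_matD[OF A] by (simp add: corner_inv_mat_def adj_mat_def)
  have YK: "Y * ?K \<in> carrier_mat n n" using Y Kc by (rule mult_carrier_mat)
  have "(Y * ?K * Y) $$ (i, i) = (\<Sum>k<n. (\<Sum>l<n. Y $$ (i, l) * ?K $$ (l, k)) * Y $$ (k, i))"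
    using i YK Y Kc by (simp add: mult_mat_index[of _ n n _ n])
  also have "\<dots> = (\<Sum>k<n. (\<Sum>c<j. Y $$ (i, n - j + c) * ?K $$ (n - j + c, k)) * Y $$ (k, i))"
    using jn K0 by (intro sum.cong refl arg_cong2[where f="(*)"] sum_last_block) auto
  also have "\<dots> = (\<Sum>k<j. (\<Sum>c<j. Y $$ (i, n - j + c) * ?K $$ (n - j + c, k)) * Y $$ (k, i))"
    using jn K0 by (intro sum_first_block) (auto intro!: sum.neutral disjI1)
  finally have "corner_minor n j x * (Y * ?K * Y) $$ (i, i) =
      corner_minor n j x * (\<Sum>k<j. (\<Sum>c<j. Y $$ (i, n - j + c) * ?K $$ (n - j + c, k)) * Y $$ (k, i))"
    by simp
  also have "\<dots> = (\<Sum>k<j. (\<Sum>c<j. x (E (Suc i) (Suc (n - j + c))) * adj_mat ?A $$ (c, k)) * x (E (Suc k) (Suc i)))"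
  proof -
    have "corner_minor n j x * (\<Sum>k<j. (\<Sum>c<j. Y $$ (i, n - j + c) * ?K $$ (n - j + c, k)) * Y $$ (k, i)) =
      (\<Sum>k<j. (\<Sum>c<j. Y $$ (i, n - j + c) * (corner_minor n j x * ?K $$ (n - j + c, k))) * Y $$ (k, i))"
      by (simp add: sum_distrib_left sum_distrib_right mult_ac)
    also have "\<dots> = (\<Sum>k<j. (\<Sum>c<j. x (E (Suc i) (Suc (n - j + c))) * adj_mat ?A $$ (c, k)) * x (E (Suc k) (Suc i)))"
      using i jn by (intro sum.cong refl arg_cong2[where f="(*)"] Kix) (auto simp: Yx)
    finally show ?thesis .
  qed
  also have "\<dots> = (\<Sum>c<j. \<Sum>k<j. x (E (Suc i) (Suc (n - j + c))) * adj_mat ?A $$ (c, k) * x (E (Suc k) (Suc i)))"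
    by (subst sum.swap) (simp add: sum_distrib_right)
  finally have 1: "corner_minor n j x * (Y * ?K * Y) $$ (i, i) =
      (\<Sum>c<j. \<Sum>k<j. x (E (Suc i) (Suc (n - j + c))) * adj_mat ?A $$ (c, k) * x (E (Suc k) (Suc i)))" .
  have "det (eval_mat x (second_block n j (Suc i))) =
      (-1) ^ (j + 1) * (\<Sum>c<j. \<Sum>k<j. x (E (Suc i) (Suc (n - j + c))) * adj_mat ?A $$ (c, k) * x (E (Suc k) (Suc i)))"
    by (subst eval_second_block) (use jn in simp, rule det_bordered_mat[OF A nz[unfolded corner_minor_eq]])
  then show ?thesis unfolding 1[symmetric] by (simp only: mult.assoc)
qed

section \<open>Scaling of the corner minors under the group\<close>

context adm_param
begin

text \<open>Triangularity makes the corner of g Y h the product of the leading block of g, the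
  corner of Y and the trailing block of h. The determinants of the two blocks are products of
  exponentials, whose exponents combine to the numbers \<open>alpha\<close>.\<close>

lemma corner_minor_coAd:
  assumes B: "B \<in> T_group n s \<gamma>" and \<epsilon>: "\<And>i. i < n \<Longrightarrow> B $$ (i, i) = exp (\<Sum>p=1..s. \<gamma> p (Suc i) * \<epsilon> p)"
    and jn: "2 * j \<le> n"
  shows "corner_minor n j (coAd n s \<gamma> B x) = exp (- (\<Sum>p=1..s. \<epsilon> p * alpha n \<gamma> p j)) * corner_minor n j x"
proof -
  obtain C where C: "C \<in> carrier_mat n n" "upper_triangular C" "B * C = 1\<^sub>m n"
    "\<And>i. i < n \<Longrightarrow> C $$ (i, i) = inverse (B $$ (i, i))"
    using T_group_inverse[OF B] by metis
  have Bc: "B \<in> carrier_mat n n" "upper_triangular B" using B by (auto simp: T_group_def)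
  obtain Y where Y: "lifts n s \<gamma> x Y" using lift_exists by blast
  have Yc: "Y \<in> carrier_mat n n" using Y by (rule liftsD)
  define g h where "g = transpose_mat C" and "h = transpose_mat B"
  have gh: "g \<in> carrier_mat n n" "h \<in> carrier_mat n n" using Bc C by (auto simp: g_def h_def)
  have gz: "g $$ (i, k) = 0" if "i < k" "k < n" for i k
    using that C upper_triangularD[OF C(2), of i k] by (simp add: g_def)
  have hz: "h $$ (i, k) = 0" if "i < k" "k < n" for i k
    using that Bc upper_triangularD[OF Bc(2), of i k] by (simp add: h_def)
  let ?x' = "coAd n s \<gamma> B x"
  have Y': "lifts n s \<gamma> ?x' (g * Y * h)"
    unfolding g_def h_def by (rule lifts_coAd[OF Bc C(1,2,3) Y])
  define G H where "G = mat j j (\<lambda>(r, a). g $$ (r, a))" and "H = mat j j (\<lambda>(b, c). h $$ (n - j + b, n - j + c))"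
  have Gc: "G \<in> carrier_mat j j" and Hc: "H \<in> carrier_mat j j" by (auto simp: G_def H_def)
  have Ac: "corner_mat n j x \<in> carrier_mat j j" using jn by simp
  have GA: "G * corner_mat n j x \<in> carrier_mat j j" using Gc Ac by (rule mult_carrier_mat)
  have "corner_mat n j ?x' = G * corner_mat n j x * H"
  proof (rule eq_matI)
    fix r c assume "r < dim_row (G * corner_mat n j x * H)" "c < dim_col (G * corner_mat n j x * H)"
    then have rc: "r < j" "c < j" using Gc Hc by auto
    have "corner_mat n j ?x' $$ (r, c) = (g * Y * h) $$ (r, n - j + c)"
      using rc jn liftsD(2)[OF Y', of r "n - j + c"] by (simp add: corner_mat_index)
    also have "\<dots> = (\<Sum>b<n. (\<Sum>a<n. g $$ (r, a) * Y $$ (a, b)) * h $$ (b, n - j + c))"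
      using rc jn gh Yc mult_carrier_mat[OF gh(1) Yc] by (simp add: mult_mat_index[of _ n n _ n])
    also have "\<dots> = (\<Sum>b<j. (\<Sum>a<n. g $$ (r, a) * Y $$ (a, n - j + b)) * h $$ (n - j + b, n - j + c))"
      using rc jn hz by (intro sum_last_block) auto
    also have "\<dots> = (\<Sum>b<j. (\<Sum>a<j. g $$ (r, a) * Y $$ (a, n - j + b)) * h $$ (n - j + b, n - j + c))"
      using rc jn gz by (intro sum.cong refl arg_cong2[where f="(*)"] sum_first_block) auto
    also have "\<dots> = (\<Sum>b<j. (\<Sum>a<j. G $$ (r, a) * corner_mat n j x $$ (a, b)) * H $$ (b, c))"
      using rc jn liftsD(2)[OF Y]
      by (intro sum.cong refl arg_cong2[where f="(*)"]) (auto simp: G_def H_def corner_mat_index)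
    also have "\<dots> = (G * corner_mat n j x * H) $$ (r, c)"
      using rc Gc Ac Hc GA by (simp add: mult_mat_index[of _ j j _ j])
    finally show "corner_mat n j ?x' $$ (r, c) = (G * corner_mat n j x * H) $$ (r, c)" .
  qed (use jn Gc Hc carrier_matD[OF corner_mat_carrier[of j n ?x']] in auto)
  then have "corner_minor n j ?x' = det G * corner_minor n j x * det H"
    using det_mult[OF GA Hc] det_mult[OF Gc Ac] by (simp add: corner_minor_eq)
  also have "det G = (\<Prod>i<j. inverse (B $$ (i, i)))"
    using gz jn C by (subst det_lower_triangular[OF _ Gc])
      (auto simp: G_def prod_list_diag_prod g_def lessThan_atLeast0 intro!: prod.cong)
  also have "\<dots> = exp (- (\<Sum>p=1..s. \<epsilon> p * (\<Sum>i<j. \<gamma> p (Suc i))))"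
  proof -
    have "(\<Prod>i<j. inverse (B $$ (i, i))) = (\<Prod>i<j. exp (- (\<Sum>p=1..s. \<gamma> p (Suc i) * \<epsilon> p)))"
      using jn by (intro prod.cong) (auto simp: \<epsilon> exp_minus)
    also have "\<dots> = exp (\<Sum>i<j. - (\<Sum>p=1..s. \<gamma> p (Suc i) * \<epsilon> p))" by (simp add: exp_sum)
    also have "(\<Sum>i<j. - (\<Sum>p=1..s. \<gamma> p (Suc i) * \<epsilon> p)) = - (\<Sum>p=1..s. \<epsilon> p * (\<Sum>i<j. \<gamma> p (Suc i)))"
      unfolding sum_negf by (subst sum.swap) (simp add: sum_distrib_left mult.commute)
    finally show ?thesis .
  qed
  also have "det H = (\<Prod>i<j. B $$ (n - j + i, n - j + i))"
    using hz jn Bc by (subst det_lower_triangular[OF _ Hc])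
      (auto simp: H_def prod_list_diag_prod h_def lessThan_atLeast0 intro!: prod.cong)
  also have "\<dots> = exp (\<Sum>p=1..s. \<epsilon> p * (\<Sum>i<j. \<gamma> p (Suc (n - j + i))))"
  proof -
    have "(\<Prod>i<j. B $$ (n - j + i, n - j + i)) = (\<Prod>i<j. exp (\<Sum>p=1..s. \<gamma> p (Suc (n - j + i)) * \<epsilon> p))"
      using jn by (intro prod.cong) (auto simp: \<epsilon>)
    also have "\<dots> = exp (\<Sum>i<j. (\<Sum>p=1..s. \<gamma> p (Suc (n - j + i)) * \<epsilon> p))" by (simp add: exp_sum)
    also have "(\<Sum>i<j. (\<Sum>p=1..s. \<gamma> p (Suc (n - j + i)) * \<epsilon> p)) = (\<Sum>p=1..s. \<epsilon> p * (\<Sum>i<j. \<gamma> p (Suc (n - j + i))))"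
      by (subst sum.swap) (simp add: sum_distrib_left mult.commute)
    finally show ?thesis .
  qed
  finally have "corner_minor n j ?x' = exp (- (\<Sum>p=1..s. \<epsilon> p * (\<Sum>i<j. \<gamma> p (Suc i)))) *
     exp (\<Sum>p=1..s. \<epsilon> p * (\<Sum>i<j. \<gamma> p (Suc (n - j + i)))) * corner_minor n j x" by simp
  also have "exp (- (\<Sum>p=1..s. \<epsilon> p * (\<Sum>i<j. \<gamma> p (Suc i)))) *
     exp (\<Sum>p=1..s. \<epsilon> p * (\<Sum>i<j. \<gamma> p (Suc (n - j + i)))) = exp (- (\<Sum>p=1..s. \<epsilon> p * alpha n \<gamma> p j))"
  proof -
    have "alpha n \<gamma> p j = (\<Sum>i<j. \<gamma> p (Suc i)) - (\<Sum>i<j. \<gamma> p (Suc (n - j + i)))" for p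
    proof -
      have "(\<Sum>i<j. \<gamma> p (Suc i)) = (\<Sum>k'=1..j. \<gamma> p k')"
        by (rule sum.reindex_bij_witness[of _ "\<lambda>k. k - 1" Suc]) auto
      moreover have "(\<Sum>i<j. \<gamma> p (Suc (n - j + i))) = (\<Sum>k'=1..j. \<gamma> p (n - k' + 1))"
        by (rule sum.reindex_bij_witness[of _ "\<lambda>k. j - k" "\<lambda>i. j - i"]) (use jn in auto)
      ultimately show ?thesis by (simp add: alpha_def sum_subtractf)
    qed
    then show ?thesis by (simp add: exp_add[symmetric] right_diff_distrib sum_subtractf)
  qed
  finally show ?thesis .
qed

end

section \<open>The reduced form\<close>

locale reduced_param = adm_param n s \<gamma> for n s :: nat and \<gamma> :: "nat \<Rightarrow> nat \<Rightarrow> 'f::{real_normed_field,banach}" +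
  fixes s' :: nat and k :: "nat \<Rightarrow> nat"
  assumes n1: "n > 1" and red: "reduced_form n s \<gamma> s' k"
begin

abbreviation "m \<equiv> n div 2"

lemma s'_le: "s' \<le> s" "s' \<le> m"
  using red by (auto simp: reduced_form_def)

lemma k_range: "q \<in> {1..s'} \<Longrightarrow> k q \<in> {1..m}"
  using red by (auto simp: reduced_form_def)

lemma k_strict_mono: "q \<in> {1..s'} \<Longrightarrow> q' \<in> {1..s'} \<Longrightarrow> q < q' \<Longrightarrow> k q < k q'"
  using red by (auto simp: reduced_form_def strict_mono_on_def)

lemma k_inj: "inj_on k {1..s'}"
proof (rule inj_onI)
  fix q q' assume "q \<in> {1..s'}" "q' \<in> {1..s'}" "k q = k q'"
  then show "q = q'" using k_strict_mono[of q q'] k_strict_mono[of q' q] by (cases q q' rule: linorder_cases) auto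
qed

lemma \<gamma>_symmetric: "p \<in> {s'<..s} \<Longrightarrow> j \<in> {1..m} \<Longrightarrow> \<gamma> p (n - j + 1) = \<gamma> p j"
  using red unfolding reduced_form_def by metis

lemma \<gamma>_below: "q \<in> {1..s'} \<Longrightarrow> j \<in> {1..<k q} \<Longrightarrow> \<gamma> q (n - j + 1) = \<gamma> q j"
  using red unfolding reduced_form_def by metis

lemma \<gamma>_pivot: "q \<in> {1..s'} \<Longrightarrow> \<gamma> q (n - k q + 1) - \<gamma> q (k q) = 1"
  using red unfolding reduced_form_def by metis

lemma \<gamma>_other: "q \<in> {1..s'} \<Longrightarrow> p \<in> {1..s} \<Longrightarrow> p \<noteq> q \<Longrightarrow> \<gamma> p (n - k q + 1) = \<gamma> p (k q)"
  using red unfolding reduced_form_def by (metis DiffI singletonD)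

lemma alpha_symmetric_zero: "p \<in> {s'<..s} \<Longrightarrow> j \<le> m \<Longrightarrow> alpha n \<gamma> p j = 0"
  unfolding alpha_def using \<gamma>_symmetric by (simp add: sum.neutral)

lemma alpha_from_k:
  assumes "q \<in> {1..s'}"
  shows "alpha n \<gamma> q j = - (\<Sum>k'=k q..j. \<gamma> q (n - k' + 1) - \<gamma> q k')"
proof -
  have "(\<Sum>k'=1..j. \<gamma> q (n - k' + 1) - \<gamma> q k') = (\<Sum>k'=k q..j. \<gamma> q (n - k' + 1) - \<gamma> q k')"
    using \<gamma>_below[OF assms] k_range[OF assms] by (intro sum.mono_neutral_right) auto
  then show ?thesis by (simp add: alpha_def)
qed

definition alpha_mat :: "'f mat" where
  "alpha_mat = mat s' s' (\<lambda>(r, c). alpha n \<gamma> (Suc r) (k (Suc c)))"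

lemma alpha_mat_carrier [simp]: "alpha_mat \<in> carrier_mat s' s'"
  by (simp add: alpha_mat_def)

text \<open>The sum defining \<open>alpha\<close> in row q effectively starts at k_q, so it is empty
  at the earlier indices and the matrix is upper triangular. The normalization of the pivots puts -1
  on its diagonal.\<close>

lemma Delta_eq: "Delta n \<gamma> s' k = (-1) ^ s'"
proof -
  have "upper_triangular alpha_mat"
  proof (rule upper_triangularI)
    fix i j assume ij: "j < i" "i < dim_row alpha_mat"
    then have i: "Suc i \<in> {1..s'}" "Suc j \<in> {1..s'}" by (auto simp: alpha_mat_def)
    then have "k (Suc j) < k (Suc i)" using ij by (intro k_strict_mono) auto
    then show "alpha_mat $$ (i, j) = 0"
      using i ij alpha_from_k[OF i(1), of "k (Suc j)"] by (simp add: alpha_mat_def)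
  qed
  moreover have "alpha_mat $$ (i, i) = -1" if "i < s'" for i
  proof -
    have i: "Suc i \<in> {1..s'}" using that by auto
    have "alpha n \<gamma> (Suc i) (k (Suc i)) = - (\<gamma> (Suc i) (n - k (Suc i) + 1) - \<gamma> (Suc i) (k (Suc i)))"
      using alpha_from_k[OF i, of "k (Suc i)"] by simp
    then show ?thesis unfolding \<gamma>_pivot[OF i] using that by (simp add: alpha_mat_def)
  qed
  ultimately have "det alpha_mat = (-1) ^ s'"
    by (subst det_upper_triangular[of _ s']) (auto simp: prod_list_diag_prod carrier_matD[OF alpha_mat_carrier])
  then show ?thesis by (simp add: Delta_def alpha_mat_def)
qed

text \<open>These equations make the weights of the corner minors cancel in the expressions of the
  first kind. For p > s' every \<open>alpha\<close> in them vanishes by symmetry; for p \<le> s'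
  they form the linear system that Cramer's rule solves.\<close>

lemma beta_system:
  assumes p: "p \<in> {1..s}" and j: "j \<le> m"
  shows "alpha n \<gamma> p j + (\<Sum>q=1..s'. beta n \<gamma> s' k q j * alpha n \<gamma> p (k q)) = 0"
proof (cases "p \<le> s'")
  case False
  then have p': "p \<in> {s'<..s}" using p by auto
  have "(\<Sum>q=1..s'. beta n \<gamma> s' k q j * alpha n \<gamma> p (k q)) = 0"
    using k_range p' by (intro sum.neutral ballI) (auto simp: alpha_symmetric_zero)
  then show ?thesis using alpha_symmetric_zero[OF p' j] by simp
next
  case True
  let ?A = alpha_mat
  have dA: "det ?A \<noteq> 0" using Delta_eq by (simp add: Delta_def alpha_mat_def)
  define b where "b = vec s' (\<lambda>r. alpha n \<gamma> (Suc r) j)"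
  have b: "b \<in> carrier_vec s'" by (simp add: b_def)
  define v where "v = (1 / det ?A) \<cdot>\<^sub>v (adj_mat ?A *\<^sub>v b)"
  have adj: "adj_mat ?A \<in> carrier_mat s' s'" using adj_mat[OF alpha_mat_carrier] by simp
  have v: "v \<in> carrier_vec s'" using adj b by (simp add: v_def)
  have "?A *\<^sub>v v = (1 / det ?A) \<cdot>\<^sub>v (?A *\<^sub>v (adj_mat ?A *\<^sub>v b))"
    unfolding v_def using adj b by (intro mult_mat_vec[OF alpha_mat_carrier]) auto
  also have "?A *\<^sub>v (adj_mat ?A *\<^sub>v b) = (?A * adj_mat ?A) *\<^sub>v b"
    using adj b by (intro assoc_mult_mat_vec[OF alpha_mat_carrier adj b, symmetric])
  also have "\<dots> = det ?A \<cdot>\<^sub>v b"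
    unfolding adj_mat(2)[OF alpha_mat_carrier] using b by auto
  finally have Av: "?A *\<^sub>v v = b" using dA b by (auto simp: smult_smult_assoc)
  \<comment> \<open>Replacing a column of the matrix by its right-hand side produces
    \<open>Delta_repl\<close>, so \<beta> is the negative of the solution.\<close>
  have vq: "beta n \<gamma> s' k (Suc c) j = - v $ c" if c: "c < s'" for c
  proof -
    have "replace_col ?A (?A *\<^sub>v v) c = mat s' s' (\<lambda>(r, c'). alpha n \<gamma> (Suc r) (if Suc c' = Suc c then j else k (Suc c')))"
      unfolding Av replace_col_def by (rule eq_matI) (auto simp: alpha_mat_def b_def)
    then have "Delta_repl n \<gamma> s' k (Suc c) j = v $ c * Delta n \<gamma> s' k"
      using cramer_lemma_mat[OF alpha_mat_carrier v c] by (simp add: Delta_repl_def Delta_def alpha_mat_def)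
    then show ?thesis using dA by (simp add: beta_def Delta_def alpha_mat_def)
  qed
  obtain p0 where p0: "p = Suc p0" "p0 < s'" using True p by (cases p) auto
  have "alpha n \<gamma> p j = (?A *\<^sub>v v) $ p0" unfolding Av using p0 by (simp add: b_def)
  also have "\<dots> = (\<Sum>c<s'. alpha n \<gamma> p (k (Suc c)) * v $ c)"
    using p0 v by (auto simp: alpha_mat_def scalar_prod_def lessThan_atLeast0 intro!: sum.cong)
  also have "\<dots> = - (\<Sum>c<s'. beta n \<gamma> s' k (Suc c) j * alpha n \<gamma> p (k (Suc c)))"
    by (simp add: vq sum_negf mult.commute)
  also have "(\<Sum>c<s'. beta n \<gamma> s' k (Suc c) j * alpha n \<gamma> p (k (Suc c))) =
      (\<Sum>q=1..s'. beta n \<gamma> s' k q j * alpha n \<gamma> p (k q))"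
    by (rule sum.reindex_bij_witness[of _ "\<lambda>q. q - 1" Suc]) auto
  finally show ?thesis by simp
qed

text \<open>Abel summation: a symmetric row is its central value plus a combination of step
  functions, the j-th of which is 1 on the first j and on the last j positions. These steps are the
  diagonals on which the matrices Y K_j Y and Y agree.\<close>

lemma \<gamma>_step:
  assumes p: "p \<in> {s'<..s}" and i: "i < n"
  shows "\<gamma> p (Suc i) = (\<Sum>j=1..m. (\<gamma> p j - \<gamma> p (j + 1)) * (if i < j \<or> n - j \<le> i then 1 else 0)) + \<gamma> p (m + 1)"
proof -
  have tele: "(\<Sum>j=a..m. \<gamma> p j - \<gamma> p (j + 1)) = \<gamma> p a - \<gamma> p (m + 1)" if "a \<le> m + 1" for a
    using sum_Suc_diff[of a m "\<lambda>j. - \<gamma> p j"] that by (simp add: algebra_simps)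
  have restrict: "(\<Sum>j=1..m. (\<gamma> p j - \<gamma> p (j + 1)) * (if i < j \<or> n - j \<le> i then 1 else 0)) =
      (\<Sum>j=a..m. \<gamma> p j - \<gamma> p (j + 1))" if "1 \<le> a" "\<And>j. j \<in> {1..m} \<Longrightarrow> (i < j \<or> n - j \<le> i) \<longleftrightarrow> a \<le> j" for a
    using that by (intro sum.mono_neutral_cong_right) auto
  have m2: "2 * m \<le> n" by simp
  have aux1: "i < M \<Longrightarrow> j \<le> M \<Longrightarrow> 2 * M \<le> n \<Longrightarrow> (i < j \<or> n - j \<le> i) \<longleftrightarrow> Suc i \<le> j" for M j by auto
  have aux2: "n - M \<le> i \<Longrightarrow> i < n \<Longrightarrow> j \<le> M \<Longrightarrow> 2 * M \<le> n \<Longrightarrow> (i < j \<or> n - j \<le> i) \<longleftrightarrow> n - i \<le> j" for M j by auto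
  have aux3: "i = M \<Longrightarrow> M < n - M \<Longrightarrow> j \<le> M \<Longrightarrow> \<not> (i < j \<or> n - j \<le> i)" for M j by auto
  \<comment> \<open>The left half, the right half (reduced to the left one by symmetry), and the
    middle position of odd n, which belongs to no step.\<close>
  consider "i < m" | "n - m \<le> i" | "i = m" "m < n - m" using i by linarith
  then show ?thesis
  proof cases
    case 1
    then have "(i < j \<or> n - j \<le> i) \<longleftrightarrow> Suc i \<le> j" if "j \<in> {1..m}" for j
      using that aux1[of m j] m2 by (metis atLeastAtMost_iff)
    then show ?thesis using restrict[of "Suc i"] tele[of "Suc i"] 1 by simp
  next
    case 2
    have a: "1 \<le> n - i" "n - i \<le> m" using 2 i by linarith+
    have "\<gamma> p (n - i) = \<gamma> p (Suc i)" using \<gamma>_symmetric[OF p, of "n - i"] a i by simp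
    moreover have "(i < j \<or> n - j \<le> i) \<longleftrightarrow> n - i \<le> j" if "j \<in> {1..m}" for j
      using aux2[of m j] 2 i m2 that by (metis atLeastAtMost_iff)
    ultimately show ?thesis using restrict[of "n - i"] tele[of "n - i"] a by simp
  next
    case 3
    have "(\<Sum>j=1..m. (\<gamma> p j - \<gamma> p (j + 1)) * (if i < j \<or> n - j \<le> i then 1 else 0)) = 0"
    proof (intro sum.neutral ballI)
      fix j assume "j \<in> {1..m}"
      then have "\<not> (i < j \<or> n - j \<le> i)" using aux3[of m j] 3 by (metis atLeastAtMost_iff)
      then show "(\<gamma> p j - \<gamma> p (j + 1)) * (if i < j \<or> n - j \<le> i then 1 else 0) = 0" by simp
    qed
    then show ?thesis using 3 by simp
  qed
qed

abbreviation K :: "nat \<Rightarrow> (lidx \<Rightarrow> 'f) \<Rightarrow> 'f mat" where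
  "K j x \<equiv> corner_inv_mat n j x"

definition regular :: "(lidx \<Rightarrow> 'f) \<Rightarrow> bool" where
  "regular x \<longleftrightarrow> (\<forall>j\<in>{1..m}. corner_minor n j x \<noteq> 0)"

lemma corner_inv_K:
  assumes "lifts n s \<gamma> x Y" "regular x" "j \<in> {1..m}"
  shows "corner_inv n j Y (K j x)"
  using assms liftsD[OF assms(1)] by (intro corner_inv_corner_inv_mat) (auto simp: regular_def)

text \<open>In tr(Y K_j Y) the outer diagonal entries are those of Y and the middle ones are the
  bordered determinants. By \<open>\<gamma>_step\<close> the outer parts, together with tr Y, add up
  to the coordinate of x at \<open>P p\<close>. The left side involves no lift, so the right side
  does not depend on the choice of Y.\<close>

lemma second_fun_lift:
  assumes p: "p \<in> {s'<..s}" and Y: "lifts n s \<gamma> x Y" and reg: "regular x"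
  shows "second_fun n \<gamma> p x = (\<Sum>j=1..m. (\<gamma> p j - \<gamma> p (j + 1)) * mtr n (Y * K j x * Y)) + \<gamma> p (m + 1) * mtr n Y"
proof -
  have Yc: "Y \<in> carrier_mat n n" using Y by (rule liftsD)
  let ?d = "\<lambda>j. \<gamma> p j - \<gamma> p (j + 1)"
  let ?c = "\<lambda>i j. i < j \<or> n - j \<le> i"
  have tr: "mtr n (Y * K j x * Y) = (\<Sum>i<n. if ?c i j then Y $$ (i, i) else 0) + (\<Sum>i\<in>{j..<n - j}. (Y * K j x * Y) $$ (i, i))"
    if j: "j \<in> {1..m}" for j
  proof -
    have "mtr n (Y * K j x * Y) = (\<Sum>i<n. (if ?c i j then Y $$ (i, i) else 0) + (if ?c i j then 0 else (Y * K j x * Y) $$ (i, i)))"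
      unfolding mtr_def using j corner_inv_diag[OF _ Yc corner_inv_K[OF Y reg j]] by (intro sum.cong) auto
    also have "\<dots> = (\<Sum>i<n. if ?c i j then Y $$ (i, i) else 0) + (\<Sum>i<n. if ?c i j then 0 else (Y * K j x * Y) $$ (i, i))"
      by (rule sum.distrib)
    also have "(\<Sum>i<n. if ?c i j then 0 else (Y * K j x * Y) $$ (i, i)) = (\<Sum>i\<in>{j..<n - j}. (Y * K j x * Y) $$ (i, i))"
      using j by (intro sum.mono_neutral_cong_right) auto
    finally show ?thesis .
  qed
  have mid: "(\<Sum>i\<in>{j<..<n - j + 1}. (- 1) ^ (j + 1) / corner_minor n j x * ?d j * det (eval_mat x (second_block n j i))) =
      ?d j * (\<Sum>i\<in>{j..<n - j}. (Y * K j x * Y) $$ (i, i))" if j: "j \<in> {1..m}" for j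
  proof -
    have nz: "corner_minor n j x \<noteq> 0" using reg j by (simp add: regular_def)
    have "(\<Sum>i\<in>{j<..<n - j + 1}. (- 1) ^ (j + 1) / corner_minor n j x * ?d j * det (eval_mat x (second_block n j i))) =
      (\<Sum>i\<in>{j..<n - j}. (- 1) ^ (j + 1) / corner_minor n j x * ?d j * det (eval_mat x (second_block n j (Suc i))))"
      by (rule sum.reindex_bij_witness[of _ Suc "\<lambda>i. i - 1"]) (use j in auto)
    also have "\<dots> = (\<Sum>i\<in>{j..<n - j}. ?d j * (Y * K j x * Y) $$ (i, i))"
    proof (intro sum.cong refl)
      fix i assume i: "i \<in> {j..<n - j}"
      have "det (eval_mat x (second_block n j (Suc i))) = (-1) ^ (j + 1) * corner_minor n j x * (Y * K j x * Y) $$ (i, i)"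
        using i j nz Yc liftsD(2)[OF Y] by (intro det_second_block) auto
      then show "(- 1) ^ (j + 1) / corner_minor n j x * ?d j * det (eval_mat x (second_block n j (Suc i))) = ?d j * (Y * K j x * Y) $$ (i, i)"
        using nz by (simp add: mult.left_commute power_mult_distrib[symmetric])
    qed
    finally show ?thesis by (simp add: sum_distrib_left)
  qed
  have "(\<Sum>i<n. \<gamma> p (Suc i) * Y $$ (i, i)) =
      (\<Sum>i<n. (\<Sum>j=1..m. ?d j * (if ?c i j then Y $$ (i, i) else 0)) + \<gamma> p (m + 1) * Y $$ (i, i))"
  proof (intro sum.cong refl)
    fix i assume "i \<in> {..<n}"
    then have i: "i < n" by simp
    have "(\<Sum>j=1..m. ?d j * (if ?c i j then 1 else 0)) * Y $$ (i, i) = (\<Sum>j=1..m. ?d j * (if ?c i j then Y $$ (i, i) else 0))"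
      unfolding sum_distrib_right by (rule sum.cong) auto
    then show "\<gamma> p (Suc i) * Y $$ (i, i) =
        (\<Sum>j=1..m. ?d j * (if ?c i j then Y $$ (i, i) else 0)) + \<gamma> p (m + 1) * Y $$ (i, i)"
      using arg_cong[OF \<gamma>_step[OF p i], of "\<lambda>c. c * Y $$ (i, i)"] by (simp only: distrib_right)
  qed
  also have "\<dots> = (\<Sum>j=1..m. ?d j * (\<Sum>i<n. if ?c i j then Y $$ (i, i) else 0)) + \<gamma> p (m + 1) * mtr n Y"
    unfolding sum.distrib mtr_def by (subst sum.swap) (simp add: sum_distrib_left)
  finally have xP: "x (P p) = \<dots>" using liftsD(3)[OF Y, of p] p by simp
  show ?thesis
    unfolding second_fun_def xP using mid tr by (simp add: sum.distrib distrib_left)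
qed

lemma regular_coAd:
  assumes "B \<in> T_group n s \<gamma>" "regular x"
  shows "regular (coAd n s \<gamma> B x)"
proof -
  obtain \<epsilon> where "\<And>i. i < n \<Longrightarrow> B $$ (i, i) = exp (\<Sum>p=1..s. \<gamma> p (Suc i) * \<epsilon> p)"
    using assms(1) by (auto simp: T_group_def)
  from corner_minor_coAd[OF assms(1) this] assms(2) show ?thesis
    unfolding regular_def by auto
qed

lemma second_fun_invariant:
  assumes p: "p \<in> {s'<..s}" and B: "B \<in> T_group n s \<gamma>" and reg: "regular x"
  shows "second_fun n \<gamma> p (coAd n s \<gamma> B x) = second_fun n \<gamma> p x"
proof -
  obtain C where C: "C \<in> carrier_mat n n" "upper_triangular C" "B * C = 1\<^sub>m n" "C * B = 1\<^sub>m n"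
    using T_group_inverse[OF B] by metis
  have Bc: "B \<in> carrier_mat n n" "upper_triangular B" using B by (auto simp: T_group_def)
  obtain Y where Y: "lifts n s \<gamma> x Y" using lift_exists by blast
  have Yc: "Y \<in> carrier_mat n n" using Y by (rule liftsD)
  define g h where "g = transpose_mat C" and "h = transpose_mat B"
  have gh: "g \<in> carrier_mat n n" "h \<in> carrier_mat n n" using Bc C by (auto simp: g_def h_def)
  have lt: "lower_tri n g" "lower_tri n h"
    using Bc C upper_triangularD[OF C(2)] upper_triangularD[OF Bc(2)] by (auto simp: lower_tri_def g_def h_def)
  have gh1: "g * h = 1\<^sub>m n"
    unfolding g_def h_def using transpose_mult[OF Bc(1) C(1)] C(3) by simp
  let ?x' = "coAd n s \<gamma> B x"
  have Y': "lifts n s \<gamma> ?x' (g * Y * h)"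
    unfolding g_def h_def by (rule lifts_coAd[OF Bc C(1,2,3) Y])
  have reg': "regular ?x'" using regular_coAd[OF B reg] .
  have "mtr n (g * Y * h * K j ?x' * (g * Y * h)) = mtr n (Y * K j x * Y)" if j: "j \<in> {1..m}" for j
    by (rule corner_trace_conj[OF _ Yc corner_inv_K[OF Y reg j] gh(1) lt(1) gh(2) lt(2) gh1 corner_inv_K[OF Y' reg' j]])
       (use j in auto)
  moreover have "mtr n (g * Y * h) = mtr n Y"
  proof -
    have "mtr n (g * Y * h) = mtr n (h * (g * Y))"
      using gh Yc mult_carrier_mat[OF gh(1) Yc] by (intro mtr_comm)
    also have "h * (g * Y) = (h * g) * Y" using gh Yc by (simp add: assoc_mult_mat[of _ n n _ n _ n])
    also have "h * g = 1\<^sub>m n" using mat_mult_left_right_inverse[OF gh gh1] .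
    finally show ?thesis using Yc by simp
  qed
  ultimately show ?thesis
    unfolding second_fun_lift[OF p Y reg] second_fun_lift[OF p Y' reg'] by simp
qed

end

section \<open>The rank of the coadjoint action\<close>

context adm_param
begin

lemma orbit_tangent_frob:
  assumes a: "a \<in> \<B>" and b: "b \<in> \<B>" and Y: "lifts n s \<gamma> x Y"
  shows "orbit_tangent n s \<gamma> x a b = frob n (Y * transpose_mat (e a) - transpose_mat (e a) * Y) (e b)"
proof -
  have Yc: "Y \<in> carrier_mat n n" using Y by (rule liftsD)
  have ec: "e c \<in> carrier_mat n n" for c by simp
  have ta: "transpose_mat (e a) \<in> carrier_mat n n" using ec by simp
  have "orbit_tangent n s \<gamma> x a b = frob n Y (e b * e a) - frob n Y (e a * e b)"
    unfolding orbit_tangent_eq[OF assms] by (intro frob_minus_right mult_carrier_mat[OF ec ec])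
  also have "\<dots> = frob n (e b) (Y * transpose_mat (e a)) - frob n (e b) (transpose_mat (e a) * Y)"
    using frob_mult_right[OF Yc ec ec] frob_mult_left[OF Yc ec ec] by simp
  also have "\<dots> = frob n (e b) (Y * transpose_mat (e a) - transpose_mat (e a) * Y)"
    by (intro frob_minus_right[symmetric] mult_carrier_mat[OF Yc ta] mult_carrier_mat[OF ta Yc])
  finally show ?thesis by (simp add: frob_comm)
qed

text \<open>A covector on the dual space is an element of the Lie algebra. Here \<open>w\<close> is
  the transpose of the lower triangular matrix U, and the condition on the coordinates
  \<open>P p\<close> says that the diagonal of U lies in the span of the rows of \<gamma>.\<close>

lemma tangent_pairing:
  assumes a: "a \<in> \<B>" and Y: "lifts n s \<gamma> x Y" and U: "U \<in> carrier_mat n n"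
    and wE: "\<And>i l. i < l \<Longrightarrow> l < n \<Longrightarrow> w (E (Suc i) (Suc l)) = U $$ (l, i)"
    and wP: "\<And>i. i < n \<Longrightarrow> (\<Sum>p=1..s. w (P p) * \<gamma> p (Suc i)) = U $$ (i, i)"
    and upper: "\<And>i l. i < l \<Longrightarrow> l < n \<Longrightarrow> U $$ (i, l) = 0"
  shows "(\<Sum>b\<in>\<B>. orbit_tangent n s \<gamma> x a b * w b) = frob n U (e a * transpose_mat Y - transpose_mat Y * e a)"
proof -
  have Yc: "Y \<in> carrier_mat n n" using Y by (rule liftsD)
  have ec: "e b \<in> carrier_mat n n" for b by simp
  let ?D = "Y * transpose_mat (e a) - transpose_mat (e a) * Y"
  have ta: "transpose_mat (e a) \<in> carrier_mat n n" using ec by simp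
  have Dc: "Y * transpose_mat (e a) \<in> carrier_mat n n" "transpose_mat (e a) * Y \<in> carrier_mat n n"
    using mult_carrier_mat[OF ta Yc] mult_carrier_mat[OF Yc ta] by auto
  have lie: "lie_elem n s \<gamma> w = transpose_mat U"
  proof (rule eq_matI)
    fix i l assume "i < dim_row (transpose_mat U)" "l < dim_col (transpose_mat U)"
    then have il: "i < n" "l < n" using U by auto
    then show "lie_elem n s \<gamma> w $$ (i, l) = transpose_mat U $$ (i, l)"
      using U wE[of i l] wP[of i] upper[of l i] by (auto simp: lie_elem_index)
  qed (use U in \<open>auto simp: lie_elem_def\<close>)
  have "(\<Sum>b\<in>\<B>. orbit_tangent n s \<gamma> x a b * w b) = (\<Sum>b\<in>\<B>. w b * frob n ?D (e b))"
    by (intro sum.cong) (auto simp: orbit_tangent_frob[OF a _ Y])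
  also have "\<dots> = frob n ?D (transpose_mat U)" unfolding lie[symmetric] by (rule frob_lie_elem[symmetric])
  also have "\<dots> = (\<Sum>l<n. \<Sum>i<n. ?D $$ (i, l) * transpose_mat U $$ (i, l))"
    unfolding frob_def by (rule sum.swap)
  also have "\<dots> = frob n U (transpose_mat ?D)"
    unfolding frob_def using U Yc Dc by (intro sum.cong refl) (auto simp: mult.commute)
  also have "transpose_mat ?D = e a * transpose_mat Y - transpose_mat Y * e a"
    using transpose_minus[OF Dc] transpose_mult[OF Yc ta] transpose_mult[OF ta Yc] by simp
  finally show ?thesis .
qed

text \<open>Invariance of the trace form: U annihilates the tangent vectors of the orbit if the
  commutator of U and Y pairs to zero with the Lie algebra.\<close>

lemma frob_commutator:
  assumes Y: "Y \<in> carrier_mat n n" and U: "U \<in> carrier_mat n n"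
  shows "frob n U (e a * transpose_mat Y - transpose_mat Y * e a) = frob n (e a) (U * Y - Y * U)"
proof -
  have ec: "e a \<in> carrier_mat n n" by simp
  have "frob n U (e a * transpose_mat Y - transpose_mat Y * e a) =
      frob n U (e a * transpose_mat Y) - frob n U (transpose_mat Y * e a)"
    using Y ec by (intro frob_minus_right mult_carrier_mat[of _ n n _ n]) auto
  also have "\<dots> = frob n (e a) (U * Y) - frob n (e a) (Y * U)"
    using frob_mult_right[OF U ec, of "transpose_mat Y"] frob_mult_left[OF U _ ec, of "transpose_mat Y"] Y by simp
  also have "\<dots> = frob n (e a) (U * Y - Y * U)"
    using Y U by (intro frob_minus_right[symmetric] mult_carrier_mat[of _ n n _ n]) auto
  finally show ?thesis .
qed

lemma frob_basis_zero:
  assumes "a \<in> \<B>" "\<And>i l. i \<le> l \<Longrightarrow> l < n \<Longrightarrow> Z $$ (i, l) = 0"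
  shows "frob n (e a) Z = 0"
  using assms(1)
proof (cases rule: basis_idx_cases)
  case (1 i j)
  then show ?thesis using frob_basis_E[of i n j Z \<gamma>] assms(2)[of i j] by (simp add: frob_comm del: basis_mat.simps)
next
  case (2 p)
  then show ?thesis using frob_basis_P[of n Z \<gamma> p] assms(2) by (simp add: frob_comm del: basis_mat.simps)
qed

end

lemma frob_sum_left:
  assumes "\<And>i j. i < n \<Longrightarrow> j < n \<Longrightarrow> U $$ (i, j) = (\<Sum>t\<in>T. c t * V t $$ (i, j))"
  shows "frob n U M = (\<Sum>t\<in>T. c t * frob n (V t) M)"
proof -
  have "frob n U M = (\<Sum>i<n. \<Sum>j<n. \<Sum>t\<in>T. c t * (V t $$ (i, j) * M $$ (i, j)))"
    unfolding frob_def using assms by (simp add: sum_distrib_right mult.assoc)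
  also have "\<dots> = (\<Sum>i<n. \<Sum>t\<in>T. \<Sum>j<n. c t * (V t $$ (i, j) * M $$ (i, j)))"
    by (rule sum.cong[OF refl], rule sum.swap)
  also have "\<dots> = (\<Sum>t\<in>T. \<Sum>i<n. \<Sum>j<n. c t * (V t $$ (i, j) * M $$ (i, j)))" by (rule sum.swap)
  finally show ?thesis unfolding frob_def by (simp add: sum_distrib_left)
qed

text \<open>Evaluation at t is a ring homomorphism. This makes a minor restricted to a line a
  polynomial in the parameter of the line.\<close>

lemma poly_det:
  fixes f :: "nat \<times> nat \<Rightarrow> 'f::field poly"
  shows "poly (det (mat j j f)) t = det (mat j j (\<lambda>ij. poly (f ij) t))"
proof -
  interpret comm_ring_hom "\<lambda>p. poly p t" by unfold_locales auto
  have "map_mat (\<lambda>p. poly p t) (mat j j f) = mat j j (\<lambda>ij. poly (f ij) t)" by (rule eq_matI) auto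
  then show ?thesis using hom_det[of "mat j j f"] by simp
qed

section \<open>Covectors annihilating the tangent vectors at a regular point\<close>

context reduced_param
begin

abbreviation "Jset \<equiv> {1..m} - k ` {1..s'}"
abbreviation "L \<equiv> expr_set n s s' k"

lemma finite_L: "finite L"
  by (simp add: expr_set_def)

lemma K_carrier [simp]: "K j x \<in> carrier_mat n n"
  by (simp add: corner_inv_mat_def)

lemma corner_inv_indep:
  assumes Y: "lifts n s \<gamma> x Y" and reg: "regular x"
    and z: "\<And>i l. i < l \<Longrightarrow> l < n \<Longrightarrow> (\<Sum>j=1..m. d j * K j x $$ (l, i)) = 0"
    and j: "j \<in> {1..m}"
  shows "d j = 0"
proof -
  have Yc: "Y \<in> carrier_mat n n" using Y by (rule liftsD)
  have U: "K j x $$ (i, l) = 0" "(Y * K j x) $$ (i, l) = (if i = l \<and> i < j then 1 else 0)"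
    if "j \<in> {1..m}" "i \<le> l" "l < n" for i l j
    using corner_inv_upper[OF _ Yc corner_inv_K[OF Y reg that(1)] that(2,3)] that(1) by auto
  \<comment> \<open>The diagonal entry i of Y times the combination of the K_j is the tail sum of
    \<open>d\<close> beyond i, and it involves only entries of the combination below the diagonal.
    Consecutive tail sums then differ by one coefficient.\<close>
  have T: "(\<Sum>j=Suc i..m. d j) = 0" if i: "i < m" for i
  proof -
    have i': "i < n" using i by simp
    have "(\<Sum>j=Suc i..m. d j) = (\<Sum>j=1..m. d j * (Y * K j x) $$ (i, i))"
      using i' U(2)[of _ i i] by (intro sum.mono_neutral_cong_left) auto
    also have "\<dots> = (\<Sum>j=1..m. \<Sum>l<n. d j * (Y $$ (i, l) * K j x $$ (l, i)))"
      using i' by (simp add: mult_mat_index[OF Yc K_carrier] sum_distrib_left)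
    also have "\<dots> = (\<Sum>l<n. \<Sum>j=1..m. d j * (Y $$ (i, l) * K j x $$ (l, i)))" by (rule sum.swap)
    also have "\<dots> = (\<Sum>l<n. Y $$ (i, l) * (\<Sum>j=1..m. d j * K j x $$ (l, i)))"
      by (simp add: sum_distrib_left mult.left_commute)
    also have "\<dots> = 0"
    proof (intro sum.neutral ballI)
      fix l assume "l \<in> {..<n}"
      moreover have "(\<Sum>j=1..m. d j * K j x $$ (l, i)) = 0" if "l \<le> i"
        using U(1)[of _ l i] that i' by (intro sum.neutral) auto
      ultimately show "Y $$ (i, l) * (\<Sum>j=1..m. d j * K j x $$ (l, i)) = 0"
        using z[of i l] by (cases "i < l") auto
    qed
    finally show ?thesis .
  qed
  obtain i where i: "j = Suc i" "i < m" using j by (cases j) auto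
  have "(\<Sum>j=Suc i..m. d j) = d j + (\<Sum>j=Suc (Suc i)..m. d j)"
    using i by (simp add: sum.atLeast_Suc_atMost)
  moreover have "(\<Sum>j=Suc (Suc i)..m. d j) = 0"
    using T[of "Suc i"] by (cases "Suc i < m") auto
  ultimately show ?thesis using T[OF i(2)] by simp
qed

text \<open>Used twice: for the differentials of the invariants, where \<open>c\<close> is the value
  of the invariant, and for the stabilizing vectors, where \<open>c\<close> is 1. The coordinates
  \<open>P p\<close> separate the second kind, and the rest is a relation between the K_j.\<close>

lemma indep_combined:
  assumes Y: "lifts n s \<gamma> x Y" and reg: "regular x"
    and vE: "\<And>j i l. j \<in> Jset \<Longrightarrow> i < l \<Longrightarrow> l < n \<Longrightarrow>
      v (Inl j) (E (Suc i) (Suc l)) = c j * (K j x $$ (l, i) + (\<Sum>q=1..s'. b q j * K (k q) x $$ (l, i)))"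
    and vP: "\<And>j p. j \<in> Jset \<Longrightarrow> p \<in> {1..s} \<Longrightarrow> v (Inl j) (P p) = 0"
    and c: "\<And>j. j \<in> Jset \<Longrightarrow> c j \<noteq> 0"
    and vP': "\<And>p p'. p \<in> {s' + 1..s} \<Longrightarrow> p' \<in> {1..s} \<Longrightarrow> v (Inr p) (P p') = (if p = p' then 1 else 0)"
  shows "indep_family L \<B> v"
proof (rule indep_familyI)
  fix d :: "nat + nat \<Rightarrow> 'f" and l
  assume z: "\<And>i. i \<in> \<B> \<Longrightarrow> (\<Sum>l\<in>L. d l * v l i) = 0" and l: "l \<in> L"
  have z': "(\<Sum>j\<in>Jset. d (Inl j) * v (Inl j) i) + (\<Sum>p=s'+1..s. d (Inr p) * v (Inr p) i) = 0"
    if "i \<in> \<B>" for i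
    using z[OF that] by (simp add: expr_set_def sum.Plus)
  have dP: "d (Inr p) = 0" if p: "p \<in> {s'+1..s}" for p
  proof -
    have p1: "p \<in> {1..s}" using p by auto
    have "(\<Sum>j\<in>Jset. d (Inl j) * v (Inl j) (P p)) = 0" using vP p1 by (intro sum.neutral) auto
    moreover have "(\<Sum>p'=s'+1..s. d (Inr p') * v (Inr p') (P p)) = (\<Sum>p'=s'+1..s. if p' = p then d (Inr p') else 0)"
      using vP' p1 by (intro sum.cong) auto
    ultimately show ?thesis using z'[of "P p"] p p1 by simp
  qed
  \<comment> \<open>Coefficients regrouped over all indices up to n/2. An index k_q collects the
    contributions that all expressions of the first kind make through their powers.\<close>
  define D where "D j = (if j \<in> Jset then d (Inl j) * c j
     else (\<Sum>j'\<in>Jset. d (Inl j') * c j' * b (the_inv_into {1..s'} k j) j'))" for j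
  have Dk: "D (k q) = (\<Sum>j'\<in>Jset. d (Inl j') * c j' * b q j')" if "q \<in> {1..s'}" for q
    using that k_inj by (auto simp: D_def the_inv_into_f_f)
  have sub: "k ` {1..s'} \<subseteq> {1..m}" using k_range by blast
  have "(\<Sum>j=1..m. D j * K j x $$ (l, i)) = 0" if il: "i < l" "l < n" for i l
  proof -
    have "0 = (\<Sum>j\<in>Jset. d (Inl j) * v (Inl j) (E (Suc i) (Suc l)))"
      using z'[of "E (Suc i) (Suc l)"] il dP by simp
    also have "\<dots> = (\<Sum>j\<in>Jset. d (Inl j) * c j * K j x $$ (l, i) +
        (\<Sum>q=1..s'. d (Inl j) * c j * b q j * K (k q) x $$ (l, i)))"
      using vE il by (intro sum.cong) (auto simp: distrib_left sum_distrib_left mult.assoc)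
    also have "\<dots> = (\<Sum>j\<in>Jset. D j * K j x $$ (l, i)) +
        (\<Sum>j\<in>Jset. \<Sum>q=1..s'. d (Inl j) * c j * b q j * K (k q) x $$ (l, i))"
      unfolding sum.distrib by (simp add: D_def)
    also have "(\<Sum>j\<in>Jset. \<Sum>q=1..s'. d (Inl j) * c j * b q j * K (k q) x $$ (l, i)) =
        (\<Sum>q=1..s'. D (k q) * K (k q) x $$ (l, i))"
      by (subst sum.swap) (simp add: Dk sum_distrib_right)
    also have "\<dots> = (\<Sum>j\<in>k ` {1..s'}. D j * K j x $$ (l, i))"
      using k_inj by (simp add: sum.reindex)
    also have "(\<Sum>j\<in>Jset. D j * K j x $$ (l, i)) + (\<Sum>j\<in>k ` {1..s'}. D j * K j x $$ (l, i)) =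
        (\<Sum>j=1..m. D j * K j x $$ (l, i))"
      using sum.subset_diff[OF sub, of "\<lambda>j. D j * K j x $$ (l, i)"] by simp
    finally show ?thesis by simp
  qed
  from corner_inv_indep[OF Y reg this] have D0: "D j = 0" if "j \<in> {1..m}" for j using that by blast
  show "d l = 0"
  proof (cases l)
    case (Inl j)
    then have "j \<in> Jset" using l by (auto simp: expr_set_def)
    then show ?thesis using D0[of j] c[of j] Inl by (simp add: D_def)
  next
    case (Inr p)
    then show ?thesis using l dP[of p] by (auto simp: expr_set_def)
  qed
qed

text \<open>On and above the diagonal the commutator of K_j and Y is diagonal, with -1 on the first
  j and 1 on the last j positions. Its pairing with a row of \<gamma> is the definition of
  \<open>alpha\<close>, up to sign.\<close>

lemma frob_corner_commutator:
  assumes Y: "lifts n s \<gamma> x Y" and reg: "regular x" and j: "j \<in> {1..m}" and a: "a \<in> \<B>"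
  shows "frob n (e a) (K j x * Y - Y * K j x) = (case a of E _ _ \<Rightarrow> 0 | P p \<Rightarrow> - alpha n \<gamma> p j)"
proof -
  have Yc: "Y \<in> carrier_mat n n" using Y by (rule liftsD)
  let ?Z = "K j x * Y - Y * K j x"
  have c: "K j x * Y \<in> carrier_mat n n" "Y * K j x \<in> carrier_mat n n"
    using Yc by (auto intro: mult_carrier_mat[OF K_carrier Yc] mult_carrier_mat[OF Yc K_carrier])
  have Z: "?Z $$ (i, l) = (if i = l \<and> n - j \<le> i then 1 else 0) - (if i = l \<and> i < j then 1 else 0)"
    if "i \<le> l" "l < n" for i l
  proof -
    have "2 * j \<le> n" using j by auto
    then show ?thesis
      using corner_inv_upper(2,3)[OF _ Yc corner_inv_K[OF Y reg j] that] that carrier_matD[OF c(1)] carrier_matD[OF c(2)]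
      by (simp del: index_mult_mat)
  qed
  show ?thesis
    using a
  proof (cases rule: basis_idx_cases)
    case (1 i l)
    then show ?thesis using frob_basis_E[of i n l ?Z \<gamma>] Z[of i l]
      by (subst frob_comm) (simp del: basis_mat.simps index_minus_mat)
  next
    case (2 p)
    have "(\<Sum>i<n. \<gamma> p (Suc i) * ?Z $$ (i, i)) =
        (\<Sum>i<n. (if n - j \<le> i then \<gamma> p (Suc i) else 0) - (if i < j then \<gamma> p (Suc i) else 0))"
      by (intro sum.cong) (auto simp: Z simp del: index_minus_mat)
    also have "\<dots> = (\<Sum>i<n. if n - j \<le> i then \<gamma> p (Suc i) else 0) - (\<Sum>i<n. if i < j then \<gamma> p (Suc i) else 0)"
      by (rule sum_subtractf)
    also have "(\<Sum>i<n. if n - j \<le> i then \<gamma> p (Suc i) else 0) = (\<Sum>i\<in>{n - j..<n}. \<gamma> p (Suc i))"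
      by (intro sum.mono_neutral_cong_right) auto
    also have "\<dots> = (\<Sum>k'=1..j. \<gamma> p (n - k' + 1))"
      by (rule sum.reindex_bij_witness[of _ "\<lambda>k. n - k" "\<lambda>i. n - i"]) (use j in auto)
    also have "(\<Sum>i<n. if i < j then \<gamma> p (Suc i) else 0) = (\<Sum>i<j. \<gamma> p (Suc i))"
      using j by (intro sum.mono_neutral_cong_right) auto
    also have "\<dots> = (\<Sum>k'=1..j. \<gamma> p k')"
      by (rule sum.reindex_bij_witness[of _ "\<lambda>k. k - 1" Suc]) auto
    finally have "(\<Sum>i<n. \<gamma> p (Suc i) * ?Z $$ (i, i)) = - alpha n \<gamma> p j"
      by (simp add: alpha_def sum_subtractf)
    then show ?thesis unfolding 2 using frob_basis_P[of n ?Z \<gamma> p] by (subst frob_comm) simp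
  qed
qed

text \<open>Gradients of the invariants: logarithmic ones for the first kind, and for the second
  kind those of the traces. Since dK = - K dY K, the gradient of tr(K Y^2) is K Y + Y K - K Y^2 K,
  and the gradient of tr Y is the identity.\<close>

definition stab_mat :: "(lidx \<Rightarrow> 'f) \<Rightarrow> 'f mat \<Rightarrow> nat + nat \<Rightarrow> 'f mat" where
  "stab_mat x Y l = mat n n (\<lambda>ij. case l of
      Inl j \<Rightarrow> K j x $$ ij + (\<Sum>q=1..s'. beta n \<gamma> s' k q j * K (k q) x $$ ij)
    | Inr p \<Rightarrow> (\<Sum>j=1..m. (\<gamma> p j - \<gamma> p (j + 1)) * (K j x * Y + Y * K j x - K j x * Y * Y * K j x) $$ ij)
        + \<gamma> p (m + 1) * 1\<^sub>m n $$ ij)"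

definition stab_vec :: "(lidx \<Rightarrow> 'f) \<Rightarrow> 'f mat \<Rightarrow> nat + nat \<Rightarrow> lidx \<Rightarrow> 'f" where
  "stab_vec x Y l b = (case b of E i j \<Rightarrow> stab_mat x Y l $$ (j - 1, i - 1) | P p \<Rightarrow> if l = Inr p then 1 else 0)"

text \<open>After translation to commutators with Y, the first kind leaves a combination of the
  numbers \<open>alpha\<close> that vanishes by \<open>beta_system\<close>. For the second kind
  every commutator already vanishes on and above the diagonal.\<close>

lemma stab_vec_annihilates:
  assumes Y: "lifts n s \<gamma> x Y" and reg: "regular x" and a: "a \<in> \<B>" and l: "l \<in> L"
  shows "(\<Sum>b\<in>\<B>. orbit_tangent n s \<gamma> x a b * stab_vec x Y l b) = 0"
proof -
  have Yc: "Y \<in> carrier_mat n n" using Y by (rule liftsD)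
  note cu = corner_inv_upper[OF _ Yc corner_inv_K[OF Y reg]]
  let ?M = "e a * transpose_mat Y - transpose_mat Y * e a"
  let ?Z = "\<lambda>j. K j x * Y + Y * K j x - K j x * Y * Y * K j x"
  have Zc: "K j x * Y \<in> carrier_mat n n" "Y * K j x \<in> carrier_mat n n" "K j x * Y * Y * K j x \<in> carrier_mat n n" for j
    using Yc by (auto intro!: mult_carrier_mat[of _ n n _ n])
  have Zcar: "?Z j \<in> carrier_mat n n" for j using Zc(3) by (rule minus_carrier_mat)
  have Zupper: "?Z j $$ (i, i') = (if i = i' \<and> (i < j \<or> n - j \<le> i) then 1 else 0)"
    if "j \<in> {1..m}" "i \<le> i'" "i' < n" for j i i'
  proof -
    have "2 * j \<le> n" using that by auto
    then show ?thesis using cu[of j i i'] that Zc[of j] by (auto simp del: index_mult_mat)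
  qed
  have pair: "(\<Sum>b\<in>\<B>. orbit_tangent n s \<gamma> x a b * stab_vec x Y l b) = frob n (stab_mat x Y l) ?M"
  proof (rule tangent_pairing[OF a Y])
    fix i assume i: "i < n"
    show "(\<Sum>p=1..s. stab_vec x Y l (P p) * \<gamma> p (Suc i)) = stab_mat x Y l $$ (i, i)"
    proof (cases l)
      case (Inl j)
      then have j: "j \<in> {1..m}" using l by (auto simp: expr_set_def)
      have z: "K j x $$ (i, i) = 0" if "j \<in> {1..m}" for j using cu(1)[of j i i] that i by auto
      then show ?thesis using Inl i j k_range by (simp add: stab_vec_def stab_mat_def)
    next
      case (Inr p)
      then have p: "p \<in> {s'<..s}" using l by (auto simp: expr_set_def)
      \<comment> \<open>The diagonals of the gradients of the traces are the steps of
        \<open>\<gamma>_step\<close>, so they add up to row p of \<gamma>, as membership in the Lie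
        algebra requires.\<close>
      have "stab_mat x Y l $$ (i, i) = (\<Sum>j=1..m. (\<gamma> p j - \<gamma> p (j + 1)) * ?Z j $$ (i, i)) + \<gamma> p (m + 1)"
        using i Inr by (simp add: stab_mat_def del: index_minus_mat)
      also have "(\<Sum>j=1..m. (\<gamma> p j - \<gamma> p (j + 1)) * ?Z j $$ (i, i)) =
          (\<Sum>j=1..m. (\<gamma> p j - \<gamma> p (j + 1)) * (if i < j \<or> n - j \<le> i then 1 else 0))"
      proof (intro sum.cong refl arg_cong2[where f="(*)"])
        fix j assume j: "j \<in> {1..m}"
        show "?Z j $$ (i, i) = (if i < j \<or> n - j \<le> i then 1 else 0)"
          unfolding Zupper[OF j order.refl i] by simp
      qed
      also have "\<dots> + \<gamma> p (m + 1) = \<gamma> p (Suc i)" by (rule \<gamma>_step[OF p i, symmetric])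
      also have "\<dots> = (\<Sum>p'=1..s. (if p = p' then 1 else 0) * \<gamma> p' (Suc i))"
        using p by (simp add: if_distrib[of "\<lambda>x. x * _"] cong: if_cong)
      finally show ?thesis using Inr by (simp add: stab_vec_def)
    qed
  next
    fix i i' assume ii: "i < i'" "i' < n"
    show "stab_mat x Y l $$ (i, i') = 0"
    proof (cases l)
      case (Inl j)
      then have j: "j \<in> {1..m}" using l by (auto simp: expr_set_def)
      have z: "K j x $$ (i, i') = 0" if "j \<in> {1..m}" for j using cu(1)[of j i i'] that ii by auto
      then show ?thesis using Inl ii j k_range by (simp add: stab_mat_def)
    next
      case (Inr p)
      then show ?thesis using ii Zupper[of _ i i'] by (simp add: stab_mat_def sum.neutral del: index_minus_mat)
    qed
  qed (auto simp: stab_vec_def stab_mat_def)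
  also have "\<dots> = 0"
  proof (cases l)
    case (Inl j)
    then have j: "j \<in> {1..m}" using l by (auto simp: expr_set_def)
    \<comment> \<open>Index 0 is added to the range of summation to carry the summand K_j; in the
      second case it carries the identity matrix.\<close>
    have "frob n (stab_mat x Y l) ?M = (\<Sum>q=0..s'. (if q = 0 then 1 else beta n \<gamma> s' k q j) * frob n (if q = 0 then K j x else K (k q) x) ?M)"
      by (rule frob_sum_left) (use Inl in \<open>auto simp: stab_mat_def sum.atLeast_Suc_atMost intro!: sum.cong\<close>)
    also have "\<dots> = frob n (K j x) ?M + (\<Sum>q=1..s'. beta n \<gamma> s' k q j * frob n (K (k q) x) ?M)"
      by (auto simp: sum.atLeast_Suc_atMost intro!: sum.cong)
    also have "\<dots> = frob n (e a) (K j x * Y - Y * K j x) +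
        (\<Sum>q=1..s'. beta n \<gamma> s' k q j * frob n (e a) (K (k q) x * Y - Y * K (k q) x))"
      by (simp only: frob_commutator[OF Yc K_carrier])
    also have "\<dots> = 0"
      using a
    proof (cases rule: basis_idx_cases)
      case (1 i l)
      then show ?thesis
        using frob_corner_commutator[OF Y reg j a] frob_corner_commutator[OF Y reg k_range a] by (simp del: basis_mat.simps)
    next
      case (2 p)
      have "frob n (e a) (K j x * Y - Y * K j x) +
        (\<Sum>q=1..s'. beta n \<gamma> s' k q j * frob n (e a) (K (k q) x * Y - Y * K (k q) x)) =
        - alpha n \<gamma> p j + (\<Sum>q=1..s'. beta n \<gamma> s' k q j * - alpha n \<gamma> p (k q))"
        using frob_corner_commutator[OF Y reg j a] frob_corner_commutator[OF Y reg k_range a] 2(2)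
        by (intro arg_cong2[where f="(+)"] sum.cong) (auto simp del: basis_mat.simps)
      also have "\<dots> = - (alpha n \<gamma> p j + (\<Sum>q=1..s'. beta n \<gamma> s' k q j * alpha n \<gamma> p (k q)))"
        by (simp add: sum_negf)
      also have "\<dots> = 0" using beta_system[OF 2(1), of j] j by simp
      finally show ?thesis .
    qed
    finally show ?thesis .
  next
    case (Inr p)
    have "frob n (stab_mat x Y l) ?M = (\<Sum>j=0..m. (if j = 0 then \<gamma> p (m + 1) else \<gamma> p j - \<gamma> p (j + 1)) *
        frob n (if j = 0 then 1\<^sub>m n else ?Z j) ?M)"
      by (rule frob_sum_left) (use Inr in \<open>auto simp: stab_mat_def sum.atLeast_Suc_atMost simp del: index_minus_mat intro!: sum.cong\<close>)
    also have "\<dots> = 0"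
    proof (intro sum.neutral ballI)
      fix j assume j: "j \<in> {0..m}"
      have "frob n (if j = 0 then 1\<^sub>m n else ?Z j) ?M = 0"
      proof (cases "j = 0")
        case True
        have "frob n (e a) (1\<^sub>m n * Y - Y * 1\<^sub>m n) = 0"
          using Yc by (intro frob_basis_zero[OF a]) auto
        then show ?thesis using True frob_commutator[OF Yc, of "1\<^sub>m n" a] by simp
      next
        case False
        then have j': "j \<in> {1..m}" using j by auto
        have "frob n (e a) (?Z j * Y - Y * ?Z j) = 0"
          using j' by (intro frob_basis_zero[OF a] corner_commutator_upper[OF _ Yc corner_inv_K[OF Y reg j']]) auto
        then show ?thesis using False frob_commutator[OF Yc Zcar] by simp
      qed
      then show "(if j = 0 then \<gamma> p (m + 1) else \<gamma> p j - \<gamma> p (j + 1)) * frob n (if j = 0 then 1\<^sub>m n else ?Z j) ?M = 0"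
        by simp
    qed
    finally show ?thesis .
  qed
  finally show ?thesis .
qed

abbreviation tang :: "(lidx \<Rightarrow> 'f) \<Rightarrow> lidx \<Rightarrow> lidx \<Rightarrow> 'f" where
  "tang x \<equiv> \<lambda>a b. if b \<in> \<B> then orbit_tangent n s \<gamma> x a b else 0"

lemma orbit_dim_regular:
  assumes reg: "regular x"
  shows "orbit_dim n s \<gamma> x + card L \<le> card \<B>"
proof -
  obtain Y where Y: "lifts n s \<gamma> x Y" using lift_exists by blast
  have "indep_family L \<B> (stab_vec x Y)"
  proof (rule indep_combined[OF Y reg, where c = "\<lambda>_. 1" and b = "beta n \<gamma> s' k"])
  qed (auto simp: stab_vec_def stab_mat_def)
  from dim_add_card_annihilator_le[OF finite_basis_idx finite_L finite_basis_idx _ this, where v = "tang x"]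
  show ?thesis unfolding orbit_dim_def using stab_vec_annihilates[OF Y reg] by auto
qed

end

text \<open>The value d at position (1, n) becomes the common value of all corner minors, which
  allows placing them in the domain of a branch of the logarithm.\<close>

definition antidiag_point :: "nat \<Rightarrow> nat \<Rightarrow> 'f::field \<Rightarrow> lidx \<Rightarrow> 'f" where
  "antidiag_point n s d = (\<lambda>a\<in>basis_idx n s. case a of
     E i j \<Rightarrow> if i + j = n + 1 then (if i = 1 then d else (-1) ^ (i - 1)) else 0 | P p \<Rightarrow> 0)"

text \<open>The signs on the antidiagonal are those of the Laplace expansion along the last row.\<close>

lemma corner_minor_antidiag_point:
  assumes "1 \<le> j" "2 * j \<le> n"
  shows "corner_minor n j (antidiag_point n s d) = d"
  using assms
proof (induction j rule: nat_induct_at_least)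
  case base
  have "corner_mat n 1 (antidiag_point n s d) \<in> carrier_mat 1 1" using base by simp
  then show ?case
    using base by (simp add: corner_minor_eq det_single corner_mat_index antidiag_point_def)
next
  case (Suc j)
  let ?x = "antidiag_point n s d"
  let ?A = "corner_mat n (Suc j) ?x"
  have A: "?A \<in> carrier_mat (Suc j) (Suc j)" using Suc by (intro corner_mat_carrier) simp
  have row: "?A $$ (j, c) = (if c = 0 then (-1) ^ j else 0)" if "c < Suc j" for c
    using that Suc by (auto simp: corner_mat_index antidiag_point_def)
  have del: "mat_delete ?A j 0 = corner_mat n j ?x"
  proof (rule eq_matI)
    fix r c assume "r < dim_row (corner_mat n j ?x)" "c < dim_col (corner_mat n j ?x)"
    then have rc: "r < j" "c < j" using carrier_matD[OF corner_mat_carrier[of j n ?x]] Suc by auto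
    have "mat_delete ?A j 0 $$ (r, c) = ?A $$ (r, Suc c)"
      using rc carrier_matD[OF A] by (simp add: mat_delete_def)
    then show "mat_delete ?A j 0 $$ (r, c) = corner_mat n j ?x $$ (r, c)"
      using rc Suc by (simp add: corner_mat_index Suc_diff_Suc)
  qed (use carrier_matD[OF A] carrier_matD[OF corner_mat_carrier[of j n ?x]] Suc in auto)
  have "det ?A = (\<Sum>c<Suc j. ?A $$ (j, c) * cofactor ?A j c)"
    by (rule laplace_expansion_row[OF A]) simp
  also have "\<dots> = (\<Sum>c<Suc j. if c = 0 then (-1) ^ j * cofactor ?A j 0 else 0)"
    by (intro sum.cong) (auto simp: row)
  also have "\<dots> = (-1) ^ j * cofactor ?A j 0" by (simp del: sum.lessThan_Suc)
  also have "\<dots> = corner_minor n j ?x"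
    by (simp add: cofactor_def del corner_minor_eq power_mult_distrib[symmetric] flip: mult.assoc)
  also have "\<dots> = d" using Suc by simp
  finally show ?case by (simp add: corner_minor_eq)
qed

section \<open>The maximal orbit dimension\<close>

context reduced_param
begin

text \<open>On the line from \<open>x\<close> to a regular point all but finitely many points are regular, and the
  dimension of the orbits is lower semicontinuous.\<close>

lemma orbit_dim_le: "orbit_dim n s \<gamma> x + card L \<le> card \<B>"
proof -
  define z where "z = antidiag_point n s (1::'f)"
  have zreg: "corner_minor n j z = 1" if "j \<in> {1..m}" for j
    unfolding z_def using that by (intro corner_minor_antidiag_point) auto
  obtain Y where Y: "lifts n s \<gamma> x Y" using lift_exists by blast
  obtain Z where Z: "lifts n s \<gamma> z Z" using lift_exists by blast
  have YZ: "Y \<in> carrier_mat n n" "Z \<in> carrier_mat n n" using Y Z by (auto dest: liftsD)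
  define xt where "xt t = (\<lambda>a\<in>\<B>. (1 - t) * x a + t * z a)" for t
  have lin: "frob n ((1 - t) \<cdot>\<^sub>m Y + t \<cdot>\<^sub>m Z) M = (1 - t) * frob n Y M + t * frob n Z M" for t M
    unfolding frob_def using YZ by (simp add: distrib_right sum.distrib sum_distrib_left mult.assoc)
  have lt: "lifts n s \<gamma> (xt t) ((1 - t) \<cdot>\<^sub>m Y + t \<cdot>\<^sub>m Z)" for t
    using Y Z YZ unfolding lifts_def by (auto simp: lin xt_def)
  have tang: "tang (xt t) a = (\<lambda>b. (1 - t) * tang x a b + t * tang z a b)" if "a \<in> \<B>" for t a
    using that by (auto simp: fun_eq_iff orbit_tangent_eq[OF that _ lt] orbit_tangent_eq[OF that _ Y]
        orbit_tangent_eq[OF that _ Z] lin)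
  obtain \<delta> where \<delta>: "\<delta> > 0" and le: "\<And>t. norm t < \<delta> \<Longrightarrow>
      fun_vs.dim (tang x ` \<B>) \<le> fun_vs.dim ((\<lambda>a b. (1 - t) * tang x a b + t * tang z a b) ` \<B>)"
    using dim_segment_lower_semicontinuous[OF finite_basis_idx finite_basis_idx, of n s "tang x" n s "tang z"] by auto
  have fin: "finite {t. corner_minor n j (xt t) = 0}" if j: "j \<in> {1..m}" for j
  proof -
    have j2: "2 * j \<le> n" using j by auto
    \<comment> \<open>The corner minor along the line, whose entries are affine in t. Its value 1 at
      t = 1 shows that it is not the zero polynomial.\<close>
    define p where "p = det (mat j j (\<lambda>(r, c). let a = E (Suc r) (Suc (n - j + c)) in [:x a, z a - x a:]))"
    have p: "poly p t = corner_minor n j (xt t)" for t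
    proof -
      have "mat j j (\<lambda>ij. poly (case ij of (r, c) \<Rightarrow> let a = E (Suc r) (Suc (n - j + c)) in [:x a, z a - x a:]) t)
          = corner_mat n j (xt t)"
      proof (rule eq_matI)
        fix r c assume "r < dim_row (corner_mat n j (xt t))" "c < dim_col (corner_mat n j (xt t))"
        then have rc: "r < j" "c < j" using carrier_matD[OF corner_mat_carrier[of j n "xt t"]] j2 by auto
        show "mat j j (\<lambda>ij. poly (case ij of (r, c) \<Rightarrow> let a = E (Suc r) (Suc (n - j + c)) in [:x a, z a - x a:]) t) $$ (r, c)
          = corner_mat n j (xt t) $$ (r, c)"
        proof -
          have "E (Suc r) (Suc (n - j + c)) \<in> \<B>" unfolding E_in_basis_idx using rc j2 by auto
          then show ?thesis
            using j2 rc by (simp add: corner_mat_index xt_def Let_def del: E_in_basis_idx) (simp add: algebra_simps)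
        qed
      qed (use carrier_matD[OF corner_mat_carrier[of j n "xt t"]] j2 in auto)
      then show ?thesis unfolding p_def poly_det by (simp add: corner_minor_eq)
    qed
    have "corner_minor n j (xt 1) = corner_minor n j z"
    proof -
      have "corner_mat n j (xt 1) = corner_mat n j z"
      proof (rule eq_matI)
        fix r c assume "r < dim_row (corner_mat n j z)" "c < dim_col (corner_mat n j z)"
        then have rc: "r < j" "c < j" using carrier_matD[OF corner_mat_carrier[of j n z]] j2 by auto
        have "E (Suc r) (Suc (n - j + c)) \<in> \<B>" unfolding E_in_basis_idx using rc j2 by auto
        then show "corner_mat n j (xt 1) $$ (r, c) = corner_mat n j z $$ (r, c)"
          using j2 rc by (simp add: corner_mat_index xt_def del: E_in_basis_idx)
      qed (use carrier_matD[OF corner_mat_carrier[of j n z]] carrier_matD[OF corner_mat_carrier[of j n "xt 1"]] j2 in auto)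
      then show ?thesis by (simp add: corner_minor_eq)
    qed
    then have "poly p 1 = 1" using zreg[OF j] p by simp
    then have "p \<noteq> 0" by auto
    then show ?thesis using poly_roots_finite[of p] p by simp
  qed
  have "finite (\<Union>j\<in>{1..m}. {t. corner_minor n j (xt t) = 0})" using fin by blast
  \<comment> \<open>The ball contains the images of infinitely many real numbers, so it is not
    exhausted by the finitely many roots.\<close>
  moreover have "infinite {t::'f. norm t < \<delta>}"
  proof -
    have "infinite (of_real ` {0<..<\<delta>} :: 'f set)"
      using \<delta> by (subst finite_image_iff) (auto simp: inj_on_def infinite_Ioo)
    then show ?thesis by (rule contrapos_nn) (rule finite_subset, auto)
  qed
  ultimately obtain t where t: "norm t < \<delta>" "t \<notin> (\<Union>j\<in>{1..m}. {t. corner_minor n j (xt t) = 0})"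
    by (metis (mono_tags, lifting) finite_subset mem_Collect_eq subsetI)
  then have reg: "regular (xt t)" by (auto simp: regular_def)
  have "orbit_dim n s \<gamma> x \<le> orbit_dim n s \<gamma> (xt t)"
  proof -
    have "(\<lambda>a b. (1 - t) * tang x a b + t * tang z a b) ` \<B> = tang (xt t) ` \<B>"
      by (rule image_cong[OF refl]) (rule tang[symmetric])
    then show ?thesis using le[OF t(1)] unfolding orbit_dim_def by simp
  qed
  with orbit_dim_regular[OF reg] show ?thesis by simp
qed

text \<open>At an antidiagonal Y the tangent vectors can be listed. Coordinate vectors off the
  antidiagonal are multiples of tangent vectors; the antidiagonal elements at the pivots produce the
  directions \<open>P q\<close> with q \<le> s', and these \<open>P q\<close> produce the pivot
  entries modulo other antidiagonal entries. No more coordinates remain than there are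
  expressions.\<close>

lemma orbit_dim_antidiag_point:
  "card \<B> \<le> orbit_dim n s \<gamma> (antidiag_point n s 1) + card L"
proof -
  define z where "z = antidiag_point n s (1::'f)"
  define \<zeta> where "\<zeta> i = z (E (Suc i) (n - i))" for i
  define Y where "Y = mat n n (\<lambda>(i, j). if i < j \<and> i + j + 1 = n then \<zeta> i else 0)"
  have \<zeta>0: "\<zeta> i \<noteq> 0" if "2 * i + 1 < n" for i
    using that by (auto simp: \<zeta>_def z_def antidiag_point_def)
  have Yc: "Y \<in> carrier_mat n n" by (simp add: Y_def)
  have Yi: "Y $$ (i, j) = (if i < j \<and> i + j + 1 = n then \<zeta> i else 0)" if "i < n" "j < n" for i j
    using that by (simp add: Y_def)
  have Y: "lifts n s \<gamma> z Y"
    unfolding lifts_def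
  proof (intro conjI ballI)
    fix a assume "a \<in> \<B>"
    then show "frob n Y (e a) = z a"
    proof (cases rule: basis_idx_cases)
      case (1 i j)
      have "Suc i + Suc j = n + 1 \<Longrightarrow> Suc j = n - i" by simp
      then show ?thesis using 1 frob_basis_E[of i n j Y \<gamma>]
        by (auto simp: Yi \<zeta>_def z_def antidiag_point_def simp del: basis_mat.simps)
    next
      case (2 p)
      then show ?thesis using frob_basis_P[of n Y \<gamma> p]
        by (simp add: Yi z_def antidiag_point_def del: basis_mat.simps)
    qed
  qed (rule Yc)
  have ec: "e a \<in> carrier_mat n n" for a by simp
  have eE: "e (E (Suc i) (Suc j)) $$ (r, c) = (if r = i \<and> c = j then 1 else 0)" if "r < n" "c < n" for i j r c
    using that by simp
  have eP: "e (P p) $$ (r, c) = (if r = c then \<gamma> p (Suc r) else 0)" if "r < n" "c < n" for p r c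
    using that by simp
  note D = orbit_tangent_frob[OF _ _ Y]
  have DE: "(Y * transpose_mat (e (E (Suc i) (Suc j))) - transpose_mat (e (E (Suc i) (Suc j))) * Y) $$ (r, c) =
      (if c = i then Y $$ (r, j) else 0) - (if r = j then Y $$ (i, c) else 0)"
    if "i < n" "j < n" "r < n" "c < n" for i j r c
  proof -
    have "(Y * transpose_mat (e (E (Suc i) (Suc j)))) $$ (r, c) = (\<Sum>l<n. if l = j then (if c = i then Y $$ (r, j) else 0) else 0)"
      using that Yc ec by (subst mult_mat_index[of _ n n _ n]) (simp_all add: if_distrib[of "\<lambda>x. _ * x"] if_distrib[of "\<lambda>x. x * _"] cong: if_cong conj_cong)
    moreover have "(transpose_mat (e (E (Suc i) (Suc j))) * Y) $$ (r, c) = (\<Sum>l<n. if l = i then (if r = j then Y $$ (i, c) else 0) else 0)"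
      using that Yc ec by (subst mult_mat_index[of _ n n _ n]) (simp_all add: if_distrib[of "\<lambda>x. _ * x"] if_distrib[of "\<lambda>x. x * _"] cong: if_cong conj_cong)
    ultimately show ?thesis using that Yc by simp
  qed
  have DP: "(Y * transpose_mat (e (P p)) - transpose_mat (e (P p)) * Y) $$ (r, c) =
      (\<gamma> p (Suc c) - \<gamma> p (Suc r)) * Y $$ (r, c)"
    if "r < n" "c < n" for p r c
  proof -
    have "(Y * transpose_mat (e (P p))) $$ (r, c) = (\<Sum>l<n. if l = c then \<gamma> p (Suc c) * Y $$ (r, c) else 0)"
      using that Yc ec by (subst mult_mat_index[of _ n n _ n]) (simp_all add: if_distrib[of "\<lambda>x. _ * x"] if_distrib[of "\<lambda>x. x * _"] mult.commute cong: if_cong)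
    moreover have "(transpose_mat (e (P p)) * Y) $$ (r, c) = (\<Sum>l<n. if l = r then \<gamma> p (Suc r) * Y $$ (r, c) else 0)"
      using that Yc ec by (subst mult_mat_index[of _ n n _ n]) (simp_all add: if_distrib[of "\<lambda>x. _ * x"] if_distrib[of "\<lambda>x. x * _"] mult.commute cong: if_cong)
    ultimately show ?thesis using that Yc by (simp add: algebra_simps)
  qed
  have tE: "tang z (E (Suc i) (Suc j)) (E (Suc r) (Suc c)) =
      (if c = i then Y $$ (r, j) else 0) - (if r = j then Y $$ (i, c) else 0)"
    if "i < j" "j < n" "r < c" "c < n" for i j r c
  proof -
    have "tang z (E (Suc i) (Suc j)) (E (Suc r) (Suc c)) =
      (Y * transpose_mat (e (E (Suc i) (Suc j))) - transpose_mat (e (E (Suc i) (Suc j))) * Y) $$ (r, c)"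
      using that D[of "E (Suc i) (Suc j)" "E (Suc r) (Suc c)"] frob_basis_E[of r n c _ \<gamma>] by (simp del: basis_mat.simps index_minus_mat)
    then show ?thesis using DE[of i j r c] that by (simp del: basis_mat.simps index_minus_mat)
  qed
  have tEP: "tang z (E (Suc i) (Suc j)) (P p) = (\<gamma> p (Suc i) - \<gamma> p (Suc j)) * Y $$ (i, j)"
    if "i < j" "j < n" "p \<in> {1..s}" for i j p
  proof -
    have "tang z (E (Suc i) (Suc j)) (P p) =
      (\<Sum>r<n. \<gamma> p (Suc r) * (Y * transpose_mat (e (E (Suc i) (Suc j))) - transpose_mat (e (E (Suc i) (Suc j))) * Y) $$ (r, r))"
      using that D[of "E (Suc i) (Suc j)" "P p"] frob_basis_P[of n _ \<gamma> p] by (simp del: basis_mat.simps index_minus_mat)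
    also have "\<dots> = (\<Sum>r<n. (if r = i then \<gamma> p (Suc r) * Y $$ (r, j) else 0) - (if r = j then \<gamma> p (Suc r) * Y $$ (i, r) else 0))"
    proof (intro sum.cong refl)
      fix r assume "r \<in> {..<n}"
      then have r: "r < n" by simp
      have ij: "i < n" "j < n" using that by auto
      show "\<gamma> p (Suc r) * (Y * transpose_mat (e (E (Suc i) (Suc j))) - transpose_mat (e (E (Suc i) (Suc j))) * Y) $$ (r, r) =
          (if r = i then \<gamma> p (Suc r) * Y $$ (r, j) else 0) - (if r = j then \<gamma> p (Suc r) * Y $$ (i, r) else 0)"
        unfolding DE[OF ij r r] by (simp add: right_diff_distrib)
    qed
    also have "\<dots> = (\<gamma> p (Suc i) - \<gamma> p (Suc j)) * Y $$ (i, j)"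
      using that by (simp add: sum_subtractf algebra_simps)
    finally show ?thesis .
  qed
  have tP: "tang z (P q) (E (Suc r) (Suc c)) = (\<gamma> q (Suc c) - \<gamma> q (Suc r)) * Y $$ (r, c)"
    if "q \<in> {1..s}" "r < c" "c < n" for q r c
  proof -
    have "tang z (P q) (E (Suc r) (Suc c)) = (Y * transpose_mat (e (P q)) - transpose_mat (e (P q)) * Y) $$ (r, c)"
      using that D[of "P q" "E (Suc r) (Suc c)"] frob_basis_E[of r n c _ \<gamma>] by (simp del: basis_mat.simps index_minus_mat)
    then show ?thesis using DP[of r c q] that by (simp del: basis_mat.simps index_minus_mat)
  qed
  have tPP: "tang z (P q) (P p) = 0" if "q \<in> {1..s}" "p \<in> {1..s}" for q p
  proof -
    have "tang z (P q) (P p) = (\<Sum>r<n. \<gamma> p (Suc r) * (Y * transpose_mat (e (P q)) - transpose_mat (e (P q)) * Y) $$ (r, r))"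
      using that D[of "P q" "P p"] frob_basis_P[of n _ \<gamma> p] by (simp del: basis_mat.simps index_minus_mat)
    also have "\<dots> = 0" using DP by (intro sum.neutral) (auto simp del: basis_mat.simps index_minus_mat)
    finally show ?thesis .
  qed
  define u :: "lidx \<Rightarrow> lidx \<Rightarrow> 'f" where "u i = (\<lambda>b. if b = i then 1 else 0)" for i
  \<comment> \<open>The coordinates not reached: antidiagonal positions that are not pivots, and the
    \<open>P p\<close> with p > s'.\<close>
  define I' where "I' = (\<lambda>j. E j (n - j + 1)) ` Jset \<union> P ` {s' + 1..s}"
  define S where "S = fun_vs.span (tang z ` \<B> \<union> u ` I')"
  have S_tang: "a \<in> \<B> \<Longrightarrow> tang z a \<in> S" and S_u: "a \<in> I' \<Longrightarrow> u a \<in> S" for a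
    unfolding S_def by (auto intro!: fun_vs.span_base)
  have from_tang: "u b \<in> S" if "a \<in> \<B>" "c \<noteq> 0" "\<And>b'. b' \<in> \<B> \<Longrightarrow> tang z a b' = c * u b b'" "b \<in> \<B>" for a b c
  proof -
    have "u b = (\<lambda>b'. inverse c * tang z a b')"
    proof
      fix b'
      show "u b b' = inverse c * tang z a b'"
        using that by (cases "b' \<in> \<B>") (auto simp: u_def)
    qed
    also have "\<dots> \<in> S" unfolding S_def by (rule fun_vs.span_scale) (use S_tang[OF that(1)] in \<open>simp add: S_def\<close>)
    finally show ?thesis .
  qed
  \<comment> \<open>The tangent vector of a basis element has two candidate entries. With the
    element chosen according to the side of the antidiagonal, one of them falls below the diagonal
    and only the desired coordinate remains.\<close>
  have uE_off: "u (E (Suc r) (Suc c)) \<in> S" if rc: "r < c" "c < n" "r + c + 1 \<noteq> n" for r c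
  proof (cases "r + c + 1 < n")
    case True
    have 1: "c < n - 1 - r" "n - 1 - r < n" using True by auto
    show ?thesis
    proof (rule from_tang[of "E (Suc c) (Suc (n - 1 - r))" "\<zeta> r"])
      fix b' assume "b' \<in> \<B>"
      then show "tang z (E (Suc c) (Suc (n - 1 - r))) b' = \<zeta> r * u (E (Suc r) (Suc c)) b'"
      proof (cases rule: basis_idx_cases)
        case (1 i j)
        then show ?thesis using tE[of c "n - 1 - r" i j] True rc by (auto simp: Yi u_def)
      next
        case (2 p)
        then show ?thesis using tEP[of c "n - 1 - r" p] True rc by (auto simp: Yi u_def)
      qed
    qed (use True rc \<zeta>0 in auto)
  next
    case False
    have 1: "n - 1 - c < r" using False rc by auto
    show ?thesis
    proof (rule from_tang[of "E (Suc (n - 1 - c)) (Suc r)" "- \<zeta> (n - 1 - c)"])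
      fix b' assume "b' \<in> \<B>"
      then show "tang z (E (Suc (n - 1 - c)) (Suc r)) b' = - \<zeta> (n - 1 - c) * u (E (Suc r) (Suc c)) b'"
      proof (cases rule: basis_idx_cases)
        case (1 i j)
        then show ?thesis using tE[of "n - 1 - c" r i j] False rc by (auto simp: Yi u_def)
      next
        case (2 p)
        then show ?thesis using tEP[of "n - 1 - c" r p] False rc by (auto simp: Yi u_def)
      qed
    qed (use False rc \<zeta>0 in auto)
  qed
  \<comment> \<open>At a pivot position on the antidiagonal the \<open>E\<close> components cancel.
    The component at \<open>P p\<close> is a difference of entries of \<gamma>, which the reduced
    form makes zero except for p = q.\<close>
  have uP: "u (P q) \<in> S" if q: "q \<in> {1..s'}" for q
  proof (rule from_tang[of "E (k q) (n - k q + 1)" "- \<zeta> (k q - 1)"])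
    have kq: "k q \<in> {1..m}" using k_range[OF q] .
    define i where "i = k q - 1"
    have i: "k q = Suc i" "n - k q + 1 = Suc (n - 1 - i)" "2 * i + 1 < n" using kq by (auto simp: i_def)
    show "E (k q) (n - k q + 1) \<in> \<B>" unfolding E_in_basis_idx using i by auto
    show "- \<zeta> (k q - 1) \<noteq> 0" using \<zeta>0[OF i(3)] i by simp
    show "P q \<in> \<B>" using q s'_le by simp
    fix b' assume "b' \<in> \<B>"
    then show "tang z (E (k q) (n - k q + 1)) b' = - \<zeta> (k q - 1) * u (P q) b'"
    proof (cases rule: basis_idx_cases)
      case (1 r c)
      have "tang z (E (Suc i) (Suc (n - 1 - i))) b' = 0"
        unfolding 1 using tE[of i "n - 1 - i" r c] 1 i(3) by (auto simp: Yi)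
      then show ?thesis unfolding i using 1 by (simp add: u_def)
    next
      case (2 p)
      have "tang z (E (Suc i) (Suc (n - 1 - i))) (P p) = (\<gamma> p (Suc i) - \<gamma> p (Suc (n - 1 - i))) * \<zeta> i"
        using tEP[of i "n - 1 - i" p] 2 i(3) by (auto simp: Yi)
      then have "tang z (E (k q) (n - k q + 1)) (P p) = (\<gamma> p (k q) - \<gamma> p (n - k q + 1)) * \<zeta> i"
        unfolding i(1)[symmetric] i(2)[symmetric] .
      moreover have "\<gamma> p (k q) - \<gamma> p (n - k q + 1) = - u (P q) (P p)"
      proof (cases "p = q")
        case True
        then show ?thesis using \<gamma>_pivot[OF q] by (simp add: u_def algebra_simps)
      next
        case False
        then show ?thesis using \<gamma>_other[OF q 2(1) False] by (simp add: u_def)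
      qed
      ultimately have "tang z (E (k q) (n - k q + 1)) (P p) = - u (P q) (P p) * \<zeta> i" by simp
      then show ?thesis unfolding 2(2) i_def[symmetric] by (simp only: mult_minus_left mult_minus_right mult.commute)
    qed
  qed
  \<comment> \<open>The tangent vector of \<open>P q\<close> is supported on the antidiagonal. Among
    the pivots only k_q contributes, with coefficient 1 times a nonzero entry, and the other
    contributions lie at positions in \<open>I'\<close>.\<close>
  have uk: "u (E (k q) (n - k q + 1)) \<in> S" if q: "q \<in> {1..s'}" for q
  proof -
    have kq: "k q \<in> {1..m}" using k_range[OF q] .
    have qs: "q \<in> {1..s}" using q s'_le by auto
    have nz: "\<zeta> (k q - 1) \<noteq> 0" 
    proof (rule \<zeta>0)
      have "1 \<le> k q" "2 * k q \<le> n" using kq by auto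
      then show "2 * (k q - 1) + 1 < n" by linarith
    qed
    let ?g = "\<lambda>j. (\<gamma> q (n - j + 1) - \<gamma> q j) * \<zeta> (j - 1)"
    have t: "tang z (P q) b = (\<Sum>j=1..m. ?g j * u (E j (n - j + 1)) b)" for b
    proof (cases "b \<in> \<B>")
      case True
      then show ?thesis
      proof (cases rule: basis_idx_cases)
        case (1 r c)
        show ?thesis
        proof (cases "r + c + 1 = n")
          case True
          then have "(\<Sum>j=1..m. ?g j * u (E j (n - j + 1)) b) = (\<Sum>j=1..m. if j = Suc r then ?g j else 0)"
            unfolding 1 using 1 by (intro sum.cong) (auto simp: u_def)
          also have "\<dots> = ?g (Suc r)" using True 1 by auto
          also have "n - Suc r + 1 = Suc c" using True by auto
          finally show ?thesis unfolding 1 using tP[OF qs 1(1,2)] True 1 by (simp add: Yi)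
        next
          case False
          then have "(\<Sum>j=1..m. ?g j * u (E j (n - j + 1)) b) = 0"
            unfolding 1 by (intro sum.neutral) (auto simp: u_def)
          then show ?thesis unfolding 1 using tP[OF qs 1(1,2)] False 1 by (simp add: Yi)
        qed
      next
        case (2 p)
        then show ?thesis using tPP[OF qs] by (auto simp: u_def)
      qed
    next
      case False
      have "(\<Sum>j=1..m. ?g j * u (E j (n - j + 1)) b) = 0"
        using False by (intro sum.neutral) (auto simp: u_def)
      then show ?thesis using False by simp
    qed
    have tq: "tang z (P q) b = ?g (k q) * u (E (k q) (n - k q + 1)) b + (\<Sum>j\<in>Jset. ?g j * u (E j (n - j + 1)) b)" for b
    proof -
      have kk: "k ` {1..s'} \<subseteq> {1..m}" using k_range by blast
      have "tang z (P q) b = (\<Sum>j\<in>Jset. ?g j * u (E j (n - j + 1)) b) + (\<Sum>j\<in>k ` {1..s'}. ?g j * u (E j (n - j + 1)) b)"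
        unfolding t using kk by (intro sum.subset_diff) auto
      also have "(\<Sum>j\<in>k ` {1..s'}. ?g j * u (E j (n - j + 1)) b) =
          (\<Sum>q'=1..s'. if q' = q then ?g (k q) * u (E (k q) (n - k q + 1)) b else 0)"
        unfolding sum.reindex[OF k_inj] o_def
      proof (intro sum.cong refl)
        fix q' assume q': "q' \<in> {1..s'}"
        show "?g (k q') * u (E (k q') (n - k q' + 1)) b = (if q' = q then ?g (k q) * u (E (k q) (n - k q + 1)) b else 0)"
          using \<gamma>_other[OF q' qs] by (cases "q' = q") auto
      qed
      also have "\<dots> = ?g (k q) * u (E (k q) (n - k q + 1)) b" using q by simp
      finally show ?thesis by (simp only: add.commute)
    qed
    have gk: "?g (k q) = \<zeta> (k q - 1)" unfolding \<gamma>_pivot[OF q] by simp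
    have *: "tang z (P q) b = \<zeta> (k q - 1) * u (E (k q) (n - k q + 1)) b + (\<Sum>j\<in>Jset. ?g j * u (E j (n - j + 1)) b)" for b
      using tq[of b] unfolding gk .
    have "u (E (k q) (n - k q + 1)) =
        (\<lambda>b. inverse (\<zeta> (k q - 1)) * (tang z (P q) - (\<Sum>j\<in>Jset. (\<lambda>b. ?g j * u (E j (n - j + 1)) b))) b)"
      unfolding sum_scaled_fun using nz * by (simp add: fun_eq_iff)
    also have "\<dots> \<in> S"
      unfolding S_def
    proof (rule fun_vs.span_scale, rule fun_vs.span_diff)
      show "tang z (P q) \<in> fun_vs.span (tang z ` \<B> \<union> u ` I')" using S_tang[of "P q"] qs by (simp add: S_def)
      show "(\<Sum>j\<in>Jset. (\<lambda>b. ?g j * u (E j (n - j + 1)) b)) \<in> fun_vs.span (tang z ` \<B> \<union> u ` I')"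
        by (intro fun_vs.span_sum fun_vs.span_scale) (use S_u in \<open>auto simp: S_def I'_def\<close>)
    qed
    finally show ?thesis .
  qed
  have "u i \<in> S" if "i \<in> \<B>" for i
    using that
  proof (cases rule: basis_idx_cases)
    case (1 r c)
    show ?thesis
    proof (cases "r + c + 1 = n")
      case False
      then show ?thesis unfolding 1 using uE_off 1 by blast
    next
      case True
      then have j: "Suc r \<in> {1..m}" "Suc c = n - Suc r + 1" using 1 by auto
      show ?thesis
      proof (cases "Suc r \<in> k ` {1..s'}")
        case True
        then obtain q where "q \<in> {1..s'}" "Suc r = k q" by auto
        then show ?thesis using uk[of q] unfolding 1 j by simp
      next
        case False
        then have "i \<in> I'" unfolding 1 j I'_def using j by blast
        then show ?thesis by (rule S_u)
      qed
    qed
  next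
    case (2 p)
    show ?thesis
    proof (cases "p \<le> s'")
      case True
      then show ?thesis unfolding 2 using uP 2 by auto
    next
      case False
      then have "i \<in> I'" unfolding 2 I'_def using 2 by auto
      then show ?thesis by (rule S_u)
    qed
  qed
  then have "card \<B> \<le> fun_vs.dim (tang z ` \<B>) + card I'"
    by (intro card_le_dim_add_card) (auto simp: S_def u_def I'_def)
  also have "card I' \<le> card L"
  proof -
    have "card I' \<le> card ((\<lambda>j. E j (n - j + 1)) ` Jset) + card (P ` {s' + 1..s})"
      unfolding I'_def by (rule card_Un_le)
    also have "\<dots> \<le> card Jset + card {s' + 1..s}" by (intro add_mono card_image_le) auto
    finally show ?thesis by (simp add: expr_set_def card_Plus)
  qed
  finally show ?thesis unfolding orbit_dim_def z_def by simp
qed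

lemma card_L_eq: "card L = card \<B> - coAd_rank n s \<gamma>"
proof -
  let ?O = "orbit_dim n s \<gamma> ` (\<Pi>\<^sub>E a\<in>\<B>. UNIV)"
  have le: "r + card L \<le> card \<B>" if "r \<in> ?O" for r using that orbit_dim_le by auto
  have z: "orbit_dim n s \<gamma> (antidiag_point n s 1) \<in> ?O"
    by (intro imageI) (auto simp: antidiag_point_def)
  have "?O \<subseteq> {..card \<B>}"
  proof
    fix r assume "r \<in> ?O"
    from le[OF this] show "r \<in> {..card \<B>}" unfolding atMost_iff by linarith
  qed
  then have fin: "finite ?O" by (rule finite_subset) simp
  have "coAd_rank n s \<gamma> \<in> ?O" unfolding coAd_rank_def using fin z by (intro Max_in) auto
  moreover have "orbit_dim n s \<gamma> (antidiag_point n s 1) \<le> coAd_rank n s \<gamma>"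
    unfolding coAd_rank_def using fin z by (intro Max_ge)
  ultimately show ?thesis using le[of "coAd_rank n s \<gamma>"] orbit_dim_antidiag_point by linarith
qed

end

section \<open>Smooth functions on the dual space\<close>

lemma continuous_map_euclidean_iff:
  "continuous_map X euclidean F \<longleftrightarrow> (\<forall>x\<in>topspace X. (F \<longlongrightarrow> F x) (atin X x))"
  by (simp add: continuous_map_atin)

lemma topspace_dual_top: "topspace (dual_top n s) = (\<Pi>\<^sub>E a\<in>basis_idx n s. UNIV)"
  by (simp add: dual_top_def)

lemma eventually_slice:
  fixes \<Omega> :: "(lidx \<Rightarrow> 'f::topological_space) set"
  assumes \<Omega>: "openin (dual_top n s) \<Omega>" and x: "x \<in> \<Omega>" and a: "a \<in> basis_idx n s"
  shows "\<forall>\<^sub>F t in nhds (x a). x(a := t) \<in> \<Omega>"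
proof -
  have xe: "x \<in> extensional (basis_idx n s)"
    using openin_subset[OF \<Omega>] x by (auto simp: topspace_dual_top PiE_def)
  have "continuous_map euclidean (dual_top n s) (\<lambda>t. x(a := t))"
    unfolding dual_top_def continuous_map_componentwise
  proof (intro conjI ballI)
    fix b assume "b \<in> basis_idx n s"
    show "continuous_map euclidean euclidean (\<lambda>t. (x(a := t)) b)" by (cases "b = a") auto
  qed (use xe a in \<open>auto simp: extensional_def\<close>)
  from openin_continuous_map_preimage[OF this \<Omega>]
  have "open {t. x(a := t) \<in> \<Omega>}" by simp
  moreover have "x a \<in> {t. x(a := t) \<in> \<Omega>}" using x by simp
  ultimately show ?thesis using eventually_nhds by blast
qed

locale dual_open =
  fixes n s :: nat and \<Omega> :: "(lidx \<Rightarrow> 'f::real_normed_field) set"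
  assumes open_\<Omega>: "openin (dual_top n s) \<Omega>"
begin

text \<open>A partial derivative with an explicit candidate \<open>D\<close>. In contrast to
  \<open>partial\<close>, the candidate can be supplied as a formula that is meaningful on \<Omega>
  only, which suits induction on the order of smoothness.\<close>

definition slice_deriv :: "lidx \<Rightarrow> ((lidx \<Rightarrow> 'f) \<Rightarrow> 'f) \<Rightarrow> ((lidx \<Rightarrow> 'f) \<Rightarrow> 'f) \<Rightarrow> bool" where
  "slice_deriv a F D \<longleftrightarrow> (\<forall>x\<in>\<Omega>. ((\<lambda>t. F (x(a := t))) has_field_derivative D x) (at (x a)))"

lemma slice_derivD: "slice_deriv a F D \<Longrightarrow> x \<in> \<Omega> \<Longrightarrow> ((\<lambda>t. F (x(a := t))) has_field_derivative D x) (at (x a))"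
  by (simp add: slice_deriv_def)

lemma slice_deriv_partial: "slice_deriv a F D \<Longrightarrow> x \<in> \<Omega> \<Longrightarrow> partial a F x = D x"
  unfolding partial_def by (rule DERIV_imp_deriv) (rule slice_derivD)

lemma slice_deriv_cong:
  assumes "slice_deriv a F D" "a \<in> basis_idx n s" "\<And>x. x \<in> \<Omega> \<Longrightarrow> F x = G x"
  shows "slice_deriv a G D"
  unfolding slice_deriv_def
proof
  fix x assume x: "x \<in> \<Omega>"
  have "\<forall>\<^sub>F t in nhds (x a). F (x(a := t)) = G (x(a := t))"
    using eventually_slice[OF open_\<Omega> x assms(2)] by eventually_elim (rule assms(3))
  from DERIV_cong_ev[OF refl this refl] slice_derivD[OF assms(1) x]
  show "((\<lambda>t. G (x(a := t))) has_field_derivative D x) (at (x a))" by simp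
qed

abbreviation cont :: "((lidx \<Rightarrow> 'f) \<Rightarrow> 'f) \<Rightarrow> bool" where
  "cont F \<equiv> continuous_map (subtopology (dual_top n s) \<Omega>) euclidean F"

lemma cont_cong: "cont F \<Longrightarrow> (\<And>x. x \<in> \<Omega> \<Longrightarrow> F x = G x) \<Longrightarrow> cont G"
  by (erule continuous_map_eq) auto

text \<open>As \<Omega> is open, functions agreeing on \<Omega> agree along short slices and so have
  the same partial derivatives there.\<close>

lemma Ck_on_cong_imp:
  "Ck_on n s m \<Omega> F \<Longrightarrow> (\<And>x. x \<in> \<Omega> \<Longrightarrow> F x = G x) \<Longrightarrow> Ck_on n s m \<Omega> G"
proof (induction m arbitrary: F G)
  case 0
  then show ?case using cont_cong by simp
next
  case (Suc m)
  have 1: "slice_deriv a G (partial a F)" if a: "a \<in> basis_idx n s" for a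
  proof (rule slice_deriv_cong[OF _ a Suc.prems(2)])
    have "\<forall>x\<in>\<Omega>. (\<lambda>t. F (x(a := t))) field_differentiable at (x a)"
      using Suc.prems(1) a by simp
    then show "slice_deriv a F (partial a F)"
      unfolding slice_deriv_def partial_def by (blast intro: field_differentiable_derivI)
  qed
  have 2: "Ck_on n s m \<Omega> (partial a G)" if a: "a \<in> basis_idx n s" for a
  proof (rule Suc.IH)
    show "Ck_on n s m \<Omega> (partial a F)" using Suc.prems(1) a by simp
  qed (rule slice_deriv_partial[OF 1[OF a], symmetric])
  have 3: "cont G" by (rule cont_cong[of F]) (use Suc.prems in auto)
  have "(\<lambda>t. G (x(a := t))) field_differentiable at (x a)" if "a \<in> basis_idx n s" "x \<in> \<Omega>" for a x
    using slice_derivD[OF 1[OF that(1)] that(2)] by (auto simp: field_differentiable_def)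
  then show ?case using 2 3 by simp
qed

lemma Ck_on_Suc_iff:
  "Ck_on n s (Suc m) \<Omega> F \<longleftrightarrow> cont F \<and> (\<forall>a\<in>basis_idx n s. \<exists>D. slice_deriv a F D \<and> Ck_on n s m \<Omega> D)" (is "?L \<longleftrightarrow> ?R")
proof
  assume ?L
  show ?R
  proof (intro conjI ballI exI)
    fix a assume a: "a \<in> basis_idx n s"
    have "\<forall>x\<in>\<Omega>. (\<lambda>t. F (x(a := t))) field_differentiable at (x a)"
      using \<open>?L\<close> a by simp
    then show "slice_deriv a F (partial a F)"
      unfolding slice_deriv_def partial_def by (blast intro: field_differentiable_derivI)
    show "Ck_on n s m \<Omega> (partial a F)" using \<open>?L\<close> a by simp
  qed (use \<open>?L\<close> in simp)
next
  assume R: ?R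
  have "(\<forall>x\<in>\<Omega>. (\<lambda>t. F (x(a := t))) field_differentiable at (x a)) \<and> Ck_on n s m \<Omega> (partial a F)"
    if "a \<in> basis_idx n s" for a
  proof -
    from R that obtain D where D: "slice_deriv a F D" "Ck_on n s m \<Omega> D" by blast
    have "Ck_on n s m \<Omega> (partial a F)"
      by (rule Ck_on_cong_imp[OF D(2)]) (simp add: slice_deriv_partial[OF D(1)])
    then show ?thesis using D(1) by (auto simp: slice_deriv_def field_differentiable_def)
  qed
  then show ?L using R by simp
qed

lemma Ck_on_cont: "Ck_on n s m \<Omega> F \<Longrightarrow> cont F"
  by (cases m) auto

text \<open>The product rule needs this: the derivative of a product again contains the
  undifferentiated factors.\<close>

lemma Ck_on_Suc_imp: "Ck_on n s (Suc m) \<Omega> F \<Longrightarrow> Ck_on n s m \<Omega> F"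
proof (induction m arbitrary: F)
  case (Suc m)
  then show ?case by (subst Ck_on_Suc_iff) (meson Ck_on_Suc_iff)
qed simp

lemma Ck_on_const: "Ck_on n s m \<Omega> (\<lambda>_. c)"
proof (induction m arbitrary: c)
  case (Suc m)
  then show ?case
    by (subst Ck_on_Suc_iff) (auto simp: slice_deriv_def intro!: exI[of _ "\<lambda>_. 0"])
qed simp

lemma cont_coord: "a \<in> basis_idx n s \<Longrightarrow> cont (\<lambda>x. x a)"
  unfolding dual_top_def by (intro continuous_map_from_subtopology continuous_map_product_projection)

lemma Ck_on_coord:
  assumes "a \<in> basis_idx n s"
  shows "Ck_on n s m \<Omega> (\<lambda>x. x a)"
proof (cases m)
  case (Suc l)
  show ?thesis
    unfolding Suc Ck_on_Suc_iff
  proof (intro conjI ballI cont_coord assms)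
    fix b
    have "slice_deriv b (\<lambda>x. x a) (\<lambda>_. if a = b then 1 else 0)" by (auto simp: slice_deriv_def)
    then show "\<exists>D. slice_deriv b (\<lambda>x. x a) D \<and> Ck_on n s l \<Omega> D" using Ck_on_const by blast
  qed
qed (use cont_coord assms in simp)

lemma cont_add: "cont F \<Longrightarrow> cont G \<Longrightarrow> cont (\<lambda>x. F x + G x)"
  and cont_mult: "cont F \<Longrightarrow> cont G \<Longrightarrow> cont (\<lambda>x. F x * G x)"
  unfolding continuous_map_euclidean_iff by (auto intro: tendsto_intros)

lemma cont_inverse:
  assumes "cont F" "\<And>x. x \<in> \<Omega> \<Longrightarrow> F x \<noteq> 0"
  shows "cont (\<lambda>x. inverse (F x))"
  using assms unfolding continuous_map_euclidean_iff by (auto intro!: tendsto_inverse)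

lemma slice_deriv_add:
  "slice_deriv a F D \<Longrightarrow> slice_deriv a G D' \<Longrightarrow> slice_deriv a (\<lambda>x. F x + G x) (\<lambda>x. D x + D' x)"
  by (auto simp: slice_deriv_def intro: DERIV_add)

lemma slice_deriv_mult:
  "slice_deriv a F D \<Longrightarrow> slice_deriv a G D' \<Longrightarrow> slice_deriv a (\<lambda>x. F x * G x) (\<lambda>x. D x * G x + D' x * F x)"
  unfolding slice_deriv_def
proof (intro ballI)
  fix x assume "\<forall>x\<in>\<Omega>. ((\<lambda>t. F (x(a := t))) has_field_derivative D x) (at (x a))"
    "\<forall>x\<in>\<Omega>. ((\<lambda>t. G (x(a := t))) has_field_derivative D' x) (at (x a))" "x \<in> \<Omega>"
  then show "((\<lambda>t. F (x(a := t)) * G (x(a := t))) has_field_derivative D x * G x + D' x * F x) (at (x a))"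
    using DERIV_mult[of "\<lambda>t. F (x(a := t))" "D x" "x a" UNIV "\<lambda>t. G (x(a := t))" "D' x"] by auto
qed

lemma slice_deriv_compose:
  assumes "slice_deriv a F D" "\<And>x. x \<in> \<Omega> \<Longrightarrow> (g has_field_derivative g' x) (at (F x))"
  shows "slice_deriv a (\<lambda>x. g (F x)) (\<lambda>x. g' x * D x)"
  unfolding slice_deriv_def
proof
  fix x assume x: "x \<in> \<Omega>"
  show "((\<lambda>t. g (F (x(a := t)))) has_field_derivative g' x * D x) (at (x a))"
    by (rule DERIV_chain2[OF _ slice_derivD[OF assms(1) x]]) (use assms(2)[OF x] in simp)
qed

lemma Ck_on_add: "Ck_on n s m \<Omega> F \<Longrightarrow> Ck_on n s m \<Omega> G \<Longrightarrow> Ck_on n s m \<Omega> (\<lambda>x. F x + G x)"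
proof (induction m arbitrary: F G)
  case (Suc m)
  show ?case
    unfolding Ck_on_Suc_iff
  proof (intro conjI ballI)
    show "cont (\<lambda>x. F x + G x)" using Suc.prems by (intro cont_add Ck_on_cont)
    fix a assume a: "a \<in> basis_idx n s"
    obtain D D' where D: "slice_deriv a F D" "Ck_on n s m \<Omega> D" "slice_deriv a G D'" "Ck_on n s m \<Omega> D'"
      using Suc.prems a unfolding Ck_on_Suc_iff by blast
    then show "\<exists>D. slice_deriv a (\<lambda>x. F x + G x) D \<and> Ck_on n s m \<Omega> D"
      using slice_deriv_add Suc.IH by blast
  qed
qed (simp add: cont_add)

lemma Ck_on_mult: "Ck_on n s m \<Omega> F \<Longrightarrow> Ck_on n s m \<Omega> G \<Longrightarrow> Ck_on n s m \<Omega> (\<lambda>x. F x * G x)"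
proof (induction m arbitrary: F G)
  case (Suc m)
  show ?case
    unfolding Ck_on_Suc_iff
  proof (intro conjI ballI)
    show "cont (\<lambda>x. F x * G x)" using Suc.prems by (intro cont_mult Ck_on_cont)
    fix a assume a: "a \<in> basis_idx n s"
    obtain D D' where D: "slice_deriv a F D" "Ck_on n s m \<Omega> D" "slice_deriv a G D'" "Ck_on n s m \<Omega> D'"
      using Suc.prems a unfolding Ck_on_Suc_iff by blast
    have "Ck_on n s m \<Omega> (\<lambda>x. D x * G x + D' x * F x)"
      using D Suc.prems Ck_on_Suc_imp by (intro Ck_on_add Suc.IH)
    then show "\<exists>D. slice_deriv a (\<lambda>x. F x * G x) D \<and> Ck_on n s m \<Omega> D"
      using slice_deriv_mult[OF D(1,3)] by blast
  qed
qed (simp add: cont_mult)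

lemma Ck_on_inverse:
  "Ck_on n s m \<Omega> F \<Longrightarrow> (\<And>x. x \<in> \<Omega> \<Longrightarrow> F x \<noteq> 0) \<Longrightarrow> Ck_on n s m \<Omega> (\<lambda>x. inverse (F x))"
proof (induction m)
  case (Suc m)
  have IH: "Ck_on n s m \<Omega> (\<lambda>x. inverse (F x))" using Suc.IH Ck_on_Suc_imp[OF Suc.prems(1)] Suc.prems(2) .
  show ?case
    unfolding Ck_on_Suc_iff
  proof (intro conjI ballI)
    show "cont (\<lambda>x. inverse (F x))" using Suc.prems by (intro cont_inverse Ck_on_cont)
    fix a assume a: "a \<in> basis_idx n s"
    obtain D where D: "slice_deriv a F D" "Ck_on n s m \<Omega> D"
      using Suc.prems a unfolding Ck_on_Suc_iff by blast
    have "slice_deriv a (\<lambda>x. inverse (F x)) (\<lambda>x. - 1 * (inverse (F x) * inverse (F x)) * D x)"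
      using Suc.prems(2) by (intro slice_deriv_compose[OF D(1)])
        (auto intro!: derivative_eq_intros simp: power2_eq_square divide_inverse)
    moreover have "Ck_on n s m \<Omega> (\<lambda>x. - 1 * (inverse (F x) * inverse (F x)) * D x)"
      by (intro Ck_on_mult Ck_on_const IH D)
    ultimately show "\<exists>D. slice_deriv a (\<lambda>x. inverse (F x)) D \<and> Ck_on n s m \<Omega> D" by blast
  qed
qed (simp add: cont_inverse)

lemma smooth_const: "smooth_fun n s \<Omega> (\<lambda>_. c)"
  and smooth_coord: "a \<in> basis_idx n s \<Longrightarrow> smooth_fun n s \<Omega> (\<lambda>x. x a)"
  and smooth_add: "smooth_fun n s \<Omega> F \<Longrightarrow> smooth_fun n s \<Omega> G \<Longrightarrow> smooth_fun n s \<Omega> (\<lambda>x. F x + G x)"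
  and smooth_mult: "smooth_fun n s \<Omega> F \<Longrightarrow> smooth_fun n s \<Omega> G \<Longrightarrow> smooth_fun n s \<Omega> (\<lambda>x. F x * G x)"
  and smooth_inverse: "smooth_fun n s \<Omega> F \<Longrightarrow> (\<And>x. x \<in> \<Omega> \<Longrightarrow> F x \<noteq> 0) \<Longrightarrow> smooth_fun n s \<Omega> (\<lambda>x. inverse (F x))"
  unfolding smooth_fun_def
  by (blast intro: Ck_on_const Ck_on_coord Ck_on_add Ck_on_mult Ck_on_inverse)+

lemma smooth_cont: "smooth_fun n s \<Omega> F \<Longrightarrow> cont F"
  unfolding smooth_fun_def using Ck_on_cont by blast

lemma smooth_slice:
  assumes "smooth_fun n s \<Omega> F" "a \<in> basis_idx n s"
  shows "slice_deriv a F (partial a F)" "smooth_fun n s \<Omega> (partial a F)"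
proof -
  have *: "Ck_on n s (Suc m) \<Omega> F" for m using assms(1) unfolding smooth_fun_def by blast
  show "slice_deriv a F (partial a F)"
  proof -
    have "\<forall>x\<in>\<Omega>. (\<lambda>t. F (x(a := t))) field_differentiable at (x a)"
      using *[of 0] assms(2) by simp
    then show ?thesis unfolding slice_deriv_def partial_def by (blast intro: field_differentiable_derivI)
  qed
  show "smooth_fun n s \<Omega> (partial a F)"
    unfolding smooth_fun_def using * assms(2) by simp
qed

lemma smooth_sum: "(\<And>i. i \<in> A \<Longrightarrow> smooth_fun n s \<Omega> (F i)) \<Longrightarrow> smooth_fun n s \<Omega> (\<lambda>x. \<Sum>i\<in>A. F i x)"
  by (induction A rule: infinite_finite_induct) (auto intro: smooth_const smooth_add)

lemma smooth_prod: "(\<And>i. i \<in> A \<Longrightarrow> smooth_fun n s \<Omega> (F i)) \<Longrightarrow> smooth_fun n s \<Omega> (\<lambda>x. \<Prod>i\<in>A. F i x)"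
  by (induction A rule: infinite_finite_induct) (auto intro: smooth_const smooth_mult)

text \<open>Bootstrapping: if every partial derivative of G is G times a smooth function, then G
  gains one order of smoothness at each step. This covers powers, of which only the differential
  equation is known.\<close>

lemma smooth_log_deriv:
  assumes "cont G" "\<And>a. a \<in> basis_idx n s \<Longrightarrow> slice_deriv a G (\<lambda>x. G x * H a x)"
    and "\<And>a. a \<in> basis_idx n s \<Longrightarrow> smooth_fun n s \<Omega> (H a)"
  shows "smooth_fun n s \<Omega> G"
  unfolding smooth_fun_def
proof
  fix m show "Ck_on n s m \<Omega> G"
  proof (induction m)
    case (Suc m)
    have "Ck_on n s m \<Omega> (\<lambda>x. G x * H a x)" if "a \<in> basis_idx n s" for a
      using Suc assms(3)[OF that] by (intro Ck_on_mult) (auto simp: smooth_fun_def)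
    then show ?case unfolding Ck_on_Suc_iff using assms(1,2) by blast
  qed (use assms in simp)
qed

lemma smooth_det_eval:
  assumes M: "M \<in> carrier_mat N N"
    and ix: "\<And>r c a. r < N \<Longrightarrow> c < N \<Longrightarrow> M $$ (r, c) = Some a \<Longrightarrow> a \<in> basis_idx n s"
  shows "smooth_fun n s \<Omega> (\<lambda>x. det (eval_mat x M))"
proof -
  have entry: "smooth_fun n s \<Omega> (\<lambda>x. eval_mat x M $$ (r, c))" if "r < N" "c < N" for r c
    using that M ix[OF that] by (cases "M $$ (r, c)") (auto simp: eval_mat_def intro: smooth_const smooth_coord)
  have "smooth_fun n s \<Omega> (\<lambda>x. \<Sum>p | p permutes {0..<N}. signof p * (\<Prod>i = 0..<N. eval_mat x M $$ (i, p i)))"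
    by (intro smooth_sum smooth_mult smooth_const smooth_prod entry) (auto simp: permutes_in_image)
  moreover have det: "det (eval_mat x M) = (\<Sum>p | p permutes {0..<N}. signof p * (\<Prod>i = 0..<N. eval_mat x M $$ (i, p i)))" for x
    using M by (intro det_def') (simp add: eval_mat_def)
  ultimately show ?thesis unfolding det by blast
qed

end

section \<open>The invariants as functions\<close>

lemma corner_mat_upd:
  assumes jn: "2 * j \<le> n" and rc: "r < j" "c < j"
  shows "corner_mat n j (x(a := t)) $$ (r, c) = (if a = E (Suc r) (Suc (n - j + c)) then t else corner_mat n j x $$ (r, c))"
  using assms by (auto simp: corner_mat_index)

text \<open>Laplace expansion along row i shows that the minor is affine in the entry, with the
  cofactor as slope; the derivative is therefore the same at every \<open>t0\<close>. Outside the
  corner both sides vanish.\<close>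

lemma corner_minor_deriv_E:
  fixes x :: "lidx \<Rightarrow> 'f::real_normed_field"
  assumes jn: "2 * j \<le> n" and nz: "corner_minor n j x \<noteq> 0" and il: "i < l" "l < n"
  shows "((\<lambda>t. corner_minor n j (x(E (Suc i) (Suc l) := t))) has_field_derivative
    corner_minor n j x * corner_inv_mat n j x $$ (l, i)) (at t0)"
proof (cases "i < j \<and> n - j \<le> l")
  case True
  define c0 where "c0 = l - (n - j)"
  have c0: "c0 < j" "l = n - j + c0" using True il jn by (auto simp: c0_def)
  let ?A = "corner_mat n j x" and ?At = "\<lambda>t. corner_mat n j (x(E (Suc i) (Suc l) := t))"
  have car: "corner_mat n j y \<in> carrier_mat j j" for y :: "lidx \<Rightarrow> 'f" using jn by simp
  have cof: "cofactor (?At t) i c = cofactor ?A i c" if "c < j" for t c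
  proof -
    have "mat_delete (?At t) i c = mat_delete ?A i c"
    proof (rule eq_matI)
      fix r c' assume "r < dim_row (mat_delete ?A i c)" "c' < dim_col (mat_delete ?A i c)"
      then have rc: "r < j - 1" "c' < j - 1" using carrier_matD[OF car[of x]] by auto
      show "mat_delete (?At t) i c $$ (r, c') = mat_delete ?A i c $$ (r, c')"
        using rc carrier_matD[OF car[of x]] carrier_matD[OF car[of "x(E (Suc i) (Suc l) := t)"]]
        by (auto simp: mat_delete_def corner_mat_upd[OF jn] simp del: fun_upd_apply)
    qed (use carrier_matD[OF car] in auto)
    then show ?thesis by (simp add: cofactor_def)
  qed
  have det: "corner_minor n j (x(E (Suc i) (Suc l) := t)) = (\<Sum>c<j. (if c = c0 then t else ?A $$ (i, c)) * cofactor ?A i c)" for t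
  proof -
    have "det (?At t) = (\<Sum>c<j. ?At t $$ (i, c) * cofactor (?At t) i c)"
      using True by (intro laplace_expansion_row[OF car]) auto
    also have "\<dots> = (\<Sum>c<j. (if c = c0 then t else ?A $$ (i, c)) * cofactor ?A i c)"
    proof (intro sum.cong refl arg_cong2[where f="(*)"])
      fix c assume "c \<in> {..<j}"
      then have c: "c < j" by simp
      show "cofactor (?At t) i c = cofactor ?A i c" by (rule cof[OF c])
      show "?At t $$ (i, c) = (if c = c0 then t else ?A $$ (i, c))"
        using True c0(2) by (subst corner_mat_upd[OF jn _ c]) auto
    qed
    finally show ?thesis by (simp add: corner_minor_eq)
  qed
  have "((\<lambda>t. \<Sum>c<j. (if c = c0 then t else ?A $$ (i, c)) * cofactor ?A i c) has_field_derivative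
      (\<Sum>c<j. if c = c0 then cofactor ?A i c else 0)) (at t0)"
    by (intro DERIV_sum) (auto intro!: derivative_eq_intros)
  moreover have "(\<Sum>c<j. if c = c0 then cofactor ?A i c else 0) = corner_minor n j x * corner_inv_mat n j x $$ (l, i)"
    using True c0 il nz by (simp add: corner_inv_mat_def)
  ultimately show ?thesis by (simp add: det)
next
  case False
  have "corner_mat n j (x(E (Suc i) (Suc l) := t)) = corner_mat n j x" for t
  proof (rule eq_matI)
    fix r c assume "r < dim_row (corner_mat n j x)" "c < dim_col (corner_mat n j x)"
    then have rc: "r < j" "c < j" using carrier_matD[OF corner_mat_carrier[of j n x]] jn by auto
    then show "corner_mat n j (x(E (Suc i) (Suc l) := t)) $$ (r, c) = corner_mat n j x $$ (r, c)"
      using False by (auto simp: corner_mat_upd[OF jn] simp del: fun_upd_apply)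
  qed (use carrier_matD[OF corner_mat_carrier[of j n x]] carrier_matD[OF corner_mat_carrier[of j n "x(E (Suc i) (Suc l) := t)"]] jn in auto)
  moreover have "corner_inv_mat n j x $$ (l, i) = 0" using False il by (auto simp: corner_inv_mat_def)
  ultimately show ?thesis by (simp add: corner_minor_eq)
qed

lemma eval_mat_upd_P:
  assumes "M \<in> carrier_mat N N" "\<And>r c q. r < N \<Longrightarrow> c < N \<Longrightarrow> M $$ (r, c) \<noteq> Some (P q)"
  shows "eval_mat (x(P p := t)) M = eval_mat x M"
  unfolding eval_mat_def
proof (rule eq_matI)
  fix r c assume "r < dim_row (map_mat (\<lambda>e. case e of None \<Rightarrow> 0 | Some a \<Rightarrow> x a) M)"
    "c < dim_col (map_mat (\<lambda>e. case e of None \<Rightarrow> 0 | Some a \<Rightarrow> x a) M)"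
  then show "map_mat (\<lambda>e. case e of None \<Rightarrow> 0 | Some a \<Rightarrow> (x(P p := t)) a) M $$ (r, c) =
      map_mat (\<lambda>e. case e of None \<Rightarrow> 0 | Some a \<Rightarrow> x a) M $$ (r, c)"
    using assms(1) assms(2)[of r c p] by (auto split: option.split)
qed auto

lemma corner_minor_upd_P: "j \<le> n \<Longrightarrow> corner_minor n j (x(P p := t)) = corner_minor n j x"
  unfolding corner_minor_def by (subst eval_mat_upd_P[of _ j]) (auto simp: Emat_def)

lemma second_block_carrier: "j \<le> n \<Longrightarrow> second_block n j i \<in> carrier_mat (Suc j) (Suc j)"
  using second_block_dim by blast

lemma second_block_upd_P:
  assumes "j \<le> n"
  shows "eval_mat (x(P p := t)) (second_block n j i) = eval_mat x (second_block n j i)"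
  by (rule eval_mat_upd_P[OF second_block_carrier[OF assms]])
     (use second_block_index[OF assms] in \<open>auto split: if_splits\<close>)

context dual_open
begin

lemma smooth_corner_minor:
  assumes "2 * j \<le> n"
  shows "smooth_fun n s \<Omega> (corner_minor n j)"
proof -
  have "smooth_fun n s \<Omega> (\<lambda>x. det (eval_mat x (Emat 1 j (n - j + 1) n)))"
    by (rule smooth_det_eval[of _ j]) (use assms in \<open>auto simp: Emat_def\<close>)
  then show ?thesis unfolding corner_minor_def .
qed

lemma smooth_det_second_block:
  assumes "2 * j \<le> n" "j < i" "i < n - j + 1"
  shows "smooth_fun n s \<Omega> (\<lambda>x. det (eval_mat x (second_block n j i)))"
proof (rule smooth_det_eval)
  show "second_block n j i \<in> carrier_mat (Suc j) (Suc j)" using assms by (intro second_block_carrier) simp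
  have jn: "j \<le> n" using assms by simp
  fix r c a assume "r < Suc j" "c < Suc j" "second_block n j i $$ (r, c) = Some a"
  then show "a \<in> basis_idx n s"
    using second_block_index[OF jn, of r c i] assms by (auto split: if_splits)
qed

end

section \<open>Symmetrization\<close>

lemma commuting_E:
  fixes \<gamma> :: "nat \<Rightarrow> nat \<Rightarrow> 'f::field"
  assumes "l \<noteq> i" "j \<noteq> r"
  shows "commuting n \<gamma> (E r l) (E i j)"
proof -
  have c: "basis_mat n \<gamma> a \<in> carrier_mat n n" for a by simp
  have 1: "(basis_mat n \<gamma> (E r l) * basis_mat n \<gamma> (E i j)) $$ (x, y) = 0" if "l \<noteq> i" "x < n" "y < n" for r l i j x y
    using that by (subst mult_mat_index[OF c c that(2,3)]) (auto intro!: sum.neutral)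
  have 2: "basis_mat n \<gamma> (E r l) * basis_mat n \<gamma> (E i j) = 0\<^sub>m n n" if "l \<noteq> i" for r l i j
    by (rule eq_matI) (use 1[OF that] in auto)
  show ?thesis unfolding commuting_def lie_bracket_def using 2 assms by simp
qed

lemma term_op_zero: "term_op (\<lambda>_. 0) w = 0"
  by (auto simp: term_op_def fun_eq_iff)

lemma term_op_uminus: "term_op (\<lambda>x. - \<phi> x) w = - term_op \<phi> w"
  by (auto simp: term_op_def fun_eq_iff)

lemma term_op_add: "term_op (\<lambda>x. \<phi> x + \<psi> x) w = term_op \<phi> w + term_op \<psi> w"
  by (auto simp: term_op_def fun_eq_iff)

lemma term_op_diff: "term_op (\<lambda>x. \<phi> x - \<psi> x) w = term_op \<phi> w - term_op \<psi> w"
  by (auto simp: term_op_def fun_eq_iff)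

lemma Sym_term_Nil: "Sym_term \<phi> [] = term_op \<phi> []"
  by (simp add: Sym_term_def)

lemma Sym_term_single: "Sym_term \<phi> [a] = term_op \<phi> [a]"
proof -
  have "{..<length [a]} = {0::nat}" by auto
  then show ?thesis by (simp add: Sym_term_def)
qed

lemma Sym_term_pair:
  "Sym_term \<phi> [a, b] = term_op (\<lambda>x. 1 / 2 * \<phi> x) [a, b] + term_op (\<lambda>x. 1 / 2 * \<phi> x) [b, a]"
proof -
  have l: "{..<length [a, b]} = {0, 1::nat}" by auto
  have s: "{\<sigma>. \<sigma> permutes {0, 1::nat}} = {id, Transposition.transpose 0 1}"
    by (auto simp: permutes_doubleton_iff)
  have ne: "id \<noteq> Transposition.transpose 0 (1::nat)"
    by (metis id_apply transpose_apply_first zero_neq_one)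
  have p: "permute_list (Transposition.transpose 0 1) [a, b] = [b, a]"
    by (simp add: permute_list_def)
  show ?thesis unfolding Sym_term_def l s using ne p by simp
qed

context dual_open
begin

lemma adaptedD:
  assumes "adapted n s \<gamma> \<Omega> J \<phi> w"
  shows "J \<subseteq> basis_idx n s" "set w \<subseteq> basis_idx n s" "smooth_fun n s \<Omega> \<phi>"
    and "\<And>a b. a \<in> J \<Longrightarrow> b \<in> J \<union> set w \<Longrightarrow> commuting n \<gamma> a b"
    and "\<And>x y. x \<in> \<Omega> \<Longrightarrow> y \<in> \<Omega> \<Longrightarrow> (\<And>a. a \<in> J \<Longrightarrow> x a = y a) \<Longrightarrow> \<phi> x = \<phi> y"
  using assms unfolding adapted_def by blast+

lemma adaptedI:
  assumes "J \<subseteq> basis_idx n s" "set w \<subseteq> basis_idx n s" "smooth_fun n s \<Omega> \<phi>"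
    and "\<And>a b. a \<in> J \<Longrightarrow> b \<in> J \<union> set w \<Longrightarrow> commuting n \<gamma> a b"
    and "\<And>x y. x \<in> \<Omega> \<Longrightarrow> y \<in> \<Omega> \<Longrightarrow> (\<And>a. a \<in> J \<Longrightarrow> x a = y a) \<Longrightarrow> \<phi> x = \<phi> y"
  shows "adapted n s \<gamma> \<Omega> J \<phi> w"
  using assms unfolding adapted_def by blast

lemma adapted_mono:
  assumes ad: "adapted n s \<gamma> \<Omega> J \<phi> w" and w': "set w' \<subseteq> set w"
  shows "adapted n s \<gamma> \<Omega> J \<phi> w'"
  by (rule adaptedI) (use adaptedD(1-4)[OF ad] adaptedD(5)[OF ad] w' in blast)+

lemma adapted_mult_const:
  assumes ad: "adapted n s \<gamma> \<Omega> J \<phi> w"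
  shows "adapted n s \<gamma> \<Omega> J (\<lambda>x. c * \<phi> x) w"
proof (rule adaptedI)
  show "smooth_fun n s \<Omega> (\<lambda>x. c * \<phi> x)" by (intro smooth_mult smooth_const adaptedD(3)[OF ad])
  show "c * \<phi> x = c * \<phi> y" if "x \<in> \<Omega>" "y \<in> \<Omega>" "\<And>a. a \<in> J \<Longrightarrow> x a = y a" for x y
    using adaptedD(5)[OF ad that] by simp
qed (use adaptedD(1,2,4)[OF ad] in blast)+

lemma adapted_uminus: "adapted n s \<gamma> \<Omega> J \<phi> w \<Longrightarrow> adapted n s \<gamma> \<Omega> J (\<lambda>x. - \<phi> x) w"
  using adapted_mult_const[of \<gamma> J \<phi> w "-1"] by simp

lemma adapted_mult_coord:
  assumes ad: "adapted n s \<gamma> \<Omega> J \<phi> w" and a: "a \<in> J"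
  shows "adapted n s \<gamma> \<Omega> J (\<lambda>x. \<phi> x * x a) w"
proof (rule adaptedI)
  show "smooth_fun n s \<Omega> (\<lambda>x. \<phi> x * x a)"
    by (intro smooth_mult smooth_coord adaptedD(3)[OF ad]) (use adaptedD(1)[OF ad] a in blast)
  show "\<phi> x * x a = \<phi> y * y a" if "x \<in> \<Omega>" "y \<in> \<Omega>" "\<And>a. a \<in> J \<Longrightarrow> x a = y a" for x y
    using adaptedD(5)[OF ad that] that(3)[OF a] by simp
qed (use adaptedD(1,2,4)[OF ad] in blast)+

text \<open>In each generating relation the coefficient function can be negated, and this gives
  symmetry of \<open>op_eq\<close>.\<close>

lemma null_op_uminus: "null_op n s \<gamma> \<Omega> S \<Longrightarrow> null_op n s \<gamma> \<Omega> (- S)"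
proof (induction rule: null_op.induct)
  case (add S T)
  show ?case unfolding minus_add_distrib by (rule null_op.add[OF add.IH])
next
  case (vanish \<phi> w)
  then show ?case unfolding term_op_uminus[symmetric] by (intro null_op.vanish) simp
next
  case (commutator J \<phi> u a b v)
  have neg: "- (A - B - C) = - A - - B - - C" for A B C :: "'f oper" by (simp add: fun_eq_iff)
  from null_op.commutator[OF adapted_uminus[OF commutator]]
  show ?case unfolding neg term_op_uminus[symmetric] sum_negf[symmetric] by (simp only: mult_minus_right)
next
  case (absorb J \<phi> u v a)
  have neg: "- (A - B) = - A - - B" for A B :: "'f oper" by (simp add: fun_eq_iff)
  from null_op.absorb[OF adapted_uminus[OF absorb(1)] absorb(2)]
  show ?case unfolding neg term_op_uminus[symmetric] by (simp only: mult_minus_left)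
qed (simp only: minus_zero null_op.zero)

lemma op_eq_refl: "op_eq n s \<gamma> \<Omega> S S"
  by (simp add: op_eq_def null_op.zero)

lemma op_eq_sym: "op_eq n s \<gamma> \<Omega> S T \<Longrightarrow> op_eq n s \<gamma> \<Omega> T S"
  unfolding op_eq_def using null_op_uminus by fastforce

lemma op_eq_add: "op_eq n s \<gamma> \<Omega> S T \<Longrightarrow> op_eq n s \<gamma> \<Omega> S' T' \<Longrightarrow> op_eq n s \<gamma> \<Omega> (S + S') (T + T')"
  unfolding op_eq_def using null_op.add[of n s \<gamma> \<Omega> "S - T" "S' - T'"] by (simp add: algebra_simps)

lemma op_eq_trans [trans]: "op_eq n s \<gamma> \<Omega> S T \<Longrightarrow> op_eq n s \<gamma> \<Omega> T V \<Longrightarrow> op_eq n s \<gamma> \<Omega> S V"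
  unfolding op_eq_def using null_op.add[of n s \<gamma> \<Omega> "S - T" "T - V"] by (simp add: algebra_simps)

lemma op_eq_absorb:
  "adapted n s \<gamma> \<Omega> J \<phi> (u @ v) \<Longrightarrow> a \<in> J \<Longrightarrow>
    op_eq n s \<gamma> \<Omega> (term_op \<phi> (u @ [a] @ v)) (term_op (\<lambda>x. \<phi> x * x a) (u @ v))"
  unfolding op_eq_def by (rule null_op.absorb)

text \<open>The word is scanned from the left: a letter of \<open>J\<close> passes into the
  coefficient, any other letter is appended to the prefix \<open>u\<close>.\<close>

lemma op_eq_absorb_filter:
  assumes "adapted n s \<gamma> \<Omega> J \<phi> (u @ w)"
  shows "op_eq n s \<gamma> \<Omega> (term_op \<phi> (u @ w))
    (term_op (\<lambda>x. \<phi> x * prod_list (map x (filter (\<lambda>a. a \<in> J) w))) (u @ filter (\<lambda>a. a \<notin> J) w))"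
  using assms
proof (induction w arbitrary: u \<phi>)
  case Nil
  then show ?case by (simp add: op_eq_refl)
next
  case (Cons a w)
  show ?case
  proof (cases "a \<in> J")
    case True
    have ad: "adapted n s \<gamma> \<Omega> J \<phi> (u @ w)"
      by (rule adapted_mono[OF Cons.prems]) auto
    have "op_eq n s \<gamma> \<Omega> (term_op \<phi> (u @ a # w)) (term_op (\<lambda>x. \<phi> x * x a) (u @ w))"
      using op_eq_absorb[OF ad True] by simp
    also note Cons.IH[OF adapted_mult_coord[OF ad True]]
    finally show ?thesis using True by (simp add: mult.assoc)
  next
    case False
    then show ?thesis using Cons.IH[of \<phi> "u @ [a]"] Cons.prems by simp
  qed
qed

lemma is_SymI:
  assumes "\<And>\<phi> w. (\<phi>, w) \<in> set ms \<Longrightarrow> \<exists>J. adapted n s \<gamma> \<Omega> J \<phi> w"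
    and "\<And>x. x \<in> \<Omega> \<Longrightarrow> F x = (\<Sum>(\<phi>, w)\<leftarrow>ms. \<phi> x * prod_list (map x w))"
    and "op_eq n s \<gamma> \<Omega> T (\<Sum>(\<phi>, w)\<leftarrow>ms. Sym_term \<phi> w)"
  shows "is_Sym n s \<gamma> \<Omega> F T"
  unfolding is_Sym_def using assms by blast

lemma is_Sym_zero: "is_Sym n s \<gamma> \<Omega> (\<lambda>_. 0) 0"
  by (rule is_SymI[of "[]"]) (auto simp: op_eq_refl)

lemma is_Sym_add:
  assumes "is_Sym n s \<gamma> \<Omega> F S" "is_Sym n s \<gamma> \<Omega> G T"
  shows "is_Sym n s \<gamma> \<Omega> (\<lambda>x. F x + G x) (S + T)"
proof -
  obtain ms where ms: "\<And>\<phi> w. (\<phi>, w) \<in> set ms \<Longrightarrow> \<exists>J. adapted n s \<gamma> \<Omega> J \<phi> w"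
    "\<And>x. x \<in> \<Omega> \<Longrightarrow> F x = (\<Sum>(\<phi>, w)\<leftarrow>ms. \<phi> x * prod_list (map x w))"
    "op_eq n s \<gamma> \<Omega> S (\<Sum>(\<phi>, w)\<leftarrow>ms. Sym_term \<phi> w)"
    using assms(1) unfolding is_Sym_def by blast
  obtain ms' where ms': "\<And>\<phi> w. (\<phi>, w) \<in> set ms' \<Longrightarrow> \<exists>J. adapted n s \<gamma> \<Omega> J \<phi> w"
    "\<And>x. x \<in> \<Omega> \<Longrightarrow> G x = (\<Sum>(\<phi>, w)\<leftarrow>ms'. \<phi> x * prod_list (map x w))"
    "op_eq n s \<gamma> \<Omega> T (\<Sum>(\<phi>, w)\<leftarrow>ms'. Sym_term \<phi> w)"
    using assms(2) unfolding is_Sym_def by blast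
  show ?thesis
  proof (rule is_SymI[of "ms @ ms'"])
    show "\<exists>J. adapted n s \<gamma> \<Omega> J \<phi> w" if "(\<phi>, w) \<in> set (ms @ ms')" for \<phi> w
      using that ms(1) ms'(1) by auto
    show "F x + G x = (\<Sum>(\<phi>, w)\<leftarrow>ms @ ms'. \<phi> x * prod_list (map x w))" if "x \<in> \<Omega>" for x
      using that ms(2) ms'(2) by simp
    show "op_eq n s \<gamma> \<Omega> (S + T) (\<Sum>(\<phi>, w)\<leftarrow>ms @ ms'. Sym_term \<phi> w)"
      using op_eq_add[OF ms(3) ms'(3)] by simp
  qed
qed

lemma is_Sym_sum:
  assumes "\<And>i. i \<in> A \<Longrightarrow> is_Sym n s \<gamma> \<Omega> (F i) (T i)"
  shows "is_Sym n s \<gamma> \<Omega> (\<lambda>x. \<Sum>i\<in>A. F i x) (\<Sum>i\<in>A. T i)"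
  using assms by (induction A rule: infinite_finite_induct) (auto simp: is_Sym_zero is_Sym_add)

lemma is_Sym_cong: "is_Sym n s \<gamma> \<Omega> F T \<Longrightarrow> (\<And>x. x \<in> \<Omega> \<Longrightarrow> F x = G x) \<Longrightarrow> is_Sym n s \<gamma> \<Omega> G T"
  unfolding is_Sym_def by (elim exE conjE, rule exI, intro conjI) auto

lemma is_Sym_op_eq: "is_Sym n s \<gamma> \<Omega> F S \<Longrightarrow> op_eq n s \<gamma> \<Omega> T S \<Longrightarrow> is_Sym n s \<gamma> \<Omega> F T"
  unfolding is_Sym_def using op_eq_trans by blast

end

text \<open>For the Leibniz expansion of a bordered determinant: the last row has zero in column 0,
  so column 0 is served by an earlier row \<open>r0\<close>.\<close>

lemma permutes_nonzero_last:
  fixes \<sigma> :: "nat \<Rightarrow> nat"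
  assumes \<sigma>: "\<sigma> permutes {..<Suc j}" "\<sigma> j \<noteq> 0"
  defines "r0 \<equiv> inv_into UNIV \<sigma> 0"
  shows "\<sigma> r0 = 0" "r0 < j" "\<And>r. r \<noteq> r0 \<Longrightarrow> \<sigma> r \<noteq> 0" "\<And>r. r < Suc j \<Longrightarrow> \<sigma> r < Suc j"
proof -
  show r0: "\<sigma> r0 = 0" unfolding r0_def using \<sigma>(1) by (simp add: permutes_inverses)
  have "r0 < Suc j" using permutes_in_image[OF \<sigma>(1), of r0] r0 by auto
  moreover have "r0 \<noteq> j" using r0 \<sigma>(2) by auto
  ultimately show "r0 < j" by simp
  show "\<sigma> r \<noteq> 0" if "r \<noteq> r0" for r
    using that r0 permutes_inj[OF \<sigma>(1)] by (metis injD)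
  show "\<sigma> r < Suc j" if "r < Suc j" for r using permutes_in_image[OF \<sigma>(1), of r] that by simp
qed

text \<open>Each monomial is split into its entries of A and exactly one entry of each border. The
  border entries are the factors that need not commute.\<close>

lemma det_bordered_mat_leibniz:
  fixes A :: "'f::field mat"
  shows "det (bordered_mat j A U V) = (\<Sum>\<sigma> | \<sigma> permutes {..<Suc j} \<and> \<sigma> j \<noteq> 0.
    of_int (sign \<sigma>) * (\<Prod>r\<in>{..<j} - {inv_into UNIV \<sigma> 0}. A $$ (r, \<sigma> r - 1)) * U (inv_into UNIV \<sigma> 0) * V (\<sigma> j - 1))"
proof -
  let ?M = "bordered_mat j A U V"
  have M: "?M \<in> carrier_mat (Suc j) (Suc j)" by (simp add: bordered_mat_def)
  have ix: "?M $$ (r, c) = (if r < j then (if c = 0 then U r else A $$ (r, c - 1)) else if c = 0 then 0 else V (c - 1))"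
    if "r < Suc j" "c < Suc j" for r c using that by (simp add: bordered_mat_def)
  have "det ?M = (\<Sum>\<sigma> | \<sigma> permutes {..<Suc j}. of_int (sign \<sigma>) * (\<Prod>r<Suc j. ?M $$ (r, \<sigma> r)))"
    using det_def'[OF M] by (simp add: lessThan_atLeast0)
  also have "\<dots> = (\<Sum>\<sigma> | \<sigma> permutes {..<Suc j} \<and> \<sigma> j \<noteq> 0. of_int (sign \<sigma>) * (\<Prod>r<Suc j. ?M $$ (r, \<sigma> r)))"
    by (intro sum.mono_neutral_right) (auto simp: finite_permutations ix)
  also have "\<dots> = (\<Sum>\<sigma> | \<sigma> permutes {..<Suc j} \<and> \<sigma> j \<noteq> 0.
    of_int (sign \<sigma>) * (\<Prod>r\<in>{..<j} - {inv_into UNIV \<sigma> 0}. A $$ (r, \<sigma> r - 1)) * U (inv_into UNIV \<sigma> 0) * V (\<sigma> j - 1))"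
  proof (intro sum.cong refl)
    fix \<sigma> assume "\<sigma> \<in> {\<sigma>. \<sigma> permutes {..<Suc j} \<and> \<sigma> j \<noteq> 0}"
    then have \<sigma>: "\<sigma> permutes {..<Suc j}" "\<sigma> j \<noteq> 0" by auto
    define r0 where "r0 = inv_into UNIV \<sigma> 0"
    note r0 = permutes_nonzero_last(1)[OF \<sigma>, folded r0_def] and r0j = permutes_nonzero_last(2)[OF \<sigma>, folded r0_def]
      and nonzero = permutes_nonzero_last(3)[OF \<sigma>, folded r0_def] and range = permutes_nonzero_last(4)[OF \<sigma>]
    have "(\<Prod>r<Suc j. ?M $$ (r, \<sigma> r)) = (\<Prod>r<j. ?M $$ (r, \<sigma> r)) * V (\<sigma> j - 1)"
      using \<sigma>(2) range[of j] by (simp add: ix)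
    also have "(\<Prod>r<j. ?M $$ (r, \<sigma> r)) = ?M $$ (r0, \<sigma> r0) * (\<Prod>r\<in>{..<j} - {r0}. ?M $$ (r, \<sigma> r))"
      using r0j by (intro prod.remove) auto
    also have "?M $$ (r0, \<sigma> r0) = U r0" using r0 r0j by (simp add: ix)
    also have "(\<Prod>r\<in>{..<j} - {r0}. ?M $$ (r, \<sigma> r)) = (\<Prod>r\<in>{..<j} - {r0}. A $$ (r, \<sigma> r - 1))"
    proof (intro prod.cong refl)
      fix r assume r: "r \<in> {..<j} - {r0}"
      have "\<sigma> r \<noteq> 0" using r by (intro nonzero) auto
      then show "?M $$ (r, \<sigma> r) = A $$ (r, \<sigma> r - 1)" using r range[of r] by (simp add: ix)
    qed
    finally show "of_int (sign \<sigma>) * (\<Prod>r<Suc j. ?M $$ (r, \<sigma> r)) =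
        of_int (sign \<sigma>) * (\<Prod>r\<in>{..<j} - {inv_into UNIV \<sigma> 0}. A $$ (r, \<sigma> r - 1)) * U (inv_into UNIV \<sigma> 0) * V (\<sigma> j - 1)"
      unfolding r0_def by (simp add: mult_ac)
  qed
  finally show ?thesis .
qed

section \<open>Ordered words and their symmetrization\<close>

locale sym_setup = reduced_param n s \<gamma> s' k + dual_open n s \<Omega>
  for n s :: nat and \<gamma> :: "nat \<Rightarrow> nat \<Rightarrow> 'f::{real_normed_field,banach}" and s' :: nat and k :: "nat \<Rightarrow> nat"
    and \<Omega> :: "(lidx \<Rightarrow> 'f) set" +
  assumes regular_\<Omega>: "\<And>x. x \<in> \<Omega> \<Longrightarrow> regular x"
begin

lemma struct_const_E:
  assumes "r < i" "i < l" "l < n" "c \<in> \<B>"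
  shows "struct_const n s \<gamma> (E (Suc r) (Suc i)) (E (Suc i) (Suc l)) c = (if c = E (Suc r) (Suc l) then 1 else 0)"
proof -
  have ec: "e a \<in> carrier_mat n n" for a by simp
  have m: "e (E (Suc a) (Suc b)) * e (E (Suc b') (Suc d)) = (if b = b' then e (E (Suc a) (Suc d)) else 0\<^sub>m n n)"
    if "b < n" for a b b' d
  proof (rule eq_matI)
    fix x y assume "x < dim_row (if b = b' then e (E (Suc a) (Suc d)) else 0\<^sub>m n n)" "y < dim_col (if b = b' then e (E (Suc a) (Suc d)) else 0\<^sub>m n n)"
    then have xy: "x < n" "y < n" by (auto split: if_splits)
    have "(e (E (Suc a) (Suc b)) * e (E (Suc b') (Suc d))) $$ (x, y) =
        (\<Sum>z<n. if z = b then (if x = a \<and> b = b' \<and> y = d then 1 else 0) else 0)"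
      by (subst mult_mat_index[OF ec ec xy], rule sum.cong[OF refl]) (use xy in auto)
    then show "(e (E (Suc a) (Suc b)) * e (E (Suc b') (Suc d))) $$ (x, y) = (if b = b' then e (E (Suc a) (Suc d)) else 0\<^sub>m n n) $$ (x, y)"
      using xy that by simp
  qed auto
  have "lie_bracket (e (E (Suc r) (Suc i))) (e (E (Suc i) (Suc l))) = e (E (Suc r) (Suc l))"
  proof -
    have "l \<noteq> r" "i < n" using assms by auto
    then have "e (E (Suc r) (Suc i)) * e (E (Suc i) (Suc l)) = e (E (Suc r) (Suc l))"
        "e (E (Suc i) (Suc l)) * e (E (Suc r) (Suc i)) = 0\<^sub>m n n"
      using m[of i r i l] m[of l i r i] assms(3) by (simp_all del: basis_mat.simps)
    moreover have "A - 0\<^sub>m n n = A" if "A \<in> carrier_mat n n" for A :: "'f mat"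
      using that by (intro eq_matI) auto
    ultimately show ?thesis unfolding lie_bracket_def using ec[of "E (Suc r) (Suc l)"] by (simp del: basis_mat.simps)
  qed
  then have "struct_const n s \<gamma> (E (Suc r) (Suc i)) (E (Suc i) (Suc l)) =
      lie_coord n s \<gamma> (e (E (Suc r) (Suc l)))" by (simp add: struct_const_def del: basis_mat.simps)
  also have "\<dots> = (\<lambda>b\<in>\<B>. if b = E (Suc r) (Suc l) then 1 else 0)"
    using assms by (subst basis_mat_eq_lie_elem) (auto simp: lie_coord_lie_elem)
  finally show ?thesis using assms(4) by simp
qed

text \<open>The commutator of the two letters is a single letter. It lies in \<open>J\<close> and is
  therefore absorbed into the coefficient.\<close>

lemma commutator_E:
  assumes ad: "adapted n s \<gamma> \<Omega> J \<psi> [E (Suc r) (Suc i), E (Suc i) (Suc l)]"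
    and ril: "r < i" "i < l" "l < n" and c: "E (Suc r) (Suc l) \<in> J"
  defines "a \<equiv> E (Suc r) (Suc i)" and "b \<equiv> E (Suc i) (Suc l)" and "c \<equiv> E (Suc r) (Suc l)"
  shows "op_eq n s \<gamma> \<Omega> (term_op \<psi> [a, b]) (term_op \<psi> [b, a] + term_op (\<lambda>x. \<psi> x * x c) [])"
proof -
  have cB: "c \<in> \<B>" using ril by (simp add: c_def)
  have "(\<Sum>d\<in>\<B>. term_op (\<lambda>x. struct_const n s \<gamma> a b d * \<psi> x) ([] @ [d] @ [])) =
      (\<Sum>d\<in>\<B>. if d = c then term_op \<psi> [c] else 0)"
    unfolding a_def b_def c_def using ril by (intro sum.cong refl) (auto simp: struct_const_E term_op_zero)
  also have "\<dots> = term_op \<psi> [c]" using cB by simp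
  finally have s: "(\<Sum>d\<in>\<B>. term_op (\<lambda>x. struct_const n s \<gamma> a b d * \<psi> x) ([] @ [d] @ [])) = term_op \<psi> [c]" .
  have "null_op n s \<gamma> \<Omega> (term_op \<psi> ([] @ [a, b] @ []) - term_op \<psi> ([] @ [b, a] @ []) - term_op \<psi> [c])"
    unfolding s[symmetric] by (rule null_op.commutator[of _ _ _ _ J]) (use ad in \<open>simp add: a_def b_def\<close>)
  then have "op_eq n s \<gamma> \<Omega> (term_op \<psi> [a, b]) (term_op \<psi> [b, a] + term_op \<psi> [c])"
    by (simp add: op_eq_def algebra_simps)
  also have "op_eq n s \<gamma> \<Omega> (term_op \<psi> [c]) (term_op (\<lambda>x. \<psi> x * x c) [])"
    using op_eq_absorb[of \<gamma> J \<psi> "[]" "[]" c] adapted_mono[OF ad, of "[]"] c by (simp add: c_def)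
  then have "op_eq n s \<gamma> \<Omega> (term_op \<psi> [b, a] + term_op \<psi> [c]) (term_op \<psi> [b, a] + term_op (\<lambda>x. \<psi> x * x c) [])"
    by (intro op_eq_add op_eq_refl)
  finally show ?thesis .
qed

text \<open>ab = (ab + ba)/2 + [a, b]/2 and ba = (ab + ba)/2 - [a, b]/2.\<close>

lemma is_Sym_ordered_pair:
  assumes ad: "adapted n s \<gamma> \<Omega> J \<psi> [E (Suc r) (Suc i), E (Suc i) (Suc l)]"
    and ril: "r < i" "i < l" "l < n" and c: "E (Suc r) (Suc l) \<in> J"
  defines "a \<equiv> E (Suc r) (Suc i)" and "b \<equiv> E (Suc i) (Suc l)" and "c \<equiv> E (Suc r) (Suc l)"
  shows "is_Sym n s \<gamma> \<Omega> (\<lambda>x. \<psi> x * (x a * x b) + (if ord then 1 / 2 else - 1 / 2) * (\<psi> x * x c))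
    (term_op \<psi> (if ord then [a, b] else [b, a]))"
proof (rule is_SymI[of "[(\<psi>, [a, b]), (\<lambda>x. (if ord then 1 / 2 else - 1 / 2) * (\<psi> x * x c), [])]"])
  let ?\<epsilon> = "if ord then 1 / 2 else - 1 / 2 :: 'f"
  have ad0: "adapted n s \<gamma> \<Omega> J \<psi> []" by (rule adapted_mono[OF ad]) simp
  have "adapted n s \<gamma> \<Omega> J (\<lambda>x. ?\<epsilon> * (\<psi> x * x c)) []"
    using c by (intro adapted_mult_const adapted_mult_coord ad0) (simp add: c_def)
  then show "\<exists>J. adapted n s \<gamma> \<Omega> J \<phi> w"
    if "(\<phi>, w) \<in> set [(\<psi>, [a, b]), (\<lambda>x. ?\<epsilon> * (\<psi> x * x c), [])]" for \<phi> w
    using that ad by (auto simp: a_def b_def)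
  have h: "op_eq n s \<gamma> \<Omega> (term_op (\<lambda>x. 1 / 2 * \<psi> x) [a, b])
      (term_op (\<lambda>x. 1 / 2 * \<psi> x) [b, a] + term_op (\<lambda>x. 1 / 2 * (\<psi> x * x c)) [])"
    using commutator_E[OF adapted_mult_const[OF ad, of "1 / 2"] ril c] by (simp add: a_def b_def c_def)
  have half: "term_op \<psi> w = term_op (\<lambda>x. 1 / 2 * \<psi> x) w + term_op (\<lambda>x. 1 / 2 * \<psi> x) w" for w
    unfolding term_op_add[symmetric] by (rule arg_cong2[where f=term_op]) (simp_all add: fun_eq_iff)
  show "op_eq n s \<gamma> \<Omega> (term_op \<psi> (if ord then [a, b] else [b, a]))
      (\<Sum>(\<phi>, w)\<leftarrow>[(\<psi>, [a, b]), (\<lambda>x. ?\<epsilon> * (\<psi> x * x c), [])]. Sym_term \<phi> w)"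
  proof (cases ord)
    case True
    have "op_eq n s \<gamma> \<Omega> (term_op (\<lambda>x. 1 / 2 * \<psi> x) [a, b] + term_op (\<lambda>x. 1 / 2 * \<psi> x) [a, b])
      (term_op (\<lambda>x. 1 / 2 * \<psi> x) [a, b] + (term_op (\<lambda>x. 1 / 2 * \<psi> x) [b, a] + term_op (\<lambda>x. 1 / 2 * (\<psi> x * x c)) []))"
      by (intro op_eq_add op_eq_refl h)
    then show ?thesis using True half[of "[a, b]"] by (simp add: Sym_term_pair Sym_term_Nil add.assoc)
  next
    case False
    let ?c = "term_op (\<lambda>x. 1 / 2 * (\<psi> x * x c)) []"
    have "op_eq n s \<gamma> \<Omega> (term_op (\<lambda>x. 1 / 2 * \<psi> x) [b, a] + ?c + (term_op (\<lambda>x. 1 / 2 * \<psi> x) [b, a] - ?c))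
      (term_op (\<lambda>x. 1 / 2 * \<psi> x) [a, b] + (term_op (\<lambda>x. 1 / 2 * \<psi> x) [b, a] - ?c))"
      by (intro op_eq_add op_eq_refl op_eq_sym[OF h])
    moreover have "term_op (\<lambda>x. 1 / 2 * \<psi> x) [b, a] + ?c + (term_op (\<lambda>x. 1 / 2 * \<psi> x) [b, a] - ?c) = term_op \<psi> [b, a]"
      unfolding half[of "[b, a]"] by (simp add: algebra_simps)
    moreover have "term_op (\<lambda>x. - 1 / 2 * (\<psi> x * x c)) [] = - ?c"
      unfolding term_op_uminus[symmetric] by simp
    ultimately show ?thesis using False by (simp add: Sym_term_pair Sym_term_Nil add.assoc add_diff_eq)
  qed
qed (simp only: list.map case_prod_conv sum_list.Cons sum_list.Nil prod_list.Cons prod_list.Nil mult_1_right add_0_right)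

end

text \<open>Replacing the product of the two noncommuting entries by the entry that is their commutator
  turns the determinant into a multiple of the corner minor.\<close>

lemma bordered_contraction:
  fixes A :: "'f::field mat"
  assumes A: "A \<in> carrier_mat j j" and nz: "det A \<noteq> 0"
  shows "(\<Sum>\<sigma> | \<sigma> permutes {..<Suc j} \<and> \<sigma> j \<noteq> 0. of_int (sign \<sigma>) *
      (\<Prod>r\<in>{..<j} - {inv_into UNIV \<sigma> 0}. A $$ (r, \<sigma> r - 1)) * A $$ (inv_into UNIV \<sigma> 0, \<sigma> j - 1)) =
    (-1) ^ (j + 1) * of_nat j * det A"
proof -
  let ?G = "{\<sigma>. \<sigma> permutes {..<Suc j} \<and> \<sigma> j \<noteq> 0}"
  define \<kappa> where "\<kappa> \<sigma> = of_int (sign \<sigma>) * (\<Prod>r\<in>{..<j} - {inv_into UNIV \<sigma> 0}. A $$ (r, \<sigma> r - 1))" for \<sigma>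
  \<comment> \<open>Borders equal to coordinate vectors extract from the bordered determinant the
    coefficient of one pair of border entries, which is a signed entry of the adjugate.\<close>
  let ?\<delta> = "\<lambda>a b. if b = a then 1 else 0 :: 'f"
  have adj: "adj_mat A \<in> carrier_mat j j" using adj_mat[OF A] by simp
  have bd: "(\<Sum>\<sigma>\<in>?G. \<kappa> \<sigma> * ?\<delta> r (inv_into UNIV \<sigma> 0) * ?\<delta> c (\<sigma> j - 1)) = (-1) ^ (j + 1) * adj_mat A $$ (c, r)"
    if "r < j" "c < j" for r c
  proof -
    have "(\<Sum>\<sigma>\<in>?G. \<kappa> \<sigma> * ?\<delta> r (inv_into UNIV \<sigma> 0) * ?\<delta> c (\<sigma> j - 1)) = det (bordered_mat j A (?\<delta> r) (?\<delta> c))"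
      unfolding det_bordered_mat_leibniz \<kappa>_def ..
    also have "\<dots> = (-1) ^ (j + 1) * (\<Sum>c'<j. \<Sum>r'<j. ?\<delta> c c' * adj_mat A $$ (c', r') * ?\<delta> r r')"
      by (rule det_bordered_mat[OF A nz])
    also have "(\<Sum>c'<j. \<Sum>r'<j. ?\<delta> c c' * adj_mat A $$ (c', r') * ?\<delta> r r') =
        (\<Sum>c'<j. \<Sum>r'<j. if r' = r then (if c' = c then adj_mat A $$ (c, r) else 0) else 0)"
      by (intro sum.cong) auto
    also have "\<dots> = adj_mat A $$ (c, r)" using that by simp
    finally show ?thesis .
  qed
  have "(\<Sum>\<sigma>\<in>?G. \<kappa> \<sigma> * A $$ (inv_into UNIV \<sigma> 0, \<sigma> j - 1)) =
      (\<Sum>\<sigma>\<in>?G. \<Sum>r<j. \<Sum>c<j. A $$ (r, c) * (\<kappa> \<sigma> * ?\<delta> r (inv_into UNIV \<sigma> 0) * ?\<delta> c (\<sigma> j - 1)))"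
  proof (intro sum.cong refl)
    fix \<sigma> assume "\<sigma> \<in> ?G"
    then have \<sigma>: "\<sigma> permutes {..<Suc j}" "\<sigma> j \<noteq> 0" by auto
    define r0 c0 where "r0 = inv_into UNIV \<sigma> 0" and "c0 = \<sigma> j - 1"
    have r0j: "r0 < j" unfolding r0_def by (rule permutes_nonzero_last(2)[OF \<sigma>])
    have c0j: "c0 < j" using permutes_nonzero_last(4)[OF \<sigma>, of j] \<sigma>(2) by (auto simp: c0_def)
    have "(\<Sum>r<j. \<Sum>c<j. A $$ (r, c) * (\<kappa> \<sigma> * ?\<delta> r r0 * ?\<delta> c c0)) =
        (\<Sum>r<j. \<Sum>c<j. if c = c0 then (if r = r0 then \<kappa> \<sigma> * A $$ (r0, c0) else 0) else 0)"
      by (intro sum.cong) auto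
    also have "\<dots> = \<kappa> \<sigma> * A $$ (r0, c0)" using r0j c0j by simp
    finally show "\<kappa> \<sigma> * A $$ (inv_into UNIV \<sigma> 0, \<sigma> j - 1) =
        (\<Sum>r<j. \<Sum>c<j. A $$ (r, c) * (\<kappa> \<sigma> * ?\<delta> r (inv_into UNIV \<sigma> 0) * ?\<delta> c (\<sigma> j - 1)))"
      unfolding r0_def c0_def by simp
  qed
  also have "\<dots> = (\<Sum>r<j. \<Sum>\<sigma>\<in>?G. \<Sum>c<j. A $$ (r, c) * (\<kappa> \<sigma> * ?\<delta> r (inv_into UNIV \<sigma> 0) * ?\<delta> c (\<sigma> j - 1)))"
    by (rule sum.swap)
  also have "\<dots> = (\<Sum>r<j. \<Sum>c<j. \<Sum>\<sigma>\<in>?G. A $$ (r, c) * (\<kappa> \<sigma> * ?\<delta> r (inv_into UNIV \<sigma> 0) * ?\<delta> c (\<sigma> j - 1)))"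
    by (rule sum.cong[OF refl], rule sum.swap)
  also have "\<dots> = (\<Sum>r<j. \<Sum>c<j. A $$ (r, c) * ((-1) ^ (j + 1) * adj_mat A $$ (c, r)))"
    by (intro sum.cong refl) (simp only: sum_distrib_left[symmetric] bd lessThan_iff)
  \<comment> \<open>The double sum is the trace of A times its adjugate, that is, of det A times the
    identity of size j.\<close>
  also have "\<dots> = (-1) ^ (j + 1) * (\<Sum>r<j. (A * adj_mat A) $$ (r, r))"
    using A adj by (simp add: mult_mat_index[of _ j j _ j] sum_distrib_left mult.left_commute sum_negf)
  also have "\<dots> = (-1) ^ (j + 1) * of_nat j * det A"
    unfolding adj_mat(2)[OF A] by simp
  finally show ?thesis unfolding \<kappa>_def .
qed

text \<open>The lower left entry is the only one without a basis element.\<close>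

lemma second_block_perms:
  assumes jn: "j \<le> n"
  shows "{\<sigma>. \<sigma> permutes {..<dim_row (second_block n j i)} \<and> (\<forall>r<dim_row (second_block n j i). second_block n j i $$ (r, \<sigma> r) \<noteq> None)}
    = {\<sigma>. \<sigma> permutes {..<Suc j} \<and> \<sigma> j \<noteq> 0}"
  unfolding second_block_dim(1)[OF jn]
proof (intro equalityI subsetI)
  fix \<sigma> assume "\<sigma> \<in> {\<sigma>. \<sigma> permutes {..<Suc j} \<and> (\<forall>r<Suc j. second_block n j i $$ (r, \<sigma> r) \<noteq> None)}"
  then have \<sigma>: "\<sigma> permutes {..<Suc j}" "second_block n j i $$ (j, \<sigma> j) \<noteq> None" by auto
  have "\<sigma> j < Suc j" using permutes_in_image[OF \<sigma>(1), of j] by simp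
  then show "\<sigma> \<in> {\<sigma>. \<sigma> permutes {..<Suc j} \<and> \<sigma> j \<noteq> 0}"
    using \<sigma> second_block_index[OF jn lessI, of "\<sigma> j" i] by (auto split: if_splits)
next
  fix \<sigma> assume "\<sigma> \<in> {\<sigma>. \<sigma> permutes {..<Suc j} \<and> \<sigma> j \<noteq> 0}"
  then have \<sigma>: "\<sigma> permutes {..<Suc j}" "\<sigma> j \<noteq> 0" by auto
  have "second_block n j i $$ (r, \<sigma> r) \<noteq> None" if r: "r < Suc j" for r
  proof -
    have "\<sigma> r < Suc j" using permutes_in_image[OF \<sigma>(1), of r] r by simp
    from second_block_index[OF jn r this, of i] show ?thesis
      using \<sigma>(2) r less_SucE[OF r] by (cases "r = j") (auto split: if_splits)
  qed
  then show "\<sigma> \<in> {\<sigma>. \<sigma> permutes {..<Suc j} \<and> (\<forall>r<Suc j. second_block n j i $$ (r, \<sigma> r) \<noteq> None)}"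
    using \<sigma> by blast
qed

lemma prod_list_map_distinct:
  "distinct L \<Longrightarrow> prod_list (map f L) = prod f (set L)"
  by (simp add: prod.distinct_set_conv_list)

lemma corner_minor_cong:
  assumes "j \<le> n" "\<And>r l. 1 \<le> r \<Longrightarrow> r \<le> j \<Longrightarrow> n - j < l \<Longrightarrow> l \<le> n \<Longrightarrow> x (E r l) = y (E r l)"
  shows "corner_minor n j x = corner_minor n j y"
proof -
  have "corner_mat n j x = corner_mat n j y"
  proof (rule eq_matI)
    fix r c assume "r < dim_row (corner_mat n j y)" "c < dim_col (corner_mat n j y)"
    then have "r < j" "c < j" using carrier_matD[OF corner_mat_carrier[OF assms(1), of y]] by auto
    then show "corner_mat n j x $$ (r, c) = corner_mat n j y $$ (r, c)"
      using assms by (simp add: corner_mat_index)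
  qed (use carrier_matD[OF corner_mat_carrier[OF assms(1), of x]] carrier_matD[OF corner_mat_carrier[OF assms(1), of y]] in auto)
  then show ?thesis by (simp add: corner_minor_eq)
qed

context sym_setup
begin

text \<open>In every monomial the factors from the corner commute with the whole word, so absorption
  leaves an ordered pair of border entries. By \<open>bordered_contraction\<close> the corrections
  of the pairs add up to a multiple of the corner minor, and the denominator of \<phi> turns it into
  a constant.\<close>

lemma is_Sym_ordered_det:
  fixes d :: 'f
  assumes j: "j \<in> {1..m}" and i: "j \<le> i" "i < n - j"
  defines "\<phi> \<equiv> \<lambda>x. (- 1) ^ (j + 1) / corner_minor n j x * d"
  shows "is_Sym n s \<gamma> \<Omega>
    (\<lambda>x. \<phi> x * det (eval_mat x (second_block n j (Suc i))) + (if ord then 1 / 2 else - 1 / 2) * (d * of_nat j))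
    (ordered_det ord \<phi> (second_block n j (Suc i)))"
proof -
  let ?\<epsilon> = "if ord then 1 / 2 else - 1 / 2 :: 'f"
  let ?M = "second_block n j (Suc i)"
  let ?G = "{\<sigma>. \<sigma> permutes {..<Suc j} \<and> \<sigma> j \<noteq> 0}"
  have jn: "j \<le> n" "2 * j \<le> n" using j by auto
  \<comment> \<open>The entries of the corner: they commute with each other and with the letters of
    row i and column i that occur in the words.\<close>
  define J where "J = {E r l | r l. 1 \<le> r \<and> r \<le> j \<and> n - j < l \<and> l \<le> n}"
  have nz: "corner_minor n j x \<noteq> 0" if "x \<in> \<Omega>" for x
    using regular_\<Omega>[OF that] j by (simp add: regular_def)
  have J_comm: "commuting n \<gamma> a b" if a: "a \<in> J"
    and b: "b \<in> J \<or> (\<exists>r. r \<le> j \<and> b = E r (Suc i)) \<or> (\<exists>l. n - j < l \<and> b = E (Suc i) l)" for a b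
  proof -
    obtain r l where a': "a = E r l" "1 \<le> r" "r \<le> j" "n - j < l" "l \<le> n" using a by (auto simp: J_def)
    show ?thesis using b
    proof (elim disjE exE conjE)
      assume "b \<in> J"
      then obtain r' l' where "b = E r' l'" "r' \<le> j" "n - j < l'" by (auto simp: J_def)
      then show ?thesis unfolding a'(1) using a' jn by (auto intro!: commuting_E)
    next
      fix r' assume "r' \<le> j" "b = E r' (Suc i)"
      then show ?thesis unfolding a'(1) using a' jn i by (auto intro!: commuting_E)
    next
      fix l' assume "n - j < l'" "b = E (Suc i) l'"
      then show ?thesis unfolding a'(1) using a' jn i by (auto intro!: commuting_E)
    qed
  qed
  have J_sub: "J \<subseteq> \<B>" using jn by (auto simp: J_def)
  have sm_\<phi>: "smooth_fun n s \<Omega> \<phi>"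
  proof -
    have "smooth_fun n s \<Omega> (\<lambda>x. (- 1) ^ (j + 1) * inverse (corner_minor n j x) * d)"
      by (intro smooth_mult smooth_const smooth_inverse smooth_corner_minor jn nz)
    then show ?thesis by (simp add: \<phi>_def divide_inverse)
  qed
  have dep_\<phi>: "\<phi> x = \<phi> y" if "\<And>a. a \<in> J \<Longrightarrow> x a = y a" for x y
  proof -
    have "corner_minor n j x = corner_minor n j y"
      using jn by (intro corner_minor_cong) (auto intro!: that simp: J_def)
    then show ?thesis by (simp add: \<phi>_def)
  qed
  define \<kappa> where "\<kappa> \<sigma> x = (\<Prod>r\<in>{..<j} - {inv_into UNIV \<sigma> 0}. corner_mat n j x $$ (r, \<sigma> r - 1))" for \<sigma> and x :: "lidx \<Rightarrow> 'f"
  define r0 where "r0 \<sigma> = inv_into UNIV \<sigma> (0::nat)" for \<sigma> :: "nat \<Rightarrow> nat"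
  define l0 where "l0 \<sigma> = n - j + (\<sigma> j - 1)" for \<sigma> :: "nat \<Rightarrow> nat"
  define \<psi> where "\<psi> \<sigma> x = of_int (sign \<sigma>) * \<phi> x * \<kappa> \<sigma> x" for \<sigma> and x :: "lidx \<Rightarrow> 'f"
  define word where "word \<sigma> = map (\<lambda>r. the (?M $$ (r, \<sigma> r))) (if ord then [0..<Suc j] else rev [0..<Suc j])" for \<sigma>
  have term_Sym: "is_Sym n s \<gamma> \<Omega>
      (\<lambda>x. \<psi> \<sigma> x * (x (E (Suc (r0 \<sigma>)) (Suc i)) * x (E (Suc i) (Suc (l0 \<sigma>)))) + ?\<epsilon> * (\<psi> \<sigma> x * x (E (Suc (r0 \<sigma>)) (Suc (l0 \<sigma>)))))
      (term_op (\<lambda>x. of_int (sign \<sigma>) * \<phi> x) (word \<sigma>))" if G: "\<sigma> \<in> ?G" for \<sigma>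
  proof -
    have \<sigma>: "\<sigma> permutes {..<Suc j}" "\<sigma> j \<noteq> 0" using G by auto
    note r0 = permutes_nonzero_last(1)[OF \<sigma>, folded r0_def] and r0j = permutes_nonzero_last(2)[OF \<sigma>, folded r0_def]
      and nonzero = permutes_nonzero_last(3)[OF \<sigma>, folded r0_def] and range = permutes_nonzero_last(4)[OF \<sigma>]
    have l0: "Suc (l0 \<sigma>) = n - j + \<sigma> j" "l0 \<sigma> < n" "n - j \<le> l0 \<sigma>"
      using \<sigma>(2) range[of j] jn by (auto simp: l0_def)
    let ?f = "\<lambda>r. the (?M $$ (r, \<sigma> r))"
    have f: "?f r = (if r = r0 \<sigma> then E (Suc r) (Suc i) else if r < j then E (Suc r) (n - j + \<sigma> r) else E (Suc i) (n - j + \<sigma> r))"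
      if r: "r < Suc j" for r
      unfolding second_block_index[OF jn(1) r range[OF r]] using r0 r0j nonzero[of r] by auto
    have fJ: "?f r \<in> J \<longleftrightarrow> r \<noteq> r0 \<sigma> \<and> r \<noteq> j" if r: "r < Suc j" for r
      unfolding f[OF r] using r range[OF r] nonzero[of r] i jn r0j by (auto simp: J_def)
    let ?L = "if ord then [0..<Suc j] else rev [0..<Suc j]"
    have L: "set ?L = {..<Suc j}" "distinct ?L" by (auto simp: lessThan_atLeast0)
    \<comment> \<open>Cutting the list of rows at \<open>r0\<close> and at the last row shows that
      absorption leaves the factor from column i before the factor from row i, or the reverse for
      the opposite order.\<close>
    have split: "[0..<Suc j] = [0..<r0 \<sigma>] @ [r0 \<sigma>] @ [Suc (r0 \<sigma>)..<j] @ [j]"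
    proof -
      have "[0..<j] = [0..<r0 \<sigma>] @ [r0 \<sigma>..<j]"
        using r0j upt_add_eq_append[of 0 "r0 \<sigma>" "j - r0 \<sigma>"] by simp
      also have "[r0 \<sigma>..<j] = r0 \<sigma> # [Suc (r0 \<sigma>)..<j]" using r0j by (rule upt_conv_Cons)
      finally show ?thesis by simp
    qed
    have "filter (\<lambda>r. \<not> (r \<noteq> r0 \<sigma> \<and> r \<noteq> j)) [0..<Suc j] = [r0 \<sigma>, j]"
      unfolding split using r0j by (auto simp: filter_empty_conv)
    then have "filter (\<lambda>r. \<not> (r \<noteq> r0 \<sigma> \<and> r \<noteq> j)) ?L = (if ord then [r0 \<sigma>, j] else [j, r0 \<sigma>])"
      by (simp only: rev_filter[symmetric] split: if_splits) simp
    moreover have "filter (\<lambda>r. ?f r \<notin> J) ?L = filter (\<lambda>r. \<not> (r \<noteq> r0 \<sigma> \<and> r \<noteq> j)) ?L"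
      using L(1) fJ by (intro filter_cong) auto
    ultimately have out: "filter (\<lambda>a. a \<notin> J) (word \<sigma>) =
        (if ord then [E (Suc (r0 \<sigma>)) (Suc i), E (Suc i) (Suc (l0 \<sigma>))] else [E (Suc i) (Suc (l0 \<sigma>)), E (Suc (r0 \<sigma>)) (Suc i)])"
      unfolding word_def filter_map o_def using f[of j] f[of "r0 \<sigma>"] r0j l0 by (simp only: if_distrib[of "map _"]) auto
    have inn: "prod_list (map x (filter (\<lambda>a. a \<in> J) (word \<sigma>))) = \<kappa> \<sigma> x" for x
    proof -
      have "prod_list (map x (filter (\<lambda>a. a \<in> J) (word \<sigma>))) = prod_list (map (\<lambda>r. x (?f r)) (filter (\<lambda>r. ?f r \<in> J) ?L))"
        unfolding word_def filter_map o_def by (simp only: map_map o_def)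
      also have "\<dots> = prod (\<lambda>r. x (?f r)) (set (filter (\<lambda>r. ?f r \<in> J) ?L))"
        using L(2) by (intro prod_list_map_distinct distinct_filter)
      also have "set (filter (\<lambda>r. ?f r \<in> J) ?L) = {..<j} - {r0 \<sigma>}"
        unfolding set_filter L(1) using fJ by auto
      also have "prod (\<lambda>r. x (?f r)) ({..<j} - {r0 \<sigma>}) = \<kappa> \<sigma> x"
        unfolding \<kappa>_def r0_def[symmetric]
      proof (intro prod.cong refl)
        fix r assume r: "r \<in> {..<j} - {r0 \<sigma>}"
        then have "\<sigma> r - 1 < j" "n - j + \<sigma> r = Suc (n - j + (\<sigma> r - 1))" using range[of r] nonzero[of r] by auto
        then show "x (?f r) = corner_mat n j x $$ (r, \<sigma> r - 1)"
          using r f[of r] jn by (simp add: corner_mat_index)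
      qed
      finally show ?thesis .
    qed
    have comm: "commuting n \<gamma> a b" if a: "a \<in> J" and b: "b \<in> J \<union> set (word \<sigma>)" for a b
    proof (rule J_comm[OF a])
      show "b \<in> J \<or> (\<exists>r. r \<le> j \<and> b = E r (Suc i)) \<or> (\<exists>l. n - j < l \<and> b = E (Suc i) l)"
        using b
      proof
        assume "b \<in> set (word \<sigma>)"
        then obtain r where r: "r < Suc j" "b = ?f r" unfolding word_def set_map L(1) by auto
        consider "r = r0 \<sigma>" | "r = j" | "r \<noteq> r0 \<sigma>" "r \<noteq> j" by blast
        then show ?thesis
        proof cases
          case 1
          then show ?thesis using r f[OF r(1)] r0j by auto
        next
          case 2
          then show ?thesis using r f[OF r(1)] r0j \<sigma>(2) by auto
        next
          case 3
          then show ?thesis using r fJ[OF r(1)] by blast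
        qed
      qed blast
    qed
    have wB: "set (word \<sigma>) \<subseteq> \<B>"
    proof
      fix b assume "b \<in> set (word \<sigma>)"
      then obtain r where r: "r < Suc j" "b = ?f r" unfolding word_def set_map L(1) by auto
      show "b \<in> \<B>"
        unfolding r(2) f[OF r(1)] using r(1) range[OF r(1)] nonzero[of r] i jn r0j by auto
    qed
    have ad: "adapted n s \<gamma> \<Omega> J (\<lambda>x. of_int (sign \<sigma>) * \<phi> x) (word \<sigma>)"
    proof (rule adaptedI[OF J_sub wB])
      show "smooth_fun n s \<Omega> (\<lambda>x. of_int (sign \<sigma>) * \<phi> x)" by (intro smooth_mult smooth_const sm_\<phi>)
      show "of_int (sign \<sigma>) * \<phi> x = of_int (sign \<sigma>) * \<phi> y" if "\<And>a. a \<in> J \<Longrightarrow> x a = y a" for x y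
        using dep_\<phi>[OF that] by simp
    qed (rule comm)
    have sm_\<kappa>: "smooth_fun n s \<Omega> (\<kappa> \<sigma>)" and dep_\<kappa>: "\<And>x y. (\<And>a. a \<in> J \<Longrightarrow> x a = y a) \<Longrightarrow> \<kappa> \<sigma> x = \<kappa> \<sigma> y"
    proof -
      have eq: "corner_mat n j x $$ (r, \<sigma> r - 1) = x (E (Suc r) (n - j + \<sigma> r))" "E (Suc r) (n - j + \<sigma> r) \<in> J"
        if "r \<in> {..<j} - {inv_into UNIV \<sigma> 0}" for x r
      proof -
        have r: "\<sigma> r - 1 < j" "n - j + \<sigma> r = Suc (n - j + (\<sigma> r - 1))" "r < j"
          using that range[of r] nonzero[of r] by (auto simp: r0_def)
        then show "corner_mat n j x $$ (r, \<sigma> r - 1) = x (E (Suc r) (n - j + \<sigma> r))"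
          using jn by (simp add: corner_mat_index)
        show "E (Suc r) (n - j + \<sigma> r) \<in> J" using r jn by (auto simp: J_def)
      qed
      have \<kappa>_eq: "\<kappa> \<sigma> = (\<lambda>x. \<Prod>r\<in>{..<j} - {inv_into UNIV \<sigma> 0}. x (E (Suc r) (n - j + \<sigma> r)))"
        unfolding \<kappa>_def by (intro ext prod.cong refl) (rule eq(1))
      show "smooth_fun n s \<Omega> (\<kappa> \<sigma>)"
        unfolding \<kappa>_eq by (intro smooth_prod smooth_coord) (use eq(2) J_sub in blast)
      show "\<kappa> \<sigma> x = \<kappa> \<sigma> y" if "\<And>a. a \<in> J \<Longrightarrow> x a = y a" for x y
        unfolding \<kappa>_eq by (intro prod.cong refl that eq(2))
    qed
    have ad2: "adapted n s \<gamma> \<Omega> J (\<psi> \<sigma>) [E (Suc (r0 \<sigma>)) (Suc i), E (Suc i) (Suc (l0 \<sigma>))]"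
    proof (rule adaptedI[OF J_sub])
      show "set [E (Suc (r0 \<sigma>)) (Suc i), E (Suc i) (Suc (l0 \<sigma>))] \<subseteq> \<B>"
        using r0j i l0 jn by auto
      show "smooth_fun n s \<Omega> (\<psi> \<sigma>)"
        unfolding \<psi>_def[abs_def] by (intro smooth_mult smooth_const sm_\<phi> sm_\<kappa>)
      show "\<psi> \<sigma> x = \<psi> \<sigma> y" if "\<And>a. a \<in> J \<Longrightarrow> x a = y a" for x y
        unfolding \<psi>_def using dep_\<phi>[OF that] dep_\<kappa>[OF that] by simp
      show "commuting n \<gamma> a b" if "a \<in> J" "b \<in> J \<union> set [E (Suc (r0 \<sigma>)) (Suc i), E (Suc i) (Suc (l0 \<sigma>))]" for a b
      proof (rule J_comm[OF that(1)])
        have "Suc (r0 \<sigma>) \<le> j" "n - j < Suc (l0 \<sigma>)" using r0j l0 by auto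
        then show "b \<in> J \<or> (\<exists>r. r \<le> j \<and> b = E r (Suc i)) \<or> (\<exists>l. n - j < l \<and> b = E (Suc i) l)"
          using that(2) by auto
      qed
    qed
    have "is_Sym n s \<gamma> \<Omega>
      (\<lambda>x. \<psi> \<sigma> x * (x (E (Suc (r0 \<sigma>)) (Suc i)) * x (E (Suc i) (Suc (l0 \<sigma>)))) + ?\<epsilon> * (\<psi> \<sigma> x * x (E (Suc (r0 \<sigma>)) (Suc (l0 \<sigma>)))))
      (term_op (\<psi> \<sigma>) (if ord then [E (Suc (r0 \<sigma>)) (Suc i), E (Suc i) (Suc (l0 \<sigma>))] else [E (Suc i) (Suc (l0 \<sigma>)), E (Suc (r0 \<sigma>)) (Suc i)]))"
      by (rule is_Sym_ordered_pair[OF ad2]) (use r0j i l0 jn in \<open>auto simp: J_def\<close>)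
    moreover have "op_eq n s \<gamma> \<Omega> (term_op (\<lambda>x. of_int (sign \<sigma>) * \<phi> x) (word \<sigma>))
      (term_op (\<psi> \<sigma>) (if ord then [E (Suc (r0 \<sigma>)) (Suc i), E (Suc i) (Suc (l0 \<sigma>))] else [E (Suc i) (Suc (l0 \<sigma>)), E (Suc (r0 \<sigma>)) (Suc i)]))"
      using op_eq_absorb_filter[of \<gamma> J "\<lambda>x. of_int (sign \<sigma>) * \<phi> x" "[]" "word \<sigma>"] ad
      unfolding append_Nil inn out \<psi>_def[abs_def] by blast
    ultimately show ?thesis by (rule is_Sym_op_eq)
  qed
  have ord_eq: "ordered_det ord \<phi> ?M = (\<Sum>\<sigma>\<in>?G. term_op (\<lambda>x. of_int (sign \<sigma>) * \<phi> x) (word \<sigma>))"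
    unfolding ordered_det_def second_block_perms[OF jn(1)] word_def unfolding second_block_dim(1)[OF jn(1)] ..
  have "is_Sym n s \<gamma> \<Omega> (\<lambda>x. \<Sum>\<sigma>\<in>?G. \<psi> \<sigma> x * (x (E (Suc (r0 \<sigma>)) (Suc i)) * x (E (Suc i) (Suc (l0 \<sigma>)))) +
       ?\<epsilon> * (\<psi> \<sigma> x * x (E (Suc (r0 \<sigma>)) (Suc (l0 \<sigma>))))) (ordered_det ord \<phi> ?M)"
    unfolding ord_eq by (rule is_Sym_sum) (rule term_Sym)
  then show ?thesis
  proof (rule is_Sym_cong)
    fix x assume x: "x \<in> \<Omega>"
    let ?A = "corner_mat n j x"
    have A: "?A \<in> carrier_mat j j" using jn by simp
    have dA: "det ?A \<noteq> 0" using nz[OF x] by (simp add: corner_minor_eq)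
    have "(\<Sum>\<sigma>\<in>?G. \<psi> \<sigma> x * (x (E (Suc (r0 \<sigma>)) (Suc i)) * x (E (Suc i) (Suc (l0 \<sigma>))))) = \<phi> x * det (eval_mat x ?M)"
      unfolding eval_second_block[OF jn(1)] det_bordered_mat_leibniz sum_distrib_left \<psi>_def \<kappa>_def r0_def l0_def
      by (intro sum.cong refl) (simp only: mult_ac)
    moreover have "(\<Sum>\<sigma>\<in>?G. ?\<epsilon> * (\<psi> \<sigma> x * x (E (Suc (r0 \<sigma>)) (Suc (l0 \<sigma>))))) = ?\<epsilon> * (d * of_nat j)"
    proof -
      have "(\<Sum>\<sigma>\<in>?G. \<psi> \<sigma> x * x (E (Suc (r0 \<sigma>)) (Suc (l0 \<sigma>)))) =
          \<phi> x * (\<Sum>\<sigma>\<in>?G. of_int (sign \<sigma>) * \<kappa> \<sigma> x * ?A $$ (inv_into UNIV \<sigma> 0, \<sigma> j - 1))"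
        unfolding sum_distrib_left
      proof (intro sum.cong refl)
        fix \<sigma> assume "\<sigma> \<in> ?G"
        then have \<sigma>: "\<sigma> permutes {..<Suc j}" "\<sigma> j \<noteq> 0" by auto
        note r0j = permutes_nonzero_last(2)[OF \<sigma>, folded r0_def]
        have "\<sigma> j - 1 < j" using permutes_nonzero_last(4)[OF \<sigma>, of j] \<sigma>(2) by auto
        then have "?A $$ (r0 \<sigma>, \<sigma> j - 1) = x (E (Suc (r0 \<sigma>)) (Suc (l0 \<sigma>)))"
          using r0j jn by (simp add: corner_mat_index l0_def)
        then show "\<psi> \<sigma> x * x (E (Suc (r0 \<sigma>)) (Suc (l0 \<sigma>))) =
            \<phi> x * (of_int (sign \<sigma>) * \<kappa> \<sigma> x * ?A $$ (inv_into UNIV \<sigma> 0, \<sigma> j - 1))"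
          unfolding r0_def[symmetric] \<psi>_def by (simp only: mult_ac)
      qed
      also have "\<dots> = \<phi> x * ((-1) ^ (j + 1) * of_nat j * det ?A)"
        unfolding \<kappa>_def bordered_contraction[OF A dA] ..
      also have "\<dots> = d * of_nat j"
      proof -
        have "((-1) ^ (j + 1) / D * d) * ((-1) ^ (j + 1) * N * D) = d * N" if "D \<noteq> 0" for D N :: 'f
          using that by (simp add: field_simps power_mult_distrib[symmetric])
        from this[OF dA] show ?thesis unfolding \<phi>_def corner_minor_eq by simp
      qed
      finally show ?thesis unfolding sum_distrib_left[symmetric] by simp
    qed
    ultimately show "(\<Sum>\<sigma>\<in>?G. \<psi> \<sigma> x * (x (E (Suc (r0 \<sigma>)) (Suc i)) * x (E (Suc i) (Suc (l0 \<sigma>)))) +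
       ?\<epsilon> * (\<psi> \<sigma> x * x (E (Suc (r0 \<sigma>)) (Suc (l0 \<sigma>))))) = \<phi> x * det (eval_mat x ?M) + ?\<epsilon> * (d * of_nat j)"
      unfolding sum.distrib by (simp only:)
  qed
qed

end

lemma DERIV_prod_log:
  fixes g :: "'q \<Rightarrow> 'f::real_normed_field \<Rightarrow> 'f"
  assumes "\<And>q. q \<in> A \<Longrightarrow> (g q has_field_derivative g q t0 * h q) (at t0)"
  shows "((\<lambda>t. \<Prod>q\<in>A. g q t) has_field_derivative (\<Prod>q\<in>A. g q t0) * (\<Sum>q\<in>A. h q)) (at t0)"
  using assms
proof (induction A rule: infinite_finite_induct)
  case (insert q A)
  have "((\<lambda>t. g q t * (\<Prod>q\<in>A. g q t)) has_field_derivative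
      g q t0 * h q * (\<Prod>q\<in>A. g q t0) + (\<Prod>q\<in>A. g q t0) * (\<Sum>q\<in>A. h q) * g q t0) (at t0)"
    using insert by (intro DERIV_mult) auto
  then show ?case using insert.hyps by (simp add: algebra_simps)
qed auto

section \<open>A basis of invariants for an abstract power function\<close>

context sym_setup
begin

definition first_fun :: "('f \<Rightarrow> 'f \<Rightarrow> 'f) \<Rightarrow> nat \<Rightarrow> (lidx \<Rightarrow> 'f) \<Rightarrow> 'f" where
  "first_fun pw j x = corner_minor n j x * (\<Prod>q=1..s'. pw (corner_minor n (k q) x) (beta n \<gamma> s' k q j))"

text \<open>The constant summand by which the ordered form differs from the symmetrized one; it collects the
  contributions of the commutators \<open>[e\<^sub>r\<^sub>i, e\<^sub>i\<^sub>l] = e\<^sub>r\<^sub>l\<close>.\<close>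

definition sym_const :: "bool \<Rightarrow> nat \<Rightarrow> 'f" where
  "sym_const ord p = (\<Sum>j=1..m. \<Sum>i\<in>{j<..<n - j + 1}.
     (if ord then 1 / 2 else - 1 / 2) * ((\<gamma> p j - \<gamma> p (j + 1)) * of_nat j))"

lemma is_Sym_second:
  assumes p: "p \<in> {s' + 1..s}"
  shows "is_Sym n s \<gamma> \<Omega> (\<lambda>x. second_fun n \<gamma> p x + sym_const ord p) (second_kind n \<gamma> ord p)"
proof -
  let ?\<phi> = "\<lambda>j x. (- 1) ^ (j + 1) / corner_minor n j x * (\<gamma> p j - \<gamma> p (j + 1))"
  have "adapted n s \<gamma> \<Omega> {} (\<lambda>_. 1) [P p]"
    using p by (intro adaptedI) (auto intro: smooth_const)
  then have 1: "is_Sym n s \<gamma> \<Omega> (\<lambda>x. x (P p)) (term_op (\<lambda>_. 1) [P p])"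
    by (intro is_SymI[of "[(\<lambda>_. 1, [P p])]"]) (auto simp: Sym_term_single op_eq_refl)
  have 2: "is_Sym n s \<gamma> \<Omega>
      (\<lambda>x. ?\<phi> j x * det (eval_mat x (second_block n j i)) + (if ord then 1 / 2 else - 1 / 2) * ((\<gamma> p j - \<gamma> p (j + 1)) * of_nat j))
      (ordered_det ord (?\<phi> j) (second_block n j i))"
    if j: "j \<in> {1..m}" and i: "i \<in> {j<..<n - j + 1}" for j i
  proof -
    have "j \<le> i - 1" "i - 1 < n - j" "Suc (i - 1) = i" using i j by auto
    then show ?thesis using is_Sym_ordered_det[OF j, of "i - 1" "\<gamma> p j - \<gamma> p (j + 1)" ord] by simp
  qed
  have "is_Sym n s \<gamma> \<Omega> (\<lambda>x. x (P p) + (\<Sum>j=1..m. \<Sum>i\<in>{j<..<n - j + 1}.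
        ?\<phi> j x * det (eval_mat x (second_block n j i)) + (if ord then 1 / 2 else - 1 / 2) * ((\<gamma> p j - \<gamma> p (j + 1)) * of_nat j)))
      (term_op (\<lambda>_. 1) [P p] + (\<Sum>j=1..m. \<Sum>i\<in>{j<..<n - j + 1}. ordered_det ord (?\<phi> j) (second_block n j i)))"
    by (intro is_Sym_add 1 is_Sym_sum 2)
  then have "is_Sym n s \<gamma> \<Omega> (\<lambda>x. x (P p) + (\<Sum>j=1..m. \<Sum>i\<in>{j<..<n - j + 1}.
        ?\<phi> j x * det (eval_mat x (second_block n j i)) + (if ord then 1 / 2 else - 1 / 2) * ((\<gamma> p j - \<gamma> p (j + 1)) * of_nat j)))
      (second_kind n \<gamma> ord p)"
    unfolding second_kind_def .
  then show ?thesis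
    by (rule is_Sym_cong) (simp only: second_fun_def sym_const_def sum.distrib add.assoc)
qed

lemma smooth_second_fun:
  assumes p: "p \<in> {s' + 1..s}"
  shows "smooth_fun n s \<Omega> (second_fun n \<gamma> p)"
proof -
  have nz: "corner_minor n j x \<noteq> 0" if "x \<in> \<Omega>" "j \<in> {1..m}" for x j
    using regular_\<Omega>[OF that(1)] that(2) by (simp add: regular_def)
  have "smooth_fun n s \<Omega> (\<lambda>x. x (P p) + (\<Sum>j=1..m. \<Sum>i\<in>{j<..<n - j + 1}.
     ((- 1) ^ (j + 1) * inverse (corner_minor n j x)) * (\<gamma> p j - \<gamma> p (j + 1)) * det (eval_mat x (second_block n j i))))"
    by (intro smooth_add smooth_sum smooth_mult smooth_const smooth_inverse smooth_corner_minor smooth_det_second_block smooth_coord nz)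
       (use p in auto)
  then show ?thesis by (simp only: second_fun_def[abs_def] divide_inverse)
qed

lemma partial_second_fun_P:
  "partial (P p) (\<lambda>x. second_fun n \<gamma> p' x + c) x = (if p' = p then 1 else 0)"
proof -
  define r where "r = (\<Sum>j=1..m. \<Sum>i\<in>{j<..<n - j + 1}.
     (- 1) ^ (j + 1) / corner_minor n j x * (\<gamma> p' j - \<gamma> p' (j + 1)) * det (eval_mat x (second_block n j i)))"
  have "second_fun n \<gamma> p' (x(P p := t)) + c = (if p' = p then t else x (P p')) + r + c" for t
  proof -
    have "(\<Sum>j=1..m. \<Sum>i\<in>{j<..<n - j + 1}. (- 1) ^ (j + 1) / corner_minor n j (x(P p := t)) *
        (\<gamma> p' j - \<gamma> p' (j + 1)) * det (eval_mat (x(P p := t)) (second_block n j i))) = r"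
      unfolding r_def
    proof (intro sum.cong refl)
      fix j i assume "j \<in> {1..m}"
      then have "j \<le> n" by auto
      then show "(- 1) ^ (j + 1) / corner_minor n j (x(P p := t)) *
        (\<gamma> p' j - \<gamma> p' (j + 1)) * det (eval_mat (x(P p := t)) (second_block n j i)) =
        (- 1) ^ (j + 1) / corner_minor n j x * (\<gamma> p' j - \<gamma> p' (j + 1)) * det (eval_mat x (second_block n j i))"
        by (simp only: corner_minor_upd_P second_block_upd_P)
    qed
    then show ?thesis unfolding second_fun_def by (simp only: fun_upd_apply lidx.inject)
  qed
  moreover have "((\<lambda>t. (if p' = p then t else x (P p')) + r + c) has_field_derivative (if p' = p then 1 else 0)) (at t)" for t
    by (auto intro!: derivative_eq_intros)
  ultimately show ?thesis unfolding partial_def by (simp add: DERIV_imp_deriv)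
qed

text \<open>The power is known only through its differential equation on \<open>W\<close>, so that
  one proof serves the real and the complex powers.\<close>

lemma smooth_first_fun:
  assumes dom: "\<Omega> \<subseteq> expr_domain n s \<gamma> s' k W"
    and pw_deriv: "\<And>b z. z \<in> W b \<Longrightarrow> z \<noteq> 0 \<Longrightarrow> ((\<lambda>z. pw z b) has_field_derivative b * pw z b / z) (at z)"
    and j: "j \<in> Jset"
  shows "smooth_fun n s \<Omega> (first_fun pw j)"
proof -
  have nz: "corner_minor n j x \<noteq> 0" if "x \<in> \<Omega>" "j \<in> {1..m}" for x j
    using regular_\<Omega>[OF that(1)] that(2) by (simp add: regular_def)
  have inW: "corner_minor n (k q) x \<in> W (beta n \<gamma> s' k q j)" if "x \<in> \<Omega>" "j \<in> Jset" "q \<in> {1..s'}" for x j q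
    using dom that unfolding expr_domain_def by blast
  have j2: "2 * j \<le> n" if "j \<in> {1..m}" for j using that by auto
  have pwd: "((\<lambda>z. pw z (beta n \<gamma> s' k q j)) has_field_derivative
      beta n \<gamma> s' k q j * pw (corner_minor n (k q) x) (beta n \<gamma> s' k q j) / corner_minor n (k q) x) (at (corner_minor n (k q) x))"
    if "x \<in> \<Omega>" "j \<in> Jset" "q \<in> {1..s'}" for x j q
    using that by (intro pw_deriv inW nz k_range)
  have smooth_pw: "smooth_fun n s \<Omega> (\<lambda>x. pw (corner_minor n (k q) x) (beta n \<gamma> s' k q j))"
    if j: "j \<in> Jset" and q: "q \<in> {1..s'}" for j q
  proof -
    let ?C = "corner_minor n (k q)" and ?b = "beta n \<gamma> s' k q j"
    have C: "smooth_fun n s \<Omega> ?C" using q by (intro smooth_corner_minor j2 k_range)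
    show ?thesis
    proof (rule smooth_log_deriv[where H = "\<lambda>a x. ?b * partial a ?C x * inverse (?C x)"])
      show "cont (\<lambda>x. pw (?C x) ?b)"
        unfolding continuous_map_euclidean_iff
      proof
        fix x assume x: "x \<in> topspace (subtopology (dual_top n s) \<Omega>)"
        then have "x \<in> \<Omega>" by simp
        then have "isCont (\<lambda>z. pw z ?b) (?C x)" using pwd[OF _ j q] by (blast intro: DERIV_isCont)
        moreover have "(?C \<longlongrightarrow> ?C x) (atin (subtopology (dual_top n s) \<Omega>) x)"
          using smooth_cont[OF C] x unfolding continuous_map_euclidean_iff by blast
        ultimately show "((\<lambda>x. pw (?C x) ?b) \<longlongrightarrow> pw (?C x) ?b) (atin (subtopology (dual_top n s) \<Omega>) x)"
          by (rule isCont_tendsto_compose)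
      qed
      fix a assume a: "a \<in> \<B>"
      have "slice_deriv a (\<lambda>x. pw (?C x) ?b) (\<lambda>x. ?b * pw (?C x) ?b / ?C x * partial a ?C x)"
        by (rule slice_deriv_compose[OF smooth_slice(1)[OF C a] pwd[OF _ j q]])
      moreover have "(\<lambda>x. ?b * pw (?C x) ?b / ?C x * partial a ?C x) = (\<lambda>x. pw (?C x) ?b * (?b * partial a ?C x * inverse (?C x)))"
        by (simp add: fun_eq_iff divide_inverse mult_ac)
      ultimately show "slice_deriv a (\<lambda>x. pw (?C x) ?b) (\<lambda>x. pw (?C x) ?b * (?b * partial a ?C x * inverse (?C x)))" by simp
      show "smooth_fun n s \<Omega> (\<lambda>x. ?b * partial a ?C x * inverse (?C x))"
        using nz k_range[OF q] by (intro smooth_mult smooth_const smooth_inverse smooth_slice(2)[OF C a] C) auto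
    qed
  qed
  show ?thesis
    unfolding first_fun_def[abs_def] using j
    by (intro smooth_mult smooth_corner_minor smooth_prod smooth_pw j2) auto
qed

text \<open>Everything common to the real and complex cases and to both orbit relations. Invariance
  of the second kind follows from \<open>R_group\<close> alone; only the first kind depends on the
  branch of the power, whence the assumption \<open>R_first\<close>. Nonvanishing of the power makes
  the differentials of the first kind nonzero multiples of logarithmic gradients.\<close>

lemma Casimir_basis_sym:
  assumes dom: "\<Omega> \<subseteq> expr_domain n s \<gamma> s' k W"
    and pw_deriv: "\<And>b z. z \<in> W b \<Longrightarrow> z \<noteq> 0 \<Longrightarrow> ((\<lambda>z. pw z b) has_field_derivative b * pw z b / z) (at z)"
    and pw_nz: "\<And>b z. z \<in> W b \<Longrightarrow> z \<noteq> 0 \<Longrightarrow> pw z b \<noteq> 0"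
    and R_group: "\<And>x y. x \<in> \<Omega> \<Longrightarrow> y \<in> \<Omega> \<Longrightarrow> R x y \<Longrightarrow> \<exists>B\<in>T_group n s \<gamma>. y = coAd n s \<gamma> B x"
    and R_first: "\<And>x y j. x \<in> \<Omega> \<Longrightarrow> y \<in> \<Omega> \<Longrightarrow> R x y \<Longrightarrow> j \<in> Jset \<Longrightarrow> first_fun pw j y = first_fun pw j x"
  shows "Casimir_basis n s \<gamma> R \<Omega> L (casimir_expr n \<gamma> s' k pw ord)"
proof -
  \<comment> \<open>The constant is included so that the symmetrization of F is the ordered
    expression itself; it affects neither invariance nor differentials.\<close>
  define F where "F = case_sum (first_fun pw) (\<lambda>p x. second_fun n \<gamma> p x + sym_const ord p)"
  have nz: "corner_minor n j x \<noteq> 0" if "x \<in> \<Omega>" "j \<in> {1..m}" for x j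
    using regular_\<Omega>[OF that(1)] that(2) by (simp add: regular_def)
  have inW: "corner_minor n (k q) x \<in> W (beta n \<gamma> s' k q j)" if "x \<in> \<Omega>" "j \<in> Jset" "q \<in> {1..s'}" for x j q
    using dom that unfolding expr_domain_def by blast
  have j2: "2 * j \<le> n" if "j \<in> {1..m}" for j using that by auto
  have pwd: "((\<lambda>z. pw z (beta n \<gamma> s' k q j)) has_field_derivative
      beta n \<gamma> s' k q j * pw (corner_minor n (k q) x) (beta n \<gamma> s' k q j) / corner_minor n (k q) x) (at (corner_minor n (k q) x))"
    if "x \<in> \<Omega>" "j \<in> Jset" "q \<in> {1..s'}" for x j q
    using that by (intro pw_deriv inW nz k_range)
  have smooth_first: "smooth_fun n s \<Omega> (first_fun pw j)" if j: "j \<in> Jset" for j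
    by (rule smooth_first_fun[OF dom pw_deriv j])
  have smooth_F: "smooth_fun n s \<Omega> (F l)" if "l \<in> L" for l
    using that smooth_first smooth_add[OF smooth_second_fun smooth_const]
    by (cases l) (auto simp: F_def expr_set_def)
  have first_nz: "first_fun pw j x \<noteq> 0" if "x \<in> \<Omega>" "j \<in> Jset" for x j
    unfolding first_fun_def using that nz k_range pw_nz[OF inW] by auto
  have partial_E: "partial (E (Suc i) (Suc l)) (first_fun pw j) x = first_fun pw j x *
      (K j x $$ (l, i) + (\<Sum>q=1..s'. beta n \<gamma> s' k q j * K (k q) x $$ (l, i)))"
    if x: "x \<in> \<Omega>" and j: "j \<in> Jset" and il: "i < l" "l < n" for x j i l
  proof -
    let ?a = "E (Suc i) (Suc l)"
    have C: "((\<lambda>t. corner_minor n j (x(?a := t))) has_field_derivative corner_minor n j x * K j x $$ (l, i)) (at (x ?a))"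
      if "j \<in> {1..m}" for j
      by (rule corner_minor_deriv_E[OF j2[OF that] nz[OF x that] il])
    have Q: "((\<lambda>t. pw (corner_minor n (k q) (x(?a := t))) (beta n \<gamma> s' k q j)) has_field_derivative
        pw (corner_minor n (k q) (x(?a := x ?a))) (beta n \<gamma> s' k q j) * (beta n \<gamma> s' k q j * K (k q) x $$ (l, i))) (at (x ?a))"
      if q: "q \<in> {1..s'}" for q
    proof -
      have "((\<lambda>t. pw (corner_minor n (k q) (x(?a := t))) (beta n \<gamma> s' k q j)) has_field_derivative
        (beta n \<gamma> s' k q j * pw (corner_minor n (k q) x) (beta n \<gamma> s' k q j) / corner_minor n (k q) x) *
        (corner_minor n (k q) x * K (k q) x $$ (l, i))) (at (x ?a))"
        by (rule DERIV_chain2[OF _ C[OF k_range[OF q]]]) (use pwd[OF x j q] in simp)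
      then show ?thesis using nz[OF x k_range[OF q]] by (simp add: mult_ac)
    qed
    have "((\<lambda>t. corner_minor n j (x(?a := t)) * (\<Prod>q=1..s'. pw (corner_minor n (k q) (x(?a := t))) (beta n \<gamma> s' k q j)))
       has_field_derivative
       corner_minor n j x * K j x $$ (l, i) * (\<Prod>q=1..s'. pw (corner_minor n (k q) (x(?a := x ?a))) (beta n \<gamma> s' k q j)) +
       ((\<Prod>q=1..s'. pw (corner_minor n (k q) (x(?a := x ?a))) (beta n \<gamma> s' k q j)) *
         (\<Sum>q=1..s'. beta n \<gamma> s' k q j * K (k q) x $$ (l, i))) * corner_minor n j (x(?a := x ?a))) (at (x ?a))"
      using j by (intro DERIV_mult DERIV_prod_log C Q) auto
    then have "partial ?a (first_fun pw j) x = corner_minor n j x * K j x $$ (l, i) * (\<Prod>q=1..s'. pw (corner_minor n (k q) x) (beta n \<gamma> s' k q j)) +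
       ((\<Prod>q=1..s'. pw (corner_minor n (k q) x) (beta n \<gamma> s' k q j)) *
         (\<Sum>q=1..s'. beta n \<gamma> s' k q j * K (k q) x $$ (l, i))) * corner_minor n j x"
      unfolding partial_def first_fun_def fun_upd_triv by (rule DERIV_imp_deriv)
    then show ?thesis unfolding first_fun_def by (simp only: distrib_left mult_ac)
  qed
  have partial_P: "partial (P p) (first_fun pw j) x = 0" if "j \<in> Jset" for p j x
  proof -
    have "first_fun pw j (x(P p := t)) = first_fun pw j x" for t
    proof -
      have "corner_minor n j (x(P p := t)) = corner_minor n j x" if "j \<in> {1..m}" for j
        using that by (intro corner_minor_upd_P) auto
      then show ?thesis unfolding first_fun_def using that k_range by simp
    qed
    then show ?thesis unfolding partial_def by simp
  qed
  have "functionally_independent n s \<Omega> L F"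
    unfolding functionally_independent_def
  proof
    fix x assume x: "x \<in> \<Omega>"
    obtain Y where Y: "lifts n s \<gamma> x Y" using lift_exists by blast
    have "indep_family L \<B> (\<lambda>l a. partial a (F l) x)"
      by (rule indep_combined[OF Y regular_\<Omega>[OF x], where c = "\<lambda>j. first_fun pw j x" and b = "beta n \<gamma> s' k"])
         (simp_all add: F_def partial_E[OF x] partial_P first_nz[OF x] partial_second_fun_P)
    then show "\<forall>c. (\<forall>a\<in>\<B>. (\<Sum>l\<in>L. c l * partial a (F l) x) = 0) \<longrightarrow> (\<forall>l\<in>L. c l = 0)"
      unfolding indep_family_def .
  qed
  moreover have "is_invariant n s R \<Omega> (F l)" if l: "l \<in> L" for l
    unfolding is_invariant_def
  proof (intro conjI ballI impI)
    show "smooth_fun n s \<Omega> (F l)" by (rule smooth_F[OF l])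
    fix x y assume xy: "x \<in> \<Omega>" "y \<in> \<Omega>" "R x y"
    show "F l y = F l x"
    proof (cases l)
      case (Inl j)
      then show ?thesis using l R_first[OF xy, of j] by (auto simp: F_def expr_set_def)
    next
      case (Inr p)
      then have p: "p \<in> {s'<..s}" using l by (auto simp: expr_set_def)
      obtain B where B: "B \<in> T_group n s \<gamma>" "y = coAd n s \<gamma> B x" using R_group[OF xy] by blast
      show ?thesis using second_fun_invariant[OF p B(1) regular_\<Omega>[OF xy(1)]] by (simp add: F_def Inr B(2))
    qed
  qed
  ultimately have "Inv_basis n s \<gamma> R \<Omega> L F"
    unfolding Inv_basis_def using finite_L card_L_eq by blast
  moreover have "is_Sym n s \<gamma> \<Omega> (F l) (casimir_expr n \<gamma> s' k pw ord l)" if l: "l \<in> L" for l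
  proof (cases l)
    case (Inl j)
    then have j: "j \<in> Jset" using l by (auto simp: expr_set_def)
    \<comment> \<open>The block of the first [n/2] rows and the last [n/2] columns contains all
      corners, and its elements commute. Hence the first kind is a single coefficient with the empty
      word.\<close>
    define J where "J = {E r l | r l. 1 \<le> r \<and> r \<le> m \<and> n - m < l \<and> l \<le> n}"
    have cong: "corner_minor n j x = corner_minor n j y" if "\<And>a. a \<in> J \<Longrightarrow> x a = y a" "j \<in> {1..m}" for x y j
    proof (rule corner_minor_cong)
      show "j \<le> n" using that(2) by auto
      fix r l assume "1 \<le> r" "r \<le> j" "n - j < l" "l \<le> n"
      moreover have "j \<le> m" using that(2) by simp
      ultimately have "E r l \<in> J" unfolding J_def by fastforce
      then show "x (E r l) = y (E r l)" by (rule that(1))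
    qed
    have "adapted n s \<gamma> \<Omega> J (first_fun pw j) []"
    proof (rule adaptedI)
      show "J \<subseteq> \<B>"
      proof
        fix a assume "a \<in> J"
        then obtain r l where "a = E r l" "1 \<le> r" "r \<le> m" "n - m < l" "l \<le> n" by (auto simp: J_def)
        moreover have "m \<le> n - m" by linarith
        ultimately show "a \<in> \<B>" by simp
      qed
      show "smooth_fun n s \<Omega> (first_fun pw j)" by (rule smooth_first[OF j])
      show "commuting n \<gamma> a b" if ab: "a \<in> J" "b \<in> J \<union> set []" for a b
      proof -
        obtain r l where a: "a = E r l" "r \<le> m" "n - m < l" using ab by (auto simp: J_def)
        obtain r' l' where b: "b = E r' l'" "r' \<le> m" "n - m < l'" using ab by (auto simp: J_def)
        have "m \<le> n - m" by linarith
        then show ?thesis unfolding a(1) b(1) using a b by (intro commuting_E) linarith+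
      qed
      show "first_fun pw j x = first_fun pw j y" if xy: "\<And>a. a \<in> J \<Longrightarrow> x a = y a" for x y
      proof -
        have "corner_minor n (k q) x = corner_minor n (k q) y" if "q \<in> {1..s'}" for q
          by (rule cong[OF xy k_range[OF that]])
        moreover have "corner_minor n j x = corner_minor n j y" using j by (intro cong xy) auto
        ultimately show ?thesis unfolding first_fun_def by simp
      qed
    qed simp
    then have "is_Sym n s \<gamma> \<Omega> (first_fun pw j) (term_op (first_fun pw j) [])"
      by (intro is_SymI[of "[(first_fun pw j, [])]"]) (auto simp: Sym_term_Nil op_eq_refl)
    then show ?thesis using Inl by (simp add: F_def casimir_expr_def first_kind_def first_fun_def[abs_def])
  next
    case (Inr p)
    then show ?thesis using l is_Sym_second[of p ord] by (auto simp: F_def casimir_expr_def expr_set_def)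
  qed
  ultimately show ?thesis unfolding Casimir_basis_def by blast
qed

end

section \<open>Powers\<close>

text \<open>One formula for all exponents. For u/v in lowest terms with v odd the constant is
  (-1)^u, because the v-th root is an odd function; otherwise the absolute value makes it 1.\<close>

lemma real_pow_eq:
  obtains c where "c \<noteq> 0" "\<And>z. z \<noteq> 0 \<Longrightarrow> real_pow z b = (if z < 0 then c else 1) * \<bar>z\<bar> powr b"
proof (cases "\<exists>r. b = of_rat r \<and> odd (snd (quotient_of r))")
  case True
  then obtain r where r: "b = of_rat r" "odd (snd (quotient_of r))" by blast
  obtain u v where uv: "quotient_of r = (u, v)" by (cases "quotient_of r")
  have v: "v > 0" using quotient_of_denom_pos[OF uv] .
  have the: "(THE r. b = of_rat r) = r" using r(1) by auto
  have b: "b = of_int u / of_int v" unfolding r(1) quotient_of_div[OF uv] by (simp add: of_rat_divide)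
  have eq: "real_pow z b = root (nat v) z powi u" for z
    using True unfolding real_pow_def the uv by simp
  have pos: "root (nat v) y powi u = y powr b" if "y > 0" for y
  proof -
    have "root (nat v) y powi u = (y powr (1 / of_int v)) powi u"
      using v that by (simp add: root_powr_inverse)
    also have "\<dots> = (y powr (1 / of_int v)) powr of_int u"
      using that by (simp add: powr_real_of_int')
    also have "\<dots> = y powr b" by (simp add: powr_powr b)
    finally show ?thesis .
  qed
  have "real_pow z b = (if z < 0 then (-1) powi u else 1) * \<bar>z\<bar> powr b" if z: "z \<noteq> 0" for z
  proof (cases "z < 0")
    case True
    have "root (nat v) z powi u = ((-1) * root (nat v) (-z)) powi u" by (simp add: real_root_minus)
    also have "\<dots> = (-1) powi u * root (nat v) (-z) powi u" by (rule power_int_mult_distrib)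
    finally show ?thesis using True pos[of "-z"] by (simp add: eq)
  next
    case False
    then show ?thesis using z pos[of z] by (simp add: eq)
  qed
  then show thesis using that[of "(-1) powi u"] by simp
next
  case False
  then have "real_pow z b = \<bar>z\<bar> powr b" for z unfolding real_pow_def by (simp only: if_False)
  then show thesis using that[of 1] by simp
qed

lemma real_pow_nonzero: "z \<noteq> 0 \<Longrightarrow> real_pow z b \<noteq> 0"
  by (rule real_pow_eq[of b]) auto

lemma real_pow_exp_mult:
  assumes "z \<noteq> 0"
  shows "real_pow (exp t * z) b = exp (b * t) * real_pow z b"
proof -
  obtain c where c: "\<And>z. z \<noteq> 0 \<Longrightarrow> real_pow z b = (if z < 0 then c else 1) * \<bar>z\<bar> powr b"
    using real_pow_eq[of b] by metis
  have "\<bar>exp t * z\<bar> powr b = exp (b * t) * \<bar>z\<bar> powr b"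
    by (simp add: abs_mult powr_mult exp_powr_real mult.commute)
  then show ?thesis using assms c[of "exp t * z"] c[of z] by (simp add: mult_less_0_iff)
qed

text \<open>Near z the sign is constant, so the absolute value of y is \<open>sgn z * y\<close>
  there and the derivative of a power with positive base applies.\<close>

lemma real_pow_deriv:
  assumes "z \<noteq> 0"
  shows "((\<lambda>z. real_pow z b) has_field_derivative b * real_pow z b / z) (at z)"
proof -
  obtain c where c: "\<And>z. z \<noteq> 0 \<Longrightarrow> real_pow z b = (if z < 0 then c else 1) * \<bar>z\<bar> powr b"
    using real_pow_eq[of b] by metis
  let ?d = "if z < 0 then c else 1"
  have d: "((\<lambda>y. ?d * (sgn z * y) powr b) has_field_derivative ?d * ((sgn z * z) powr b * (sgn z * b / (sgn z * z)))) (at z)"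
  proof (rule DERIV_cmult)
    have "((\<lambda>y. (sgn z * y) powr b) has_field_derivative
        (sgn z * z) powr b * (0 * ln (sgn z * z) + sgn z * b / (sgn z * z))) (at z)"
      using assms by (intro DERIV_powr) (auto intro!: derivative_eq_intros simp: sgn_if)
    then show "((\<lambda>y. (sgn z * y) powr b) has_field_derivative (sgn z * z) powr b * (sgn z * b / (sgn z * z))) (at z)"
      by simp
  qed
  have ev: "\<forall>\<^sub>F y in nhds z. ?d * (sgn z * y) powr b = real_pow y b"
  proof -
    have "\<forall>\<^sub>F y in nhds z. sgn z * y > 0"
      using assms by (intro order_tendstoD(1)[of _ "sgn z * z"] tendsto_intros) (auto simp: filterlim_ident sgn_if)
    then show ?thesis
    proof eventually_elim
      case (elim y)
      then show ?case using c[of y] by (auto simp: sgn_if zero_less_mult_iff split: if_splits)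
    qed
  qed
  have "((\<lambda>y. real_pow y b) has_field_derivative ?d * ((sgn z * z) powr b * (sgn z * b / (sgn z * z)))) (at z)"
    using d unfolding DERIV_cong_ev[OF refl ev refl] .
  moreover have "?d * ((sgn z * z) powr b * (sgn z * b / (sgn z * z))) = b * real_pow z b / z"
    using assms c[OF assms] by (auto simp: sgn_if)
  ultimately show ?thesis by simp
qed

text \<open>Only continuity of the branch is assumed; its derivative comes from inverting the
  exponential function.\<close>

lemma log_branch_deriv:
  assumes "log_branch D lg" "z \<in> D"
  shows "(lg has_field_derivative inverse z) (at z)"
proof -
  have D: "open D" "continuous_on D lg" "\<And>z. z \<in> D \<Longrightarrow> exp (lg z) = z"
    using assms(1) by (auto simp: log_branch_def)
  have "DERIV lg z :> inverse (exp (lg z))"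
  proof (rule has_field_derivative_inverse_basic[of exp])
    show "DERIV exp (lg z) :> exp (lg z)" by (rule DERIV_exp)
    show "exp (lg z) \<noteq> 0" by (rule exp_not_eq_zero)
    show "continuous (at z) lg" using D(1,2) assms(2) by (simp add: continuous_on_eq_continuous_at)
  qed (use D assms(2) in auto)
  then show ?thesis using D(3)[OF assms(2)] by simp
qed

lemma log_branch_nonzero: "log_branch D lg \<Longrightarrow> z \<in> D \<Longrightarrow> z \<noteq> 0"
  unfolding log_branch_def by (metis exp_not_eq_zero)

lemma complex_pow_of_int: "complex_pow lg z (of_int u) = z powi u"
  by (simp add: complex_pow_def)

lemma complex_pow_nonzero: "z \<noteq> 0 \<Longrightarrow> complex_pow lg z b \<noteq> 0"
  by (auto simp: complex_pow_def)

lemma complex_pow_deriv: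
  assumes lb: "log_branch D lg" and z: "z \<in> complex_pow_dom D b" "z \<noteq> 0"
  shows "((\<lambda>z. complex_pow lg z b) has_field_derivative b * complex_pow lg z b / z) (at z)"
proof (cases "b \<in> \<int>")
  case True
  then obtain u where u: "b = of_int u" by (auto elim: Ints_cases)
  have "((\<lambda>z. z powi u) has_field_derivative of_int u * z powi (u - 1) * 1) (at z)"
    using z(2) by (intro DERIV_power_int DERIV_ident) auto
  then show ?thesis unfolding u complex_pow_of_int using z(2) by (simp add: power_int_diff)
next
  case False
  then have "z \<in> D" using z by (simp add: complex_pow_dom_def)
  from log_branch_deriv[OF lb this]
  have "((\<lambda>z. exp (b * lg z)) has_field_derivative exp (b * lg z) * (b * inverse z)) (at z)"
    by (auto intro!: derivative_eq_intros)
  then show ?thesis using False by (simp add: complex_pow_def divide_inverse mult_ac)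
qed

lemma complex_pow_exp_mult_int:
  assumes "b \<in> \<int>"
  shows "complex_pow lg (exp t * z) b = exp (b * t) * complex_pow lg z b"
proof -
  obtain u where u: "b = of_int u" using assms by (auto elim: Ints_cases)
  show ?thesis unfolding u complex_pow_of_int by (simp add: power_int_mult_distrib exp_power_int)
qed

lemma complex_pow_exp_mult:
  assumes "b \<notin> \<int>" "lg w = lg z + t"
  shows "complex_pow lg w b = exp (b * t) * complex_pow lg z b"
  using assms by (simp add: complex_pow_def exp_add[symmetric] distrib_left add.commute)

lemma countable_exp_fiber: "countable {w::complex. exp w = c}"
proof (cases "\<exists>w. exp w = c")
  case True
  then obtain w0 where w0: "exp w0 = c" by blast
  have "{w. exp w = c} \<subseteq> range (\<lambda>n::int. w0 + (of_int (2 * n) * pi) * \<i>)"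
    using exp_eq[of _ w0] w0 by auto
  then show ?thesis by (rule countable_subset) auto
qed simp

text \<open>The image of the interval is connected, and a connected set with two points in a metric
  space is uncountable.\<close>

lemma continuous_countable_values_eq:
  fixes h :: "real \<Rightarrow> 'a::metric_space"
  assumes "continuous_on {0..1} h" "countable (h ` {0..1})"
  shows "h 0 = h 1"
proof (rule ccontr)
  assume "h 0 \<noteq> h 1"
  moreover have "connected (h ` {0..1})" using assms(1) by (intro connected_continuous_image) auto
  ultimately have "uncountable (h ` {0..1})" by (rule connected_uncountable[rotated 3]) auto
  then show False using assms(2) by simp
qed

context reduced_param
begin

lemma coAd_id:
  assumes "x \<in> topspace (dual_top n s)"
  shows "coAd n s \<gamma> (T_param n s \<gamma> (\<lambda>_. 0)) x = x"
proof -
  have T: "T_param n s \<gamma> (\<lambda>_. 0) = 1\<^sub>m n"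
    unfolding T_param_def by (intro eq_matI) auto
  obtain Y where Y: "lifts n s \<gamma> x Y" using lift_exists by blast
  have "coAd n s \<gamma> (1\<^sub>m n) x a = frob n Y (1\<^sub>m n * e a * 1\<^sub>m n)" if "a \<in> \<B>" for a
    by (rule coAd_frob(1)[OF _ _ _ _ _ Y that]) auto
  moreover have "1\<^sub>m n * e a * 1\<^sub>m n = e a" for a
    using left_mult_one_mat[of "e a" n n] right_mult_one_mat[of "e a" n n] by simp
  ultimately have "coAd n s \<gamma> (1\<^sub>m n) x a = x a" if "a \<in> \<B>" for a
    using Y that by (simp add: lifts_def)
  then show ?thesis unfolding T
    using assms by (intro extensionalityI[of _ \<B>]) (auto simp: coAd_def topspace_dual_top PiE_def)
qed

lemma expr_domain_nonempty:
  assumes "d \<noteq> 0" "\<And>b. d \<in> W b"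
  shows "expr_domain n s \<gamma> s' k W \<noteq> {}"
proof -
  let ?z = "antidiag_point n s d"
  have c: "corner_minor n j ?z = d" if "j \<in> {1..m}" for j
    using that by (intro corner_minor_antidiag_point) auto
  have "?z \<in> topspace (dual_top n s)" by (auto simp: topspace_dual_top antidiag_point_def)
  then have "?z \<in> expr_domain n s \<gamma> s' k W"
    unfolding expr_domain_def using c assms k_range by simp
  then show ?thesis by blast
qed

lemma expr_domain_regular: "x \<in> expr_domain n s \<gamma> s' k W \<Longrightarrow> regular x"
  by (simp add: expr_domain_def regular_def)

text \<open>A group element with parameters \<epsilon> multiplies the j-th corner minor by the
  exponential of this number.\<close>

definition weight :: "(nat \<Rightarrow> 'f) \<Rightarrow> nat \<Rightarrow> 'f" where
  "weight \<epsilon> j = - (\<Sum>p=1..s. \<epsilon> p * alpha n \<gamma> p j)"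

lemma weight_beta:
  assumes "j \<le> m"
  shows "weight \<epsilon> j + (\<Sum>q=1..s'. beta n \<gamma> s' k q j * weight \<epsilon> (k q)) = 0"
proof -
  have "(\<Sum>q=1..s'. beta n \<gamma> s' k q j * weight \<epsilon> (k q)) =
      - (\<Sum>q=1..s'. \<Sum>p=1..s. \<epsilon> p * (beta n \<gamma> s' k q j * alpha n \<gamma> p (k q)))"
    by (simp add: weight_def sum_negf sum_distrib_left mult.left_commute)
  also have "\<dots> = - (\<Sum>p=1..s. \<epsilon> p * (\<Sum>q=1..s'. beta n \<gamma> s' k q j * alpha n \<gamma> p (k q)))"
    by (subst sum.swap) (simp add: sum_distrib_left)
  finally have "weight \<epsilon> j + (\<Sum>q=1..s'. beta n \<gamma> s' k q j * weight \<epsilon> (k q)) =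
      - (\<Sum>p=1..s. \<epsilon> p * (alpha n \<gamma> p j + (\<Sum>q=1..s'. beta n \<gamma> s' k q j * alpha n \<gamma> p (k q))))"
    by (simp add: weight_def distrib_left sum.distrib)
  also have "\<dots> = 0" using beta_system[OF _ assms] by simp
  finally show ?thesis .
qed

end

context sym_setup
begin

text \<open>The weights cancel by \<open>weight_beta\<close>. What remains are the factors \<mu>,
  which record by how much a power with a fixed branch deviates from the expected scaling.\<close>

lemma first_fun_scale:
  assumes j: "j \<in> Jset" and c: "corner_minor n j y = exp (weight \<epsilon> j) * corner_minor n j x"
    and pw: "\<And>q. q \<in> {1..s'} \<Longrightarrow> pw (corner_minor n (k q) y) (beta n \<gamma> s' k q j) =
      \<mu> q * (exp (beta n \<gamma> s' k q j * weight \<epsilon> (k q)) * pw (corner_minor n (k q) x) (beta n \<gamma> s' k q j))"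
  shows "first_fun pw j y = (\<Prod>q=1..s'. \<mu> q) * first_fun pw j x"
proof -
  have "first_fun pw j y = (\<Prod>q=1..s'. \<mu> q) * first_fun pw j x *
      (exp (weight \<epsilon> j) * (\<Prod>q=1..s'. exp (beta n \<gamma> s' k q j * weight \<epsilon> (k q))))"
    unfolding first_fun_def c using pw by (simp add: prod.distrib mult_ac)
  also have "exp (weight \<epsilon> j) * (\<Prod>q=1..s'. exp (beta n \<gamma> s' k q j * weight \<epsilon> (k q))) =
      exp (weight \<epsilon> j + (\<Sum>q=1..s'. beta n \<gamma> s' k q j * weight \<epsilon> (k q)))"
    by (simp add: exp_sum exp_add)
  also have "\<dots> = 1" using weight_beta[of j \<epsilon>] j by simp
  finally show ?thesis by simp
qed

end

section \<open>Invariance of the expressions of the first kind\<close>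

lemma (in reduced_param) corner_minor_coAd_weight:
  assumes "B \<in> T_group n s \<gamma>" "\<And>i. i < n \<Longrightarrow> B $$ (i, i) = exp (\<Sum>p=1..s. \<gamma> p (Suc i) * \<epsilon> p)" "j \<in> {1..m}"
  shows "corner_minor n j (coAd n s \<gamma> B x) = exp (weight \<epsilon> j) * corner_minor n j x"
  using corner_minor_coAd[OF assms(1,2), of j x] assms(3) by (auto simp: weight_def)

lemma (in reduced_param) T_group_exponents:
  assumes "B \<in> T_group n s \<gamma>"
  obtains \<epsilon> where "\<And>j x. j \<in> {1..m} \<Longrightarrow> corner_minor n j (coAd n s \<gamma> B x) = exp (weight \<epsilon> j) * corner_minor n j x"
proof -
  obtain \<epsilon> where "\<And>i. i < n \<Longrightarrow> B $$ (i, i) = exp (\<Sum>p=1..s. \<gamma> p (Suc i) * \<epsilon> p)"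
    using assms by (auto simp: T_group_def)
  from that[OF corner_minor_coAd_weight[OF assms this]] show thesis by blast
qed

lemma Casimir_basis_real:
  fixes \<gamma> :: "nat \<Rightarrow> nat \<Rightarrow> real"
  assumes "n > 1" "admissible n s \<gamma>" "reduced_form n s \<gamma> s' k"
    and \<Omega>: "openin (dual_top n s) \<Omega>" "\<Omega> \<subseteq> expr_domain n s \<gamma> s' k (\<lambda>_. UNIV)"
  shows "Casimir_basis n s \<gamma> (same_orbit n s \<gamma>) \<Omega> (expr_set n s s' k) (casimir_expr n \<gamma> s' k real_pow ord)"
proof -
  interpret reduced_param n s \<gamma> s' k by unfold_locales (use assms in auto)
  interpret sym_setup n s \<gamma> s' k \<Omega> by unfold_locales (use \<Omega> expr_domain_regular in auto)
  show ?thesis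
  proof (rule Casimir_basis_sym[OF \<Omega>(2)])
    show "\<exists>B\<in>T_group n s \<gamma>. y = coAd n s \<gamma> B x" if "same_orbit n s \<gamma> x y" for x y
      using that by (simp add: same_orbit_def)
    fix x y j assume x: "x \<in> \<Omega>" and R: "same_orbit n s \<gamma> x y" and j: "j \<in> Jset"
    obtain B where B: "B \<in> T_group n s \<gamma>" "y = coAd n s \<gamma> B x" using R by (auto simp: same_orbit_def)
    obtain \<epsilon> where c: "\<And>j x. j \<in> {1..m} \<Longrightarrow> corner_minor n j (coAd n s \<gamma> B x) = exp (weight \<epsilon> j) * corner_minor n j x"
      using T_group_exponents[OF B(1)] by metis
    have "first_fun real_pow j y = (\<Prod>q=1..s'. 1) * first_fun real_pow j x"
    proof (rule first_fun_scale[OF j, where \<epsilon> = \<epsilon>])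
      show "corner_minor n j y = exp (weight \<epsilon> j) * corner_minor n j x" unfolding B(2) using j by (intro c) auto
      fix q assume q: "q \<in> {1..s'}"
      have "corner_minor n (k q) x \<noteq> 0" using regular_\<Omega>[OF x] k_range[OF q] by (simp add: regular_def)
      then show "real_pow (corner_minor n (k q) y) (beta n \<gamma> s' k q j) =
          1 * (exp (beta n \<gamma> s' k q j * weight \<epsilon> (k q)) * real_pow (corner_minor n (k q) x) (beta n \<gamma> s' k q j))"
        unfolding B(2) c[OF k_range[OF q]] by (simp add: real_pow_exp_mult)
    qed
    then show "first_fun real_pow j y = first_fun real_pow j x" by simp
  qed (simp_all add: real_pow_deriv real_pow_nonzero)
qed

section \<open>Complex powers with a fixed branch of the logarithm\<close>

locale complex_setup = sym_setup n s \<gamma> s' k \<Omega>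
  for n s :: nat and \<gamma> :: "nat \<Rightarrow> nat \<Rightarrow> complex" and s' :: nat and k :: "nat \<Rightarrow> nat" and \<Omega> :: "(lidx \<Rightarrow> complex) set" +
  fixes D :: "complex set" and lg :: "complex \<Rightarrow> complex"
  assumes log_branch: "log_branch D lg"
    and domain: "\<Omega> \<subseteq> expr_domain n s \<gamma> s' k (complex_pow_dom D)"
begin

abbreviation "F1 \<equiv> first_fun (complex_pow lg)"

lemma exp_lg: "z \<in> D \<Longrightarrow> exp (lg z) = z"
  using log_branch by (simp add: log_branch_def)

lemma corner_in_D:
  assumes "x \<in> \<Omega>" "j \<in> Jset" "q \<in> {1..s'}" "beta n \<gamma> s' k q j \<notin> \<int>"
  shows "corner_minor n (k q) x \<in> D"
proof -
  have "corner_minor n (k q) x \<in> complex_pow_dom D (beta n \<gamma> s' k q j)"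
    using domain assms(1-3) unfolding expr_domain_def by blast
  then show ?thesis using assms(4) by (simp add: complex_pow_dom_def)
qed

text \<open>Along a path the branch of the logarithm changes continuously, so that it cannot jump.\<close>

lemma F1_local_orbit:
  assumes x: "x \<in> \<Omega>" and R: "same_local_orbit n s \<gamma> \<Omega> x y" and j: "j \<in> Jset"
  shows "F1 j y = F1 j x"
proof -
  obtain \<theta> where \<theta>: "\<And>a. a \<in> \<B> \<Longrightarrow> continuous_on {0..1} (\<lambda>t. \<theta> t a)" "\<And>a. a \<in> \<B> \<Longrightarrow> \<theta> (0::real) a = 0"
    "\<And>t. t \<in> {0..1} \<Longrightarrow> coAd n s \<gamma> (T_param n s \<gamma> (\<theta> t)) x \<in> \<Omega>"
    "y = coAd n s \<gamma> (T_param n s \<gamma> (\<theta> 1)) x"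
    using R unfolding same_local_orbit_def by blast
  define w where "w t j = weight (\<lambda>p. \<theta> t (P p)) j" for t j
  have c: "corner_minor n j (coAd n s \<gamma> (T_param n s \<gamma> (\<theta> t)) x) = exp (w t j) * corner_minor n j x"
    if "j \<in> {1..m}" for j t
    unfolding w_def by (rule corner_minor_coAd_weight[OF T_param_in_T_group _ that]) (simp add: T_param_def)
  have w_cont: "continuous_on {0..1} (\<lambda>t. w t j)" for j
    unfolding w_def weight_def by (intro continuous_intros \<theta>(1)) auto
  have w0: "w 0 j = 0" for j
    unfolding w_def weight_def using \<theta>(2) by (simp add: sum.neutral)
  have "F1 j y = (\<Prod>q=1..s'. 1) * F1 j x"
  proof (rule first_fun_scale[OF j, where \<epsilon> = "\<lambda>p. \<theta> 1 (P p)", folded w_def])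
    show "corner_minor n j y = exp (w 1 j) * corner_minor n j x" unfolding \<theta>(4) using j by (intro c) auto
    fix q assume q: "q \<in> {1..s'}"
    let ?C = "corner_minor n (k q)" and ?b = "beta n \<gamma> s' k q j"
    have Cy: "?C y = exp (w 1 (k q)) * ?C x" unfolding \<theta>(4) by (rule c[OF k_range[OF q]])
    have "complex_pow lg (?C y) ?b = exp (?b * w 1 (k q)) * complex_pow lg (?C x) ?b"
    proof (cases "?b \<in> \<int>")
      case True
      then show ?thesis unfolding Cy by (rule complex_pow_exp_mult_int)
    next
      case False
      have inD: "exp (w t (k q)) * ?C x \<in> D" if "t \<in> {0..1}" for t
        using corner_in_D[OF \<theta>(3)[OF that] j q False] unfolding c[OF k_range[OF q]] .
      \<comment> \<open>For every t this is a logarithm of the minor at x, so its values lie in one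
        fiber of the exponential function. At t = 0 it is the chosen branch because the path starts
        at the identity.\<close>
      define h where "h t = lg (exp (w t (k q)) * ?C x) - w t (k q)" for t
      have "continuous_on {0..1} (\<lambda>t. lg (exp (w t (k q)) * ?C x))"
        by (rule continuous_on_compose2[of D lg]) (use log_branch inD in \<open>auto simp: log_branch_def intro!: continuous_intros w_cont\<close>)
      then have "continuous_on {0..1} h" unfolding h_def by (intro continuous_intros w_cont)
      moreover have "h ` {0..1} \<subseteq> {z. exp z = ?C x}"
        using inD by (auto simp: h_def exp_diff exp_lg)
      then have "countable (h ` {0..1})" using countable_exp_fiber countable_subset by blast
      ultimately have "h 0 = h 1" by (rule continuous_countable_values_eq)
      then have "lg (?C y) = lg (?C x) + w 1 (k q)" unfolding Cy by (simp add: h_def w0 algebra_simps)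
      then show ?thesis by (rule complex_pow_exp_mult[OF False])
    qed
    then show "complex_pow lg (?C y) ?b = 1 * (exp (?b * w 1 (k q)) * complex_pow lg (?C x) ?b)" by simp
  qed
  then show ?thesis by simp
qed

text \<open>On a whole orbit the powers are determined up to the countably many periods of the logarithm.\<close>

lemma F1_orbit_countable:
  assumes y: "y \<in> \<Omega>" and j: "j \<in> Jset"
  shows "countable (F1 j ` (orbit n s \<gamma> y \<inter> \<Omega>))"
proof -
  \<comment> \<open>\<open>N q\<close> counts the periods by which the branch differs from the
    continued logarithm at the minor with index k_q.\<close>
  define \<Phi> where "\<Phi> N = (\<Prod>q=1..s'. exp (2 * pi * \<i> * of_int (N q) * beta n \<gamma> s' k q j)) * F1 j y" for N :: "nat \<Rightarrow> int"
  have "F1 j ` (orbit n s \<gamma> y \<inter> \<Omega>) \<subseteq> \<Phi> ` (\<Pi>\<^sub>E q\<in>{1..s'}. UNIV)"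
  proof
    fix v assume "v \<in> F1 j ` (orbit n s \<gamma> y \<inter> \<Omega>)"
    then obtain B z where B: "B \<in> T_group n s \<gamma>" "z = coAd n s \<gamma> B y" and z: "z \<in> \<Omega>" "v = F1 j z"
      by (auto simp: orbit_def)
    obtain \<epsilon> where c: "\<And>j x. j \<in> {1..m} \<Longrightarrow> corner_minor n j (coAd n s \<gamma> B x) = exp (weight \<epsilon> j) * corner_minor n j x"
      using T_group_exponents[OF B(1)] by metis
    have "\<exists>N::int. complex_pow lg (corner_minor n (k q) z) (beta n \<gamma> s' k q j) =
        exp (2 * pi * \<i> * of_int N * beta n \<gamma> s' k q j) *
        (exp (beta n \<gamma> s' k q j * weight \<epsilon> (k q)) * complex_pow lg (corner_minor n (k q) y) (beta n \<gamma> s' k q j))"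
      if q: "q \<in> {1..s'}" for q
    proof -
      let ?C = "corner_minor n (k q)" and ?b = "beta n \<gamma> s' k q j"
      have Cz: "?C z = exp (weight \<epsilon> (k q)) * ?C y" unfolding B(2) by (rule c[OF k_range[OF q]])
      show ?thesis
      proof (cases "?b \<in> \<int>")
        case True
        then show ?thesis unfolding Cz complex_pow_exp_mult_int[OF True] by (intro exI[of _ 0]) simp
      next
        case False
        have "exp (lg (?C z)) = exp (lg (?C y) + weight \<epsilon> (k q))"
          using exp_lg[OF corner_in_D[OF z(1) j q False]] exp_lg[OF corner_in_D[OF y j q False]] Cz
          by (simp add: exp_add)
        then obtain N :: int where "lg (?C z) = lg (?C y) + weight \<epsilon> (k q) + (of_int (2 * N) * pi) * \<i>"
          unfolding exp_eq by blast
        then have "lg (?C z) = lg (?C y) + (weight \<epsilon> (k q) + (of_int (2 * N) * pi) * \<i>)" by (simp add: add.assoc)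
        from complex_pow_exp_mult[of ?b lg, OF False this]
        have "complex_pow lg (?C z) ?b = exp (2 * pi * \<i> * of_int N * ?b) * (exp (?b * weight \<epsilon> (k q)) * complex_pow lg (?C y) ?b)"
          by (simp add: distrib_left exp_add mult_ac)
        then show ?thesis by blast
      qed
    qed
    then obtain N :: "nat \<Rightarrow> int" where N: "\<And>q. q \<in> {1..s'} \<Longrightarrow> complex_pow lg (corner_minor n (k q) z) (beta n \<gamma> s' k q j) =
        exp (2 * pi * \<i> * of_int (N q) * beta n \<gamma> s' k q j) *
        (exp (beta n \<gamma> s' k q j * weight \<epsilon> (k q)) * complex_pow lg (corner_minor n (k q) y) (beta n \<gamma> s' k q j))"
      by metis
    have "v = \<Phi> N"
      unfolding z(2) \<Phi>_def
    proof (rule first_fun_scale[OF j, where \<epsilon> = \<epsilon>])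
      show "corner_minor n j z = exp (weight \<epsilon> j) * corner_minor n j y" unfolding B(2) using j by (intro c) auto
    qed (rule N)
    \<comment> \<open>Only finitely many of the integers matter, so the index set can be taken
      countable.\<close>
    also have "\<dots> = \<Phi> (restrict N {1..s'})" unfolding \<Phi>_def by simp
    finally show "v \<in> \<Phi> ` (\<Pi>\<^sub>E q\<in>{1..s'}. UNIV)" by auto
  qed
  moreover have "countable (\<Phi> ` (\<Pi>\<^sub>E q\<in>{1..s'}. UNIV))"
    by (intro countable_image countable_PiE) auto
  ultimately show ?thesis by (rule countable_subset)
qed

text \<open>The invariant is continuous along a path joining the two points inside the orbit and
  \<Omega>, and it takes only countably many values there.\<close>

lemma F1_path_connected_orbit:
  assumes pc: "path_connectedin (dual_top n s) (orbit n s \<gamma> y \<inter> \<Omega>)"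
    and y: "y \<in> \<Omega>" and z: "z \<in> \<Omega>" and R: "same_orbit n s \<gamma> y z" and j: "j \<in> Jset"
  shows "F1 j z = F1 j y"
proof -
  have yt: "y \<in> topspace (dual_top n s)" using openin_subset[OF open_\<Omega>] y by blast
  have "y \<in> orbit n s \<gamma> y"
    unfolding orbit_def mem_Collect_eq
    by (rule exI[of _ "T_param n s \<gamma> (\<lambda>_. 0)"]) (simp add: coAd_id[OF yt] T_param_in_T_group)
  moreover have "z \<in> orbit n s \<gamma> y" using R by (auto simp: same_orbit_def orbit_def)
  ultimately obtain g where g: "pathin (dual_top n s) g" "g \<in> {0..1} \<rightarrow> orbit n s \<gamma> y \<inter> \<Omega>" "g 0 = y" "g 1 = z"
    using pc y z unfolding path_connectedin by blast
  have "pathin (subtopology (dual_top n s) \<Omega>) g"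
    using g(1,2) by (auto simp: pathin_subtopology)
  moreover have "cont (F1 j)"
    by (rule smooth_cont[OF smooth_first_fun[OF domain complex_pow_deriv[OF log_branch] j]])
  ultimately have "pathin euclidean (F1 j \<circ> g)" by (rule pathin_compose)
  then have "continuous_on {0..1} (F1 j \<circ> g)" unfolding pathin_def by simp
  moreover have "countable ((F1 j \<circ> g) ` {0..1})"
    by (rule countable_subset[OF _ F1_orbit_countable[OF y j]]) (use g(2) in auto)
  ultimately have "(F1 j \<circ> g) 0 = (F1 j \<circ> g) 1" by (rule continuous_countable_values_eq)
  then show ?thesis using g(3,4) by simp
qed

lemma Casimir_basis_local:
  "Casimir_basis n s \<gamma> (same_local_orbit n s \<gamma> \<Omega>) \<Omega> L (casimir_expr n \<gamma> s' k (complex_pow lg) ord)"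
proof (rule Casimir_basis_sym[OF domain complex_pow_deriv[OF log_branch] complex_pow_nonzero])
  show "\<exists>B\<in>T_group n s \<gamma>. y = coAd n s \<gamma> B x" if "same_local_orbit n s \<gamma> \<Omega> x y" for x y
    using that T_param_in_T_group unfolding same_local_orbit_def by blast
  show "F1 j y = F1 j x" if "x \<in> \<Omega>" "same_local_orbit n s \<gamma> \<Omega> x y" "j \<in> Jset" for x y j
    using that by (rule F1_local_orbit)
qed

lemma Casimir_basis_path_connected:
  assumes "\<And>y. y \<in> topspace (dual_top n s) \<Longrightarrow> path_connectedin (dual_top n s) (orbit n s \<gamma> y \<inter> \<Omega>)"
  shows "Casimir_basis n s \<gamma> (same_orbit n s \<gamma>) \<Omega> L (casimir_expr n \<gamma> s' k (complex_pow lg) ord)"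
proof (rule Casimir_basis_sym[OF domain complex_pow_deriv[OF log_branch] complex_pow_nonzero])
  show "\<exists>B\<in>T_group n s \<gamma>. y = coAd n s \<gamma> B x" if "same_orbit n s \<gamma> x y" for x y
    using that by (simp add: same_orbit_def)
  show "F1 j y = F1 j x" if "x \<in> \<Omega>" "y \<in> \<Omega>" "same_orbit n s \<gamma> x y" "j \<in> Jset" for x y j
    using that openin_subset[OF open_\<Omega>] by (intro F1_path_connected_orbit assms) auto
qed

end

lemma complex_setupI:
  assumes "n > 1" "admissible n s \<gamma>" "reduced_form n s \<gamma> s' k" "log_branch D lg"
    and \<Omega>: "openin (dual_top n s) \<Omega>" "\<Omega> \<subseteq> expr_domain n s \<gamma> s' k (complex_pow_dom D)"
  shows "complex_setup n s \<gamma> s' k \<Omega> D lg"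
proof -
  interpret reduced_param n s \<gamma> s' k by unfold_locales (use assms in auto)
  show ?thesis by unfold_locales (use assms expr_domain_regular in auto)
qed

text \<open>Over the complex numbers two points of \<Omega> on one orbit may be related by a group
  element along which the logarithm leaves its branch. Invariance is therefore stated for local
  orbits on the whole of \<Omega>, and for full orbits on small neighbourhoods when the action is
  regular.\<close>

theorem theorem9:
  fixes n s s' :: nat and k :: "nat \<Rightarrow> nat"
  assumes "n > 1" and "s \<le> n - 1"
  shows
    "(\<forall>\<gamma>::nat \<Rightarrow> nat \<Rightarrow> real. admissible n s \<gamma> \<and> reduced_form n s \<gamma> s' k \<longrightarrow>
        (\<forall>q\<in>{1..s'}. \<forall>j\<in>{1..n div 2}.
            alpha n \<gamma> q j = - (\<Sum>k'=k q..j. \<gamma> q (n - k' + 1) - \<gamma> q k')) \<and>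
        Delta n \<gamma> s' k = (- 1) ^ s' \<and>
        expr_domain n s \<gamma> s' k (\<lambda>_. UNIV) \<noteq> {} \<and>
        (\<forall>ord \<Omega>. openin (dual_top n s) \<Omega> \<and> \<Omega> \<noteq> {} \<and> \<Omega> \<subseteq> expr_domain n s \<gamma> s' k (\<lambda>_. UNIV) \<longrightarrow>
            Casimir_basis n s \<gamma> (same_orbit n s \<gamma>) \<Omega> (expr_set n s s' k)
              (casimir_expr n \<gamma> s' k real_pow ord)))
   \<and> (\<forall>(\<gamma>::nat \<Rightarrow> nat \<Rightarrow> complex) D lg.
        admissible n s \<gamma> \<and> reduced_form n s \<gamma> s' k \<and> log_branch D lg \<longrightarrow>
        (\<forall>q\<in>{1..s'}. \<forall>j\<in>{1..n div 2}.
            alpha n \<gamma> q j = - (\<Sum>k'=k q..j. \<gamma> q (n - k' + 1) - \<gamma> q k')) \<and>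
        Delta n \<gamma> s' k = (- 1) ^ s' \<and>
        expr_domain n s \<gamma> s' k (complex_pow_dom D) \<noteq> {} \<and>
        (\<forall>ord \<Omega>. openin (dual_top n s) \<Omega> \<and> \<Omega> \<noteq> {} \<and>
              \<Omega> \<subseteq> expr_domain n s \<gamma> s' k (complex_pow_dom D) \<longrightarrow>
            Casimir_basis n s \<gamma> (same_local_orbit n s \<gamma> \<Omega>) \<Omega> (expr_set n s s' k)
              (casimir_expr n \<gamma> s' k (complex_pow lg) ord) \<and>
            (acts_regularly n s \<gamma> \<Omega> \<longrightarrow>
              (\<forall>x\<in>\<Omega>. \<exists>\<Omega>'. openin (dual_top n s) \<Omega>' \<and> x \<in> \<Omega>' \<and> \<Omega>' \<subseteq> \<Omega> \<and>
                Casimir_basis n s \<gamma> (same_orbit n s \<gamma>) \<Omega>' (expr_set n s s' k)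
                  (casimir_expr n \<gamma> s' k (complex_pow lg) ord)))))"
proof (intro conjI allI impI; elim conjE)
  fix \<gamma> :: "nat \<Rightarrow> nat \<Rightarrow> real"
  assume \<gamma>: "admissible n s \<gamma>" "reduced_form n s \<gamma> s' k"
  interpret reduced_param n s \<gamma> s' k by unfold_locales (use assms \<gamma> in auto)
  show "\<forall>q\<in>{1..s'}. \<forall>j\<in>{1..n div 2}. alpha n \<gamma> q j = - (\<Sum>k'=k q..j. \<gamma> q (n - k' + 1) - \<gamma> q k')"
    by (intro ballI alpha_from_k)
  show "Delta n \<gamma> s' k = (- 1) ^ s'" by (rule Delta_eq)
  show "expr_domain n s \<gamma> s' k (\<lambda>_. UNIV) \<noteq> {}"
    by (rule expr_domain_nonempty[of 1]) auto
  show "Casimir_basis n s \<gamma> (same_orbit n s \<gamma>) \<Omega> (expr_set n s s' k) (casimir_expr n \<gamma> s' k real_pow ord)"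
    if "openin (dual_top n s) \<Omega>" "\<Omega> \<subseteq> expr_domain n s \<gamma> s' k (\<lambda>_. UNIV)" for ord \<Omega>
    using Casimir_basis_real[OF assms(1) \<gamma> that] .
next
  fix \<gamma> :: "nat \<Rightarrow> nat \<Rightarrow> complex" and D lg
  assume \<gamma>: "admissible n s \<gamma>" "reduced_form n s \<gamma> s' k" and lb: "log_branch D lg"
  interpret reduced_param n s \<gamma> s' k by unfold_locales (use assms \<gamma> in auto)
  show "\<forall>q\<in>{1..s'}. \<forall>j\<in>{1..n div 2}. alpha n \<gamma> q j = - (\<Sum>k'=k q..j. \<gamma> q (n - k' + 1) - \<gamma> q k')"
    by (intro ballI alpha_from_k)
  show "Delta n \<gamma> s' k = (- 1) ^ s'" by (rule Delta_eq)
  obtain d where d: "d \<in> D" using lb by (auto simp: log_branch_def)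
  show "expr_domain n s \<gamma> s' k (complex_pow_dom D) \<noteq> {}"
  proof (rule expr_domain_nonempty)
    show "d \<noteq> 0" by (rule log_branch_nonzero[OF lb d])
    show "d \<in> complex_pow_dom D b" for b using d by (simp add: complex_pow_dom_def)
  qed
  fix ord \<Omega>
  assume \<Omega>: "openin (dual_top n s) \<Omega>" "\<Omega> \<subseteq> expr_domain n s \<gamma> s' k (complex_pow_dom D)"
  show "Casimir_basis n s \<gamma> (same_local_orbit n s \<gamma> \<Omega>) \<Omega> (expr_set n s s' k)
      (casimir_expr n \<gamma> s' k (complex_pow lg) ord)"
    by (rule complex_setup.Casimir_basis_local[OF complex_setupI[OF assms(1) \<gamma> lb \<Omega>]])
  assume reg: "acts_regularly n s \<gamma> \<Omega>"
  show "\<forall>x\<in>\<Omega>. \<exists>\<Omega>'. openin (dual_top n s) \<Omega>' \<and> x \<in> \<Omega>' \<and> \<Omega>' \<subseteq> \<Omega> \<and>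
      Casimir_basis n s \<gamma> (same_orbit n s \<gamma>) \<Omega>' (expr_set n s s' k) (casimir_expr n \<gamma> s' k (complex_pow lg) ord)"
  proof
    fix x assume x: "x \<in> \<Omega>"
    \<comment> \<open>Regularity, applied with \<Omega> itself as the given neighbourhood, provides
      one that meets every orbit in a pathwise connected set.\<close>
    have "\<exists>V. openin (dual_top n s) V \<and> x \<in> V \<and> V \<subseteq> \<Omega> \<and>
        (\<forall>y\<in>topspace (dual_top n s). path_connectedin (dual_top n s) (orbit n s \<gamma> y \<inter> V))"
      using reg[unfolded acts_regularly_def, THEN conjunct2, rule_format, OF x] x \<Omega>(1) by simp
    then obtain V where V: "openin (dual_top n s) V" "x \<in> V" "V \<subseteq> \<Omega>"
      "\<And>y. y \<in> topspace (dual_top n s) \<Longrightarrow> path_connectedin (dual_top n s) (orbit n s \<gamma> y \<inter> V)"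
      by blast
    have "V \<subseteq> expr_domain n s \<gamma> s' k (complex_pow_dom D)" using V(3) \<Omega>(2) by blast
    from complex_setup.Casimir_basis_path_connected[OF complex_setupI[OF assms(1) \<gamma> lb V(1) this] V(4)]
    show "\<exists>\<Omega>'. openin (dual_top n s) \<Omega>' \<and> x \<in> \<Omega>' \<and> \<Omega>' \<subseteq> \<Omega> \<and>
      Casimir_basis n s \<gamma> (same_orbit n s \<gamma>) \<Omega>' (expr_set n s s' k) (casimir_expr n \<gamma> s' k (complex_pow lg) ord)"
      using V(1-3) by blast
  qed
qed

end
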